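(* Let $P(x)=x^{2}+c_{0}$ be the quadratic polynomial with a parabolic fixed point of multiplier $\lambda=e^{2\pi i p/q}$, and let $r>3$. There exists $\delta>0$ such that for all parameters $(c,a)\in\mathcal{P}_{\lambda}$ with $0<|a|<\delta$ there exists a homeomorphism $$\Phi: J_{P}\times \mathbb{D}_{r}\to J^{+}\cap V$$ such that $$H_{c,a}\circ\Phi=\Phi\circ\psi \quad\text{on } J_{P}\times\mathbb{D}_{r},$$ where $\psi:J_{P}\times\mathbb{D}_{r}\to J_{P}\times\mathbb{D}_{r}$ is the map $$\psi(\zeta,z)=\left(P(\zeta),\ a\zeta-\frac{a^{2}z}{P'(\zeta)}\right).$$
   Context: Let $p/q$ be a rational number in lowest terms ($q\ge 1$), $\lambda=e^{2\pi i p/q}$, and $c_{0}=\frac{\lambda}{2}-\frac{\lambda^{2}}{4}$; the polynomial $P(x)=x^{2}+c_{0}$ has the parabolic fixed point $\lambda/2$ of multiplier $\lambda$. $J_{P}$ denotes the Julia set of $P$. For $c,a\in\mathbb{C}$, $a\neq 0$, the complex Hénon map is $H_{c,a}(x,y)=(x^{2}+c+ay,\ ax)$, an automorphism of $\mathbb{C}^{2}$. $K^{+}$ (resp. $K^{-}$) is the set of points of $\mathbb{C}^{2}$ with bounded forward (resp. backward) orbit under $H_{c,a}$, and $J^{\pm}=\partial K^{\pm}$. The curve $\mathcal{P}_{\lambda}\subset\mathbb{C}^{2}$ is the set of parameters $(c,a)$ for which $H_{c,a}$ has a fixed point at which the derivative has an eigenvalue $\lambda$; explicitly $$\mathcal{P}_{\lambda}=\left\{(c,a)\in\mathbb{C}^2:\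 c=(1-a^{2})\left(\tfrac{\lambda}{2}-\tfrac{a^{2}}{2\lambda}\right)-\left(\tfrac{\lambda}{2}-\tfrac{a^{2}}{2\lambda}\right)^{2}\right\}.$$ $\mathbb{D}_{r}=\{z\in\mathbb{C}:|z|<r\}$ and $V=\mathbb{D}_{r}\times\mathbb{D}_{r}$. *)

theory Defs
  imports "HOL-Analysis.Analysis"
begin

definition filled_julia :: "(complex \<Rightarrow> complex) \<Rightarrow> complex set" where
  "filled_julia f = {z. bounded (range (\<lambda>n. (f ^^ n) z))}"

text \<open>The Julia set of a polynomial, as the boundary of its filled Julia set.\<close>

definition julia :: "(complex \<Rightarrow> complex) \<Rightarrow> complex set" where
  "julia f = frontier (filled_julia f)"

definition parabolic_poly :: "complex \<Rightarrow> complex \<Rightarrow> complex" where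
  "parabolic_poly lam x = x\<^sup>2 + (lam / 2 - lam\<^sup>2 / 4)"

definition henon :: "complex \<Rightarrow> complex \<Rightarrow> complex \<times> complex \<Rightarrow> complex \<times> complex" where
  "henon c a = (\<lambda>(x, y). (x\<^sup>2 + c + a * y, a * x))"

definition K_plus :: "complex \<Rightarrow> complex \<Rightarrow> (complex \<times> complex) set" where
  "K_plus c a = {w. bounded (range (\<lambda>n. (henon c a ^^ n) w))}"

definition J_plus :: "complex \<Rightarrow> complex \<Rightarrow> (complex \<times> complex) set" where
  "J_plus c a = frontier (K_plus c a)"

text \<open>The Frechet derivative is taken over the reals; as the Henon map is holomorphic, it is
  the complex derivative. The eigenvalue equation is over the complex numbers.\<close>

definition param_curve :: "complex \<Rightarrow> (complex \<times> complex) set" where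
  "param_curve lam = {(c, a). \<exists>w. henon c a w = w \<and>
     (\<exists>v. v \<noteq> (0, 0) \<and>
        frechet_derivative (henon c a) (at w) v = (lam * fst v, lam * snd v))}"

definition model_map :: "complex \<Rightarrow> complex \<Rightarrow> complex \<times> complex \<Rightarrow> complex \<times> complex" where
  "model_map lam a = (\<lambda>(\<zeta>, z).
     (parabolic_poly lam \<zeta>, a * \<zeta> - a\<^sup>2 * z / deriv (parabolic_poly lam) \<zeta>))"

lemma parabolic_poly_fixed_point:
  "parabolic_poly lam (lam / 2) = lam / 2"
  by (simp add: parabolic_poly_def power2_eq_square)

lemma deriv_parabolic_poly: "deriv (parabolic_poly lam) x = 2 * x"
  unfolding parabolic_poly_def
  by (rule DERIV_imp_deriv) (auto intro!: derivative_eq_intros)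

lemma frechet_derivative_henon:
  "frechet_derivative (henon c a) (at w) = (\<lambda>v. (2 * fst w * fst v + a * snd v, a * fst v))"
proof -
  have "(henon c a has_derivative (\<lambda>v. (2 * fst w * fst v + a * snd v, a * fst v))) (at w)"
    unfolding henon_def case_prod_beta
    by (rule has_derivative_Pair) (auto intro!: derivative_eq_intros)
  then show ?thesis
    by (metis frechet_derivative_at)
qed

lemma param_curve_explicit:
  assumes "lam \<noteq> 0"
  shows "param_curve lam = {(c, a). c = (1 - a\<^sup>2) * (lam / 2 - a\<^sup>2 / (2 * lam))
                                     - (lam / 2 - a\<^sup>2 / (2 * lam))\<^sup>2}"
proof -
  have "(c, a) \<in> param_curve lam \<longleftrightarrow>
      c = (1 - a\<^sup>2) * (lam / 2 - a\<^sup>2 / (2 * lam)) - (lam / 2 - a\<^sup>2 / (2 * lam))\<^sup>2"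
    (is "_ \<longleftrightarrow> c = (1 - a\<^sup>2) * ?x - ?x\<^sup>2") for c a
  proof
    assume "(c, a) \<in> param_curve lam"
    then obtain x y u v where fp: "x\<^sup>2 + c + a * y = x" "a * x = y" and nz: "(u, v) \<noteq> (0, 0)"
      and ev: "2 * x * u + a * v = lam * u" "a * u = lam * v"
      unfolding param_curve_def frechet_derivative_henon by (auto simp: henon_def)
    have v: "v = a * u / lam"
      using ev(2) assms by (simp add: field_simps)
    then have "u \<noteq> 0"
      using nz by auto
    moreover have "u * (2 * x) = u * (lam - a\<^sup>2 / lam)"
      using ev(1) unfolding v by (simp add: algebra_simps power2_eq_square)
    ultimately have "2 * x = lam - a\<^sup>2 / lam"
      by simp
    then have "x = ?x"
      using assms by (simp add: field_simps)
    moreover have "c = (1 - a\<^sup>2) * x - x\<^sup>2"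
    proof -
      have "c = x - x\<^sup>2 - a * (a * x)"
        using fp by (simp add: eq_diff_eq ac_simps)
      then show ?thesis
        by (simp add: algebra_simps power2_eq_square)
    qed
    ultimately show "c = (1 - a\<^sup>2) * ?x - ?x\<^sup>2"
      by simp
  next
    assume c: "c = (1 - a\<^sup>2) * ?x - ?x\<^sup>2"
    define x where "x = ?x"
    have "2 * x * lam + a * a = lam * lam"
      unfolding x_def using assms by (simp add: field_simps power2_eq_square)
    moreover have "henon c a (x, a * x) = (x, a * x)"
      unfolding henon_def c x_def[symmetric] by (simp add: algebra_simps power2_eq_square)
    ultimately show "(c, a) \<in> param_curve lam"
      using assms unfolding param_curve_def frechet_derivative_henon
      by (simp only: mem_Collect_eq case_prod_conv)
         (rule exI[of _ "(x, a * x)"], rule conjI, assumption, rule exI[of _ "(lam, a)"], simp add: mult.commute)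
  qed
  then show ?thesis
    by auto
qed

end

theory Submission imports Defs "HOL-Complex_Analysis.Complex_Analysis"
begin

text \<open>The first coordinates of a Henon orbit satisfy \<open>x\<^sub>n\<^sub>+\<^sub>2 = x\<^sub>n\<^sub>+\<^sub>1\<^sup>2 + c + b x\<^sub>n\<close> with \<open>b = a\<^sup>2\<close>, which for \<open>b = 0\<close> is
  the iteration of \<open>P\<close>. The critical orbit of \<open>P\<close> converges to the parabolic fixed point along every attracting
  direction, and the directions reached by one orbit form a single orbit of the rotation by \<open>\<lambda>\<close>; so there are
  exactly \<open>q\<close> petals. On the curve \<open>\<P>\<^sub>\<lambda>\<close> the fixed point keeps the multiplier \<open>\<lambda>\<close>, and a polynomial that
  parametrizes its invariant curve up to order \<open>q\<close> carries the trapping petals over to small \<open>b\<close>. Hence escaping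
  points of the bidisc avoid a fixed neighbourhood of the critical value.

  Consequently every \<open>z\<close> with \<open>\<bar>P\<^sup>n(z)\<bar> = 3\<close> continues to a graph \<open>x = g(a, y)\<close> of points with the same fate,
  holomorphic in \<open>a\<close>: each pull-back is a square root of a function without zeros. Distinct graphs
  are disjoint, so Harnack's inequality makes \<open>z \<mapsto> g(a, y)\<close> bi-Hoelder, uniformly in \<open>n\<close>, and the graphs have
  limits \<open>g\<^sub>\<zeta>\<close> for \<open>\<zeta> \<in> J\<^sub>P\<close>; these sweep out \<open>J\<^sup>+ \<inter> V\<close>.

  In the coordinates \<open>(\<zeta>, y)\<close> the Henon map is \<open>(P(\<zeta>), a g\<^sub>\<zeta>(y))\<close>, a fibrewise contraction close to \<open>\<psi>\<close>. A cut-off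
  gives a homeomorphism \<open>g\<^sub>0\<close> with \<open>g\<^sub>0 \<circ> \<psi>\<close> equal to it that is the identity near the boundary of \<open>V\<close>,
  and two such contractions are conjugate, because a conjugacy may be prescribed on a fundamental domain.\<close>

text \<open>The parabolic point lies in \<open>J_P\<close>, so there is no uniform expansion there
  and leaves cannot be found by a contraction along orbits. What replaces it is a definite distance
  between escaping points and the critical value: pull-backs are then square roots of functions
  bounded away from zero, the leaves form a holomorphic motion in \<open>a\<close>, and disjointness
  yields the equicontinuity that expansion would give. Counting petals serves to show that the
  resonant coefficient \<open>gam 0\<close> is nonzero: by continuity \<open>gam b\<close> is close
  to it for small \<open>b\<close>, so one trapping region serves all these parameters. As the
  recurrence has order two, a trapped state is a pair of consecutive terms, the first in a petal and
  the second close to the image of the first under the map induced on the curve. In the comparison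
  with \<open>\<psi>\<close>, recovering \<open>z\<close> from \<open>\<psi>(\<zeta>, z)\<close>
  costs a factor of order 1/a^2; it is offset by a Lipschitz constant of order a^2 for the deviation
  of a leaf from its linear approximation.\<close>

section \<open>Attracting petals and the critical orbit\<close>

text \<open>The map \<open>t \<mapsto> v t\<^bsup>-1/m\<^esup>\<close> inverts the coordinate \<open>t = (v/x)\<^sup>m\<close> on the petal in direction \<open>v\<close>.\<close>

definition petal :: "complex \<Rightarrow> nat \<Rightarrow> complex \<Rightarrow> complex" where
  "petal v m t = v * exp (- Ln t / of_nat m)"

lemma petal_power:
  assumes "m \<ge> 1" "t \<noteq> 0"
  shows "petal v m t ^ m = v ^ m / t"
proof -
  have "exp (- Ln t / of_nat m) ^ m = exp (of_nat m * (- Ln t / of_nat m))"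
    by (rule exp_of_nat_mult [symmetric])
  also have "\<dots> = exp (- Ln t)"
    using assms by simp
  also have "\<dots> = 1 / t"
    using assms by (simp add: exp_minus inverse_eq_divide)
  finally show ?thesis
    by (simp add: petal_def power_mult_distrib)
qed

text \<open>As \<open>t = (v/x)^m\<close>, multiplying \<open>x\<close> by \<open>w\<close>
  multiplies \<open>t\<close> by \<open>w^(-m)\<close>. The bounds keep the sum of the two arguments
  inside the principal strip, so that the logarithms add.\<close>

lemma petal_mult:
  assumes "Re t > 0" "w \<noteq> 0" "m \<ge> 1" "real m * \<bar>Im (Ln w)\<bar> < pi / 2"
  shows "petal v m (t * exp (- of_nat m * Ln w)) = petal v m t * w"
proof -
  have t0: "t \<noteq> 0" using assms by auto
  have "\<bar>Im (Ln t)\<bar> < pi / 2"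
    using assms t0 Re_Ln_pos_lt by blast
  moreover have "\<bar>real m * Im (Ln w)\<bar> < pi/2" using assms by (simp add: abs_mult)
  ultimately have "\<bar>Im (Ln t) - real m * Im (Ln w)\<bar> < pi" by linarith
  then have "Ln (exp (Ln t - of_nat m * Ln w)) = Ln t - of_nat m * Ln w"
    by (intro Ln_exp) auto
  moreover have "t * exp (- of_nat m * Ln w) = exp (Ln t - of_nat m * Ln w)"
    using t0 by (simp add: exp_diff exp_minus field_simps)
  ultimately have "petal v m (t * exp (- of_nat m * Ln w)) = v * exp (- (Ln t - of_nat m * Ln w) / of_nat m)"
    by (simp add: petal_def)
  also have "- (Ln t - of_nat m * Ln w) / of_nat m = - Ln t / of_nat m + Ln w"
    using assms by (simp add: field_simps)
  finally have "petal v m (t * exp (- of_nat m * Ln w)) = v * (exp (- Ln t / of_nat m) * exp (Ln w))"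
    unfolding exp_add .
  then show ?thesis
    using assms by (simp add: petal_def)
qed

lemma petal_nonzero: "v \<noteq> 0 \<Longrightarrow> petal v m t \<noteq> 0"
  by (simp add: petal_def)

lemma petal_tendsto_0:
  assumes "m \<ge> 1"
  shows "(petal v m \<longlongrightarrow> 0) at_infinity"
proof (rule tendstoI)
  fix e :: real assume e: "e > 0"
  have "((\<lambda>t. v ^ m / t) \<longlongrightarrow> 0) at_infinity"
    using tendsto_mult_right_zero[OF tendsto_inverse_0, of "v^m"]  by (simp add: divide_inverse)
  then have "\<forall>\<^sub>F t in at_infinity. norm (v ^ m / t) < e ^ m"
    using e by (auto dest!: tendstoD[of _ _ _ "e^m"])
  moreover have "\<forall>\<^sub>F t::complex in at_infinity. t \<noteq> 0"
    by (auto simp: eventually_at_infinity intro!: exI[of _ 1])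
  ultimately show "\<forall>\<^sub>F t in at_infinity. dist (petal v m t) 0 < e"
  proof eventually_elim
    case (elim t)
    then have "norm (petal v m t) ^ m < e ^ m"
      using petal_power[OF assms, of t v] by (simp flip: norm_power)
    then show ?case
      using e by (simp add: power_less_imp_less_base)
  qed
qed

text \<open>The last clause makes \<open>\<bar>(G\<^sup>k)'(x\<^sub>0)\<bar>\<^sup>2 \<bar>t\<^sub>k\<bar> / \<bar>x\<^sub>k\<bar>\<^sup>2\<close> nonincreasing along an orbit, so the inverse branches along it
  expand relative to the distance from 0.\<close>

lemma petal_dynamics:
  fixes R :: "complex poly"
  assumes m: "m \<ge> 1" and v: "v ^ m * poly R 0 = -1" and eta: "\<eta> > 0"
    and G: "\<And>x. G x = x * (1 + x ^ m * poly R x)"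
  obtains M t1 where "M > 0" "((\<lambda>t. t1 t - t) \<longlongrightarrow> of_nat m) at_infinity"
    "\<And>t. norm t \<ge> M \<Longrightarrow> norm (t1 t - t - of_nat m) < \<eta>"
    "\<And>t. norm t \<ge> M \<Longrightarrow> Re t > 0 \<Longrightarrow> G (petal v m t) = petal v m (t1 t)"
    "\<And>t. norm t \<ge> M \<Longrightarrow> Re t > 0 \<Longrightarrow> \<bar>Im t\<bar> \<le> Re t \<Longrightarrow> 
       (norm (deriv G (petal v m t)) * norm (petal v m t))\<^sup>2 * norm (t1 t) \<le> (norm (G (petal v m t)))\<^sup>2 * norm t"
proof -
  have v0: "v \<noteq> 0" using v m by (auto simp: power_0_left)
  define w where "w t = 1 + v ^ m / t * poly R (petal v m t)" for t
  \<comment> \<open>\<open>G\<close> multiplies \<open>x = petal v m t\<close> by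
    \<open>w t\<close>, hence takes the coordinate \<open>t\<close> to
    \<open>t * w^(-m)\<close>.\<close>
  define t1 where "t1 t = t * exp (- of_nat m * Ln (w t))" for t
  have ev1: "\<forall>\<^sub>F t::complex in at_infinity. t \<noteq> 0"
    by (auto simp: eventually_at_infinity intro!: exI[of _ 1])
  have Rlim: "((\<lambda>t. poly R (petal v m t)) \<longlongrightarrow> poly R 0) at_infinity"
    by (intro tendsto_intros petal_tendsto_0 m)
  have R'lim: "((\<lambda>t. poly (pderiv R) (petal v m t)) \<longlongrightarrow> poly (pderiv R) 0) at_infinity"
    by (intro tendsto_intros petal_tendsto_0 m)
  have tw: "((\<lambda>t. t * (w t - 1)) \<longlongrightarrow> -1) at_infinity"
  proof -
    have "((\<lambda>t. v ^ m * poly R (petal v m t)) \<longlongrightarrow> -1) at_infinity"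
      using tendsto_mult_left[OF Rlim, of "v^m"] v by simp
    then show ?thesis
      by (rule Lim_transform_eventually) (use ev1 in eventually_elim, auto simp: w_def)
  qed
  have w1: "(w \<longlongrightarrow> 1) at_infinity"
  proof -
    have "((\<lambda>t. 1 + inverse t * (t * (w t - 1))) \<longlongrightarrow> 1 + 0 * (-1)) at_infinity"
      by (intro tendsto_intros tw tendsto_inverse_0)
    then have "((\<lambda>t. 1 + inverse t * (t * (w t - 1))) \<longlongrightarrow> 1) at_infinity" by simp
    then show ?thesis
      by (rule Lim_transform_eventually) (use ev1 in eventually_elim, auto simp: field_simps)
  qed
  have wat: "filterlim w (at 1) at_infinity"
  proof -
    have "\<forall>\<^sub>F t in at_infinity. t * (w t - 1) \<noteq> 0"
      by (rule tendsto_imp_eventually_ne[OF tw]) auto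
    then have "\<forall>\<^sub>F t in at_infinity. w t \<noteq> 1" by eventually_elim auto
    then show ?thesis using w1 by (simp add: filterlim_at)
  qed
  \<comment> \<open>The derivative of \<open>w^(-m)\<close> at 1 is \<open>-m\<close>, and
    \<open>t * (w t - 1)\<close> tends to -1; the product is the translation length
    \<open>m\<close>.\<close>
  have "((\<lambda>w. exp (- of_nat m * Ln w)) has_field_derivative - of_nat m) (at 1)"
    by (auto intro!: derivative_eq_intros)
  then have "((\<lambda>w. (exp (- of_nat m * Ln w) - 1) / (w - 1)) \<longlongrightarrow> - of_nat m) (at 1)"
    by (simp add: has_field_derivative_iff)
  from filterlim_compose[OF this wat]
  have "((\<lambda>t. (exp (- of_nat m * Ln (w t)) - 1) / (w t - 1) * (t * (w t - 1))) \<longlongrightarrow> - of_nat m * (-1)) at_infinity"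
    by (intro tendsto_mult tw)
  then have "((\<lambda>t. (exp (- of_nat m * Ln (w t)) - 1) / (w t - 1) * (t * (w t - 1))) \<longlongrightarrow> of_nat m) at_infinity"
    by simp
  moreover have "\<forall>\<^sub>F t in at_infinity. w t \<noteq> 1"
    using wat by (simp add: filterlim_at)
  ultimately have t1lim: "((\<lambda>t. t1 t - t) \<longlongrightarrow> of_nat m) at_infinity"
    by (elim Lim_transform_eventually, elim eventually_mono) (simp add: t1_def field_simps)
  have A: "\<forall>\<^sub>F t in at_infinity. norm (t1 t - t - of_nat m) < \<eta>"
    using tendstoD[OF t1lim eta] by (simp add: dist_norm)
  have "((\<lambda>t. real m * \<bar>Im (Ln (w t))\<bar>) \<longlongrightarrow> real m * \<bar>Im (Ln 1)\<bar>) at_infinity"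
    by (intro tendsto_intros w1) auto
  then have B1: "\<forall>\<^sub>F t in at_infinity. real m * \<bar>Im (Ln (w t))\<bar> < pi / 2"
    by (rule order_tendstoD) auto
  have B2: "\<forall>\<^sub>F t in at_infinity. w t \<noteq> 0"
    by (rule tendsto_imp_eventually_ne[OF w1]) auto
  have Gw: "G (petal v m t) = petal v m t * w t" if "t \<noteq> 0" for t
    using that by (simp add: G w_def petal_power[OF m])
  define d where "d t = 1 + v ^ m / t * (of_nat (Suc m) * poly R (petal v m t) + petal v m t * poly (pderiv R) (petal v m t))" for t
  have derivG: "deriv G (petal v m t) = d t" if "t \<noteq> 0" for t
  proof -
    have "G = (\<lambda>x. x + x ^ Suc m * poly R x)" by (auto simp: G algebra_simps)
    then have "(G has_field_derivative 1 + (of_nat (Suc m) * x ^ m * poly R x + x ^ Suc m * poly (pderiv R) x)) (at x)" for x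
      by (auto intro!: derivative_eq_intros poly_DERIV simp del: power_Suc)
    then have "deriv G (petal v m t) = 1 + (of_nat (Suc m) * petal v m t ^ m * poly R (petal v m t) + petal v m t ^ Suc m * poly (pderiv R) (petal v m t))"
      by (rule DERIV_imp_deriv)
    then show ?thesis using that
      by (simp add: d_def petal_power[OF m] algebra_simps add_divide_distrib)
  qed
  have td: "((\<lambda>t. t * (d t - 1)) \<longlongrightarrow> - of_nat (Suc m)) at_infinity"
  proof -
    have "((\<lambda>t. v ^ m * (of_nat (Suc m) * poly R (petal v m t) + petal v m t * poly (pderiv R) (petal v m t)))
       \<longlongrightarrow> v ^ m * (of_nat (Suc m) * poly R 0 + 0 * poly (pderiv R) 0)) at_infinity"
      by (intro tendsto_intros petal_tendsto_0 m Rlim R'lim)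
    also have "v ^ m * (of_nat (Suc m) * poly R 0 + 0 * poly (pderiv R) 0) = of_nat (Suc m) * (v ^ m * poly R 0)"
      by (simp add: algebra_simps)
    also have "\<dots> = - of_nat (Suc m)" by (simp add: v)
    finally show ?thesis
      by (rule Lim_transform_eventually) (use ev1 in eventually_elim, auto simp: d_def)
  qed
  have dw: "((\<lambda>t. t * (d t / w t - 1)) \<longlongrightarrow> - of_nat m) at_infinity"
  proof -
    have "((\<lambda>t. (t * (d t - 1) - t * (w t - 1)) / w t) \<longlongrightarrow> (- of_nat (Suc m) - (-1)) / 1) at_infinity"
      by (intro tendsto_intros td tw w1) auto
    then have "((\<lambda>t. (t * (d t - 1) - t * (w t - 1)) / w t) \<longlongrightarrow> - of_nat m) at_infinity" by simp
    then show ?thesis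
      by (rule Lim_transform_eventually) (use B2 in eventually_elim, auto simp: field_simps)
  qed
  have dw1: "((\<lambda>t. d t / w t) \<longlongrightarrow> 1) at_infinity"
  proof -
    have "((\<lambda>t. 1 + inverse t * (t * (d t / w t - 1))) \<longlongrightarrow> 1 + 0 * (- of_nat m)) at_infinity"
      by (intro tendsto_intros dw tendsto_inverse_0)
    then have "((\<lambda>t. 1 + inverse t * (t * (d t / w t - 1))) \<longlongrightarrow> 1) at_infinity" by simp
    then show ?thesis
      by (rule Lim_transform_eventually) (use ev1 in eventually_elim, auto simp: field_simps)
  qed
  \<comment> \<open>Here \<open>d t\<close> is the derivative of \<open>G\<close> and
    \<open>w t = G x / x\<close>, so \<open>1 + \<beta> t / t\<close> is the ratio of consecutive
    values of the quantity to be shown nonincreasing. Its first-order coefficient is -2m from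
    \<open>(d/w)^2\<close> plus m from \<open>t1 t / t\<close>.\<close>
  define \<beta> where "\<beta> t = t * ((d t / w t)\<^sup>2 * (t1 t / t) - 1)" for t
  have blim: "(\<beta> \<longlongrightarrow> - of_nat m) at_infinity"
  proof -
    have "((\<lambda>t. t * (d t / w t - 1) * (d t / w t + 1) + (d t / w t)\<^sup>2 * (t1 t - t)) \<longlongrightarrow> - of_nat m * (1 + 1) + 1\<^sup>2 * of_nat m) at_infinity"
      by (intro tendsto_intros dw dw1 t1lim)
    also have "- of_nat m * (1 + 1) + 1\<^sup>2 * of_nat m = (- of_nat m :: complex)" by simp
    finally show ?thesis
      by (rule Lim_transform_eventually) (use ev1 B2 in eventually_elim, auto simp: \<beta>_def field_simps power2_eq_square)
  qed
  have C: "\<forall>\<^sub>F t in at_infinity. norm (\<beta> t + of_nat m) < 1/8"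
    using tendstoD[OF blim, of "1/8"] by (simp add: dist_norm)
  have D: "\<forall>\<^sub>F t::complex in at_infinity. norm t \<ge> 8 * (real m + 1)\<^sup>2"
    by (auto simp: eventually_at_infinity)
  have "\<forall>\<^sub>F t in at_infinity. t \<noteq> 0 \<and> norm (t1 t - t - of_nat m) < \<eta> \<and> real m * \<bar>Im (Ln (w t))\<bar> < pi / 2 \<and> w t \<noteq> 0
     \<and> norm (\<beta> t + of_nat m) < 1/8 \<and> norm t \<ge> 8 * (real m + 1)\<^sup>2"
    using ev1 A B1 B2 C D by eventually_elim auto
  then obtain M where M: "\<And>t. norm t \<ge> M \<Longrightarrow> t \<noteq> 0 \<and> norm (t1 t - t - of_nat m) < \<eta> \<and> real m * \<bar>Im (Ln (w t))\<bar> < pi / 2 \<and> w t \<noteq> 0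
     \<and> norm (\<beta> t + of_nat m) < 1/8 \<and> norm t \<ge> 8 * (real m + 1)\<^sup>2"
    by (auto simp: eventually_at_infinity)
  show ?thesis
  proof (rule that[of "max M 1" t1])
    fix t :: complex assume t: "norm t \<ge> max M 1"
    show "norm (t1 t - t - of_nat m) < \<eta>" using M[of t] t by simp
    assume Re: "Re t > 0"
    show "G (petal v m t) = petal v m (t1 t)"
      using M[of t] t Gw[of t] petal_mult[OF Re, of "w t" m v] m by (simp add: t1_def)
    assume Im: "\<bar>Im t\<bar> \<le> Re t"
    have t0: "t \<noteq> 0" "w t \<noteq> 0" and mb: "norm (\<beta> t + of_nat m) < 1/8" and mt: "norm t \<ge> 8 * (real m + 1)\<^sup>2"
      using M[of t] t by auto
    \<comment> \<open>In the sector the real part of \<open>1/t\<close> is at least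
      \<open>1 / (2 * norm t)\<close>, so the linear term of \<open>\<beta> t / t\<close> decreases
      the modulus; the lower bound on \<open>norm t\<close> keeps the square of
      \<open>\<beta> t / t\<close> below that gain.\<close>
    have "norm (1 + \<beta> t / t) \<le> 1"
    proof -
      define e where "e = \<beta> t + of_nat m"
      have e: "norm e < 1/8" using mb e_def by simp
      have bt: "norm (\<beta> t) \<le> real m + 1"
        using norm_triangle_ineq4[of "e" "of_nat m"] e by (simp add: e_def)
      have "norm t \<le> 2 * Re t" using cmod_le[of t] Re Im by simp
      have "Re (\<beta> t / t) = - real m * Re (1 / t) + Re (e / t)"
        unfolding e_def by (simp add: add_divide_distrib Re_divide)
      also have "Re (1/t) = Re t / (norm t)\<^sup>2"
        by (simp add: Re_divide cmod_power2)
      also have "Re (e / t) \<le> norm (e / t)" by (rule complex_Re_le_cmod)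
      also have "norm (e/t) \<le> (1/8) / norm t" using e t0 by (simp add: norm_divide field_simps)
      finally have "Re (\<beta> t / t) \<le> - real m * (Re t / (norm t)\<^sup>2) + (1/8) / norm t" by simp
      moreover have "Re t / (norm t)\<^sup>2 \<ge> (norm t / 2) / (norm t)\<^sup>2"
        using \<open>norm t \<le> 2 * Re t\<close> by (intro divide_right_mono) auto
      moreover have "(norm t / 2) / (norm t)\<^sup>2 = 1 / (2 * norm t)"
        using t0 by (simp add: power2_eq_square)
      moreover have "real m * (Re t / (norm t)\<^sup>2) \<ge> 1 * (Re t / (norm t)\<^sup>2)"
        using m Re by (intro mult_right_mono) auto
      ultimately have r: "Re (\<beta> t / t) \<le> - (1 / (2 * norm t)) + (1/8) / norm t" by linarith
      have "(norm (\<beta> t / t))\<^sup>2 = (norm (\<beta> t))\<^sup>2 / (norm t)\<^sup>2"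
        by (simp add: norm_divide power_divide)
      also have "\<dots> \<le> (real m + 1)\<^sup>2 / (norm t)\<^sup>2"
        using bt by (intro divide_right_mono power_mono) auto
      also have "\<dots> \<le> (norm t / 8) / (norm t)\<^sup>2"
        using mt by (intro divide_right_mono) auto
      also have "\<dots> = 1 / (8 * norm t)"
        using t0 by (simp add: power2_eq_square)
      finally have q: "(norm (\<beta> t / t))\<^sup>2 \<le> 1 / (8 * norm t)" .
      have "(norm (1 + \<beta> t / t))\<^sup>2 = 1 + 2 * Re (\<beta> t / t) + (norm (\<beta> t / t))\<^sup>2"
        by (simp only: cmod_power2) (simp add: power2_eq_square algebra_simps)
      also have "\<dots> \<le> 1 + 2 * (- (1 / (2 * norm t)) + (1/8) / norm t) + 1 / (8 * norm t)"
        using add_mono[OF mult_left_mono[OF r, of 2] q] by simp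
      also have "\<dots> \<le> 1" using t0 by (simp add: field_simps)
      finally show ?thesis by (simp add: power_le_one_iff)
    qed
    moreover have "1 + \<beta> t / t = (d t / w t)\<^sup>2 * (t1 t / t)"
      using t0 by (simp add: \<beta>_def)
    ultimately have "(norm (d t))\<^sup>2 / (norm (w t))\<^sup>2 * (norm (t1 t) / norm t) \<le> 1"
      by (simp add: norm_mult norm_divide norm_power power_divide)
    then have "(norm (d t))\<^sup>2 * norm (t1 t) \<le> (norm (w t))\<^sup>2 * norm t"
      using t0 by (simp add: field_simps)
    from mult_right_mono[OF this, of "(norm (petal v m t))\<^sup>2"]
    show "(norm (deriv G (petal v m t)) * norm (petal v m t))\<^sup>2 * norm (t1 t) \<le> (norm (G (petal v m t)))\<^sup>2 * norm t"
      using t0 by (simp add: derivG Gw norm_mult power_mult_distrib mult_ac)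
  qed (use t1lim in simp_all)
qed

text \<open>The Stolz-Cesaro argument. Applied to petal coordinates it gives
  \<open>t_k / k \<longlonglongrightarrow> m\<close>, which controls the argument of
  \<open>t_k\<close> and hence the direction in which the orbit approaches 0.\<close>

lemma LIMSEQ_increments_imp_average:
  fixes u :: "nat \<Rightarrow> complex"
  assumes "(\<lambda>k. u (Suc k) - u k) \<longlonglongrightarrow> L"
  shows "(\<lambda>k. u k / of_nat k) \<longlonglongrightarrow> L"
proof (rule LIMSEQ_I)
  fix e :: real assume e: "e > 0"
  obtain K where K: "\<And>k. k \<ge> K \<Longrightarrow> norm (u (Suc k) - u k - L) < e / 2"
    using LIMSEQ_D[OF assms, of "e/2"] e by auto
  define v where "v k = u k - of_nat k * L" for k
  have v: "norm (v (K + j)) \<le> norm (v K) + real j * (e / 2)" for j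
  proof (induction j)
    case (Suc j)
    have "v (K + Suc j) = v (K + j) + (u (Suc (K + j)) - u (K + j) - L)"
      by (simp add: v_def algebra_simps)
    then have "norm (v (K + Suc j)) \<le> norm (v (K + j)) + norm (u (Suc (K + j)) - u (K + j) - L)"
      by (metis norm_triangle_ineq)
    also have "\<dots> \<le> norm (v K) + real j * (e / 2) + e / 2"
      using Suc K[of "K + j"] by (intro add_mono) auto
    finally show ?case by (simp add: field_simps)
  qed simp
  obtain N :: nat where N: "real N > 2 * norm (v K) / e" using reals_Archimedean2 by blast
  show "\<exists>no. \<forall>n\<ge>no. norm (u n / of_nat n - L) < e"
  proof (intro exI allI impI)
    fix n assume n: "n \<ge> max (Suc K) N"
    then have n0: "n > 0" by simp
    have "real n > 2 * norm (v K) / e" using n N by (meson less_le_trans max.boundedE of_nat_le_iff)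
    then have a: "norm (v K) < real n * (e / 2)" using e by (simp add: field_simps)
    have "norm (v n) \<le> norm (v K) + real (n - K) * (e / 2)"
      using v[of "n - K"] n by simp
    also have "\<dots> < real n * (e / 2) + real n * (e / 2)"
      using a e by (intro add_less_le_mono mult_right_mono) auto
    finally have "norm (v n) < real n * e" by (simp add: field_simps)
    moreover have "u n / of_nat n - L = v n / of_nat n"
      using n0 by (simp add: v_def field_simps)
    ultimately show "norm (u n / of_nat n - L) < e"
      using n0 by (simp add: norm_divide field_simps)
  qed
qed

text \<open>Division by \<open>k\<close> does not change the argument, and \<open>T k / k\<close>
  tends to a positive real, so the argument of \<open>T k\<close> tends to 0; the direction of
  \<open>petal v m (T k)\<close> differs from that of \<open>v\<close> by this argument divided by
  \<open>-m\<close>.\<close>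

lemma petal_tendsto_direction:
  assumes "m \<ge> 1" "(\<lambda>k. T k / of_nat k) \<longlonglongrightarrow> of_nat m"
  shows "(\<lambda>k. sgn (petal v m (T k))) \<longlonglongrightarrow> sgn v"
proof -
  have L: "(\<lambda>k. Ln (T k / of_nat k)) \<longlonglongrightarrow> Ln (of_nat m)"
    using assms by (intro tendsto_Ln) auto
  have "(\<lambda>k. Im (Ln (T k / of_nat k))) \<longlonglongrightarrow> Im (Ln (of_nat m))"
    by (intro tendsto_intros L)
  then have I: "(\<lambda>k. Im (Ln (T k / of_nat k))) \<longlonglongrightarrow> 0"
    using assms by (simp add: Ln_of_nat)
  have "\<forall>\<^sub>F k in sequentially. T k / of_nat k \<noteq> 0"
    using assms by (intro tendsto_imp_eventually_ne[OF assms(2)]) auto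
  then have e: "\<forall>\<^sub>F k in sequentially. Im (Ln (T k / of_nat k)) = Im (Ln (T k))"
    using eventually_gt_at_top[of 0]
  proof eventually_elim
    case (elim k)
    then have "T k = of_real (real k) * (T k / of_nat k)" by simp
    then have "Ln (T k) = of_real (ln (real k)) + Ln (T k / of_nat k)"
      using Ln_times_of_real[of "real k" "T k / of_nat k"] elim by simp
    then show ?case by simp
  qed
  have "(\<lambda>k. sgn v * exp (- (\<i> * of_real (Im (Ln (T k / of_nat k)) / real m)))) \<longlonglongrightarrow> sgn v * exp (- (\<i> * of_real (0 / real m)))"
    using assms by (intro tendsto_intros I) auto
  then have "(\<lambda>k. sgn v * exp (- (\<i> * of_real (Im (Ln (T k / of_nat k)) / real m)))) \<longlonglongrightarrow> sgn v" by simp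
  then show ?thesis
  proof (rule Lim_transform_eventually)
    show "\<forall>\<^sub>F k in sequentially. sgn v * exp (- (\<i> * of_real (Im (Ln (T k / of_nat k)) / real m))) = sgn (petal v m (T k))"
      using e
    proof eventually_elim
      case (elim k)
      have "sgn (exp z) = exp (\<i> * of_real (Im z))" for z
        using exp_eq_polar[of z] by (simp add: sgn_eq norm_mult flip: cis_conv_exp)
      from this[of "- Ln (T k) / of_nat m"] show ?case
        using elim by (simp add: petal_def sgn_mult Im_divide_of_nat)
    qed
  qed
qed

text \<open>The map \<open>f\<close> is \<open>P\<close> with the parabolic fixed point moved to 0;
  its critical value is \<open>- lam^2 / 4\<close>, and \<open>f x = y\<close> means
  \<open>(x + lam/2)^2 = y + lam^2/4\<close>. A backward invariant set without the critical value
  never produces a zero of the right-hand side, so a holomorphic square root exists on the disc at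
  every stage.\<close>

lemma quadratic_inverse_branch:
  fixes lam :: complex
  defines "f \<equiv> \<lambda>x. lam * x + x\<^sup>2"
  assumes bwd: "\<And>z. f z \<in> B \<Longrightarrow> z \<in> B" and cv: "- lam\<^sup>2 / 4 \<notin> B"
    and B: "ball w \<rho> \<subseteq> B" "\<rho> > 0" and z: "(f ^^ n) z = w"
  shows "\<exists>h. h holomorphic_on ball w \<rho> \<and> h w = z \<and> (\<forall>x\<in>ball w \<rho>. (f ^^ n) (h x) = x \<and> h x \<in> B)"
  using z
proof (induction n arbitrary: z)
  case 0
  then show ?case using B by (intro exI[of _ "\<lambda>x. x"]) auto
next
  case (Suc n)
  have "(f ^^ n) (f z) = w" using Suc.prems by (simp add: funpow_swap1)
  from Suc.IH[OF this] obtain h where h: "h holomorphic_on ball w \<rho>" "h w = f z"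
    "\<And>x. x \<in> ball w \<rho> \<Longrightarrow> (f ^^ n) (h x) = x \<and> h x \<in> B" by blast
  have "h x + lam\<^sup>2 / 4 \<noteq> 0" if "x \<in> ball w \<rho>" for x
  proof
    assume "h x + lam\<^sup>2 / 4 = 0"
    then have "h x = - lam\<^sup>2 / 4" by (simp add: add_eq_0_iff2)
    then show False using h(3)[OF that] cv by metis
  qed
  moreover have "(\<lambda>x. h x + lam\<^sup>2 / 4) holomorphic_on ball w \<rho>"
    by (intro holomorphic_intros h)
  ultimately obtain g where g: "g holomorphic_on ball w \<rho>" "\<And>x. x \<in> ball w \<rho> \<Longrightarrow> h x + lam\<^sup>2 / 4 = (g x)\<^sup>2"
    using contractible_imp_holomorphic_sqrt[of "\<lambda>x. h x + lam\<^sup>2 / 4" "ball w \<rho>"] convex_imp_contractible[OF convex_ball]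
    by metis
  have w: "w \<in> ball w \<rho>" using B by simp
  have "(g w)\<^sup>2 = (z + lam / 2)\<^sup>2"
    using g(2)[OF w] h(2) by (simp add: f_def power2_eq_square algebra_simps)
  then have "g w = z + lam / 2 \<or> - g w = z + lam / 2"
    unfolding power2_eq_iff by auto
  then obtain s where s: "s = 1 \<or> s = -1" "s * g w = z + lam / 2"
    by (metis mult_1 mult_minus1)
  define h' where "h' x = s * g x - lam / 2" for x
  have s2: "s\<^sup>2 = 1" using s by auto
  have f: "f (h' x) = h x" if "x \<in> ball w \<rho>" for x
  proof -
    have "f (h' x) = s\<^sup>2 * (g x)\<^sup>2 - lam\<^sup>2 / 4"
      by (simp add: f_def h'_def power2_eq_square algebra_simps)
    also have "\<dots> = h x" using g(2)[OF that] s2 by (metis add_diff_cancel_right' mult_1)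
    finally show ?thesis .
  qed
  show ?case
  proof (intro exI[of _ h'] conjI ballI)
    show "h' holomorphic_on ball w \<rho>" unfolding h'_def by (intro holomorphic_intros g)
    show "h' w = z" using s by (simp add: h'_def)
    fix x assume x: "x \<in> ball w \<rho>"
    show "(f ^^ Suc n) (h' x) = x" using f[OF x] h(3)[OF x] by (simp add: funpow_swap1)
    show "h' x \<in> B" using f[OF x] h(3)[OF x] bwd by metis
  qed
qed

lemma quadratic_escape_step:
  assumes "norm lam = 1" "norm x \<ge> (3::real)"
  shows "norm (lam * x + x\<^sup>2 :: complex) \<ge> 3"
proof -
  have "norm (x\<^sup>2) \<le> norm (lam * x + x\<^sup>2) + norm (lam * x)"
    using norm_triangle_ineq4[of "lam * x + x\<^sup>2" "lam * x"] by simp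
  then have "norm x * norm x - norm x \<le> norm (lam * x + x\<^sup>2)"
    using assms by (simp add: norm_mult norm_power power2_eq_square)
  moreover have "norm x * norm x \<ge> 3 * norm x" using assms by (intro mult_right_mono) auto
  ultimately show ?thesis using assms by linarith
qed

lemma quadratic_escape_funpow:
  assumes "norm lam = 1" "norm x \<ge> (3::real)"
  shows "norm (((\<lambda>x::complex. lam * x + x\<^sup>2) ^^ n) x) \<ge> 3"
  by (induction n) (use assms quadratic_escape_step in auto)

text \<open>Since \<open>m \<ge> 1\<close> and the error is below 1/4, each step moves
  \<open>t\<close> to the right by at least 3/4 and vertically by at most 1/4. The half-plane is
  thus invariant and orbits end up in the sector \<open>\<bar>Im t\<bar> \<le> Re t\<close>.\<close>

lemma petal_orbit:
  assumes M: "M > 0" "\<And>t. norm t \<ge> M \<Longrightarrow> norm (t1 t - t - of_nat m) < 1/4"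
    "\<And>t. norm t \<ge> M \<Longrightarrow> Re t > 0 \<Longrightarrow> G (petal v m t) = petal v m (t1 t)" and m: "m \<ge> 1"
    and t: "Re t \<ge> M"
  shows "Re ((t1 ^^ k) t) \<ge> Re t + real k * (3/4)" "\<bar>Im ((t1 ^^ k) t)\<bar> \<le> \<bar>Im t\<bar> + real k / 4"
    "(G ^^ k) (petal v m t) = petal v m ((t1 ^^ k) t)"
proof -
  have "Re ((t1 ^^ k) t) \<ge> Re t + real k * (3/4) \<and> \<bar>Im ((t1 ^^ k) t)\<bar> \<le> \<bar>Im t\<bar> + real k / 4
    \<and> (G ^^ k) (petal v m t) = petal v m ((t1 ^^ k) t)"
  proof (induction k)
    case (Suc k)
    define s where "s = (t1 ^^ k) t"
    have s: "Re s \<ge> Re t + real k * (3/4)" "\<bar>Im s\<bar> \<le> \<bar>Im t\<bar> + real k / 4" "(G ^^ k) (petal v m t) = petal v m s"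
      using Suc unfolding s_def by auto
    have "Re s \<ge> M" using s(1) t by (smt (verit) of_nat_0_le_iff mult_nonneg_nonneg divide_nonneg_nonneg)
    then have n: "norm s \<ge> M" "Re s > 0" using complex_Re_le_cmod[of s] M by auto
    have "\<bar>Re (t1 s - s - of_nat m)\<bar> < 1/4" "\<bar>Im (t1 s - s - of_nat m)\<bar> < 1/4"
      using M(2)[OF n(1)] abs_Re_le_cmod[of "t1 s - s - of_nat m"] abs_Im_le_cmod[of "t1 s - s - of_nat m"] by linarith+
    moreover have "Re (t1 s - s - of_nat m) = Re (t1 s) - Re s - real m" "Im (t1 s - s - of_nat m) = Im (t1 s) - Im s"
      by simp_all
    moreover have "real m \<ge> 1" using m by simp
    ultimately have "Re (t1 s) \<ge> Re s + 3/4" "\<bar>Im (t1 s)\<bar> \<le> \<bar>Im s\<bar> + 1/4"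
      by linarith+
    then show ?case using s M(3)[OF n] by (simp add: s_def[symmetric] field_simps)
  qed auto
  then show "Re ((t1 ^^ k) t) \<ge> Re t + real k * (3/4)" "\<bar>Im ((t1 ^^ k) t)\<bar> \<le> \<bar>Im t\<bar> + real k / 4"
    "(G ^^ k) (petal v m t) = petal v m ((t1 ^^ k) t)" by auto
qed

lemma petal_orbit_norm_at_top:
  assumes "\<And>k. Re (T k) \<ge> c + real k * (3/4)"
  shows "filterlim T at_infinity sequentially"
proof -
  have "filterlim (\<lambda>k. c + real k * (3/4)) at_top sequentially"
    by real_asymp
  then have "filterlim (\<lambda>k. norm (T k)) at_top sequentially"
    by (rule filterlim_at_top_mono) (intro always_eventually allI order_trans[OF assms] complex_Re_le_cmod)
  then show ?thesis by (rule filterlim_norm_at_top_imp_at_infinity)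
qed

text \<open>A relative change of \<open>x\<close> by a factor \<open>w\<close> near 1 changes
  \<open>t\<close> by the factor \<open>w^(-m)\<close>, also near 1. In the sector
  \<open>norm t \<le> 2 * Re t\<close>, so a relative change of 1/4 costs at most half of the real
  part.\<close>

lemma petal_contains_disc:
  assumes m: "m \<ge> 1"
  obtains s where "s > 0" "\<And>t x. Re t > 0 \<Longrightarrow> \<bar>Im t\<bar> \<le> Re t \<Longrightarrow> x \<in> ball (petal v m t) (s * norm (petal v m t)) \<Longrightarrow>
     \<exists>u. x = petal v m u \<and> Re u \<ge> Re t / 2"
proof -
  have "((\<lambda>w. exp (- of_nat m * Ln w)) \<longlongrightarrow> exp (- of_nat m * Ln 1)) (nhds 1)"
    by (intro tendsto_intros filterlim_ident) auto
  then have 1: "\<forall>\<^sub>F w in nhds 1. norm (exp (- of_nat m * Ln w) - 1) < 1/4"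
    by (auto dest!: tendstoD[of _ _ _ "1/4"] simp: dist_norm)
  have "((\<lambda>w. real m * \<bar>Im (Ln w)\<bar>) \<longlongrightarrow> real m * \<bar>Im (Ln 1)\<bar>) (nhds 1)"
    by (intro tendsto_intros filterlim_ident) auto
  then have 2: "\<forall>\<^sub>F w in nhds 1. real m * \<bar>Im (Ln w)\<bar> < pi / 2"
    by (rule order_tendstoD) auto
  have 3: "\<forall>\<^sub>F w in nhds (1::complex). w \<noteq> 0"
    by (rule t1_space_nhds) auto
  have "\<forall>\<^sub>F w in nhds 1. norm (exp (- of_nat m * Ln w) - 1) < 1/4 \<and> real m * \<bar>Im (Ln w)\<bar> < pi / 2 \<and> w \<noteq> 0"
    using 1 2 3 by eventually_elim auto
  then obtain s where s: "s > 0" "\<And>w. dist w 1 < s \<Longrightarrow> norm (exp (- of_nat m * Ln w) - 1) < 1/4 \<and> real m * \<bar>Im (Ln w)\<bar> < pi / 2 \<and> w \<noteq> 0"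
    by (auto simp: eventually_nhds_metric)
  show ?thesis
  proof (rule that[OF s(1)])
    fix t x assume t: "Re t > 0" "\<bar>Im t\<bar> \<le> Re t" and x: "x \<in> ball (petal v m t) (s * norm (petal v m t))"
    let ?p = "petal v m t"
    have p0: "?p \<noteq> 0" using x s by auto
    define w where "w = x / ?p"
    have "norm (w - 1) = norm (x - ?p) / norm ?p"
      using p0 by (simp add: w_def norm_divide[symmetric] diff_divide_distrib)
    also have "\<dots> < s" using x p0 by (simp add: dist_norm norm_minus_commute field_simps)
    finally have "dist w 1 < s" by (simp add: dist_norm)
    note w = s(2)[OF this]
    define u where "u = t * exp (- of_nat m * Ln w)"
    have "petal v m u = ?p * w" unfolding u_def using petal_mult[of t w m v] t w m by simp
    then have "x = petal v m u" using p0 by (simp add: w_def)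
    moreover have "Re u \<ge> Re t / 2"
    proof -
      have "norm (u - t) \<le> norm t * (1/4)"
        using w unfolding u_def by (metis (no_types, opaque_lifting) less_eq_real_def mult.right_neutral mult_left_mono norm_ge_zero norm_mult right_diff_distrib)
      moreover have "norm t \<le> 2 * Re t" using cmod_le[of t] t by simp
      moreover have "\<bar>Re (u - t)\<bar> \<le> norm (u - t)" by (rule abs_Re_le_cmod)
      ultimately show ?thesis by simp
    qed
    ultimately show "\<exists>u. x = petal v m u \<and> Re u \<ge> Re t / 2" by blast
  qed
qed

text \<open>Otherwise the inverse branches along an orbit in the petal would be defined on discs of radius
  comparable to \<open>\<bar>x\<^sub>k\<bar>\<close> and bounded, which Cauchy's estimate and the expansion along the orbit exclude.\<close>

lemma critical_orbit_enters_petal: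
  fixes lam v :: complex and R :: "complex poly"
  defines "f \<equiv> \<lambda>x. lam * x + x\<^sup>2"
  assumes lam: "norm lam = 1" and m: "m \<ge> 1" and v: "v ^ m * poly R 0 = -1"
    and G: "\<And>x. (f ^^ q) x = x * (1 + x ^ m * poly R x)"
  obtains M t1 where "M > 0" "((\<lambda>t. t1 t - t) \<longlongrightarrow> of_nat m) at_infinity"
    "\<And>t. norm t \<ge> M \<Longrightarrow> norm (t1 t - t - of_nat m) < 1/4"
    "\<And>t. norm t \<ge> M \<Longrightarrow> Re t > 0 \<Longrightarrow> (f ^^ q) (petal v m t) = petal v m (t1 t)"
    "\<exists>n t. Re t \<ge> M \<and> (f ^^ n) (- lam\<^sup>2 / 4) = petal v m t"
proof -
  define G where "G = f ^^ q"
  have G: "G x = x * (1 + x ^ m * poly R x)" for x using G by (simp add: G_def)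
  have v0: "v \<noteq> 0" using v m by (auto simp: power_0_left)
  have q4: "(1/4 :: real) > 0" by simp
  obtain M1 t1 where M1: "M1 > 0" and t1lim: "((\<lambda>t. t1 t - t) \<longlongrightarrow> of_nat m) at_infinity"
    and t1a: "\<And>t. norm t \<ge> M1 \<Longrightarrow> norm (t1 t - t - of_nat m) < 1/4"
    and t1b: "\<And>t. norm t \<ge> M1 \<Longrightarrow> Re t > 0 \<Longrightarrow> G (petal v m t) = petal v m (t1 t)"
    and t1c: "\<And>t. norm t \<ge> M1 \<Longrightarrow> Re t > 0 \<Longrightarrow> \<bar>Im t\<bar> \<le> Re t \<Longrightarrow>
       (norm (deriv G (petal v m t)) * norm (petal v m t))\<^sup>2 * norm (t1 t) \<le> (norm (G (petal v m t)))\<^sup>2 * norm t"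
    by (rule petal_dynamics[OF m v q4 G], rule that)
  have "\<forall>\<^sub>F t in at_infinity. dist (petal v m t) 0 < 3"
    by (rule tendstoD[OF petal_tendsto_0[OF m]]) simp
  then obtain M2 where M2: "\<And>t. norm t \<ge> M2 \<Longrightarrow> norm (petal v m t) < 3"
    by (auto simp: eventually_at_infinity)
  \<comment> \<open>The bound \<open>M2\<close> puts the petal inside the disc of radius 3. Points
    of modulus at least 3 never return there, so the whole set \<open>B\<close> below stays in that
    disc.\<close>
  define M where "M = max M1 M2"
  have M: "M > 0" "M \<ge> M1" "M \<ge> M2" using M1 by (auto simp: M_def)
  have t1a': "\<And>t. norm t \<ge> M \<Longrightarrow> norm (t1 t - t - of_nat m) < 1/4" using t1a M by auto
  have t1b': "\<And>t. norm t \<ge> M \<Longrightarrow> Re t > 0 \<Longrightarrow> G (petal v m t) = petal v m (t1 t)" using t1b M by auto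
  define B where "B = {z. \<exists>n t. Re t \<ge> M \<and> (f ^^ n) z = petal v m t}"
  have cvB: "- lam\<^sup>2 / 4 \<in> B"
  proof (rule ccontr)
    assume cv: "- lam\<^sup>2 / 4 \<notin> B"
    have bwd: "z \<in> B" if "lam * z + z\<^sup>2 \<in> B" for z
    proof -
      from that obtain n t where "Re t \<ge> M" "(f ^^ n) (f z) = petal v m t" unfolding B_def f_def by blast
      then have "Re t \<ge> M \<and> (f ^^ Suc n) z = petal v m t" by (simp add: funpow_swap1)
      then show ?thesis unfolding B_def by blast
    qed
    have B3: "norm z < 3" if zB: "z \<in> B" for z
    proof (rule ccontr)
      assume "\<not> norm z < 3"
      then have "norm ((f ^^ n) z) \<ge> 3" for n
        unfolding f_def using quadratic_escape_funpow[OF lam] by simp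
      moreover obtain n t where "Re t \<ge> M" "(f ^^ n) z = petal v m t" using zB unfolding B_def by blast
      moreover have "norm (petal v m t) < 3"
        using M2 M \<open>Re t \<ge> M\<close> complex_Re_le_cmod[of t] by fastforce
      ultimately show False by (metis not_less)
    qed
    define T where "T k = (t1 ^^ k) (of_real M)" for k
    define \<xi> where "\<xi> k = petal v m (T k)" for k
    have T1: "Re (T k) \<ge> M + real k * (3/4)" "\<bar>Im (T k)\<bar> \<le> real k / 4" "(G ^^ k) (\<xi> 0) = \<xi> k" for k
      using petal_orbit[OF M(1) t1a' t1b' m, of "of_real M" k] by (auto simp: T_def \<xi>_def)
    have TS: "T (Suc k) = t1 (T k)" for k by (simp add: T_def)
    have TM: "Re (T k) \<ge> M" "norm (T k) \<ge> M" "Re (T k) > 0" for k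
      using T1(1)[of k] M(1) complex_Re_le_cmod[of "T k"] by (smt (verit) of_nat_0_le_iff mult_nonneg_nonneg divide_nonneg_nonneg)+
    have Tsec: "\<bar>Im (T k)\<bar> \<le> Re (T k)" for k using T1(1,2)[of k] M(1) by simp
    have \<xi>0: "\<xi> k \<noteq> 0" for k unfolding \<xi>_def by (rule petal_nonzero[OF v0])
    have \<xi>S: "\<xi> (Suc k) = G (\<xi> k)" for k
      unfolding \<xi>_def TS using t1b' TM by metis
    define D where "D k = (\<Prod>i<k. deriv G (\<xi> i))" for k
    have dG: "(G has_field_derivative deriv G x) (at x)" for x
    proof -
      have "G = (\<lambda>x. x * (1 + x ^ m * poly R x))" using G by blast
      moreover have "((\<lambda>x. x * (1 + x ^ m * poly R x)) has_field_derivative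
          1 * (1 + x ^ m * poly R x) + (of_nat m * x ^ (m - 1) * poly R x + x ^ m * poly (pderiv R) x) * x) (at x)"
        by (auto intro!: derivative_eq_intros poly_DERIV simp: algebra_simps)
      ultimately have "G field_differentiable at x" by (metis field_differentiable_def)
      then show ?thesis by (simp add: field_differentiable_derivI)
    qed
    have dGk: "((G ^^ k) has_field_derivative D k) (at (\<xi> 0))" for k
    proof (induction k)
      case (Suc k)
      have "(G \<circ> (G ^^ k) has_field_derivative deriv G ((G ^^ k) (\<xi> 0)) * D k) (at (\<xi> 0))"
        by (rule DERIV_chain[OF dG Suc])
      then show ?case using T1(3)[of k] by (simp add: D_def mult.commute comp_def)
    qed (simp add: D_def id_def)
    \<comment> \<open>\<open>D k\<close> is the derivative of \<open>G^k\<close> at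
      \<open>\<xi> 0\<close>; the last clause of \<open>petal_dynamics\<close> makes the following
      quantity nonincreasing in \<open>k\<close>.\<close>
    define C where "C = (norm (D 0) / norm (\<xi> 0))\<^sup>2 * norm (T 0)"
    have R: "(norm (D k) / norm (\<xi> k))\<^sup>2 * norm (T k) \<le> C" for k
    proof (induction k)
      case (Suc k)
      have "(norm (deriv G (\<xi> k)) * norm (\<xi> k))\<^sup>2 * norm (T (Suc k)) \<le> (norm (\<xi> (Suc k)))\<^sup>2 * norm (T k)"
        unfolding \<xi>S TS unfolding \<xi>_def by (rule t1c) (use TM[of k] Tsec[of k] M in auto)
      then have "(norm (deriv G (\<xi> k)))\<^sup>2 * norm (T (Suc k)) / (norm (\<xi> (Suc k)))\<^sup>2 \<le> norm (T k) / (norm (\<xi> k))\<^sup>2"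
        using \<xi>0[of k] \<xi>0[of "Suc k"] by (simp add: field_simps power_mult_distrib)
      from mult_left_mono[OF this, of "(norm (D k))\<^sup>2"]
      have "(norm (D (Suc k)) / norm (\<xi> (Suc k)))\<^sup>2 * norm (T (Suc k)) \<le> (norm (D k) / norm (\<xi> k))\<^sup>2 * norm (T k)"
        by (simp add: D_def norm_mult power_mult_distrib power_divide mult_ac)
      then show ?case using Suc by simp
    qed (simp add: C_def)
    obtain s where s: "s > 0" "\<And>t x. Re t > 0 \<Longrightarrow> \<bar>Im t\<bar> \<le> Re t \<Longrightarrow> x \<in> ball (petal v m t) (s * norm (petal v m t)) \<Longrightarrow>
       \<exists>u. x = petal v m u \<and> Re u \<ge> Re t / 2"
      using petal_contains_disc[OF m] by blast
    \<comment> \<open>The branch \<open>h\<close> of the inverse of \<open>G^k\<close> is defined on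
      the disc of radius \<open>s * norm (\<xi> k)\<close> and has modulus at most 3. Cauchy's
      estimate on the disc of half that radius bounds its derivative, which is the reciprocal of
      \<open>D k\<close>.\<close>
    have low: "norm (D k) / norm (\<xi> k) \<ge> s / 6" if k: "Re (T k) \<ge> 2 * M" for k
    proof -
      define \<rho> where "\<rho> = s * norm (\<xi> k)"
      have \<rho>: "\<rho> > 0" using s \<xi>0 by (simp add: \<rho>_def)
      have "ball (\<xi> k) \<rho> \<subseteq> B"
      proof
        fix x assume "x \<in> ball (\<xi> k) \<rho>"
        then obtain u where u: "x = petal v m u" "Re u \<ge> Re (T k) / 2"
          using s(2)[of "T k" x] TM Tsec unfolding \<rho>_def \<xi>_def by blast
        then have "Re u \<ge> M" using k by simp
        then show "x \<in> B" unfolding B_def u(1) by (intro CollectI exI[of _ 0] exI[of _ u]) auto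
      qed
      moreover have fk: "(\<lambda>x. lam * x + x\<^sup>2) ^^ (k * q) = G ^^ k"
        unfolding G_def f_def by (simp add: funpow_mult mult.commute)
      then have "((\<lambda>x. lam * x + x\<^sup>2) ^^ (k * q)) (\<xi> 0) = \<xi> k" using T1(3) by simp
      ultimately obtain h where h: "h holomorphic_on ball (\<xi> k) \<rho>" "h (\<xi> k) = \<xi> 0"
         "\<And>x. x \<in> ball (\<xi> k) \<rho> \<Longrightarrow> (G ^^ k) (h x) = x \<and> h x \<in> B"
        using quadratic_inverse_branch[of lam B, OF bwd cv, of "\<xi> k" \<rho> "k * q" "\<xi> 0"] \<rho> unfolding fk by blast
      have \<xi>b: "\<xi> k \<in> ball (\<xi> k) \<rho>" using \<rho> by simp
      have dh: "(h has_field_derivative deriv h (\<xi> k)) (at (\<xi> k))"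
        using h(1) \<xi>b by (meson holomorphic_derivI open_ball)
      have "((\<lambda>x. (G ^^ k) (h x)) has_field_derivative D k * deriv h (\<xi> k)) (at (\<xi> k))"
        using DERIV_chain2[OF _ dh] dGk[of k] h(2) by simp
      then have "((\<lambda>x. x) has_field_derivative D k * deriv h (\<xi> k)) (at (\<xi> k))"
        by (rule has_field_derivative_transform_within_open[of _ _ _ "ball (\<xi> k) \<rho>"]) (use h \<xi>b in auto)
      then have one: "D k * deriv h (\<xi> k) = 1"
        by (rule DERIV_unique) (rule DERIV_ident)
      have sub: "cball (\<xi> k) (\<rho>/2) \<subseteq> ball (\<xi> k) \<rho>" using \<rho> by auto
      have "norm ((deriv ^^ 1) h (\<xi> k)) \<le> fact 1 * 3 / (\<rho> / 2) ^ 1"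
      proof (rule Cauchy_inequality)
        show "h holomorphic_on ball (\<xi> k) (\<rho> / 2)"
          by (rule holomorphic_on_subset[OF h(1)]) (use \<rho> in auto)
        show "continuous_on (cball (\<xi> k) (\<rho> / 2)) h"
          by (rule holomorphic_on_imp_continuous_on, rule holomorphic_on_subset[OF h(1) sub])
        show "norm (h x) \<le> 3" if "norm (\<xi> k - x) = \<rho> / 2" for x
        proof -
          have "x \<in> ball (\<xi> k) \<rho>" using that \<rho> by (simp add: dist_norm)
          then show ?thesis using h(3) B3 by (meson less_imp_le)
        qed
      qed (use \<rho> in auto)
      then have "norm (deriv h (\<xi> k)) \<le> 6 / \<rho>" by simp
      then have "norm (D k) * norm (deriv h (\<xi> k)) \<le> norm (D k) * (6 / \<rho>)" by (intro mult_left_mono) auto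
      moreover have "norm (D k) * norm (deriv h (\<xi> k)) = 1" using one by (metis norm_mult norm_one)
      ultimately have "1 \<le> norm (D k) * (6 / (s * norm (\<xi> k)))" by (simp add: \<rho>_def)
      then show ?thesis using s \<xi>0[of k] by (simp add: field_simps)
    qed
    \<comment> \<open>The lower bound just shown and the growth of \<open>Re (T k)\<close> make the
      nonincreasing quantity exceed its initial value \<open>C\<close>.\<close>
    obtain k :: nat where k: "real k > max (2 * M) (C / (s / 6)\<^sup>2) * 2" using reals_Archimedean2 by blast
    have "Re (T k) > max (2 * M) (C / (s / 6)\<^sup>2)"
      using T1(1)[of k] k M by (simp add: max_def split: if_splits)
    then have Rk: "Re (T k) \<ge> 2 * M" "Re (T k) > C / (s / 6)\<^sup>2" by auto
    have "C < (s / 6)\<^sup>2 * Re (T k)" using Rk(2) s(1) by (simp add: field_simps)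
    also have "\<dots> \<le> (norm (D k) / norm (\<xi> k))\<^sup>2 * norm (T k)"
      using low[OF Rk(1)] s(1) complex_Re_le_cmod[of "T k"] TM[of k] by (intro mult_mono power_mono) auto
    also have "\<dots> \<le> C" by (rule R)
    finally show False by simp
  qed
  show ?thesis
  proof (rule that[of M t1])
    show "\<exists>n t. Re t \<ge> M \<and> (f ^^ n) (- lam\<^sup>2 / 4) = petal v m t"
      using cvB unfolding B_def by blast
  qed (use M t1lim t1a' t1b' G_def in auto)
qed

lemma sgn_tendsto_ratio:
  fixes x y :: "nat \<Rightarrow> complex"
  assumes "(\<lambda>k. sgn (x k)) \<longlonglongrightarrow> L" "(\<lambda>k. y k / x k) \<longlonglongrightarrow> \<mu>" "\<mu> \<noteq> 0"
  shows "(\<lambda>k. sgn (y k)) \<longlonglongrightarrow> sgn \<mu> * L"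
proof -
  have "(\<lambda>k. sgn (y k / x k) * sgn (x k)) \<longlonglongrightarrow> sgn \<mu> * L"
    by (intro tendsto_intros assms)
  moreover have "\<forall>\<^sub>F k in sequentially. sgn (y k / x k) * sgn (x k) = sgn (y k)"
    using tendsto_imp_eventually_ne[OF assms(2,3)]
  proof eventually_elim
    case (elim k)
    then have "y k / x k * x k = y k" by auto
    then show ?case using sgn_mult[of "y k / x k" "x k"] by simp
  qed
  ultimately show ?thesis by (rule Lim_transform_eventually)
qed

lemma quadratic_funpow_ratio:
  fixes lam :: complex
  defines "f \<equiv> \<lambda>x. lam * x + x\<^sup>2"
  assumes "x \<longlonglongrightarrow> 0" "\<And>k. x k \<noteq> (0::complex)"
  shows "(\<lambda>k. (f ^^ j) (x k) / x k) \<longlonglongrightarrow> lam ^ j" "(\<lambda>k. (f ^^ j) (x k)) \<longlonglongrightarrow> 0"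
proof -
  have "(\<lambda>k. (f ^^ j) (x k) / x k) \<longlonglongrightarrow> lam ^ j \<and> (\<lambda>k. (f ^^ j) (x k)) \<longlonglongrightarrow> 0"
  proof (induction j)
    case 0
    then show ?case using assms by simp
  next
    case (Suc j)
    have "(\<lambda>k. (lam + (f ^^ j) (x k)) * ((f ^^ j) (x k) / x k)) \<longlonglongrightarrow> (lam + 0) * lam ^ j"
      using Suc by (intro tendsto_intros) auto
    moreover have "(\<lambda>k. lam * (f ^^ j) (x k) + ((f ^^ j) (x k))\<^sup>2) \<longlonglongrightarrow> lam * 0 + 0\<^sup>2"
      using Suc by (intro tendsto_intros) auto
    ultimately show ?case
      by (simp add: f_def power2_eq_square algebra_simps add_divide_distrib)
  qed
  then show "(\<lambda>k. (f ^^ j) (x k) / x k) \<longlonglongrightarrow> lam ^ j" "(\<lambda>k. (f ^^ j) (x k)) \<longlonglongrightarrow> 0" by auto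
qed

text \<open>The critical orbit converges along every attracting direction; the directions it can
  converge along form a single orbit of the rotation by lam, so there are at most q of them.\<close>

lemma parabolic_multiplicity_le:
  fixes lam :: complex and R :: "complex poly"
  defines "f \<equiv> \<lambda>x. lam * x + x\<^sup>2"
  assumes lam: "norm lam = 1" and q: "q \<ge> 1" and m: "m \<ge> 1" and R: "poly R 0 \<noteq> 0"
    and G: "\<And>x. (f ^^ q) x = x * (1 + x ^ m * poly R x)"
  shows "m \<le> q"
proof -
  \<comment> \<open>The attracting directions are the \<open>m\<close>-th roots of
    \<open>c\<close>.\<close>
  define c where "c = - 1 / poly R 0"
  have c0: "c \<noteq> 0" using R by (simp add: c_def)
  have orb: "\<exists>n T. (\<lambda>k. sgn (petal v m (T k))) \<longlonglongrightarrow> sgn v \<and> filterlim T at_infinity sequentially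
     \<and> (\<forall>k. (f ^^ (n + q * k)) (- lam\<^sup>2 / 4) = petal v m (T k))" if v: "v ^ m = c" for v
  proof -
    have "v ^ m * poly R 0 = -1" using v R by (simp add: c_def)
    then show ?thesis
    proof (rule critical_orbit_enters_petal[OF lam m, folded f_def, OF _ G])
    fix M t1 assume M1: "M > 0" "((\<lambda>t. t1 t - t) \<longlongrightarrow> of_nat m) at_infinity"
    "\<And>t. norm t \<ge> M \<Longrightarrow> norm (t1 t - t - of_nat m) < 1/4"
    "\<And>t. norm t \<ge> M \<Longrightarrow> Re t > 0 \<Longrightarrow> (f ^^ q) (petal v m t) = petal v m (t1 t)"
    and "\<exists>n t. Re t \<ge> M \<and> (f ^^ n) (- lam\<^sup>2 / 4) = petal v m t"
    then obtain n t where "Re t \<ge> M" "(f ^^ n) (- lam\<^sup>2 / 4) = petal v m t" by blast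
    note M = M1 this
    define T where "T k = (t1 ^^ k) t" for k
    note po = petal_orbit[OF M(1,3,4) m M(5), folded T_def]
    have Tinf: "filterlim T at_infinity sequentially"
      using po(1) by (rule petal_orbit_norm_at_top)
    have "(\<lambda>k. T (Suc k) - T k) \<longlonglongrightarrow> of_nat m"
      using filterlim_compose[OF M(2) Tinf] by (simp add: T_def)
    from LIMSEQ_increments_imp_average[OF this]
    have "(\<lambda>k. sgn (petal v m (T k))) \<longlonglongrightarrow> sgn v"
      by (rule petal_tendsto_direction[OF m])
    moreover have "(f ^^ (n + q * k)) (- lam\<^sup>2 / 4) = petal v m (T k)" for k
    proof -
      have "(f ^^ (n + q * k)) (- lam\<^sup>2 / 4) = ((f ^^ q) ^^ k) ((f ^^ n) (- lam\<^sup>2 / 4))"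
        by (simp add: funpow_add funpow_mult add.commute[of n])
      then show ?thesis using po(3) M(6) by simp
    qed
    ultimately show ?thesis using Tinf by blast
    qed
  qed
  obtain v where v: "v ^ m = c"
    using exists_complex_root[of m c] m by auto
  obtain n T where nT: "(\<lambda>k. sgn (petal v m (T k))) \<longlonglongrightarrow> sgn v" "filterlim T at_infinity sequentially"
     "\<And>k. (f ^^ (n + q * k)) (- lam\<^sup>2 / 4) = petal v m (T k)" using orb[OF v] by blast
  have v0: "v \<noteq> 0" using v c0 m by (auto simp: power_0_left)
  have "{w::complex. w ^ m = 1} \<subseteq> (\<lambda>j. lam ^ j) ` {..<q}"
  proof
    fix w :: complex assume "w \<in> {w. w ^ m = 1}"
    then have w: "w ^ m = 1" by simp
    then have wv: "(w * v) ^ m = c" using v by (simp add: power_mult_distrib)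
    obtain n' T' where nT': "(\<lambda>k. sgn (petal (w * v) m (T' k))) \<longlonglongrightarrow> sgn (w * v)"
     "\<And>k. (f ^^ (n' + q * k)) (- lam\<^sup>2 / 4) = petal (w * v) m (T' k)" using orb[OF wv] by blast
    \<comment> \<open>The two descriptions of the critical orbit are aligned up to fewer than
      \<open>q\<close> iterations. The summand \<open>q * n\<close> keeps the natural-number
      subtraction exact, because \<open>n \<le> q * n\<close>.\<close>
    define j where "j = (n' + q * n - n) mod q"
    define B where "B = (n' + q * n - n) div q"
    have le: "n \<le> q * n" using q by simp
    have nj: "n + q * B + j = n' + q * n"
    proof -
      have "q * B + j = n' + q * n - n" unfolding j_def B_def by simp
      then show ?thesis using le by linarith
    qed
    have eq: "(f ^^ j) (petal v m (T (k + B))) = petal (w * v) m (T' (k + n))" for k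
    proof -
      have "petal (w * v) m (T' (k + n)) = (f ^^ (j + (n + q * (k + B)))) (- lam\<^sup>2 / 4)"
      proof -
        have "j + (n + q * (k + B)) = n' + q * (k + n)" using nj unfolding distrib_left by linarith
        then show ?thesis using nT'(2)[of "k + n"] by simp
      qed
      also have "\<dots> = (f ^^ j) (petal v m (T (k + B)))"
        using nT(3)[of "k + B"] by (simp add: funpow_add)
      finally show ?thesis by simp
    qed
    have p0: "petal v m (T (k + B)) \<noteq> 0" for k by (rule petal_nonzero[OF v0])
    have "(\<lambda>k. petal v m (T k)) \<longlonglongrightarrow> 0"
      by (rule filterlim_compose[OF petal_tendsto_0[OF m] nT(2)])
    then have lim0: "(\<lambda>k. petal v m (T (k + B))) \<longlonglongrightarrow> 0" by (rule LIMSEQ_ignore_initial_segment)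
    \<comment> \<open>Applying \<open>f^j\<close> near 0 rotates directions by \<open>lam^j\<close>;
      uniqueness of the limit direction then forces \<open>w = lam^j\<close>.\<close>
    have "(\<lambda>k. sgn (petal (w * v) m (T' (k + n)))) \<longlonglongrightarrow> sgn (lam ^ j) * sgn v"
      unfolding eq[symmetric] f_def
      by (rule sgn_tendsto_ratio[OF LIMSEQ_ignore_initial_segment[OF nT(1)] quadratic_funpow_ratio(1)[OF lim0 p0]])
         (use lam in auto)
    moreover have "(\<lambda>k. sgn (petal (w * v) m (T' (k + n)))) \<longlonglongrightarrow> sgn (w * v)"
      by (rule LIMSEQ_ignore_initial_segment[OF nT'(1)])
    ultimately have "sgn (lam ^ j) * sgn v = sgn (w * v)" by (rule LIMSEQ_unique)
    moreover have "sgn v \<noteq> 0" using v0 by (simp add: sgn_zero_iff)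
    ultimately have "sgn (lam ^ j) = sgn w" by (simp add: sgn_mult)
    moreover have "norm w = 1" using w m by (metis norm_one norm_power power_eq_1_iff not_one_le_zero)
    ultimately have "w = lam ^ j" using lam by (simp add: sgn_eq norm_power)
    moreover have "j < q" using q by (simp add: j_def)
    ultimately show "w \<in> (\<lambda>j. lam ^ j) ` {..<q}" by blast
  qed
  then have "card {w::complex. w ^ m = 1} \<le> card ((\<lambda>j. lam ^ j) ` {..<q})"
    by (intro card_mono) auto
  also have "\<dots> \<le> q" using card_image_le[of "{..<q}" "\<lambda>j. lam ^ j"] by simp
  finally show ?thesis using card_roots_unity_eq[of m] m by simp
qed

section \<open>Normal form at the parabolic fixed point\<close>

text \<open>The relation \<open>f b s = O(s^n)\<close> as \<open>s\<close> tends to 0, uniform in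
  the parameter \<open>b\<close> near 0.\<close>

definition ord_ge :: "nat \<Rightarrow> (complex \<Rightarrow> complex \<Rightarrow> complex) \<Rightarrow> bool" where
  "ord_ge n f \<longleftrightarrow> (\<exists>C>0. \<exists>d>0. \<forall>b s. norm b < d \<longrightarrow> norm s < d \<longrightarrow> norm (f b s) \<le> C * norm s ^ n)"

lemma ord_geI:
  assumes "C > 0" "d > 0" "\<And>b s. norm b < d \<Longrightarrow> norm s < d \<Longrightarrow> norm (f b s) \<le> C * norm s ^ n"
  shows "ord_ge n f"
  using assms unfolding ord_ge_def by blast

lemma ord_geE:
  assumes "ord_ge n f"
  obtains C d where "C > 0" "d > 0" "d \<le> 1"
    "\<And>b s. norm b < d \<Longrightarrow> norm s < d \<Longrightarrow> norm (f b s) \<le> C * norm s ^ n"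
proof -
  obtain C d where "C > 0" "d > 0" "\<forall>b s. norm b < d \<longrightarrow> norm s < d \<longrightarrow> norm (f b s) \<le> C * norm s ^ n"
    using assms unfolding ord_ge_def by blast
  then show ?thesis by (intro that[of C "min d 1"]) auto
qed

lemma ord_ge_mono: assumes "ord_ge n f" "k \<le> n" shows "ord_ge k f"
proof -
  from assms(1) obtain C d where C: "C > 0" "d > 0" "d \<le> 1"
    "\<And>b s. norm b < d \<Longrightarrow> norm s < d \<Longrightarrow> norm (f b s) \<le> C * norm s ^ n" by (rule ord_geE) blast
  show ?thesis
  proof (rule ord_geI[OF C(1,2)])
    fix b s :: complex assume s: "norm b < d" "norm s < d"
    have "norm s ^ n \<le> norm s ^ k" using s C assms(2) by (intro power_decreasing) auto
    then show "norm (f b s) \<le> C * norm s ^ k"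
      using C(4)[OF s] C(1) by (meson mult_left_mono order_trans less_imp_le)
  qed
qed

lemma ord_ge_add: assumes "ord_ge n f" "ord_ge n g" shows "ord_ge n (\<lambda>b s. f b s + g b s)"
proof -
  from assms(1) obtain C d where C: "C > 0" "d > 0" "d \<le> 1"
    "\<And>b s. norm b < d \<Longrightarrow> norm s < d \<Longrightarrow> norm (f b s) \<le> C * norm s ^ n" by (rule ord_geE) blast
  from assms(2) obtain C' d' where C': "C' > 0" "d' > 0" "d' \<le> 1"
    "\<And>b s. norm b < d' \<Longrightarrow> norm s < d' \<Longrightarrow> norm (g b s) \<le> C' * norm s ^ n" by (rule ord_geE) blast
  show ?thesis
  proof (rule ord_geI[of "C + C'" "min d d'"])
    fix b s :: complex assume "norm b < min d d'" "norm s < min d d'"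
    then have "norm (f b s) \<le> C * norm s ^ n" "norm (g b s) \<le> C' * norm s ^ n"
      using C C' by auto
    then show "norm (f b s + g b s) \<le> (C + C') * norm s ^ n"
      using norm_triangle_ineq[of "f b s" "g b s"] by (simp add: algebra_simps)
  qed (use C C' in auto)
qed

lemma ord_ge_mult: assumes "ord_ge n f" "ord_ge k g" shows "ord_ge (n + k) (\<lambda>b s. f b s * g b s)"
proof -
  from assms(1) obtain C d where C: "C > 0" "d > 0" "d \<le> 1"
    "\<And>b s. norm b < d \<Longrightarrow> norm s < d \<Longrightarrow> norm (f b s) \<le> C * norm s ^ n" by (rule ord_geE) blast
  from assms(2) obtain C' d' where C': "C' > 0" "d' > 0" "d' \<le> 1"
    "\<And>b s. norm b < d' \<Longrightarrow> norm s < d' \<Longrightarrow> norm (g b s) \<le> C' * norm s ^ k" by (rule ord_geE) blast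
  show ?thesis
  proof (rule ord_geI[of "C * C'" "min d d'"])
    fix b s :: complex assume "norm b < min d d'" "norm s < min d d'"
    then have "norm (f b s) \<le> C * norm s ^ n" "norm (g b s) \<le> C' * norm s ^ k"
      using C C' by auto
    then have "norm (f b s) * norm (g b s) \<le> (C * norm s ^ n) * (C' * norm s ^ k)"
      using C by (intro mult_mono) auto
    then show "norm (f b s * g b s) \<le> (C * C') * norm s ^ (n + k)"
      by (simp add: norm_mult power_add mult_ac)
  qed (use C C' in auto)
qed

lemma ord_ge_mult': assumes "ord_ge n f" "ord_ge k g" "l \<le> n + k" shows "ord_ge l (\<lambda>b s. f b s * g b s)"
  using ord_ge_mono[OF ord_ge_mult[OF assms(1,2)] assms(3)] .

lemma ord_ge_cong: assumes "ord_ge n f" "\<And>b s. norm b < 1 \<Longrightarrow> f b s = g b s" shows "ord_ge n g"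
proof -
  from assms(1) obtain C d where C: "C > 0" "d > 0" "d \<le> 1"
    "\<And>b s. norm b < d \<Longrightarrow> norm s < d \<Longrightarrow> norm (f b s) \<le> C * norm s ^ n" by (rule ord_geE) blast
  show ?thesis
    by (rule ord_geI[OF C(1,2)]) (use C(3,4) assms(2) in force)
qed

lemma ord_ge_bounded: assumes "isCont c 0" shows "ord_ge 0 (\<lambda>b s. c b)"
proof -
  obtain d where d: "d > 0" "\<And>b. norm b < d \<Longrightarrow> dist (c b) (c 0) < 1"
    using assms unfolding continuous_at_eps_delta by (metis dist_0_norm dist_commute zero_less_one)
  show ?thesis
  proof (rule ord_geI[of "norm (c 0) + 1" d])
    fix b s :: complex assume "norm b < d"
    then show "norm (c b) \<le> (norm (c 0) + 1) * norm s ^ 0"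
      using d(2)[of b] norm_triangle_ineq2[of "c b" "c 0"] by (simp add: dist_norm)
  qed (use d norm_ge_zero[of "c 0"] in linarith)+
qed

lemma ord_ge_const: "ord_ge 0 (\<lambda>b s. c)"
  by (rule ord_ge_bounded) simp

lemma ord_ge_power: "ord_ge n (\<lambda>b s. s ^ n)"
  by (rule ord_geI[of 1 1]) (auto simp: norm_power)

lemma ord_ge_coeff: assumes "isCont c 0" "k \<le> n" shows "ord_ge k (\<lambda>b s. c b * s ^ n)"
  by (rule ord_ge_mult'[OF ord_ge_bounded[OF assms(1)] ord_ge_power]) (use assms in auto)

lemma ord_ge_minus: "ord_ge n f \<Longrightarrow> ord_ge n (\<lambda>b s. - f b s)"
  by (simp add: ord_ge_def)

lemma ord_ge_diff: assumes "ord_ge n f" "ord_ge n g" shows "ord_ge n (\<lambda>b s. f b s - g b s)"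
  using ord_ge_add[OF assms(1) ord_ge_minus[OF assms(2)]] by simp

lemma ord_ge_sum: assumes "finite A" "\<And>i. i \<in> A \<Longrightarrow> ord_ge n (f i)" shows "ord_ge n (\<lambda>b s. \<Sum>i\<in>A. f i b s)"
  using assms
proof (induction A rule: finite_induct)
  case empty
  then show ?case by (auto intro!: ord_geI[of 1 1])
next
  case (insert x F)
  then show ?case by (simp add: ord_ge_add)
qed

lemma ord_ge_id: "ord_ge 1 (\<lambda>b s. s)"
  using ord_ge_power[of 1] by simp

lemma ord_ge_cmult: assumes "ord_ge n f" shows "ord_ge n (\<lambda>b s. c * f b s)"
  using ord_ge_mult'[OF ord_ge_const[of c] assms, of n] by simp

lemma ord_ge_compose:
  assumes "ord_ge n f" "ord_ge 1 g" shows "ord_ge n (\<lambda>b s. f b (g b s))"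
proof -
  from assms(1) obtain C d where C: "C > 0" "d > 0" "d \<le> 1"
    "\<And>b s. norm b < d \<Longrightarrow> norm s < d \<Longrightarrow> norm (f b s) \<le> C * norm s ^ n" by (rule ord_geE) blast
  from assms(2) obtain C' d' where C': "C' > 0" "d' > 0" "d' \<le> 1"
    "\<And>b s. norm b < d' \<Longrightarrow> norm s < d' \<Longrightarrow> norm (g b s) \<le> C' * norm s ^ 1" by (rule ord_geE) blast
  show ?thesis
  proof (rule ord_geI[of "C * C' ^ n" "min (min d d') (d / C')"])
    fix b s :: complex assume bs: "norm b < min (min d d') (d / C')" "norm s < min (min d d') (d / C')"
    then have g: "norm (g b s) \<le> C' * norm s" using C'(4)[of b s] by auto
    moreover have "C' * norm s < d" using bs C' by (simp add: field_simps)
    ultimately have "norm (f b (g b s)) \<le> C * norm (g b s) ^ n" using bs by (intro C(4)) auto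
    also have "\<dots> \<le> C * (C' * norm s) ^ n" using g C by (intro mult_left_mono power_mono) auto
    finally show "norm (f b (g b s)) \<le> C * C' ^ n * norm s ^ n" by (simp add: power_mult_distrib mult_ac)
  qed (use C C' in auto)
qed

lemma ord_ge_at_0: assumes "ord_ge n f" shows "ord_ge n (\<lambda>b s. f 0 s)"
proof -
  from assms(1) obtain C d where C: "C > 0" "d > 0" "d \<le> 1"
    "\<And>b s. norm b < d \<Longrightarrow> norm s < d \<Longrightarrow> norm (f b s) \<le> C * norm s ^ n" by (rule ord_geE) blast
  then show ?thesis by (intro ord_geI[of C d]) auto
qed

lemma ord_ge_one_plus_power: assumes "ord_ge 1 z" shows "ord_ge 1 (\<lambda>b s. (1 + z b s) ^ n - 1)"
proof (induction n)
  case 0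
  then show ?case by (auto intro!: ord_geI[of 1 1])
next
  case (Suc n)
  have "ord_ge 1 (\<lambda>b s. (1 + z b s) * ((1 + z b s) ^ n - 1) + z b s)"
    by (intro ord_ge_add assms ord_ge_mult'[where n = 0, OF _ Suc] ord_ge_const[of 1] ord_ge_mono[OF assms]) auto
  then show ?case by (simp add: algebra_simps)
qed

text \<open>Every term of the difference contains at least one factor \<open>t\<close>, of order 2,
  in place of a factor \<open>x\<close>, of order 1, which raises the order by one.\<close>

lemma ord_ge_power_diff:
  assumes "ord_ge 1 x" "ord_ge 2 t" shows "ord_ge (Suc n) (\<lambda>b s. (x b s + t b s) ^ n - x b s ^ n)"
proof (induction n)
  case 0
  then show ?case by (auto intro!: ord_geI[of 1 1])
next
  case (Suc n)
  have xn: "ord_ge n (\<lambda>b s. x b s ^ n)" for n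
  proof (induction n)
    case 0
    show ?case unfolding power_0 by (rule ord_ge_const)
  next
    case (Suc n)
    from ord_ge_mult[OF assms(1) Suc] show ?case by simp
  qed
  have xt: "ord_ge 1 (\<lambda>b s. x b s + t b s)" by (intro ord_ge_add assms ord_ge_mono[OF assms(2)]) auto
  have "ord_ge (Suc (Suc n)) (\<lambda>b s. (x b s + t b s) * ((x b s + t b s) ^ n - x b s ^ n) + t b s * x b s ^ n)"
    by (intro ord_ge_add ord_ge_mult'[OF xt Suc] ord_ge_mult'[OF assms(2) xn]) auto
  then show ?case by (simp add: algebra_simps)
qed

text \<open>The coefficients of the formal solution \<open>k\<close> of \<open>k(\<lambda>s) = (\<lambda> - b/\<lambda>) k(s) + k(s)\<^sup>2 + b k(s/\<lambda>)\<close> with \<open>k(s) = s + \<dots>\<close>,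
  that is, of the invariant curve of the recurrence \<open>\<xi>\<^sub>n\<^sub>+\<^sub>2 = (\<lambda> - b/\<lambda>) \<xi>\<^sub>n\<^sub>+\<^sub>1 + \<xi>\<^sub>n\<^sub>+\<^sub>1\<^sup>2 + b \<xi>\<^sub>n\<close>. The recursion
  resonates first at \<open>n = q + 1\<close>, so only the terms up to \<open>q\<close> are used.\<close>

fun jet :: "complex \<Rightarrow> complex \<Rightarrow> nat \<Rightarrow> complex" where
  "jet lam b n = (if n = 0 then 0 else if n = 1 then 1
     else lam ^ n * (\<Sum>i\<in>{1..<n}. jet lam b i * jet lam b (n - i)) / ((lam ^ n - lam) * (lam ^ n + b / lam)))"

declare jet.simps [simp del]

section \<open>The approximate invariant curve and its resonant term\<close>

locale root_of_unity =
  fixes lam :: complex and q :: nat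
  assumes lam1: "norm lam = 1" and q1: "q \<ge> 1" and lamq: "lam ^ q = 1"
    and prim: "\<And>j. 0 < j \<Longrightarrow> j < q \<Longrightarrow> lam ^ j \<noteq> 1"
begin

lemma lam0: "lam \<noteq> 0" using lam1 by auto

text \<open>The second root of the characteristic equation
  \<open>k^2 = (lam - b/lam) * k + b\<close> of the linearized recurrence; the first one is
  \<open>lam\<close>.\<close>

definition mu :: "complex \<Rightarrow> complex" where "mu b = - b / lam"
definition co :: "complex \<Rightarrow> nat \<Rightarrow> complex" where "co b j = (if j \<le> q then jet lam b j else 0)"
definition sq :: "complex \<Rightarrow> nat \<Rightarrow> complex" where "sq b r = (\<Sum>k\<le>r. co b k * co b (r - k))"
definition jet_curve :: "complex \<Rightarrow> complex \<Rightarrow> complex" where "jet_curve b s = (\<Sum>j\<le>q. co b j * s ^ j)"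
text \<open>At order \<open>q + 1\<close> the divisor \<open>lam^(q+1) - lam\<close> vanishes, so
  the quadratic term of that order cannot be absorbed into the curve. It goes into the induced map
  \<open>phi\<close> on the curve instead: comparing coefficients of order \<open>q + 1\<close>
  gives \<open>lam * gam = sq + mu * gam\<close>, the last term coming from the inverse of
  \<open>phi\<close>.\<close>

definition gam :: "complex \<Rightarrow> complex" where "gam b = sq b (Suc q) / (lam - mu b)"
definition phi :: "complex \<Rightarrow> complex \<Rightarrow> complex" where "phi b s = lam * s * (1 + gam b * s ^ q)"

lemma norm_mu: "norm (mu b) = norm b"
  by (simp add: mu_def norm_divide lam1)

lemma lam_mu_ne: assumes "norm b < 1" shows "lam ^ j - mu b \<noteq> 0"
proof
  assume "lam ^ j - mu b = 0"
  then have "norm (lam ^ j) = norm (mu b)" by simp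
  then show False using assms by (simp add: norm_mu norm_power lam1)
qed

lemma lam_pow_ne: assumes "2 \<le> j" "j \<le> q" shows "lam ^ j - lam \<noteq> 0"
proof
  assume "lam ^ j - lam = 0"
  moreover have "lam ^ j = lam * lam ^ (j - 1)" using assms by (simp flip: power_Suc)
  ultimately have "lam ^ (j - 1) = 1" using lam0 by simp
  moreover have "0 < j - 1" "j - 1 < q" using assms by auto
  ultimately show False using prim by blast
qed

lemma co_0: "co b 0 = 0" by (simp add: co_def jet.simps)
lemma co_1: "co b 1 = 1" using q1 by (simp add: co_def jet.simps)
lemma co_1': "co b (Suc 0) = 1" using co_1 by simp

lemma sq_eq: "sq b r = (\<Sum>k\<in>{1..<r}. co b k * co b (r - k))"
  unfolding sq_def by (rule sum.mono_neutral_right) (auto simp: co_0 not_less le_less Suc_le_eq)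

text \<open>The coefficient of order \<open>j\<close> of the functional equation multiplied by
  \<open>lam^j\<close>, where \<open>b = - lam * mu b\<close> factors the quadratic polynomial in
  \<open>lam^j\<close>.\<close>

lemma co_rec: assumes "norm b < 1" "j \<le> q"
  shows "co b j * (lam ^ j - lam) * (lam ^ j - mu b) = lam ^ j * sq b j"
proof -
  consider "j = 0" | "j = 1" | "2 \<le> j" by linarith
  then show ?thesis
  proof cases
    case 3
    have e: "lam ^ j - mu b = lam ^ j + b / lam" by (simp add: mu_def)
    have "sq b j = (\<Sum>i\<in>{1..<j}. jet lam b i * jet lam b (j - i))"
      unfolding sq_eq using assms by (intro sum.cong) (auto simp: co_def)
    moreover have "co b j = lam ^ j * (\<Sum>i\<in>{1..<j}. jet lam b i * jet lam b (j - i)) / ((lam ^ j - lam) * (lam ^ j + b / lam))"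
      using 3 assms jet.simps[of lam b j] by (simp add: co_def)
    ultimately show ?thesis
      using lam_pow_ne[OF 3 assms(2)] lam_mu_ne[OF assms(1), of j] unfolding e by simp
  qed (auto simp: co_0 sq_eq)
qed

lemma mu_cont: "isCont mu 0"
  unfolding mu_def by (intro continuous_intros) (use lam0 in auto)

lemma jet_cont: "j \<le> q \<Longrightarrow> isCont (\<lambda>b. jet lam b j) 0"
proof (induction j rule: less_induct)
  case (less j)
  consider "j = 0" | "j = 1" | "2 \<le> j" by linarith
  then show ?case
  proof cases
    case 3
    have "isCont (\<lambda>b. lam ^ j * (\<Sum>i\<in>{1..<j}. jet lam b i * jet lam b (j - i)) / ((lam ^ j - lam) * (lam ^ j + b / lam))) 0"
      using lam_pow_ne[OF 3 less.prems] lam0 3 less.prems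
      by (intro continuous_intros less.IH) auto
    then show ?thesis by (subst jet.simps) (use 3 in simp)
  qed (simp_all add: jet.simps)
qed

lemma co_cont: "isCont (\<lambda>b. co b j) 0"
  using jet_cont[of j] by (cases "j \<le> q") (simp_all add: co_def)

lemma sq_cont: "isCont (\<lambda>b. sq b r) 0"
  unfolding sq_def by (intro continuous_intros co_cont)

lemma gam_cont: "isCont gam 0"
  unfolding gam_def using lam0 by (intro continuous_intros sq_cont mu_cont) (auto simp: mu_def)

lemma jet_curve_0: "jet_curve b 0 = 0"
  unfolding jet_curve_def by (rule sum.neutral) (auto simp: co_0 power_0_left)

lemma norm_power_diff_le:
  assumes "norm u \<le> \<rho>" "norm v \<le> \<rho>" shows "norm (u ^ j - v ^ j :: complex) \<le> real j * \<rho> ^ (j - 1) * norm (u - v)"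
proof (induction j)
  case (Suc j)
  have r0: "\<rho> \<ge> 0" using assms norm_ge_zero order_trans by blast
  have "u ^ Suc j - v ^ Suc j = u * (u ^ j - v ^ j) + (u - v) * v ^ j" by (simp add: algebra_simps)
  then have "norm (u ^ Suc j - v ^ Suc j) \<le> norm u * norm (u ^ j - v ^ j) + norm (u - v) * norm v ^ j"
    by (metis norm_mult norm_power norm_triangle_ineq)
  also have "\<dots> \<le> \<rho> * (real j * \<rho> ^ (j - 1) * norm (u - v)) + norm (u - v) * \<rho> ^ j"
    using assms r0 Suc by (intro add_mono mult_mono power_mono) auto
  also have "\<dots> = real (Suc j) * \<rho> ^ (Suc j - 1) * norm (u - v)"
    by (cases j) (auto simp: algebra_simps)
  finally show ?case .
qed simp

text \<open>The linear coefficient is 1, so only terms of degree at least 2 remain, and their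
  Lipschitz constant on the disc of radius \<open>\<rho>\<close> is of order
  \<open>\<rho>\<close>.\<close>

lemma jet_curve_lipschitz:
  obtains K d where "K > 0" "d > 0" "\<And>b u v \<rho>. norm b < d \<Longrightarrow> norm u \<le> \<rho> \<Longrightarrow> norm v \<le> \<rho> \<Longrightarrow> \<rho> \<le> 1 \<Longrightarrow>
    norm (jet_curve b u - jet_curve b v - (u - v)) \<le> K * \<rho> * norm (u - v)"
proof -
  have "ord_ge 0 (\<lambda>b s. \<Sum>j\<le>q. of_real (norm (co b j)) * of_nat j)"
    by (rule ord_ge_bounded) (intro continuous_intros co_cont)
  then obtain C d where C: "C > 0" "d > 0" and Cb: "\<And>b s::complex. norm b < d \<Longrightarrow> norm s < d \<Longrightarrow> norm (\<Sum>j\<le>q. complex_of_real (norm (co b j)) * of_nat j) \<le> C * norm s ^ 0"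
    by (rule ord_geE) blast
  have Cb': "(\<Sum>j\<le>q. norm (co b j) * real j) \<le> C" if b: "norm b < d" for b
  proof -
    have "(\<Sum>j\<le>q. complex_of_real (norm (co b j)) * of_nat j) = of_real (\<Sum>j\<le>q. norm (co b j) * real j)" by simp
    moreover have "(\<Sum>j\<le>q. norm (co b j) * real j) \<ge> 0" by (intro sum_nonneg) auto
    ultimately have "norm (\<Sum>j\<le>q. complex_of_real (norm (co b j)) * of_nat j) = (\<Sum>j\<le>q. norm (co b j) * real j)"
      by (simp only: norm_of_real abs_of_nonneg)
    then show ?thesis using Cb[OF b, of 0] C by simp
  qed
  show ?thesis
  proof (rule that[OF C])
    fix b u v :: complex and \<rho> :: real
    assume b: "norm b < d" and u: "norm u \<le> \<rho>" and v: "norm v \<le> \<rho>" and \<rho>: "\<rho> \<le> 1"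
    have r0: "\<rho> \<ge> 0" using u norm_ge_zero order_trans by blast
    have "jet_curve b u - jet_curve b v - (u - v) = (\<Sum>j\<in>{..q} - {1}. co b j * (u ^ j - v ^ j))"
    proof -
      have "jet_curve b u - jet_curve b v = (\<Sum>j\<le>q. co b j * (u ^ j - v ^ j))"
        by (simp add: jet_curve_def sum_subtractf right_diff_distrib)
      also have "\<dots> = co b 1 * (u ^ 1 - v ^ 1) + (\<Sum>j\<in>{..q} - {1}. co b j * (u ^ j - v ^ j))"
        using q1 by (intro sum.remove) auto
      finally show ?thesis by (simp add: co_1')
    qed
    also have "norm \<dots> \<le> (\<Sum>j\<in>{..q} - {1}. norm (co b j) * real j * (\<rho> * norm (u - v)))"
    proof (rule sum_norm_le)
      fix j assume j: "j \<in> {..q} - {1}"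
      show "norm (co b j * (u ^ j - v ^ j)) \<le> norm (co b j) * real j * (\<rho> * norm (u - v))"
      proof (cases "j = 0")
        case False
        have "norm (u ^ j - v ^ j) \<le> real j * \<rho> ^ (j - 1) * norm (u - v)"
          by (rule norm_power_diff_le[OF u v])
        also have "\<rho> ^ (j - 1) \<le> \<rho> ^ 1" using False j r0 \<rho> by (intro power_decreasing) auto
        finally have "norm (u ^ j - v ^ j) \<le> real j * \<rho> * norm (u - v)"
          by (simp add: mult_left_mono mult_right_mono)
        then show ?thesis by (simp add: norm_mult mult_left_mono mult.assoc)
      qed (simp add: co_0)
    qed
    also have "\<dots> \<le> (\<Sum>j\<le>q. norm (co b j) * real j * (\<rho> * norm (u - v)))"
      using r0 by (intro sum_mono2) auto
    also have "\<dots> = (\<Sum>j\<le>q. norm (co b j) * real j) * (\<rho> * norm (u - v))"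
      by (simp add: sum_distrib_right)
    also have "\<dots> \<le> C * (\<rho> * norm (u - v))" using Cb'[OF b] r0 by (intro mult_right_mono) auto
    finally show "norm (jet_curve b u - jet_curve b v - (u - v)) \<le> C * \<rho> * norm (u - v)" by (simp add: mult.assoc)
  qed
qed

lemma jet_curve_ord_add:
  assumes x: "ord_ge 1 x" and t: "ord_ge (Suc n) t"
  shows "ord_ge (Suc (Suc n)) (\<lambda>b s. jet_curve b (x b s + t b s) - jet_curve b (x b s) - t b s)"
proof -
  obtain K d where K: "K > 0" "d > 0" "\<And>b u v \<rho>. norm b < d \<Longrightarrow> norm u \<le> \<rho> \<Longrightarrow> norm v \<le> \<rho> \<Longrightarrow> \<rho> \<le> 1 \<Longrightarrow>
    norm (jet_curve b u - jet_curve b v - (u - v)) \<le> K * \<rho> * norm (u - v)" by (rule jet_curve_lipschitz) blast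
  have xt: "ord_ge 1 (\<lambda>b s. x b s + t b s)" by (intro ord_ge_add x ord_ge_mono[OF t]) auto
  from x obtain C1 d1 where C1: "C1 > 0" "d1 > 0" "d1 \<le> 1"
    "\<And>b s. norm b < d1 \<Longrightarrow> norm s < d1 \<Longrightarrow> norm (x b s) \<le> C1 * norm s ^ 1" by (rule ord_geE) blast
  from xt obtain C2 d2 where C2: "C2 > 0" "d2 > 0" "d2 \<le> 1"
    "\<And>b s. norm b < d2 \<Longrightarrow> norm s < d2 \<Longrightarrow> norm (x b s + t b s) \<le> C2 * norm s ^ 1" by (rule ord_geE) blast
  from t obtain C3 d3 where C3: "C3 > 0" "d3 > 0" "d3 \<le> 1"
    "\<And>b s. norm b < d3 \<Longrightarrow> norm s < d3 \<Longrightarrow> norm (t b s) \<le> C3 * norm s ^ Suc n" by (rule ord_geE) blast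
  define D where "D = min (min d (1 / (C1 + C2))) (min d1 (min d2 d3))"
  show ?thesis
  proof (rule ord_geI[of "K * (C1 + C2) * C3" D])
    fix b s :: complex assume b: "norm b < D" and s: "norm s < D"
    define \<rho> where "\<rho> = (C1 + C2) * norm s"
    have bd: "norm (x b s) \<le> C1 * norm s" "norm (x b s + t b s) \<le> C2 * norm s" "norm (t b s) \<le> C3 * norm s ^ Suc n"
      using C1(4)[of b s] C2(4)[of b s] C3(4)[of b s] b s unfolding D_def by auto
    have "norm (x b s) \<le> \<rho>" "norm (x b s + t b s) \<le> \<rho>"
      using bd C1 C2 unfolding \<rho>_def by (auto simp: distrib_right intro: order_trans)
    moreover have "norm s < 1 / (C1 + C2)" using s unfolding D_def by simp
    then have "\<rho> \<le> 1" using C1 C2 by (simp add: \<rho>_def field_simps)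
    moreover have "norm b < d" using b D_def by simp
    ultimately have "norm (jet_curve b (x b s + t b s) - jet_curve b (x b s) - t b s) \<le> K * \<rho> * norm (t b s)"
      using K(3)[of b "x b s + t b s" \<rho> "x b s"] by simp
    also have "\<dots> \<le> K * \<rho> * (C3 * norm s ^ Suc n)"
      using bd K C1 C2 by (intro mult_left_mono) (auto simp: \<rho>_def)
    finally show "norm (jet_curve b (x b s + t b s) - jet_curve b (x b s) - t b s) \<le> K * (C1 + C2) * C3 * norm s ^ Suc (Suc n)"
      by (simp add: \<rho>_def mult_ac)
  qed (use K C1 C2 C3 in \<open>auto simp: D_def\<close>)
qed

lemma jet_curve_ord2: "ord_ge 2 (\<lambda>b s. jet_curve b s - s)"
proof -
  have "ord_ge (Suc (Suc 0)) (\<lambda>b s. jet_curve b (0 + s) - jet_curve b 0 - s)"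
    by (rule jet_curve_ord_add) (use ord_ge_id in \<open>auto intro!: ord_geI[of 1 1]\<close>)
  then show ?thesis by (simp add: jet_curve_0 numeral_2_eq_2)
qed

lemma jet_curve_ord: "ord_ge 1 jet_curve"
proof -
  have "ord_ge 1 (\<lambda>b s. (jet_curve b s - s) + s)"
    by (intro ord_ge_add ord_ge_id ord_ge_mono[OF jet_curve_ord2]) auto
  then show ?thesis by simp
qed

lemma phi_ord: "ord_ge 1 phi"
proof -
  have "ord_ge 1 (\<lambda>b s. lam * s + (lam * gam b) * s ^ (Suc q))"
    by (intro ord_ge_add ord_ge_cmult ord_ge_id ord_ge_coeff continuous_intros gam_cont) auto
  moreover have "phi = (\<lambda>b s. lam * s + (lam * gam b) * s ^ (Suc q))"
    by (auto simp: phi_def fun_eq_iff algebra_simps)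
  ultimately show ?thesis by simp
qed

lemma jet_curve_square: "(jet_curve b u)\<^sup>2 = (\<Sum>r\<le>q + q. sq b r * u ^ r)"
  unfolding jet_curve_def power2_eq_square sq_def
  by (rule polynomial_product) (auto simp: co_def)

text \<open>If two consecutive terms of the recurrence are \<open>jet_curve b s\<close> and
  \<open>jet_curve b s'\<close>, then the next one minus \<open>jet_curve b (phi b s')\<close>
  equals \<open>defect b s' + b * jet_curve b s\<close>. The part depending on \<open>s'\<close>
  alone is separated because it has strict derivative 0 at the fixed point.\<close>

definition defect :: "complex \<Rightarrow> complex \<Rightarrow> complex" where
  "defect b u = (lam + mu b) * jet_curve b u + (jet_curve b u)\<^sup>2 - jet_curve b (phi b u)"

text \<open>Orders up to \<open>q\<close> cancel by the recursion for the coefficients. At order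
  \<open>q + 1\<close> the definition of \<open>gam\<close> leaves \<open>- gam b * mu b\<close>,
  because \<open>u / lam\<close> is only the linear part of the inverse of
  \<open>phi\<close>.\<close>

lemma defect_expansion: "ord_ge (q + 2) (\<lambda>b u. defect b u + b * jet_curve b (u / lam) + gam b * mu b * u ^ Suc q)"
proof -
  have 1: "ord_ge (Suc (Suc q)) (\<lambda>b u. jet_curve b (lam * u + (lam * gam b) * u ^ (Suc q)) - jet_curve b (lam * u) - (lam * gam b) * u ^ (Suc q))"
    by (intro jet_curve_ord_add ord_ge_cmult ord_ge_id ord_ge_coeff continuous_intros gam_cont) auto
  have 2: "ord_ge (Suc (Suc q)) (\<lambda>b u. \<Sum>r\<in>{q + 2..q + q}. sq b r * u ^ r)"
    by (intro ord_ge_sum ord_ge_coeff sq_cont) auto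
  have "ord_ge (Suc (Suc q)) (\<lambda>b u. (\<Sum>r\<in>{q + 2..q + q}. sq b r * u ^ r) - (jet_curve b (lam * u + (lam * gam b) * u ^ (Suc q)) - jet_curve b (lam * u) - (lam * gam b) * u ^ (Suc q)))"
    by (rule ord_ge_diff[OF 2 1])
  then have "ord_ge (q + 2) (\<lambda>b u. (\<Sum>r\<in>{q + 2..q + q}. sq b r * u ^ r) - (jet_curve b (lam * u + (lam * gam b) * u ^ (Suc q)) - jet_curve b (lam * u) - (lam * gam b) * u ^ (Suc q)))"
    by simp
  then show ?thesis
  proof (rule ord_ge_cong)
    fix b u :: complex assume b: "norm b < 1"
    have low: "(lam + mu b) * jet_curve b u + (\<Sum>r\<le>q. sq b r * u ^ r) - jet_curve b (lam * u) + b * jet_curve b (u / lam) = 0"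
    proof -
      have "(lam + mu b) * jet_curve b u + (\<Sum>r\<le>q. sq b r * u ^ r) - jet_curve b (lam * u) + b * jet_curve b (u / lam)
         = (\<Sum>r\<le>q. ((lam + mu b) * co b r + sq b r - co b r * lam ^ r + b * co b r / lam ^ r) * u ^ r)"
        unfolding jet_curve_def sum_distrib_left
        by (simp only: sum.distrib[symmetric] sum_subtractf[symmetric])
           (rule sum.cong, auto simp: power_mult_distrib power_divide algebra_simps)
      also have "\<dots> = 0"
      proof (rule sum.neutral, rule ballI)
        fix r assume "r \<in> {..q}"
        then have "co b r * (lam ^ r - lam) * (lam ^ r - mu b) = lam ^ r * sq b r" by (intro co_rec b) simp
        then have "sq b r = co b r * (lam ^ r - lam) * (lam ^ r - mu b) / lam ^ r" using lam0 by (simp add: field_simps)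
        moreover have "b = - lam * mu b" using lam0 by (simp add: mu_def)
        ultimately have "(lam + mu b) * co b r + sq b r - co b r * lam ^ r + b * co b r / lam ^ r
          = (lam + mu b) * co b r + co b r * (lam ^ r - lam) * (lam ^ r - mu b) / lam ^ r - co b r * lam ^ r + (- lam * mu b) * co b r / lam ^ r"
          by metis
        also have "\<dots> = 0" using lam0 by (simp add: field_simps)
        finally show "((lam + mu b) * co b r + sq b r - co b r * lam ^ r + b * co b r / lam ^ r) * u ^ r = 0" by simp
      qed
      finally show ?thesis .
    qed
    have "(\<Sum>r\<le>q + q. sq b r * u ^ r) = (\<Sum>r\<le>q. sq b r * u ^ r) + (\<Sum>r\<in>{Suc q..q + q}. sq b r * u ^ r)"
    proof -
      have "{..q + q} = {..q} \<union> {Suc q..q + q}" by auto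
      moreover have "(\<Sum>r\<in>{..q} \<union> {Suc q..q + q}. sq b r * u ^ r) = (\<Sum>r\<le>q. sq b r * u ^ r) + (\<Sum>r\<in>{Suc q..q + q}. sq b r * u ^ r)"
        by (rule sum.union_disjoint) auto
      ultimately show ?thesis by simp
    qed
    moreover have "(\<Sum>r\<in>{Suc q..q + q}. sq b r * u ^ r) = sq b (Suc q) * u ^ Suc q + (\<Sum>r\<in>{q + 2..q + q}. sq b r * u ^ r)"
      using q1 by (subst sum.atLeast_Suc_atMost) auto
    moreover have "sq b (Suc q) = gam b * (lam - mu b)"
      using lam_mu_ne[OF b, of 1] by (simp add: gam_def)
    ultimately have s: "(jet_curve b u)\<^sup>2 = (\<Sum>r\<le>q. sq b r * u ^ r) + gam b * (lam - mu b) * u ^ Suc q + (\<Sum>r\<in>{q + 2..q + q}. sq b r * u ^ r)"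
      unfolding jet_curve_square by simp
    have p: "phi b u = lam * u + (lam * gam b) * u ^ (Suc q)" by (simp add: phi_def algebra_simps)
    show "(\<Sum>r\<in>{q + 2..q + q}. sq b r * u ^ r) - (jet_curve b (lam * u + (lam * gam b) * u ^ (Suc q)) - jet_curve b (lam * u) - (lam * gam b) * u ^ (Suc q))
      = defect b u + b * jet_curve b (u / lam) + gam b * mu b * u ^ Suc q"
      unfolding defect_def s p using low by (simp add: algebra_simps)
  qed
qed

text \<open>Substituting \<open>u = phi b s\<close> replaces \<open>u / lam\<close> by
  \<open>s + gam b * s^(q+1)\<close>; the two contributions of order \<open>q + 1\<close> then have
  coefficient \<open>gam b * (b + lam * mu b) = 0\<close>.\<close>

lemma defect_phi: "ord_ge (q + 2) (\<lambda>b s. defect b (phi b s) + b * jet_curve b s)"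
proof -
  have 1: "ord_ge (q + 2) (\<lambda>b s. defect b (phi b s) + b * jet_curve b (phi b s / lam) + gam b * mu b * phi b s ^ Suc q)"
    by (rule ord_ge_compose[OF defect_expansion phi_ord])
  have 2: "ord_ge (q + 2) (\<lambda>b s. b * (jet_curve b (s + gam b * s ^ Suc q) - jet_curve b s - gam b * s ^ Suc q))"
  proof -
    have "ord_ge (Suc (Suc q)) (\<lambda>b s. jet_curve b (s + gam b * s ^ Suc q) - jet_curve b s - gam b * s ^ Suc q)"
      by (intro jet_curve_ord_add ord_ge_id ord_ge_coeff gam_cont) auto
    then show ?thesis by (intro ord_ge_mult'[OF ord_ge_bounded]) auto
  qed
  have 3: "ord_ge (q + 2) (\<lambda>b s. ((gam b * mu b * lam) * s ^ Suc q) * ((1 + gam b * s ^ q) ^ Suc q - 1))"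
    using q1 by (intro ord_ge_mult'[where n = "Suc q" and k = 1] ord_ge_one_plus_power ord_ge_coeff gam_cont continuous_intros mu_cont) auto
  from ord_ge_diff[OF ord_ge_diff[OF 1 2] 3] show ?thesis
  proof (rule ord_ge_cong)
    fix b s :: complex assume b: "norm b < 1"
    have "phi b s / lam = s + gam b * s ^ Suc q" using lam0 by (simp add: phi_def field_simps)
    moreover have "phi b s ^ Suc q = lam * s ^ Suc q * (1 + gam b * s ^ q) ^ Suc q"
      unfolding phi_def power_mult_distrib using lamq by simp
    ultimately have "defect b (phi b s) + b * jet_curve b (phi b s / lam) + gam b * mu b * phi b s ^ Suc q
       - b * (jet_curve b (s + gam b * s ^ Suc q) - jet_curve b s - gam b * s ^ Suc q)
       - gam b * mu b * lam * s ^ Suc q * ((1 + gam b * s ^ q) ^ Suc q - 1) = defect b (phi b s) + b * jet_curve b s + gam b * s ^ Suc q * (b + lam * mu b)"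
      by (simp add: algebra_simps del: power_Suc)
    moreover have "b + lam * mu b = 0" using lam0 by (simp add: mu_def)
    ultimately show "defect b (phi b s) + b * jet_curve b (phi b s / lam) + gam b * mu b * phi b s ^ Suc q
       - b * (jet_curve b (s + gam b * s ^ Suc q) - jet_curve b s - gam b * s ^ Suc q)
       - gam b * mu b * lam * s ^ Suc q * ((1 + gam b * s ^ q) ^ Suc q - 1) = defect b (phi b s) + b * jet_curve b s"
      by simp
  qed
qed

end

lemma ord_ge_tendsto:
  assumes "ord_ge (Suc n) F" "x \<longlonglongrightarrow> 0" "\<And>k. x k \<noteq> 0"
  shows "(\<lambda>k. F 0 (x k) / x k ^ n) \<longlonglongrightarrow> 0"
proof -
  from assms(1) obtain C d where C: "C > 0" "d > 0" "d \<le> 1"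
    "\<And>b s. norm b < d \<Longrightarrow> norm s < d \<Longrightarrow> norm (F b s) \<le> C * norm s ^ Suc n" by (rule ord_geE) blast
  have "\<forall>\<^sub>F k in sequentially. norm (x k) < d"
    using tendstoD[OF assms(2) C(2)] by simp
  then have "\<forall>\<^sub>F k in sequentially. norm (F 0 (x k) / x k ^ n) \<le> C * norm (x k)"
  proof eventually_elim
    case (elim k)
    then show ?case using C(4)[of 0 "x k"] C(2) assms(3)[of k] by (simp add: norm_divide norm_power field_simps)
  qed
  moreover have "(\<lambda>k. C * norm (x k)) \<longlonglongrightarrow> C * norm (0::complex)" by (intro tendsto_intros assms)
  ultimately show ?thesis by (intro Lim_null_comparison[where f = "\<lambda>k. F 0 (x k) / x k ^ n"]) auto
qed

lemma quadratic_funpow_poly: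
  fixes lam :: complex
  defines "f \<equiv> \<lambda>x. lam * x + x\<^sup>2"
  shows "\<exists>p. degree p = 2 ^ n \<and> (\<forall>x. poly p x = (f ^^ n) x)"
proof (induction n)
  case 0
  show ?case by (rule exI[of _ "[:0, 1:]"]) simp
next
  case (Suc n)
  then obtain p where p: "degree p = 2 ^ n" "\<And>x. poly p x = (f ^^ n) x" by blast
  have "degree (pcompose [:0, lam, 1:] p) = 2 ^ Suc n"
    using p by (simp add: degree_pcompose)
  moreover have "poly (pcompose [:0, lam, 1:] p) x = (f ^^ Suc n) x" for x
    using p by (simp add: poly_pcompose f_def power2_eq_square algebra_simps)
  ultimately show ?case by blast
qed

section \<open>Normal form of the polynomial: the resonant coefficient is nonzero\<close>

context root_of_unity
begin

definition f0 :: "complex \<Rightarrow> complex" where "f0 = (\<lambda>x. lam * x + x\<^sup>2)"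

lemma f0_jet_curve: "ord_ge (q + 2) (\<lambda>b u. f0 (jet_curve 0 u) - jet_curve 0 (phi 0 u))"
  using ord_ge_at_0[OF defect_expansion] by (simp add: defect_def mu_def f0_def)

lemma phi_funpow_ord: "ord_ge 1 (\<lambda>b s. (phi 0 ^^ n) s)"
proof (induction n)
  case 0
  then show ?case using ord_ge_id by simp
next
  case (Suc n)
  show ?case using ord_ge_compose[OF ord_ge_at_0[OF phi_ord] Suc] by simp
qed

lemma f0_funpow_jet_curve: "ord_ge (q + 2) (\<lambda>b s. (f0 ^^ n) (jet_curve 0 s) - jet_curve 0 ((phi 0 ^^ n) s))"
proof (induction n)
  case 0
  show ?case by (auto intro!: ord_geI[of 1 1])
next
  case (Suc n)
  let ?x = "\<lambda>s. (f0 ^^ n) (jet_curve 0 s)" and ?y = "\<lambda>s. (phi 0 ^^ n) s"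
  have k: "ord_ge 1 (\<lambda>b s. jet_curve 0 (?y s))" by (rule ord_ge_compose[OF ord_ge_at_0[OF jet_curve_ord] phi_funpow_ord])
  have "ord_ge 1 (\<lambda>b s. (?x s - jet_curve 0 (?y s)) + jet_curve 0 (?y s))"
    by (intro ord_ge_add k ord_ge_mono[OF Suc]) auto
  then have x: "ord_ge 1 (\<lambda>b s. ?x s)" by simp
  have c: "ord_ge 0 (\<lambda>b s. lam + ?x s + jet_curve 0 (?y s))"
    by (intro ord_ge_add ord_ge_const ord_ge_mono[OF x] ord_ge_mono[OF k]) auto
  have "ord_ge (q + 2) (\<lambda>b s. (?x s - jet_curve 0 (?y s)) * (lam + ?x s + jet_curve 0 (?y s)) + (f0 (jet_curve 0 (?y s)) - jet_curve 0 (phi 0 (?y s))))"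
    by (intro ord_ge_add ord_ge_mult'[OF Suc c] ord_ge_compose[OF f0_jet_curve phi_funpow_ord]) auto
  then show ?case by (simp add: f0_def power2_eq_square algebra_simps)
qed

text \<open>Because \<open>lam^q = 1\<close>, each iteration of \<open>phi 0\<close> adds the same
  amount \<open>gam 0\<close> to the resonant coefficient.\<close>

lemma phi_funpow: "ord_ge (q + 2) (\<lambda>b s. (phi 0 ^^ n) s - (lam ^ n * s + lam ^ n * of_nat n * gam 0 * s ^ Suc q))"
proof (induction n)
  case 0
  show ?case by (auto intro!: ord_geI[of 1 1])
next
  case (Suc n)
  let ?y = "\<lambda>s. (phi 0 ^^ n) s"
  let ?t = "\<lambda>s. (?y s - (lam ^ n * s + lam ^ n * of_nat n * gam 0 * s ^ Suc q)) + lam ^ n * of_nat n * gam 0 * s ^ Suc q"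
  have t: "ord_ge 2 (\<lambda>b s. ?t s)"
    using q1 by (intro ord_ge_add ord_ge_mono[OF Suc] ord_ge_coeff) auto
  have "ord_ge (Suc (Suc q)) (\<lambda>b s. (lam ^ n * s + ?t s) ^ Suc q - (lam ^ n * s) ^ Suc q)"
    by (intro ord_ge_power_diff t ord_ge_cmult ord_ge_id)
  then have "ord_ge (q + 2) (\<lambda>b s. ?y s ^ Suc q - (lam ^ n * s) ^ Suc q)"
    by simp
  then have "ord_ge (q + 2) (\<lambda>b s. lam * (?y s - (lam ^ n * s + lam ^ n * of_nat n * gam 0 * s ^ Suc q)) + (lam * gam 0) * (?y s ^ Suc q - (lam ^ n * s) ^ Suc q))"
    by (intro ord_ge_add ord_ge_cmult Suc)
  moreover have "lam * (?y s - (lam ^ n * s + lam ^ n * of_nat n * gam 0 * s ^ Suc q)) + (lam * gam 0) * (?y s ^ Suc q - (lam ^ n * s) ^ Suc q)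
      = (phi 0 ^^ Suc n) s - (lam ^ Suc n * s + lam ^ Suc n * of_nat (Suc n) * gam 0 * s ^ Suc q)" for s
  proof -
    have "(lam ^ n) ^ q = (lam ^ q) ^ n" by (simp add: mult.commute flip: power_mult)
    then have "(lam ^ n) ^ Suc q = lam ^ n" using lamq by simp
    then have eq: "(lam ^ n * s) ^ Suc q = lam ^ n * s ^ Suc q"
      unfolding power_mult_distrib by simp
    show ?thesis unfolding eq by (simp add: phi_def algebra_simps)
  qed
  ultimately show ?case by simp
qed

lemma f0_funpow_q: "ord_ge (q + 2) (\<lambda>b s. (f0 ^^ q) (jet_curve 0 s) - jet_curve 0 s - of_nat q * gam 0 * s ^ Suc q)"
proof -
  let ?e = "\<lambda>s. (phi 0 ^^ q) s - (lam ^ q * s + lam ^ q * of_nat q * gam 0 * s ^ Suc q)"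
  let ?t = "\<lambda>s. ?e s + of_nat q * gam 0 * s ^ Suc q"
  have "ord_ge (Suc q) (\<lambda>b s. ?t s)"
    by (intro ord_ge_add ord_ge_mono[OF phi_funpow] ord_ge_coeff) auto
  then have "ord_ge (Suc (Suc q)) (\<lambda>b s. jet_curve b (s + ?t s) - jet_curve b s - ?t s)"
    by (intro jet_curve_ord_add ord_ge_id)
  from ord_ge_at_0[OF this] have "ord_ge (q + 2) (\<lambda>b s. jet_curve 0 (s + ?t s) - jet_curve 0 s - ?t s)" by simp
  then have "ord_ge (q + 2) (\<lambda>b s. ((f0 ^^ q) (jet_curve 0 s) - jet_curve 0 ((phi 0 ^^ q) s)) + (jet_curve 0 (s + ?t s) - jet_curve 0 s - ?t s) + ?e s)"
    by (intro ord_ge_add f0_funpow_jet_curve phi_funpow)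
  then show ?thesis by (simp add: lamq algebra_simps del: power_Suc)
qed

text \<open>The degree \<open>2^q\<close> rules out the identity, so \<open>f0^q - id\<close> is a
  nonzero polynomial whose zero at the origin can be split off; it is at least double because
  \<open>(f0^q)'(0) = lam^q = 1\<close>.\<close>

lemma f0_funpow_q_form:
  "\<exists>m R. m \<ge> 1 \<and> poly R 0 \<noteq> 0 \<and> (\<forall>x. (f0 ^^ q) x = x * (1 + x ^ m * poly R x))"
proof -
  obtain p where p: "degree p = 2 ^ q" "\<And>x. poly p x = (f0 ^^ q) x"
    using quadratic_funpow_poly[of q lam] unfolding f0_def by blast
  define r where "r = p - [:0, 1:]"
  have "(2::nat) ^ q \<ge> 2 ^ 1" using q1 by (intro power_increasing) auto
  then have "p \<noteq> [:0, 1:]" using p(1) by auto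
  then have "r \<noteq> 0" by (simp add: r_def)
  from order_decomp[OF this, of 0] obtain R where R: "r = [:0, 1:] ^ order 0 r * R" "\<not> [:0, 1:] dvd R" by auto
  define k where "k = order 0 r"
  have R0: "poly R 0 \<noteq> 0" using R(2) by (simp add: poly_eq_0_iff_dvd)
  have G: "(f0 ^^ q) x = x + x ^ k * poly R x" for x
  proof -
    have "poly r x = x ^ k * poly R x" by (subst R(1)) (simp add: k_def)
    then show ?thesis using p(2)[of x] by (simp add: r_def algebra_simps)
  qed
  define x :: "nat \<Rightarrow> complex" where "x n = of_real (inverse (real (Suc n)))" for n
  have x: "x \<longlonglongrightarrow> 0" "\<And>n. x n \<noteq> 0"
    unfolding x_def using tendsto_of_real[OF LIMSEQ_inverse_real_of_nat, where 'a = complex]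
    by (simp_all only: of_real_0 of_real_eq_0_iff) auto
  have l1: "(\<lambda>n. (f0 ^^ q) (x n) / x n) \<longlonglongrightarrow> 1"
    using quadratic_funpow_ratio(1)[OF x, where lam = lam and j = q] lamq by (simp add: f0_def)
  have Rx: "(\<lambda>n. poly R (x n)) \<longlonglongrightarrow> poly R 0" by (intro tendsto_intros x)
  have "k \<noteq> 0"
  proof
    assume "k = 0"
    have "(f0 ^^ n) 0 = 0" for n by (induction n) (auto simp: f0_def)
    then show False using G[of 0] R0 \<open>k = 0\<close> by simp
  qed
  moreover have "k \<noteq> 1"
  proof
    assume "k = 1"
    then have "(\<lambda>n. (f0 ^^ q) (x n) / x n) = (\<lambda>n. 1 + poly R (x n))"
      using x(2) by (auto simp: G field_simps)
    moreover have "(\<lambda>n. 1 + poly R (x n)) \<longlonglongrightarrow> 1 + poly R 0" by (intro tendsto_intros Rx)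
    ultimately have "(1::complex) = 1 + poly R 0" using l1 LIMSEQ_unique by metis
    then show False using R0 by simp
  qed
  ultimately have "k = Suc (k - 1)" "k - 1 \<ge> 1" by auto
  moreover from this have "(f0 ^^ q) x = x * (1 + x ^ (k - 1) * poly R x)" for x
    using G[of x] by (metis distrib_left mult.assoc mult.right_neutral power_Suc)
  ultimately show ?thesis using R0 by blast
qed

text \<open>On the curve, \<open>f0^q - id\<close> is both \<open>q * gam 0 * s^(q+1)\<close> up to
  order \<open>q + 2\<close> and a multiple of order exactly \<open>m + 1\<close>. The petal count
  gives \<open>m \<le> q\<close>; if \<open>m < q\<close>, dividing by \<open>s^(m+1)\<close> would
  give \<open>poly R 0 = 0\<close>. Hence \<open>m = q\<close>, and the leading coefficients
  agree.\<close>

lemma parabolic_normal_form: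
  obtains R where "poly R 0 = of_nat q * gam 0" "gam 0 \<noteq> 0" "\<And>x. (f0 ^^ q) x = x * (1 + x ^ q * poly R x)"
proof -
  obtain m R where m: "m \<ge> 1" and R0: "poly R 0 \<noteq> 0" and G: "\<And>x. (f0 ^^ q) x = x * (1 + x ^ m * poly R x)"
    using f0_funpow_q_form by blast
  have mq: "m \<le> q"
    using parabolic_multiplicity_le[OF lam1 q1 m R0] G unfolding f0_def by blast
  define x :: "nat \<Rightarrow> complex" where "x n = of_real (inverse (real (Suc n)))" for n
  have x: "x \<longlonglongrightarrow> 0" "\<And>n. x n \<noteq> 0"
    unfolding x_def using tendsto_of_real[OF LIMSEQ_inverse_real_of_nat, where 'a = complex]
    by (simp_all only: of_real_0 of_real_eq_0_iff) auto
  let ?k = "\<lambda>n. jet_curve 0 (x n)"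
  have "ord_ge (Suc 1) (\<lambda>b s. jet_curve b s - s)" using jet_curve_ord2 by (simp add: numeral_2_eq_2)
  from ord_ge_tendsto[OF this x] have "(\<lambda>n. (?k n - x n) / x n ^ 1 + 1) \<longlonglongrightarrow> 0 + 1"
    by (intro tendsto_intros)
  then have k1: "(\<lambda>n. ?k n / x n) \<longlonglongrightarrow> 1" using x(2) by (simp add: diff_divide_distrib)
  have "(\<lambda>n. ?k n / x n * x n) \<longlonglongrightarrow> 1 * 0" by (intro tendsto_intros k1 x)
  then have k0: "?k \<longlonglongrightarrow> 0" using x(2) by simp
  let ?L = "\<lambda>n. (?k n / x n) ^ Suc m * poly R (?k n)"
  have L: "?L \<longlonglongrightarrow> 1 ^ Suc m * poly R 0" by (intro tendsto_intros k0 k1)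
  let ?E = "\<lambda>s. (f0 ^^ q) (jet_curve 0 s) - jet_curve 0 s - of_nat q * gam 0 * s ^ Suc q"
  have "ord_ge (Suc (Suc m)) (\<lambda>b s. ?E s)" by (rule ord_ge_mono[OF f0_funpow_q]) (use mq in auto)
  from ord_ge_tendsto[OF this x] have E: "(\<lambda>n. ?E (x n) / x n ^ Suc m) \<longlonglongrightarrow> 0" .
  have eq: "?L n - ?E (x n) / x n ^ Suc m = of_nat q * gam 0 * x n ^ (q - m)" for n
  proof -
    have xq: "x n ^ Suc q = x n ^ (q - m) * x n ^ Suc m" using mq by (simp flip: power_add)
    have "?E (x n) = (?k n) ^ Suc m * poly R (?k n) - of_nat q * gam 0 * x n ^ (q - m) * x n ^ Suc m"
      unfolding xq G by (simp add: algebra_simps)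
    then show ?thesis using x(2)[of n] by (simp add: diff_divide_distrib power_divide)
  qed
  have "(\<lambda>n. ?L n - ?E (x n) / x n ^ Suc m) \<longlonglongrightarrow> 1 ^ Suc m * poly R 0 - 0" by (intro tendsto_diff L E)
  then have lim: "(\<lambda>n. of_nat q * gam 0 * x n ^ (q - m)) \<longlonglongrightarrow> poly R 0" unfolding eq by simp
  have "m = q"
  proof (rule ccontr)
    assume "m \<noteq> q"
    then have "(\<lambda>n. of_nat q * gam 0 * x n ^ (q - m)) \<longlonglongrightarrow> of_nat q * gam 0 * 0 ^ (q - m)"
      by (intro tendsto_intros x)
    then have "poly R 0 = 0" using LIMSEQ_unique[OF lim] \<open>m \<noteq> q\<close> mq by (auto simp: power_0_left)
    then show False using R0 by simp
  qed
  then have "(\<lambda>n. of_nat q * gam 0 * x n ^ (q - m)) \<longlonglongrightarrow> of_nat q * gam 0" by simp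
  from LIMSEQ_unique[OF lim this] have "poly R 0 = of_nat q * gam 0" .
  then show ?thesis using that[of R] R0 G \<open>m = q\<close> by auto
qed

lemma gam_nonzero: "gam 0 \<noteq> 0"
  using parabolic_normal_form by metis

text \<open>With \<open>v^q = -1 / (q * gam 0)\<close>, the displayed quotient is the petal
  coordinate of \<open>x\<close>, whose real part tends to infinity faster than its imaginary
  part.\<close>

lemma critical_orbit_deep:
  fixes M' :: real
  obtains N x where "x = (f0 ^^ N) (- lam\<^sup>2 / 4)" "x \<noteq> 0"
    "Re (1 / (- (of_nat q * gam 0 * x ^ q))) \<ge> M'"
    "\<bar>Im (1 / (- (of_nat q * gam 0 * x ^ q)))\<bar> \<le> Re (1 / (- (of_nat q * gam 0 * x ^ q)))"
proof -
  obtain R where R: "poly R 0 = of_nat q * gam 0" "gam 0 \<noteq> 0" "\<And>x. (f0 ^^ q) x = x * (1 + x ^ q * poly R x)"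
    by (rule parabolic_normal_form) blast
  define C where "C = of_nat q * gam 0"
  have C0: "C \<noteq> 0" using R(2) q1 by (simp add: C_def)
  have "q \<noteq> 0" using q1 by auto
  then obtain v where "- 1 / C = v ^ q" by (rule exists_complex_root)
  then have v: "v ^ q = - 1 / C" by simp
  have vR: "v ^ q * poly R 0 = -1" using C0 v R(1) by (simp add: C_def)
  have v0: "v \<noteq> 0" using v C0 q1 by (auto simp: power_0_left)
  show ?thesis
  proof (rule critical_orbit_enters_petal[OF lam1 q1 vR, folded f0_def, OF R(3)])
    fix M t1 assume M: "M > 0" "((\<lambda>t. t1 t - t) \<longlongrightarrow> of_nat q) at_infinity"
    "\<And>t. norm t \<ge> M \<Longrightarrow> norm (t1 t - t - of_nat q) < 1/4"
    "\<And>t. norm t \<ge> M \<Longrightarrow> Re t > 0 \<Longrightarrow> (f0 ^^ q) (petal v q t) = petal v q (t1 t)"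
    and "\<exists>n t. Re t \<ge> M \<and> (f0 ^^ n) (- lam\<^sup>2 / 4) = petal v q t"
    then obtain n t where nt: "Re t \<ge> M" "(f0 ^^ n) (- lam\<^sup>2 / 4) = petal v q t" by blast
    define T where "T k = (t1 ^^ k) t" for k
    note po = petal_orbit[OF M(1,3,4) q1 nt(1), folded T_def]
    obtain k :: nat where k: "real k > 2 * max \<bar>M'\<bar> \<bar>Im t\<bar>" using reals_Archimedean2 by blast
    have arith: "m' \<le> y \<and> i' \<le> y" if "k > 2 * a" "k > 2 * i" "m' \<le> a" "0 \<le> a" "0 < M" "M \<le> r"
      "r + k * (3/4) \<le> y" "i' \<le> i + k / 4" for k a i m' M r y i' :: real
      using that by linarith
    have "real k > 2 * \<bar>M'\<bar>" "real k > 2 * \<bar>Im t\<bar>" using k by auto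
    from arith[OF this abs_ge_self abs_ge_zero M(1) nt(1) po(1)[of k] po(2)[of k]]
    have Re: "Re (T k) \<ge> M'" and Im: "\<bar>Im (T k)\<bar> \<le> Re (T k)" by auto
    have "real k \<ge> 0" by simp
    then have "Re (T k) > 0" using po(1)[of k] nt(1) M(1) by linarith
    then have "T k \<noteq> 0" by auto
    define x where "x = petal v q (T k)"
    have "x ^ q = v ^ q / T k" unfolding x_def by (rule petal_power[OF q1 \<open>T k \<noteq> 0\<close>])
    then have xq: "1 / (- (C * x ^ q)) = T k" using v C0 by simp
    have "(f0 ^^ (q * k + n)) (- lam\<^sup>2 / 4) = x"
      using po(3)[of k] nt(2) by (simp add: funpow_add funpow_mult x_def)
    then show ?thesis
      using that[of x "q * k + n"] xq Re Im petal_nonzero[OF v0, of q "T k"] unfolding C_def x_def[symmetric] by metis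
  qed
qed

end

section \<open>Persistence of the trapping region\<close>

text \<open>The strict derivative in the second variable at 0, uniform in \<open>b\<close>. Unlike
  the plain derivative it compares two arbitrary nearby points, as both the inverse function
  argument and the error estimate for the trap require.\<close>

definition strict_deriv0 :: "complex \<Rightarrow> (complex \<Rightarrow> complex \<Rightarrow> complex) \<Rightarrow> bool" where
  "strict_deriv0 L f \<longleftrightarrow> (\<forall>e>0. \<exists>d>0. \<forall>b u v. norm b < d \<longrightarrow> norm u < d \<longrightarrow> norm v < d \<longrightarrow>
     norm (f b u - f b v - L * (u - v)) \<le> e * norm (u - v))"

lemma strict_deriv0D:
  assumes "strict_deriv0 L f" "e > 0"
  obtains d where "d > 0" "\<And>b u v. norm b < d \<Longrightarrow> norm u < d \<Longrightarrow> norm v < d \<Longrightarrow>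
     norm (f b u - f b v - L * (u - v)) \<le> e * norm (u - v)"
  using assms unfolding strict_deriv0_def by blast

lemma strict_deriv0_add:
  assumes "strict_deriv0 L f" "strict_deriv0 L' g"
  shows "strict_deriv0 (L + L') (\<lambda>b u. f b u + g b u)"
  unfolding strict_deriv0_def
proof (intro allI impI)
  fix e :: real assume "e > 0"
  then have e: "e / 2 > 0" by simp
  from assms(1) e obtain d where d: "d > 0" "\<And>b u v. norm b < d \<Longrightarrow> norm u < d \<Longrightarrow> norm v < d \<Longrightarrow>
     norm (f b u - f b v - L * (u - v)) \<le> e / 2 * norm (u - v)" by (rule strict_deriv0D) blast
  from assms(2) e obtain d' where d': "d' > 0" "\<And>b u v. norm b < d' \<Longrightarrow> norm u < d' \<Longrightarrow> norm v < d' \<Longrightarrow>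
     norm (g b u - g b v - L' * (u - v)) \<le> e / 2 * norm (u - v)" by (rule strict_deriv0D) blast
  show "\<exists>d>0. \<forall>b u v. norm b < d \<longrightarrow> norm u < d \<longrightarrow> norm v < d \<longrightarrow>
     norm (f b u + g b u - (f b v + g b v) - (L + L') * (u - v)) \<le> e * norm (u - v)"
  proof (intro exI[of _ "min d d'"] conjI allI impI)
    fix b u v :: complex assume "norm b < min d d'" "norm u < min d d'" "norm v < min d d'"
    then have "norm (f b u - f b v - L * (u - v)) \<le> e / 2 * norm (u - v)"
       "norm (g b u - g b v - L' * (u - v)) \<le> e / 2 * norm (u - v)" using d d' by auto
    moreover have "f b u + g b u - (f b v + g b v) - (L + L') * (u - v) = (f b u - f b v - L * (u - v)) + (g b u - g b v - L' * (u - v))"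
      by (simp add: algebra_simps)
    ultimately show "norm (f b u + g b u - (f b v + g b v) - (L + L') * (u - v)) \<le> e * norm (u - v)"
      by (smt (verit) norm_triangle_ineq field_sum_of_halves distrib_right)
  qed (use d d' in auto)
qed

lemma strict_deriv0_coeff:
  assumes f: "strict_deriv0 L f" and c: "isCont c 0"
  shows "strict_deriv0 (c 0 * L) (\<lambda>b u. c b * f b u)"
  unfolding strict_deriv0_def
proof (intro allI impI)
  fix e :: real assume e: "e > 0"
  define B where "B = norm (c 0) + 1"
  have B: "B > 0" by (simp add: B_def add_nonneg_pos)
  define e1 where "e1 = min 1 (e / (2 * (norm L + 1)))"
  have e1: "e1 > 0" using e by (simp add: e1_def add_nonneg_pos)
  obtain d0 where d0: "d0 > 0" "\<And>b. norm b < d0 \<Longrightarrow> norm (c b - c 0) < e1"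
    using c e1 unfolding continuous_at_eps_delta dist_norm by (metis diff_zero)
  have "e / (2 * B) > 0" using e B by simp
  from f this obtain d where d: "d > 0" "\<And>b u v. norm b < d \<Longrightarrow> norm u < d \<Longrightarrow> norm v < d \<Longrightarrow>
     norm (f b u - f b v - L * (u - v)) \<le> e / (2 * B) * norm (u - v)" by (rule strict_deriv0D) blast
  show "\<exists>d>0. \<forall>b u v. norm b < d \<longrightarrow> norm u < d \<longrightarrow> norm v < d \<longrightarrow>
     norm (c b * f b u - c b * f b v - c 0 * L * (u - v)) \<le> e * norm (u - v)"
  proof (intro exI[of _ "min d d0"] conjI allI impI)
    fix b u v :: complex assume b: "norm b < min d d0" and "norm u < min d d0" "norm v < min d d0"
    then have 1: "norm (f b u - f b v - L * (u - v)) \<le> e / (2 * B) * norm (u - v)" using d by auto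
    have cb: "norm (c b - c 0) < e1" using b d0 by auto
    then have "norm (c b - c 0) < 1" by (simp add: e1_def)
    then have cB: "norm (c b) \<le> B" using norm_triangle_ineq2[of "c b" "c 0"] by (simp add: B_def)
    have "c b * f b u - c b * f b v - c 0 * L * (u - v) = c b * (f b u - f b v - L * (u - v)) + (c b - c 0) * L * (u - v)"
      by (simp add: algebra_simps)
    also have "norm \<dots> \<le> norm (c b) * norm (f b u - f b v - L * (u - v)) + norm (c b - c 0) * norm L * norm (u - v)"
      by (metis norm_mult norm_triangle_ineq)
    also have "\<dots> \<le> B * (e / (2 * B) * norm (u - v)) + e1 * norm L * norm (u - v)"
      using cB cb 1 B e1 by (intro add_mono mult_mono) auto
    also have "B * (e / (2 * B) * norm (u - v)) = e / 2 * norm (u - v)" using B by simp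
    also have "e1 * norm L \<le> e / 2"
    proof -
      have "e1 * norm L \<le> e1 * (norm L + 1)" using e1 by (intro mult_left_mono) auto
      also have "\<dots> \<le> e / (2 * (norm L + 1)) * (norm L + 1)" by (intro mult_right_mono) (auto simp: e1_def)
      also have "\<dots> = e / 2"
      proof -
        have "e / (2 * c) * c = e / 2" if "c \<noteq> 0" for c using that by simp
        moreover have "norm L + 1 \<noteq> 0" using norm_ge_zero[of L] by linarith
        ultimately show ?thesis by blast
      qed
      finally show ?thesis .
    qed
    then have "e / 2 * norm (u - v) + e1 * norm L * norm (u - v) \<le> e / 2 * norm (u - v) + e / 2 * norm (u - v)"
      by (intro add_mono mult_right_mono) auto
    finally show "norm (c b * f b u - c b * f b v - c 0 * L * (u - v)) \<le> e * norm (u - v)" by simp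
  qed (use d d0 in auto)
qed

lemma strict_deriv0_diff:
  assumes "strict_deriv0 L f" "strict_deriv0 L' g"
  shows "strict_deriv0 (L - L') (\<lambda>b u. f b u - g b u)"
  using strict_deriv0_add[OF assms(1) strict_deriv0_coeff[OF assms(2), of "\<lambda>_. -1"]] by simp

lemma strict_deriv0_id: "strict_deriv0 1 (\<lambda>b u. u)"
  by (auto simp: strict_deriv0_def intro!: exI[of _ 1])

lemma ord_ge_small:
  assumes "ord_ge 1 f" "e > 0"
  obtains d where "d > 0" "\<And>b u. norm b < d \<Longrightarrow> norm u < d \<Longrightarrow> norm (f b u) < e"
proof -
  from assms(1) obtain C d where C: "C > 0" "d > 0" "d \<le> 1"
    "\<And>b s. norm b < d \<Longrightarrow> norm s < d \<Longrightarrow> norm (f b s) \<le> C * norm s ^ 1" by (rule ord_geE) blast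
  show ?thesis
  proof (rule that[of "min d (e / C)"])
    fix b u :: complex assume "norm b < min d (e / C)" "norm u < min d (e / C)"
    then have "norm (f b u) \<le> C * norm u" "C * norm u < e" using C by (auto simp: field_simps)
    then show "norm (f b u) < e" by simp
  qed (use C assms in auto)
qed

lemma strict_deriv0_lipschitz:
  assumes "norm (x - L * y) \<le> 1 * norm y" shows "norm x \<le> (norm L + 1) * norm (y::complex)"
proof -
  have "norm x \<le> norm (x - L * y) + norm (L * y)" by (metis diff_add_cancel norm_triangle_ineq)
  then show ?thesis using assms by (simp add: norm_mult algebra_simps)
qed

lemma strict_deriv0_mult:
  assumes f: "strict_deriv0 L f" "ord_ge 1 f" and g: "strict_deriv0 L' g" "ord_ge 1 g"
  shows "strict_deriv0 0 (\<lambda>b u. f b u * g b u)"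
  unfolding strict_deriv0_def
proof (intro allI impI)
  fix e :: real assume e: "e > 0"
  define B where "B = norm L + norm L' + 2"
  have B: "B > 0" by (simp add: B_def add_nonneg_pos)
  from f(1) obtain d1 where d1: "d1 > 0" "\<And>b u v. norm b < d1 \<Longrightarrow> norm u < d1 \<Longrightarrow> norm v < d1 \<Longrightarrow>
     norm (f b u - f b v - L * (u - v)) \<le> 1 * norm (u - v)" by (rule strict_deriv0D[of _ _ 1]) auto
  from g(1) obtain d2 where d2: "d2 > 0" "\<And>b u v. norm b < d2 \<Longrightarrow> norm u < d2 \<Longrightarrow> norm v < d2 \<Longrightarrow>
     norm (g b u - g b v - L' * (u - v)) \<le> 1 * norm (u - v)" by (rule strict_deriv0D[of _ _ 1]) auto
  have eB: "e / (2 * B) > 0" using e B by simp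
  from f(2) eB obtain d3 where d3: "d3 > 0" "\<And>b u. norm b < d3 \<Longrightarrow> norm u < d3 \<Longrightarrow> norm (f b u) < e / (2 * B)"
    by (rule ord_ge_small) blast
  from g(2) eB obtain d4 where d4: "d4 > 0" "\<And>b u. norm b < d4 \<Longrightarrow> norm u < d4 \<Longrightarrow> norm (g b u) < e / (2 * B)"
    by (rule ord_ge_small) blast
  show "\<exists>d>0. \<forall>b u v. norm b < d \<longrightarrow> norm u < d \<longrightarrow> norm v < d \<longrightarrow>
     norm (f b u * g b u - f b v * g b v - 0 * (u - v)) \<le> e * norm (u - v)"
  proof (intro exI[of _ "min (min d1 d2) (min d3 d4)"] conjI allI impI)
    fix b u v :: complex assume "norm b < min (min d1 d2) (min d3 d4)" "norm u < min (min d1 d2) (min d3 d4)" "norm v < min (min d1 d2) (min d3 d4)"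
    then have 1: "norm (f b u - f b v - L * (u - v)) \<le> 1 * norm (u - v)"
      and 2: "norm (g b u - g b v - L' * (u - v)) \<le> 1 * norm (u - v)" 
      and 3: "norm (f b u) < e / (2 * B)" and 4: "norm (g b v) < e / (2 * B)"
      using d1(2) d2(2) d3(2) d4(2) by auto
    have n1: "norm (f b u - f b v) \<le> B * norm (u - v)"
      using strict_deriv0_lipschitz[OF 1] by (rule order_trans) (auto simp: B_def intro!: mult_right_mono)
    have n2: "norm (g b u - g b v) \<le> B * norm (u - v)"
      using strict_deriv0_lipschitz[OF 2] by (rule order_trans) (auto simp: B_def intro!: mult_right_mono)
    have "f b u * g b u - f b v * g b v - 0 * (u - v) = f b u * (g b u - g b v) + g b v * (f b u - f b v)"
      by (simp add: algebra_simps)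
    also have "norm \<dots> \<le> norm (f b u) * norm (g b u - g b v) + norm (g b v) * norm (f b u - f b v)"
      by (metis norm_mult norm_triangle_ineq)
    also have "\<dots> \<le> e / (2 * B) * (B * norm (u - v)) + e / (2 * B) * (B * norm (u - v))"
      using 3 4 n1 n2 eB by (intro add_mono mult_mono) auto
    also have "\<dots> = e * norm (u - v)" using B by (simp add: field_simps)
    finally show "norm (f b u * g b u - f b v * g b v - 0 * (u - v)) \<le> e * norm (u - v)" .
  qed (use d1 d2 d3 d4 in auto)
qed

lemma strict_deriv0_power: "strict_deriv0 0 (\<lambda>b u. u ^ Suc (Suc n))"
proof (induction n)
  case 0
  show ?case using strict_deriv0_mult[OF strict_deriv0_id ord_ge_id strict_deriv0_id ord_ge_id] by simp
next
  case (Suc n)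
  have "ord_ge 1 (\<lambda>b u. u ^ Suc (Suc n))" by (rule ord_ge_mono[OF ord_ge_power]) simp
  from strict_deriv0_mult[OF strict_deriv0_id ord_ge_id Suc this] show ?case by simp
qed

lemma strict_deriv0_compose:
  assumes f: "strict_deriv0 L f" and g: "strict_deriv0 L' g" "ord_ge 1 g"
  shows "strict_deriv0 (L * L') (\<lambda>b u. f b (g b u))"
  unfolding strict_deriv0_def
proof (intro allI impI)
  fix e :: real assume e: "e > 0"
  define B where "B = norm L + norm L' + 1"
  have B: "B > 0" "B \<ge> 1" by (simp_all add: B_def add_nonneg_pos)
  have eB: "e / (2 * B) > 0" using e B by simp
  from f eB obtain d1 where d1: "d1 > 0" "\<And>b u v. norm b < d1 \<Longrightarrow> norm u < d1 \<Longrightarrow> norm v < d1 \<Longrightarrow>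
     norm (f b u - f b v - L * (u - v)) \<le> e / (2 * B) * norm (u - v)" by (rule strict_deriv0D) blast
  have "min 1 (e / (2 * B)) > 0" using eB by simp
  from g(1) this obtain d2 where d2: "d2 > 0" "\<And>b u v. norm b < d2 \<Longrightarrow> norm u < d2 \<Longrightarrow> norm v < d2 \<Longrightarrow>
     norm (g b u - g b v - L' * (u - v)) \<le> min 1 (e / (2 * B)) * norm (u - v)" by (rule strict_deriv0D) blast
  from g(2) d1(1) obtain d3 where d3: "d3 > 0" "\<And>b u. norm b < d3 \<Longrightarrow> norm u < d3 \<Longrightarrow> norm (g b u) < d1"
    by (rule ord_ge_small) blast
  show "\<exists>d>0. \<forall>b u v. norm b < d \<longrightarrow> norm u < d \<longrightarrow> norm v < d \<longrightarrow>
     norm (f b (g b u) - f b (g b v) - L * L' * (u - v)) \<le> e * norm (u - v)"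
  proof (intro exI[of _ "min d1 (min d2 d3)"] conjI allI impI)
    fix b u v :: complex assume h: "norm b < min d1 (min d2 d3)" "norm u < min d1 (min d2 d3)" "norm v < min d1 (min d2 d3)"
    then have 1: "norm (f b (g b u) - f b (g b v) - L * (g b u - g b v)) \<le> e / (2 * B) * norm (g b u - g b v)"
      using d1(2) d3(2) by auto
    have 2: "norm (g b u - g b v - L' * (u - v)) \<le> min 1 (e / (2 * B)) * norm (u - v)" using h d2(2) by auto
    have n2: "norm (g b u - g b v) \<le> B * norm (u - v)"
    proof -
      have "norm (g b u - g b v - L' * (u - v)) \<le> 1 * norm (u - v)" by (rule order_trans[OF 2]) (intro mult_right_mono, auto)
      from strict_deriv0_lipschitz[OF this] show ?thesis by (rule order_trans) (auto simp: B_def intro!: mult_right_mono)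
    qed
    have n2b: "norm (g b u - g b v - L' * (u - v)) \<le> e / (2 * B) * norm (u - v)" by (rule order_trans[OF 2]) (intro mult_right_mono, auto)
    have "f b (g b u) - f b (g b v) - L * L' * (u - v) = (f b (g b u) - f b (g b v) - L * (g b u - g b v)) + L * (g b u - g b v - L' * (u - v))"
      by (simp add: algebra_simps)
    also have "norm \<dots> \<le> norm (f b (g b u) - f b (g b v) - L * (g b u - g b v)) + norm L * norm (g b u - g b v - L' * (u - v))"
      by (metis norm_mult norm_triangle_ineq)
    also have "\<dots> \<le> e / (2 * B) * (B * norm (u - v)) + B * (e / (2 * B) * norm (u - v))"
      using 1 n2 n2b eB B
      by (intro add_mono mult_mono order_trans[OF 1] mult_left_mono) (auto simp: B_def)
    also have "\<dots> = e * norm (u - v)" using B by (simp add: field_simps)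
    finally show "norm (f b (g b u) - f b (g b v) - L * L' * (u - v)) \<le> e * norm (u - v)" .
  qed (use d1 d2 d3 in auto)
qed

context root_of_unity
begin

lemma jet_curve_strict_deriv0: "strict_deriv0 1 jet_curve"
  unfolding strict_deriv0_def
proof (intro allI impI)
  fix e :: real assume e: "e > 0"
  obtain K d where K: "K > 0" "d > 0" "\<And>b u v \<rho>. norm b < d \<Longrightarrow> norm u \<le> \<rho> \<Longrightarrow> norm v \<le> \<rho> \<Longrightarrow> \<rho> \<le> 1 \<Longrightarrow>
    norm (jet_curve b u - jet_curve b v - (u - v)) \<le> K * \<rho> * norm (u - v)" by (rule jet_curve_lipschitz) blast
  define \<rho> where "\<rho> = min 1 (e / K)"
  have \<rho>: "\<rho> > 0" "\<rho> \<le> 1" "K * \<rho> \<le> e" using K e by (auto simp: \<rho>_def min_def field_simps)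
  show "\<exists>d>0. \<forall>b u v. norm b < d \<longrightarrow> norm u < d \<longrightarrow> norm v < d \<longrightarrow> norm (jet_curve b u - jet_curve b v - 1 * (u - v)) \<le> e * norm (u - v)"
  proof (intro exI[of _ "min d \<rho>"] conjI allI impI)
    fix b u v :: complex assume "norm b < min d \<rho>" "norm u < min d \<rho>" "norm v < min d \<rho>"
    then have "norm (jet_curve b u - jet_curve b v - (u - v)) \<le> K * \<rho> * norm (u - v)" using \<rho> by (intro K(3)) auto
    also have "\<dots> \<le> e * norm (u - v)" using \<rho> by (intro mult_right_mono) auto
    finally show "norm (jet_curve b u - jet_curve b v - 1 * (u - v)) \<le> e * norm (u - v)" by simp
  qed (use K \<rho> in auto)
qed

lemma phi_strict_deriv0: "strict_deriv0 lam phi"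
proof -
  obtain q' where q': "q = Suc q'" using q1 by (cases q) auto
  have "strict_deriv0 (lam * 1 + (lam * gam 0) * 0) (\<lambda>b u. lam * u + (lam * gam b) * u ^ Suc (Suc q'))"
    by (intro strict_deriv0_add strict_deriv0_coeff[where c = "\<lambda>_. lam"] strict_deriv0_coeff[where c = "\<lambda>b. lam * gam b"]
       strict_deriv0_id strict_deriv0_power continuous_intros gam_cont)
  moreover have "phi = (\<lambda>b u. lam * u + (lam * gam b) * u ^ Suc (Suc q'))"
    unfolding phi_def by (auto simp: q' fun_eq_iff algebra_simps)
  ultimately show ?thesis by simp
qed

lemma defect_strict_deriv0: "strict_deriv0 0 defect"
proof -
  have 1: "strict_deriv0 ((lam + mu 0) * 1) (\<lambda>b u. (lam + mu b) * jet_curve b u)"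
    by (rule strict_deriv0_coeff[OF jet_curve_strict_deriv0]) (intro continuous_intros mu_cont)
  have 2: "strict_deriv0 0 (\<lambda>b u. jet_curve b u * jet_curve b u)"
    by (rule strict_deriv0_mult[OF jet_curve_strict_deriv0 jet_curve_ord jet_curve_strict_deriv0 jet_curve_ord])
  have 3: "strict_deriv0 (1 * lam) (\<lambda>b u. jet_curve b (phi b u))"
    by (rule strict_deriv0_compose[OF jet_curve_strict_deriv0 phi_strict_deriv0 phi_ord])
  note strict_deriv0_diff[OF strict_deriv0_add[OF 1 2] 3]
  moreover have "defect = (\<lambda>b u. (lam + mu b) * jet_curve b u + jet_curve b u * jet_curve b u - jet_curve b (phi b u))"
    by (auto simp: defect_def fun_eq_iff power2_eq_square)
  ultimately show ?thesis by (simp add: mu_def)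
qed

text \<open>A quantitative inverse function theorem: \<open>jet_curve b - id\<close> has Lipschitz
  constant 1/2 near 0, so the equation is a fixed point problem for a contraction of the disc about
  \<open>v\<close> whose radius is twice the distance to be corrected.\<close>

lemma jet_curve_inverse:
  obtains d where "d > 0" "\<And>b v y. norm b < d \<Longrightarrow> norm v < d \<Longrightarrow> norm (y - jet_curve b v) < d \<Longrightarrow>
     \<exists>s. jet_curve b s = y \<and> norm (s - v) \<le> 2 * norm (y - jet_curve b v)"
proof -
  from jet_curve_strict_deriv0 obtain d where d: "d > 0" "\<And>b u v. norm b < d \<Longrightarrow> norm u < d \<Longrightarrow> norm v < d \<Longrightarrow>
    norm (jet_curve b u - jet_curve b v - 1 * (u - v)) \<le> 1/2 * norm (u - v)" by (rule strict_deriv0D[of _ _ "1/2"]) auto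
  show ?thesis
  proof (rule that[of "d / 4"])
    fix b v y :: complex assume b: "norm b < d / 4" and v: "norm v < d / 4" and y: "norm (y - jet_curve b v) < d / 4"
    define \<eta> where "\<eta> = norm (y - jet_curve b v)"
    define T where "T s = y - (jet_curve b s - s)" for s
    have small: "norm s < d" if "s \<in> cball v (2 * \<eta>)" for s
    proof -
      have "norm s \<le> norm v + norm (s - v)" by (metis add.commute diff_add_cancel norm_triangle_ineq)
      moreover have "norm (s - v) \<le> 2 * \<eta>" using that by (simp add: dist_norm norm_minus_commute)
      ultimately show ?thesis using v y d(1) unfolding \<eta>_def by linarith
    qed
    have contr: "dist (T s) (T s') \<le> 1/2 * dist s s'" if "s \<in> cball v (2 * \<eta>)" "s' \<in> cball v (2 * \<eta>)" for s s'
    proof -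
      have "dist (T s) (T s') = norm (jet_curve b s - jet_curve b s' - 1 * (s - s'))"
        by (simp add: T_def dist_norm norm_minus_commute algebra_simps)
      then show ?thesis using d(2)[of b s s'] small that b d(1) by (simp add: dist_norm)
    qed
    have vin: "v \<in> cball v (2 * \<eta>)" by (simp add: \<eta>_def)
    have maps: "T ` cball v (2 * \<eta>) \<subseteq> cball v (2 * \<eta>)"
    proof safe
      fix s assume s: "s \<in> cball v (2 * \<eta>)"
      have "dist v (T s) \<le> dist v (T v) + dist (T v) (T s)" by (rule dist_triangle)
      also have "dist v (T v) = \<eta>" by (simp add: T_def \<eta>_def dist_norm norm_minus_commute)
      also have "dist (T v) (T s) \<le> 1/2 * dist v s" by (rule contr[OF vin s])
      finally show "T s \<in> cball v (2 * \<eta>)" using s by simp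
    qed
    have "\<exists>!s. s \<in> cball v (2 * \<eta>) \<and> T s = s"
      by (rule Banach_fix[where c = "1/2"]) (use contr maps vin in \<open>auto simp: complete_eq_closed\<close>)
    then obtain s where "s \<in> cball v (2 * \<eta>)" "T s = s" by blast
    then show "\<exists>s. jet_curve b s = y \<and> norm (s - v) \<le> 2 * norm (y - jet_curve b v)"
      by (intro exI[of _ s]) (auto simp: T_def \<eta>_def dist_norm norm_minus_commute algebra_simps)
  qed (use d in auto)
qed

text \<open>This is \<open>(v/s)^q\<close> with \<open>v^q = -1 / (q * gam 0)\<close>. It does not
  depend on the root \<open>v\<close>, so a half-plane in this coordinate describes all
  \<open>q\<close> petals at once.\<close>

definition petal_coord :: "complex \<Rightarrow> complex" where "petal_coord s = 1 / (- (of_nat q * gam 0 * s ^ q))"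

lemma petal_coord_small:
  assumes "e > 0" obtains M where "M > 0" "\<And>s. s \<noteq> 0 \<Longrightarrow> norm (petal_coord s) > M \<Longrightarrow> norm s < e"
proof -
  define C where "C = norm (of_nat q * gam 0)"
  have C: "C > 0" using gam_nonzero q1 by (simp add: C_def)
  show ?thesis
  proof (rule that[of "1 / (C * e ^ q)"])
    fix s assume s: "s \<noteq> 0" "1 / (C * e ^ q) < norm (petal_coord s)"
    have "norm (petal_coord s) = 1 / (C * norm s ^ q)" by (simp add: petal_coord_def C_def norm_divide norm_mult norm_power)
    then have "1 / (C * e ^ q) < 1 / (C * norm s ^ q)" using s by simp
    then have "norm s ^ q < e ^ q" using C s assms by (simp add: field_simps)
    then show "norm s < e" using assms by (simp add: power_less_imp_less_base)
  qed (use C assms in auto)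
qed

text \<open>A deviation of \<open>s'\<close> from \<open>phi b s\<close> of size
  \<open>\<kappa> * norm s ^ Suc q\<close> only replaces the resonant coefficient by some
  \<open>g\<close> close to \<open>gam 0\<close>. The coordinate changes approximately by
  \<open>g / gam 0\<close>, hence by 1 up to an error of at most 1/2.\<close>

lemma petal_coord_step:
  obtains M \<kappa> d where "M > 0" "\<kappa> > 0" "d > 0"
    "\<And>b s s'. norm b < d \<Longrightarrow> s \<noteq> 0 \<Longrightarrow> Re (petal_coord s) > M \<Longrightarrow> norm (s' - phi b s) \<le> \<kappa> * norm s ^ Suc q \<Longrightarrow>
      s' \<noteq> 0 \<and> Re (petal_coord s') > Re (petal_coord s) \<and> norm s / 2 \<le> norm s' \<and> norm s' \<le> 2 * norm s"
proof -
  have "((\<lambda>z::complex. 1 / (1 + z) ^ q) has_field_derivative - of_nat q) (at 0)"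
    using q1 by (auto intro!: derivative_eq_intros)
  then have "((\<lambda>z::complex. (1 / (1 + z) ^ q - 1) / z) \<longlongrightarrow> - of_nat q) (at 0)"
    by (simp add: has_field_derivative_iff)
  then obtain e where e: "e > 0" "\<And>z::complex. z \<noteq> 0 \<Longrightarrow> norm z < e \<Longrightarrow> norm ((1 / (1 + z) ^ q - 1) / z + of_nat q) < 1/8"
    unfolding LIM_eq by (metis diff_zero diff_minus_eq_add zero_less_divide_1_iff zero_less_numeral)
  define g0 where "g0 = norm (gam 0)"
  have g0: "g0 > 0" using gam_nonzero by (simp add: g0_def)
  define \<kappa> where "\<kappa> = g0 / 8"
  obtain d where d: "d > 0" "\<And>b. norm b < d \<Longrightarrow> norm (gam b - gam 0) < g0 / 8"
    using gam_cont g0 unfolding continuous_at_eps_delta dist_norm by (metis diff_zero zero_less_divide_iff zero_less_numeral)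
  define e' where "e' = min 1 (min (e / (2 * g0)) (1 / (4 * g0)))"
  have e': "e' > 0" "e' \<le> 1" "2 * g0 * e' \<le> e" "2 * g0 * e' \<le> 1/2" using e g0 by (auto simp: e'_def min_def field_simps)
  obtain M where M: "M > 0" "\<And>s. s \<noteq> 0 \<Longrightarrow> norm (petal_coord s) > M \<Longrightarrow> norm s < e'" using petal_coord_small[OF e'(1)] by blast
  show ?thesis
  proof (rule that[OF M(1) _ d(1)])
    show "\<kappa> > 0" using g0 by (simp add: \<kappa>_def)
    fix b s s' assume b: "norm b < d" and s0: "s \<noteq> 0" and Re: "Re (petal_coord s) > M" and s': "norm (s' - phi b s) \<le> \<kappa> * norm s ^ Suc q"
    have se: "norm s < e'" using M(2)[OF s0] Re complex_Re_le_cmod[of "petal_coord s"] by simp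
    define g where "g = gam b + (s' - phi b s) / (lam * s ^ Suc q)"
    have gg: "norm (g - gam 0) \<le> g0 / 4"
    proof -
      have "norm ((s' - phi b s) / (lam * s ^ Suc q)) = norm (s' - phi b s) / norm s ^ Suc q"
        by (simp add: norm_divide norm_mult norm_power lam1)
      also have "\<dots> \<le> \<kappa>" using s' s0 by (simp add: field_simps)
      finally have "norm ((s' - phi b s) / (lam * s ^ Suc q)) \<le> g0 / 8" by (simp add: \<kappa>_def)
      moreover have "norm (gam b - gam 0) < g0 / 8" using d b by simp
      moreover have "norm (g - gam 0) = norm ((gam b - gam 0) + (s' - phi b s) / (lam * s ^ Suc q))" by (simp add: g_def add_diff_eq diff_add_eq)
      ultimately show ?thesis using norm_triangle_ineq[of "gam b - gam 0" "(s' - phi b s) / (lam * s ^ Suc q)"] by linarith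
    qed
    have gne: "g \<noteq> 0" using gg g0 by (auto simp: g0_def)
    have gle: "norm g \<le> 2 * g0" using gg norm_triangle_ineq2[of g "gam 0"] g0 unfolding g0_def by linarith
    define z where "z = g * s ^ q"
    have zne: "z \<noteq> 0" using gne s0 by (simp add: z_def)
    have "norm s ^ q \<le> norm s ^ 1" using se e' q1 by (intro power_decreasing) auto
    then have "norm s ^ q < e'" using se by simp
    then have "norm z < 2 * g0 * e'"
      unfolding z_def norm_mult norm_power using gle g0
      by (intro le_less_trans[OF mult_right_mono[OF gle] mult_strict_left_mono]) auto
    then have z: "norm z < e" "norm z < 1/2" using e' by linarith+
    have s'eq: "s' = lam * s * (1 + z)"
      using s0 lam0 by (simp add: z_def g_def phi_def field_simps)
    have z1: "1/2 \<le> norm (1 + z)" "norm (1 + z) \<le> 2"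
      using z(2) norm_triangle_ineq[of 1 z] norm_triangle_ineq2[of 1 "-z"] by auto
    then have z10: "1 + z \<noteq> 0" by auto
    have ns': "norm s' = norm s * norm (1 + z)" by (simp add: s'eq norm_mult lam1)
    define C where "C = of_nat q * gam 0"
    have C0: "C \<noteq> 0" using gam_nonzero q1 by (simp add: C_def)
    have tts': "petal_coord s' = petal_coord s * (1 / (1 + z) ^ q)"
      by (simp add: petal_coord_def s'eq power_mult_distrib lamq)
    define F where "F = (1 / (1 + z) ^ q - 1) / z"
    have F: "norm (F + of_nat q) < 1/8" using e(2)[OF zne z(1)] by (simp add: F_def)
    have zF: "z * F = 1 / (1 + z) ^ q - 1" using zne by (simp add: F_def)
    have "petal_coord s' - petal_coord s = petal_coord s * (z * F)" unfolding tts' zF by (simp add: algebra_simps)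
    also have "\<dots> = - (g / C) * F" using s0 C0 by (simp add: petal_coord_def z_def C_def)
    also have "\<dots> = - (g / C) * (F + of_nat q) + (g - gam 0) / gam 0 + 1"
      using C0 gam_nonzero q1 by (simp add: C_def field_simps)
    finally have "norm (petal_coord s' - petal_coord s - 1) \<le> norm (g / C) * norm (F + of_nat q) + norm (g - gam 0) / g0"
      using norm_triangle_ineq[of "- (g / C) * (F + of_nat q)" "(g - gam 0) / gam 0"]
      by (simp add: norm_mult norm_divide g0_def)
    also have "norm (g / C) \<le> 2"
    proof -
      have "norm C \<ge> g0" using q1 g0 mult_right_mono[of 1 "real q" g0] by (simp add: C_def norm_mult g0_def)
      then have "norm g / norm C \<le> (2 * g0) / g0" using gle g0 by (intro frac_le) auto
      then show ?thesis using g0 by (simp add: norm_divide)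
    qed
    then have "norm (g / C) * norm (F + of_nat q) \<le> 2 * (1/8)" using F by (intro mult_mono) auto
    moreover have "norm (g - gam 0) / g0 \<le> 1/4" using gg g0 by (simp add: field_simps)
    ultimately have "norm (petal_coord s' - petal_coord s - 1) \<le> 1/2" by linarith
    then have "\<bar>Re (petal_coord s' - petal_coord s - 1)\<bar> \<le> 1/2" using abs_Re_le_cmod order_trans by blast
    moreover have "Re (petal_coord s' - petal_coord s - 1) = Re (petal_coord s') - Re (petal_coord s) - 1" by simp
    ultimately have "Re (petal_coord s') > Re (petal_coord s)" by linarith
    moreover have "norm s / 2 \<le> norm s'" "norm s' \<le> 2 * norm s"
      unfolding ns' using z1 mult_left_mono[OF z1(1), of "norm s"] mult_left_mono[OF z1(2), of "norm s"] by auto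
    moreover have "s' \<noteq> 0" using s'eq lam0 s0 z10 by simp
    ultimately show "s' \<noteq> 0 \<and> Re (petal_coord s') > Re (petal_coord s) \<and> norm s / 2 \<le> norm s' \<and> norm s' \<le> 2 * norm s" by blast
  qed
qed

end

section \<open>Trapping for the second-order recurrence\<close>

context root_of_unity
begin

text \<open>The invariant concerns a pair of consecutive terms: the first has a curve parameter
  \<open>s\<close> in the petal, and the parameter \<open>s'\<close> of the second is within
  \<open>\<kappa> * norm s ^ Suc q\<close> of \<open>phi b s\<close>. The petal condition persists
  by \<open>petal_coord_step\<close>. The closeness condition persists because \<open>defect\<close>
  has strict derivative 0, so the old error is multiplied by a small constant, while the new error
  has the higher order \<open>q + 2\<close>.\<close>

lemma semiparabolic_trap:
  obtains M \<kappa> D where "M > 0" "\<kappa> > 0" "D > 0"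
    "\<And>b \<xi> s s' n. norm b < D \<Longrightarrow> (\<And>n. \<xi> (Suc (Suc n)) = (lam + mu b) * \<xi> (Suc n) + (\<xi> (Suc n))\<^sup>2 + b * \<xi> n) \<Longrightarrow>
      \<xi> 0 = jet_curve b s \<Longrightarrow> \<xi> 1 = jet_curve b s' \<Longrightarrow> s \<noteq> 0 \<Longrightarrow> Re (petal_coord s) > M \<Longrightarrow> norm (s' - phi b s) \<le> \<kappa> * norm s ^ Suc q \<Longrightarrow>
      norm (\<xi> n) < 1/4"
proof -
  obtain M1 \<kappa>1 d1 where 1: "M1 > 0" "\<kappa>1 > 0" "d1 > 0"
    "\<And>b s s'. norm b < d1 \<Longrightarrow> s \<noteq> 0 \<Longrightarrow> Re (petal_coord s) > M1 \<Longrightarrow> norm (s' - phi b s) \<le> \<kappa>1 * norm s ^ Suc q \<Longrightarrow>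
      s' \<noteq> 0 \<and> Re (petal_coord s') > Re (petal_coord s) \<and> norm s / 2 \<le> norm s' \<and> norm s' \<le> 2 * norm s"
    by (rule petal_coord_step) blast
  define \<kappa> where "\<kappa> = min 1 \<kappa>1"
  have \<kappa>: "\<kappa> > 0" "\<kappa> \<le> 1" "\<kappa> \<le> \<kappa>1" using 1 by (auto simp: \<kappa>_def)
  \<comment> \<open>The factor \<open>2 ^ Suc q\<close> pays for replacing \<open>norm s\<close> by
    \<open>2 * norm s'\<close>. Two error terms and the factor 2 from inverting the curve contribute
    4, so the new error is half of what is allowed.\<close>
  define \<theta> :: real where "\<theta> = 1 / (8 * 2 ^ Suc q)"
  have \<theta>: "\<theta> > 0" "\<theta> \<le> 1" by (auto simp: \<theta>_def divide_le_eq_1)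
     (metis add.commute add_increasing2 le_add_same_cancel2 mult_le_cancel_left1 not_less one_le_numeral one_le_power order_trans zero_le_one zero_less_numeral mult_ge1_I)
  from defect_strict_deriv0 \<theta>(1) obtain d2 where 2: "d2 > 0" "\<And>b u v. norm b < d2 \<Longrightarrow> norm u < d2 \<Longrightarrow> norm v < d2 \<Longrightarrow>
    norm (defect b u - defect b v - 0 * (u - v)) \<le> \<theta> * norm (u - v)" by (rule strict_deriv0D) blast
  from defect_phi obtain C3 d3 where 3: "C3 > 0" "d3 > 0" "d3 \<le> 1"
    "\<And>b s. norm b < d3 \<Longrightarrow> norm s < d3 \<Longrightarrow> norm (defect b (phi b s) + b * jet_curve b s) \<le> C3 * norm s ^ (q + 2)" by (rule ord_geE) blast
  obtain d4 where 4: "d4 > 0" "\<And>b v y. norm b < d4 \<Longrightarrow> norm v < d4 \<Longrightarrow> norm (y - jet_curve b v) < d4 \<Longrightarrow>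
     \<exists>s. jet_curve b s = y \<and> norm (s - v) \<le> 2 * norm (y - jet_curve b v)" by (rule jet_curve_inverse) blast
  have q14: "(1/4 :: real) > 0" by simp
  from jet_curve_ord q14 obtain d5 where 5: "d5 > 0" "\<And>b u. norm b < d5 \<Longrightarrow> norm u < d5 \<Longrightarrow> norm (jet_curve b u) < 1/4"
    by (rule ord_ge_small) blast
  define m where "m = min d2 d4"
  have m: "m > 0" using 2 4 by (simp add: m_def)
  from phi_ord m obtain d6 where 6: "d6 > 0" "\<And>b u. norm b < d6 \<Longrightarrow> norm u < d6 \<Longrightarrow> norm (phi b u) < m"
    by (rule ord_ge_small) blast
  define E where "E = min (min (min d3 (d6 / 2)) (min d5 (d2 / 2))) (min (min (1/2) (d4 / 4)) (\<kappa> * \<theta> / C3))"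
  have E: "E > 0" "E \<le> d3" "E \<le> d6 / 2" "E \<le> d5" "E \<le> d2 / 2" "E \<le> 1/2" "E \<le> d4 / 4" "E * C3 \<le> \<kappa> * \<theta>"
  proof -
    show "E > 0" using 1 2 3 4 5 6 \<kappa> \<theta> by (auto simp: E_def)
    show "E \<le> d3" "E \<le> d6 / 2" "E \<le> d5" "E \<le> d2 / 2" "E \<le> 1/2" "E \<le> d4 / 4" unfolding E_def min_le_iff_disj by auto
    have "E \<le> \<kappa> * \<theta> / C3" by (auto simp: E_def)
    then show "E * C3 \<le> \<kappa> * \<theta>" using 3(1) by (simp add: field_simps)
  qed
  obtain M0 where M0: "M0 > 0" "\<And>s. s \<noteq> 0 \<Longrightarrow> norm (petal_coord s) > M0 \<Longrightarrow> norm s < E" using petal_coord_small[OF E(1)] by blast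
  define M where "M = max M0 M1"
  define D where "D = min (min d1 d2) (min (min d3 d4) (min d5 d6))"
  show ?thesis
  proof (rule that[of M \<kappa> D])
    show "M > 0" using M0 by (simp add: M_def)
    show "\<kappa> > 0" by (rule \<kappa>)
    show "D > 0" using 1 2 3 4 5 6 by (simp add: D_def)
    fix b s s' n and \<xi> :: "nat \<Rightarrow> complex"
    assume b: "norm b < D" and rec: "\<And>n. \<xi> (Suc (Suc n)) = (lam + mu b) * \<xi> (Suc n) + (\<xi> (Suc n))\<^sup>2 + b * \<xi> n"
      and init: "\<xi> 0 = jet_curve b s" "\<xi> 1 = jet_curve b s'" "s \<noteq> 0" "Re (petal_coord s) > M" "norm (s' - phi b s) \<le> \<kappa> * norm s ^ Suc q"
    have bb: "norm b < d1" "norm b < d2" "norm b < d3" "norm b < d4" "norm b < d5" "norm b < d6"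
      using b by (auto simp: D_def)
    have inv: "\<exists>s s'. \<xi> n = jet_curve b s \<and> \<xi> (Suc n) = jet_curve b s' \<and> s \<noteq> 0 \<and> Re (petal_coord s) > M \<and> norm (s' - phi b s) \<le> \<kappa> * norm s ^ Suc q" for n
    proof (induction n)
      case 0
      show ?case using init by auto
    next
      case (Suc n)
      then obtain s s' where s: "\<xi> n = jet_curve b s" "\<xi> (Suc n) = jet_curve b s'" "s \<noteq> 0" "Re (petal_coord s) > M" "norm (s' - phi b s) \<le> \<kappa> * norm s ^ Suc q"
        by blast
      have small: "norm s < E"
        using M0(2)[OF s(3)] s(4) complex_Re_le_cmod[of "petal_coord s"] by (simp add: M_def)
      have "norm (s' - phi b s) \<le> \<kappa>1 * norm s ^ Suc q"
        using s(5) \<kappa>(3) by (meson mult_right_mono norm_ge_zero order_trans zero_le_power)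
      with 1(4)[OF bb(1) s(3), of s'] s(4) have s': "s' \<noteq> 0" "Re (petal_coord s') > Re (petal_coord s)" "norm s / 2 \<le> norm s'" "norm s' \<le> 2 * norm s"
        by (auto simp: M_def)
      have sq: "norm s ^ Suc q \<le> norm s"
        using small E(6) power_decreasing[of 1 "Suc q" "norm s"] by simp
      have phs: "norm (phi b s) < d2" using 6(2)[of b s] bb small E m_def by auto
      have s'd: "norm s' < d2" "norm s' < d6" using s'(4) small E by auto
      have phs': "norm (phi b s') < d4" using 6(2)[of b s'] bb s'd m_def by auto
      define \<delta> where "\<delta> = \<xi> (Suc (Suc n)) - jet_curve b (phi b s')"
      \<comment> \<open>The first bracket compares the actual second term with the ideal one and is
        controlled by the strict derivative; the second is the error of an exact step along the
        curve, bounded in \<open>defect_phi\<close>.\<close>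
      have "\<delta> = (defect b s' - defect b (phi b s) - 0 * (s' - phi b s)) + (defect b (phi b s) + b * jet_curve b s)"
        unfolding \<delta>_def rec s(1,2) by (simp add: defect_def)
      then have "norm \<delta> \<le> norm (defect b s' - defect b (phi b s) - 0 * (s' - phi b s)) + norm (defect b (phi b s) + b * jet_curve b s)"
        by (metis norm_triangle_ineq)
      also have "\<dots> \<le> \<theta> * norm (s' - phi b s) + C3 * norm s ^ (q + 2)"
        using 2(2)[OF bb(2) s'd(1) phs] 3(4)[OF bb(3), of s] small E by (intro add_mono) auto
      also have "\<dots> \<le> \<theta> * (\<kappa> * norm s ^ Suc q) + \<kappa> * \<theta> * norm s ^ Suc q"
      proof (intro add_mono mult_left_mono s(5))
        have "C3 * norm s \<le> C3 * E" using small 3(1) by (intro mult_left_mono) auto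
        then have "C3 * norm s \<le> \<kappa> * \<theta>" using E(8) by (simp add: mult.commute)
        then have "C3 * norm s * norm s ^ Suc q \<le> \<kappa> * \<theta> * norm s ^ Suc q" by (intro mult_right_mono) auto
        then show "C3 * norm s ^ (q + 2) \<le> \<kappa> * \<theta> * norm s ^ Suc q" by (simp add: mult_ac)
      qed (use \<theta> in auto)
      finally have \<delta>: "norm \<delta> \<le> 2 * \<theta> * \<kappa> * norm s ^ Suc q" by (simp add: mult_ac)
      also have "\<dots> \<le> 2 * 1 * 1 * norm s" using sq \<theta> \<kappa> by (intro mult_mono) auto
      also have "\<dots> < d4" using small E(7) 4(1) by linarith
      finally have \<delta>4: "norm (\<xi> (Suc (Suc n)) - jet_curve b (phi b s')) < d4" by (simp add: \<delta>_def)
      from 4(2)[OF bb(4) phs' this] obtain s'' where s'': "jet_curve b s'' = \<xi> (Suc (Suc n))" "norm (s'' - phi b s') \<le> 2 * norm \<delta>"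
        unfolding \<delta>_def by blast
      have "norm (s'' - phi b s') \<le> \<kappa> * norm s' ^ Suc q"
      proof -
        have "norm s ^ Suc q \<le> (2 * norm s') ^ Suc q" using s'(3) by (intro power_mono) auto
        then have a: "norm s ^ Suc q \<le> 2 ^ Suc q * norm s' ^ Suc q" by (simp only: power_mult_distrib)
        have "2 * norm \<delta> \<le> 4 * \<theta> * \<kappa> * norm s ^ Suc q" using mult_left_mono[OF \<delta>, of 2] by (simp add: mult_ac)
        also have "\<dots> \<le> 4 * \<theta> * \<kappa> * (2 ^ Suc q * norm s' ^ Suc q)" using a \<theta> \<kappa> by (intro mult_left_mono) auto
        also have "\<dots> = (4 * \<theta> * 2 ^ Suc q) * (\<kappa> * norm s' ^ Suc q)" by (simp add: mult_ac)
        also have "4 * \<theta> * 2 ^ Suc q = 1/2" by (simp add: \<theta>_def)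
        also have "1/2 * (\<kappa> * norm s' ^ Suc q) \<le> \<kappa> * norm s' ^ Suc q" using \<kappa> by simp
        finally show ?thesis using s''(2) by linarith
      qed
      then show ?case using s(2) s''(1) s' s(4) by (intro exI[of _ s'] exI[of _ s'']) auto
    qed
    from inv[of n] obtain s where s: "\<xi> n = jet_curve b s" "s \<noteq> 0" "Re (petal_coord s) > M" by blast
    have "norm s < E" using M0(2)[OF s(2)] s(3) complex_Re_le_cmod[of "petal_coord s"] by (simp add: M_def)
    then show "norm (\<xi> n) < 1/4" using 5(2)[OF bb(5), of s] s(1) E by auto
  qed
qed

text \<open>A point of the critical orbit deep in a petal is written as
  \<open>jet_curve 0 s\<close>. The image is within order \<open>q + 2\<close> of
  \<open>jet_curve 0 (phi 0 s)\<close>, which beats \<open>\<kappa> * norm s ^ Suc q\<close> for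
  small \<open>s\<close>. The inequalities are strict so that they survive perturbation.\<close>

lemma critical_orbit_trapped:
  assumes "\<kappa> > 0" "E > 0"
  obtains N s s' where "norm s < E" "norm s' < E" "jet_curve 0 s = (f0 ^^ N) (- lam\<^sup>2 / 4)" "jet_curve 0 s' = (f0 ^^ Suc N) (- lam\<^sup>2 / 4)" "s \<noteq> 0"
     "Re (petal_coord s) > M" "norm (s' - phi 0 s) < \<kappa> * norm s ^ Suc q"
proof -
  from jet_curve_ord2 obtain C2 d2 where 2: "C2 > 0" "d2 > 0" "d2 \<le> 1"
    "\<And>b s. norm b < d2 \<Longrightarrow> norm s < d2 \<Longrightarrow> norm (jet_curve b s - s) \<le> C2 * norm s ^ 2" by (rule ord_geE) blast
  from f0_jet_curve obtain C3 d3 where 3: "C3 > 0" "d3 > 0" "d3 \<le> 1"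
    and C3b: "\<And>b s::complex. norm b < d3 \<Longrightarrow> norm s < d3 \<Longrightarrow> norm (f0 (jet_curve 0 s) - jet_curve 0 (phi 0 s)) \<le> C3 * norm s ^ (q + 2)" by (rule ord_geE) blast
  obtain d4 where 4: "d4 > 0" "\<And>b v y. norm b < d4 \<Longrightarrow> norm v < d4 \<Longrightarrow> norm (y - jet_curve b v) < d4 \<Longrightarrow>
     \<exists>s. jet_curve b s = y \<and> norm (s - v) \<le> 2 * norm (y - jet_curve b v)" by (rule jet_curve_inverse) blast
  define e where "e = min (d4 / 2) (E / 2)"
  have e: "e > 0" "e \<le> d4 / 2" "e \<le> E / 2" using 4 assms by (auto simp: e_def)
  from phi_ord e(1) obtain d6 where 6: "d6 > 0" "\<And>b u. norm b < d6 \<Longrightarrow> norm u < d6 \<Longrightarrow> norm (phi b u) < e"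
    by (rule ord_ge_small) blast
  have "((\<lambda>w::complex. 1 / w ^ q) \<longlongrightarrow> 1 / 1 ^ q) (nhds 1)"
    by (intro tendsto_intros filterlim_ident) auto
  then have "\<forall>\<^sub>F w in nhds (1::complex). dist (1 / w ^ q) (1 / 1 ^ q) < 1/4" by (rule tendstoD) simp
  then obtain r where r: "r > 0" "\<And>w::complex. dist w 1 < r \<Longrightarrow> dist (1 / w ^ q) (1 / 1 ^ q) < 1/4"
    by (auto simp: eventually_nhds_metric)
  define h where "h = min (min (min d2 (d4 / 2)) (min (1 / (4 * C2)) (r / (2 * C2)))) (min (min (d3 / 2) (d6 / 2)) (min (E / 4) (min (\<kappa> / (8 * C3)) (min (1/2) (min (d4 / (4 * C3)) (1 / (8 * C3)))))))"
  have h: "h > 0" using 2 3 4 6 r assms by (simp add: h_def)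
  obtain M0 where M0: "M0 > 0" "\<And>s. s \<noteq> 0 \<Longrightarrow> norm (petal_coord s) > M0 \<Longrightarrow> norm s < h" using petal_coord_small[OF h] by blast
  \<comment> \<open>Passing from \<open>x\<close> to the curve parameter \<open>s\<close> changes
    the petal coordinate by at most a quarter of its modulus. In the sector this is at most half of
    its real part, whence the bound \<open>2 * \<bar>M\<bar> + 2\<close>.\<close>
  obtain N x where x: "x = (f0 ^^ N) (- lam\<^sup>2 / 4)" "x \<noteq> 0" "Re (petal_coord x) \<ge> max (M0 + 1) (2 * \<bar>M\<bar> + 2)" "\<bar>Im (petal_coord x)\<bar> \<le> Re (petal_coord x)"
    by (rule critical_orbit_deep[of "max (M0 + 1) (2 * \<bar>M\<bar> + 2)", folded petal_coord_def], rule that)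
  have xh: "norm x < h" using M0(2)[OF x(2)] x(3) complex_Re_le_cmod[of "petal_coord x"] by simp
  have xx: "norm x < d2" "norm x < d4 / 2" "norm x < 1 / (4 * C2)" "norm x < r / (2 * C2)" "norm x < d3 / 2" "norm x < d6 / 2" "norm x < E / 4" "norm x < \<kappa> / (8 * C3)" "norm x < 1/2" "norm x < d4 / (4 * C3)" "norm x < 1 / (8 * C3)"
    using xh unfolding h_def min_less_iff_conj by blast+
  have kx: "norm (x - jet_curve 0 x) \<le> C2 * norm x * norm x"
    using 2(4)[of 0 x] xx 2 by (simp add: norm_minus_commute power2_eq_square mult_ac)
  have C2x: "C2 * norm x < 1/4" "2 * (C2 * norm x) < r" using xx(3,4) 2(1) by (simp_all add: field_simps)
  have kx4: "norm (x - jet_curve 0 x) \<le> norm x / 4"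
    using kx C2x(1) mult_right_mono[of "C2 * norm x" "1/4" "norm x"] by simp
  then have "norm (x - jet_curve 0 x) < d4" using xx(2) norm_ge_zero[of x] 4(1) by linarith
  with 4(2)[of 0 x x] xx 4(1) obtain s where s: "jet_curve 0 s = x" "norm (s - x) \<le> 2 * norm (x - jet_curve 0 x)" by auto
  have sx: "norm (s - x) \<le> norm x / 2" using s(2) kx4 by linarith
  have s1: "norm s \<le> 2 * norm x" using sx norm_triangle_ineq2[of s x] norm_ge_zero[of x] by linarith
  have s0: "s \<noteq> 0" using sx x(2) by auto
  have "dist (s / x) 1 < r"
  proof -
    have "dist (s / x) 1 = norm (s - x) / norm x" using x(2) by (simp add: dist_norm norm_divide[symmetric] diff_divide_distrib)
    also have "\<dots> \<le> 2 * (C2 * norm x)" using s(2) kx x(2) by (simp add: field_simps)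
    finally show ?thesis using C2x(2) by linarith
  qed
  from r(2)[OF this] have "norm (1 / (s / x) ^ q - 1) < 1/4" by (simp add: dist_norm)
  then have "norm (petal_coord x) * norm (1 / (s / x) ^ q - 1) \<le> norm (petal_coord x) * (1/4)" by (intro mult_left_mono) auto
  moreover have "petal_coord s - petal_coord x = petal_coord x * (1 / (s / x) ^ q - 1)"
    using x(2) s0 gam_nonzero q1 by (simp add: petal_coord_def power_divide field_simps)
  ultimately have t1: "norm (petal_coord s - petal_coord x) \<le> norm (petal_coord x) * (1/4)"
    by (simp only: norm_mult)
  have t2: "norm (petal_coord x) \<le> 2 * Re (petal_coord x)" using cmod_le[of "petal_coord x"] x(3,4) by simp
  have t3: "Re (petal_coord x) - Re (petal_coord s) \<le> norm (petal_coord s - petal_coord x)"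
    using complex_Re_le_cmod[of "petal_coord x - petal_coord s"] by (simp add: norm_minus_commute)
  have t4: "Re (petal_coord x) \<ge> 2 * \<bar>M\<bar> + 2" using x(3) by simp
  have tM: "Re (petal_coord s) > M" using t1 t2 t3 t4 abs_ge_self[of M] by linarith
  have phs: "norm (phi 0 s) < e" using 6(2)[of 0 s] 6(1) s1 xx(6) by simp
  have fs: "norm (f0 x - jet_curve 0 (phi 0 s)) \<le> C3 * norm s ^ (q + 2)"
    using C3b[of 0 s] s(1) 3(2) s1 xx(5) by simp
  have C3x: "C3 * norm x < \<kappa> / 8" "C3 * norm x < d4 / 4" "C3 * norm x < 1/8"
    using xx(8,10,11) 3(1) by (simp_all add: field_simps)
  have C3sx: "C3 * norm s \<le> 2 * (C3 * norm x)" using mult_left_mono[OF s1, of C3] 3(1) by simp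
  have C3s: "C3 * norm s \<le> \<kappa> / 4" "C3 * norm s < d4" "norm s < 1" "C3 * norm s \<le> 1/4" 
    using C3x C3sx s1 xx(9) 4(1) by linarith+
  have sq: "norm s ^ Suc q \<le> 1" using C3s(3) by (intro power_le_one) auto
  have eq: "C3 * norm s ^ (q + 2) = C3 * norm s * norm s ^ Suc q" by (simp add: mult_ac)
  have "C3 * norm s * norm s ^ Suc q \<le> C3 * norm s * 1" using sq 3(1) by (intro mult_left_mono) auto
  then have fd: "norm (f0 x - jet_curve 0 (phi 0 s)) < d4" using fs C3s eq by linarith
  with 4(2)[of 0 "phi 0 s" "f0 x"] phs e 4(1) obtain s' where s': "jet_curve 0 s' = f0 x" "norm (s' - phi 0 s) \<le> 2 * norm (f0 x - jet_curve 0 (phi 0 s))"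
    by auto
  have b: "norm (s' - phi 0 s) \<le> (\<kappa> / 2) * norm s ^ Suc q"
  proof -
    have "2 * (C3 * norm s * norm s ^ Suc q) \<le> 2 * (\<kappa> / 4 * norm s ^ Suc q)" using C3s(1) by (intro mult_left_mono mult_right_mono) auto
    then show ?thesis using s'(2) fs eq by simp
  qed
  show ?thesis
  proof (rule that[of s s' N])
    show "norm s < E" using s1 xx(7) assms by linarith
    show "norm s' < E"
    proof -
      have "norm s ^ Suc q \<le> norm s" using C3s(3) power_decreasing[of 1 "Suc q" "norm s"] by simp
      then have "C3 * norm s * norm s ^ Suc q \<le> 1/4 * norm s" using C3s(4) by (intro mult_mono) auto
      then have "norm (s' - phi 0 s) \<le> norm s / 2" using s'(2) fs eq by linarith
      moreover have "norm s' \<le> norm (s' - phi 0 s) + norm (phi 0 s)" by (metis diff_add_cancel norm_triangle_ineq)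
      ultimately show ?thesis using phs e s1 xx(7) by linarith
    qed
    show "jet_curve 0 s = (f0 ^^ N) (- lam\<^sup>2 / 4)" using s x by simp
    show "jet_curve 0 s' = (f0 ^^ Suc N) (- lam\<^sup>2 / 4)" using s' x by simp
    show "norm (s' - phi 0 s) < \<kappa> * norm s ^ Suc q"
    proof -
      have "0 < \<kappa> * norm s ^ Suc q" using assms s0 by simp
      then show ?thesis using b by linarith
    qed
  qed (use s0 tM in auto)
qed

end

text \<open>The argument is the triple of the parameter and the first two terms, so that continuity
  in all three variables is a single statement about a function on a product space.\<close>

fun rec_orbit :: "(complex \<Rightarrow> complex) \<Rightarrow> nat \<Rightarrow> complex \<times> complex \<times> complex \<Rightarrow> complex" where
  "rec_orbit c 0 p = fst (snd p)"
| "rec_orbit c (Suc 0) p = snd (snd p)"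
| "rec_orbit c (Suc (Suc n)) p = (rec_orbit c (Suc n) p)\<^sup>2 + c (fst p) + fst p * rec_orbit c n p"

lemma continuous_rec_orbit:
  assumes "continuous_on UNIV c"
  shows "continuous_on UNIV (rec_orbit c n)"
proof -
  have c: "continuous_on UNIV (\<lambda>p::complex \<times> complex \<times> complex. c (fst p))"
    by (rule continuous_on_compose2[OF assms]) (auto intro!: continuous_intros)
  have "continuous_on UNIV (rec_orbit c n) \<and> continuous_on UNIV (rec_orbit c (Suc n))"
  proof (induction n)
    case 0
    have "rec_orbit c 0 = (\<lambda>p. fst (snd p))" "rec_orbit c (Suc 0) = (\<lambda>p. snd (snd p))" by auto
    then show ?case by (auto intro!: continuous_intros)
  next
    case (Suc n)
    have "rec_orbit c (Suc (Suc n)) = (\<lambda>p. (rec_orbit c (Suc n) p)\<^sup>2 + c (fst p) + fst p * rec_orbit c n p)" by auto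
    then show ?case using Suc c by (auto intro!: continuous_intros)
  qed
  then show ?thesis by blast
qed

section \<open>A trapped neighbourhood of the critical value\<close>

context root_of_unity
begin

text \<open>Here \<open>b\<close> stands for \<open>a\<^sup>2\<close>: the first coordinates of a Henon orbit satisfy a recurrence that
  involves only \<open>a\<^sup>2\<close>, and \<open>xf b\<close> is the first coordinate of the semiparabolic fixed point.\<close>

definition xf :: "complex \<Rightarrow> complex" where "xf b = lam / 2 - b / (2 * lam)"
definition cc :: "complex \<Rightarrow> complex" where "cc b = (1 - b) * xf b - (xf b)\<^sup>2"

lemma cc_0: "cc 0 = lam / 2 - lam\<^sup>2 / 4"
  by (simp add: cc_def xf_def power_divide)

lemma two_xf: "2 * xf b = lam + mu b"
  using lam0 by (simp add: xf_def mu_def field_simps)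

lemma continuous_cc: "continuous_on UNIV cc"
  unfolding cc_def xf_def using lam0 by (auto intro!: continuous_intros)

lemma rec_orbit_central:
  "rec_orbit cc n (0, cc 0, (cc 0)\<^sup>2 + cc 0) = lam / 2 + (f0 ^^ n) (- lam\<^sup>2 / 4)"
proof -
  let ?p = "(0, cc 0, (cc 0)\<^sup>2 + cc 0)"
  have P: "(lam / 2 + x)\<^sup>2 + cc 0 = lam / 2 + f0 x" for x
    by (simp add: cc_0 f0_def power2_eq_square field_simps)
  have "rec_orbit cc n ?p = lam / 2 + (f0 ^^ n) (- lam\<^sup>2 / 4) \<and> rec_orbit cc (Suc n) ?p = lam / 2 + (f0 ^^ Suc n) (- lam\<^sup>2 / 4)"
  proof (induction n)
    case 0
    have "cc 0 = lam / 2 + (- lam\<^sup>2 / 4)" by (simp add: cc_0)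
    then have "(cc 0)\<^sup>2 + cc 0 = lam / 2 + f0 (- lam\<^sup>2 / 4)" using P by metis
    then show ?case by (simp add: cc_0)
  next
    case (Suc n)
    then show ?case using P[of "(f0 ^^ Suc n) (- lam\<^sup>2 / 4)"] by simp
  qed
  then show ?thesis by blast
qed

lemma jet_curve_continuous_param: "isCont (\<lambda>b. jet_curve b s) 0"
  unfolding jet_curve_def by (intro continuous_intros co_cont)

text \<open>For \<open>b = 0\<close> and the critical orbit itself, the \<open>N\<close>-th and next
  terms satisfy the entrance conditions of the trap strictly. These depend continuously on the
  parameter and the first two terms, so they hold on a whole neighbourhood. The final bound adds 1/4
  from the trap to at most 5/8 for the fixed point.\<close>

theorem critical_value_region_trapped:
  obtains e N where "e > 0" "\<And>b x n. norm b < e \<Longrightarrow> norm (x 0 - cc 0) < e \<Longrightarrow> norm (x 1 - ((cc 0)\<^sup>2 + cc 0)) < e \<Longrightarrow>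
     (\<And>n. x (Suc (Suc n)) = (x (Suc n))\<^sup>2 + cc b + b * x n) \<Longrightarrow> n \<ge> N \<Longrightarrow> norm (x n) < 1"
proof -
  obtain M \<kappa> D where T: "M > 0" "\<kappa> > 0" "D > 0"
    "\<And>b \<xi> s s' n. norm b < D \<Longrightarrow> (\<And>n. \<xi> (Suc (Suc n)) = (lam + mu b) * \<xi> (Suc n) + (\<xi> (Suc n))\<^sup>2 + b * \<xi> n) \<Longrightarrow>
      \<xi> 0 = jet_curve b s \<Longrightarrow> \<xi> 1 = jet_curve b s' \<Longrightarrow> s \<noteq> 0 \<Longrightarrow> Re (petal_coord s) > M \<Longrightarrow> norm (s' - phi b s) \<le> \<kappa> * norm s ^ Suc q \<Longrightarrow>
      norm (\<xi> n) < 1/4" by (rule semiparabolic_trap) blast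
  obtain d4 where 4: "d4 > 0" "\<And>b v y. norm b < d4 \<Longrightarrow> norm v < d4 \<Longrightarrow> norm (y - jet_curve b v) < d4 \<Longrightarrow>
     \<exists>s. jet_curve b s = y \<and> norm (s - v) \<le> 2 * norm (y - jet_curve b v)" by (rule jet_curve_inverse) blast
  obtain N s s' where s: "norm s < d4" "norm s' < d4" "jet_curve 0 s = (f0 ^^ N) (- lam\<^sup>2 / 4)" "jet_curve 0 s' = (f0 ^^ Suc N) (- lam\<^sup>2 / 4)" "s \<noteq> 0"
     "Re (petal_coord s) > M" "norm (s' - phi 0 s) < \<kappa> * norm s ^ Suc q" by (rule critical_orbit_trapped[OF T(2) 4(1)]) blast
  define p0 where "p0 = (0::complex, cc 0, (cc 0)\<^sup>2 + cc 0)"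
  define F where "F = nhds p0"
  have fst0: "((\<lambda>p. fst p) \<longlongrightarrow> 0) F"
  proof -
    have "((\<lambda>p. fst p) \<longlongrightarrow> fst p0) F" unfolding F_def by (intro tendsto_intros filterlim_ident)
    then show ?thesis by (simp add: p0_def)
  qed
  have lim: "((\<lambda>p. rec_orbit cc n p - xf (fst p) - jet_curve (fst p) \<sigma>) \<longlongrightarrow> 0) F" if \<sigma>: "jet_curve 0 \<sigma> = (f0 ^^ n) (- lam\<^sup>2 / 4)" for n \<sigma>
  proof -
    have "isCont (rec_orbit cc n) p0" using continuous_rec_orbit[OF continuous_cc, of n] by (simp add: continuous_on_eq_continuous_at p0_def)
    then have 1: "((\<lambda>p. rec_orbit cc n p) \<longlongrightarrow> rec_orbit cc n p0) F"
      unfolding F_def by (metis continuous_at continuous_within tendsto_at_iff_tendsto_nhds)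
    have "isCont xf 0" unfolding xf_def using lam0 by (intro continuous_intros) auto
    then have 2: "((\<lambda>p. xf (fst p)) \<longlongrightarrow> xf 0) F" using fst0 by (rule isCont_tendsto_compose)
    have 3: "((\<lambda>p. jet_curve (fst p) \<sigma>) \<longlongrightarrow> jet_curve 0 \<sigma>) F" by (rule isCont_tendsto_compose[OF jet_curve_continuous_param fst0])
    have "rec_orbit cc n p0 - xf 0 - jet_curve 0 \<sigma> = 0"
      unfolding p0_def rec_orbit_central using \<sigma> by (simp add: xf_def)
    then show ?thesis using tendsto_diff[OF tendsto_diff[OF 1 2] 3] by simp
  qed
  have ex: "\<exists>\<tau>. (\<forall>\<^sub>F p in F. jet_curve (fst p) (\<tau> p) = rec_orbit cc n p - xf (fst p)) \<and> (\<tau> \<longlongrightarrow> \<sigma>) F"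
    if \<sigma>: "jet_curve 0 \<sigma> = (f0 ^^ n) (- lam\<^sup>2 / 4)" "norm \<sigma> < d4" for n \<sigma>
  proof -
    define Q where "Q p t \<longleftrightarrow> jet_curve (fst p) t = rec_orbit cc n p - xf (fst p) \<and> norm (t - \<sigma>) \<le> 2 * norm (rec_orbit cc n p - xf (fst p) - jet_curve (fst p) \<sigma>)" for p t
    \<comment> \<open>A curve parameter is merely selected; the distance bound inside
      \<open>Q\<close> is what makes the selected values tend to \<open>\<sigma>\<close>.\<close>
    define \<tau> where "\<tau> p = (SOME t. Q p t)" for p
    have "\<forall>\<^sub>F p in F. norm (rec_orbit cc n p - xf (fst p) - jet_curve (fst p) \<sigma>) < d4"
      using tendstoD[OF lim[OF \<sigma>(1)] 4(1)] by simp
    moreover have "\<forall>\<^sub>F p in F. norm (fst p) < d4" using tendstoD[OF fst0 4(1)] by simp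
    ultimately have Q: "\<forall>\<^sub>F p in F. Q p (\<tau> p)"
    proof eventually_elim
      case (elim p)
      show ?case unfolding \<tau>_def by (rule someI_ex) (use 4(2)[OF elim(2) \<sigma>(2) elim(1)] in \<open>simp add: Q_def\<close>)
    qed
    have "((\<lambda>p. 2 * norm (rec_orbit cc n p - xf (fst p) - jet_curve (fst p) \<sigma>)) \<longlongrightarrow> 2 * norm (0::complex)) F"
      by (intro tendsto_intros lim \<sigma>)
    then have "((\<lambda>p. 2 * norm (rec_orbit cc n p - xf (fst p) - jet_curve (fst p) \<sigma>)) \<longlongrightarrow> 0) F" by simp
    then have "((\<lambda>p. \<tau> p - \<sigma>) \<longlongrightarrow> 0) F"
      by (rule Lim_null_comparison[rotated]) (use Q in eventually_elim, simp add: Q_def)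
    then have "(\<tau> \<longlongrightarrow> \<sigma>) F" by (rule LIM_zero_cancel)
    moreover have "\<forall>\<^sub>F p in F. jet_curve (fst p) (\<tau> p) = rec_orbit cc n p - xf (fst p)"
      using Q by eventually_elim (simp add: Q_def)
    ultimately show ?thesis by blast
  qed
  from ex[OF s(3,1)] obtain \<tau> where \<tau>: "\<forall>\<^sub>F p in F. jet_curve (fst p) (\<tau> p) = rec_orbit cc N p - xf (fst p)" "(\<tau> \<longlongrightarrow> s) F" by blast
  from ex[OF s(4,2)] obtain \<tau>' where \<tau>': "\<forall>\<^sub>F p in F. jet_curve (fst p) (\<tau>' p) = rec_orbit cc (Suc N) p - xf (fst p)" "(\<tau>' \<longlongrightarrow> s') F" by blast
  have e1: "\<forall>\<^sub>F p in F. \<tau> p \<noteq> 0" by (rule tendsto_imp_eventually_ne[OF \<tau>(2) s(5)])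
  have "((\<lambda>p. Re (petal_coord (\<tau> p))) \<longlongrightarrow> Re (petal_coord s)) F"
    unfolding petal_coord_def using s(5) gam_nonzero q1 by (intro tendsto_intros \<tau>) auto
  then have e2: "\<forall>\<^sub>F p in F. Re (petal_coord (\<tau> p)) > M" using s(6) by (rule order_tendstoD)
  have g: "((\<lambda>p. gam (fst p)) \<longlongrightarrow> gam 0) F" by (rule isCont_tendsto_compose[OF gam_cont fst0])
  have "((\<lambda>p. \<kappa> * norm (\<tau> p) ^ Suc q - norm (\<tau>' p - phi (fst p) (\<tau> p))) \<longlongrightarrow> \<kappa> * norm s ^ Suc q - norm (s' - phi 0 s)) F"
    unfolding phi_def by (intro tendsto_intros \<tau> \<tau>' g)
  then have e3: "\<forall>\<^sub>F p in F. \<kappa> * norm (\<tau> p) ^ Suc q - norm (\<tau>' p - phi (fst p) (\<tau> p)) > 0"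
    using s(7) by (intro order_tendstoD(1)) auto
  have e4: "\<forall>\<^sub>F p in F. norm (fst p) < min D (1/4)" using tendstoD[OF fst0, of "min D (1/4)"] T(3) by simp
  have "\<forall>\<^sub>F p in F. \<forall>n\<ge>N. norm (rec_orbit cc n p) < 1"
    using \<tau>(1) \<tau>'(1) e1 e2 e3 e4
  proof eventually_elim
    case (elim p)
    define b where "b = fst p"
    define \<xi> where "\<xi> n = rec_orbit cc (N + n) p - xf b" for n
    have "\<xi> (Suc (Suc n)) = (lam + mu b) * \<xi> (Suc n) + (\<xi> (Suc n))\<^sup>2 + b * \<xi> n" for n
      unfolding \<xi>_def two_xf[symmetric] by (simp add: cc_def b_def[symmetric] power2_eq_square algebra_simps)
    moreover have "\<xi> 0 = jet_curve b (\<tau> p)" "\<xi> 1 = jet_curve b (\<tau>' p)" using elim by (auto simp: \<xi>_def b_def)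
    moreover have "norm b < D" "norm b < 1/4" using elim by (auto simp: b_def)
    ultimately have \<xi>: "norm (\<xi> n) < 1/4" for n
      using T(4)[of b \<xi> "\<tau> p" "\<tau>' p" n] elim by (simp add: b_def)
    show ?case
    proof (intro allI impI)
      fix n assume "n \<ge> N"
      then have "rec_orbit cc n p = \<xi> (n - N) + xf b" by (simp add: \<xi>_def)
      moreover have "norm (xf b) \<le> 1/2 + 1/8"
      proof -
        have "norm (xf b) \<le> norm (lam / 2) + norm (b / (2 * lam))" unfolding xf_def by (rule norm_triangle_ineq4)
        then show ?thesis using \<open>norm b < 1/4\<close> lam1 by (simp add: norm_divide norm_mult)
      qed
      moreover have "norm (\<xi> (n - N) + xf b) \<le> norm (\<xi> (n - N)) + norm (xf b)" by (rule norm_triangle_ineq)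
      ultimately show "norm (rec_orbit cc n p) < 1" using \<xi>[of "n - N"] by simp
    qed
  qed
  then obtain e where e: "e > 0" "\<And>p n. dist p p0 < e \<Longrightarrow> n \<ge> N \<Longrightarrow> norm (rec_orbit cc n p) < 1"
    unfolding F_def eventually_nhds_metric by blast
  show ?thesis
  proof (rule that[of "e / 3" N])
    fix b n and x :: "nat \<Rightarrow> complex"
    assume h: "norm b < e / 3" "norm (x 0 - cc 0) < e / 3" "norm (x 1 - ((cc 0)\<^sup>2 + cc 0)) < e / 3"
     and rec: "\<And>n. x (Suc (Suc n)) = (x (Suc n))\<^sup>2 + cc b + b * x n" and n: "n \<ge> N"
    have x: "x n = rec_orbit cc n (b, x 0, x 1) \<and> x (Suc n) = rec_orbit cc (Suc n) (b, x 0, x 1)" for n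
      by (induction n) (auto simp: rec)
    have "dist (b, x 0, x 1) p0 \<le> dist b 0 + dist (x 0, x 1) (cc 0, (cc 0)\<^sup>2 + cc 0)"
      unfolding p0_def by (subst dist_Pair_Pair) (rule sqrt_sum_squares_le_sum, simp_all)
    also have "dist (x 0, x 1) (cc 0, (cc 0)\<^sup>2 + cc 0) \<le> dist (x 0) (cc 0) + dist (x 1) ((cc 0)\<^sup>2 + cc 0)"
      by (subst dist_Pair_Pair) (rule sqrt_sum_squares_le_sum, simp_all)
    finally have "dist (b, x 0, x 1) p0 < e" using h by (simp add: dist_norm)
    from e(2)[OF this n] x[of n] show "norm (x n) < 1" by metis
  qed (use e in simp)
qed

end

section \<open>Leaves of escaping points\<close>

text \<open>The square of \<open>s1 / s2\<close> stays in the disc of radius 1 about 1, so the real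
  part of this quotient has no zero; by connectedness it stays positive. The resulting bound keeps
  \<open>s1 + s2\<close> away from 0, so that \<open>s1 - s2\<close> can be estimated from the
  difference of the squares.\<close>

lemma square_root_branch_near:
  fixes s1 s2 :: "complex \<Rightarrow> complex"
  assumes c: "continuous_on S s1" "continuous_on S s2" and S: "connected S" "z0 \<in> S"
    and near: "\<And>z. z \<in> S \<Longrightarrow> norm ((s1 z)\<^sup>2 - (s2 z)\<^sup>2) < (norm (s2 z))\<^sup>2"
    and eq: "s1 z0 = s2 z0" and z: "z \<in> S"
  shows "norm (s2 z) \<le> norm (s1 z + s2 z)"
proof -
  have s20: "s2 z \<noteq> 0" if "z \<in> S" for z using near[OF that] by auto
  define Q where "Q z = Re (s1 z / s2 z)" for z
  have cQ: "continuous_on S Q" unfolding Q_def using s20 by (intro continuous_intros c) auto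
  have Q0: "Q z \<noteq> 0" if "z \<in> S" for z
  proof
    assume "Q z = 0"
    define w where "w = s1 z / s2 z"
    have "Re w = 0" using \<open>Q z = 0\<close> by (simp add: Q_def w_def)
    then have "Re (w\<^sup>2) \<le> 0" by (simp add: power2_eq_square)
    then have "norm (w\<^sup>2 - 1) \<ge> 1" using abs_Re_le_cmod[of "w\<^sup>2 - 1"] by simp
    moreover have "w\<^sup>2 - 1 = ((s1 z)\<^sup>2 - (s2 z)\<^sup>2) / (s2 z)\<^sup>2"
      using s20[OF that] by (simp add: w_def power_divide diff_divide_distrib)
    moreover have "norm (((s1 z)\<^sup>2 - (s2 z)\<^sup>2) / (s2 z)\<^sup>2) < 1"
      using near[OF that] s20[OF that] by (simp add: norm_divide norm_power)
    ultimately show False by simp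
  qed
  have "Q z0 = 1" using eq s20[OF S(2)] by (simp add: Q_def)
  have "Q z > 0"
  proof (rule ccontr)
    assume "\<not> Q z > 0"
    then have "Q z \<le> 0" "0 \<le> Q z0" using \<open>Q z0 = 1\<close> by auto
    then have "0 \<in> Q ` S"
      using connected_continuous_image[OF cQ S(1)] z S(2) unfolding connected_iff_interval by (metis imageI)
    then show False using Q0 by auto
  qed
  then have "norm (s1 z / s2 z + 1) \<ge> 1"
    using abs_Re_le_cmod[of "s1 z / s2 z + 1"] by (simp add: Q_def)
  moreover have "s1 z + s2 z = s2 z * (s1 z / s2 z + 1)" using s20[OF z] by (simp add: field_simps)
  ultimately show ?thesis by (metis mult_left_mono mult.right_neutral norm_ge_zero norm_mult)
qed

text \<open>The condition \<open>\<delta> * (6 + 2 * \<rho>) < e\<^sup>2\<close> makes any two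
  radicands occurring for the same parameter differ by less than the square of the roots, and
  \<open>2 * \<delta> \<le> e\<close> gives the lifting operator the contraction factor 1/2. The
  condition \<open>\<delta> * \<rho> \<le> 1\<close> keeps \<open>a * y\<close> below 1 on the
  bidisc.\<close>

locale henon_base =
  fixes cc :: "complex \<Rightarrow> complex" and \<delta> \<rho> e :: real
  assumes cc_hol: "cc holomorphic_on ball 0 \<delta>"
    and cc_le: "\<And>a. norm a < \<delta> \<Longrightarrow> norm (cc a) \<le> 1"
    and delta: "\<delta> > 0" "\<delta> * \<rho> \<le> 1" "\<delta> * (6 + 2 * \<rho>) < e\<^sup>2" "2 * \<delta> \<le> e" and rho: "\<rho> > 3" and e0: "e > 0"
begin

definition X :: "complex \<Rightarrow> nat \<Rightarrow> complex \<Rightarrow> complex \<Rightarrow> complex" where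
  "X a n x y = fst ((henon (cc a) a ^^ n) (x, y))"

lemma X_0 [simp]: "X a 0 x y = x" by (simp add: X_def)

lemma X_Suc: "X a (Suc n) x y = X a n (x\<^sup>2 + cc a + a * y) (a * x)"
  unfolding X_def by (subst funpow_Suc_right) (simp add: henon_def)

lemma delta_third: "\<delta> < 1/3"
proof (rule ccontr)
  assume "\<not> \<delta> < 1/3"
  then have "\<delta> * \<rho> > 1/3 * 3" using rho by (intro mult_le_less_imp_less) auto
  then show False using delta by simp
qed

lemma norm_a_mult: "norm a < \<delta> \<Longrightarrow> norm x \<le> 3 \<Longrightarrow> norm (a * x :: complex) < \<rho>"
proof -
  assume "norm a < \<delta>" "norm x \<le> 3"
  then have "norm a * norm x \<le> 1/3 * 3" using delta_third by (intro mult_mono) auto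
  then show ?thesis using rho by (simp add: norm_mult)
qed

lemma norm_a_mult_y: fixes a y :: complex assumes "norm a < \<delta>" "norm y < \<rho>" shows "norm a * norm y \<le> 1"
proof -
  have "norm a * norm y \<le> \<delta> * \<rho>" using assms delta rho by (intro mult_mono) auto
  then show ?thesis using delta by simp
qed

text \<open>A condition under which escape is irreversible; it is invariant and holds on the bidisc.\<close>

definition tame :: "complex \<Rightarrow> complex \<Rightarrow> complex \<Rightarrow> bool" where
  "tame a x y \<longleftrightarrow> norm a * norm y \<le> max 1 (norm x / 3)"

lemma escape_step:
  assumes a: "norm a < \<delta>" and t: "tame a x y" and x: "norm x \<ge> 3"
  shows "norm (x\<^sup>2 + cc a + a * y) \<ge> 2 * norm x"
proof -
  have "norm (x\<^sup>2) \<le> norm (x\<^sup>2 + cc a + a * y) + norm (cc a) + norm (a * y)"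
    using norm_triangle_ineq4[of "x\<^sup>2 + cc a + a * y - cc a" "a * y"] norm_triangle_ineq4[of "x\<^sup>2 + cc a + a * y" "cc a"] by simp
  moreover have "norm (a * y) \<le> norm x / 3" using t x by (simp add: tame_def norm_mult)
  moreover have "norm (cc a) \<le> norm x / 3" using cc_le[OF a] x by simp
  moreover have "norm (x\<^sup>2) \<ge> 3 * norm x" using x by (simp add: norm_mult power2_eq_square mult_right_mono)
  ultimately show ?thesis using x by simp
qed

lemma tame_step:
  assumes a: "norm a < \<delta>" and t: "tame a x y"
  shows "tame a (x\<^sup>2 + cc a + a * y) (a * x)"
proof -
  have a1: "norm a < 1/3" using a delta_third by simp
  have aa: "norm a * norm a \<le> 1/3 * (1/3)" using a1 by (intro mult_mono) auto
  show ?thesis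
  proof (cases "norm x < 3")
    case True
    have "norm a * norm a * norm x \<le> 1/3 * (1/3) * 3" by (rule mult_mono[OF aa]) (use True in auto)
    then show ?thesis by (simp add: tame_def norm_mult le_max_iff_disj mult.assoc)
  next
    case False
    then have "norm (x\<^sup>2 + cc a + a * y) \<ge> 2 * norm x" using escape_step a t by simp
    moreover have "norm a * norm a * norm x \<le> 1/3 * (1/3) * norm x" using aa by (intro mult_right_mono) auto
    ultimately have "norm a * (norm a * norm x) \<le> norm (x\<^sup>2 + cc a + a * y) / 3"
      unfolding mult.assoc using norm_ge_zero[of x] by linarith
    then show ?thesis by (simp add: tame_def norm_mult le_max_iff_disj)
  qed
qed

lemma tame_small: "norm a < \<delta> \<Longrightarrow> norm y < \<rho> \<Longrightarrow> tame a x y"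
  using norm_a_mult_y unfolding tame_def by fastforce

lemma X_growth0:
  assumes "norm a < \<delta>" "tame a x y" "norm x \<ge> 3"
  shows "norm (X a k x y) \<ge> 2 ^ k * norm x"
  using assms(2,3)
proof (induction k arbitrary: x y)
  case (Suc k)
  have s: "norm (x\<^sup>2 + cc a + a * y) \<ge> 2 * norm x" using escape_step assms Suc by simp
  then have "norm (X a k (x\<^sup>2 + cc a + a * y) (a * x)) \<ge> 2 ^ k * norm (x\<^sup>2 + cc a + a * y)"
    using Suc assms(1) tame_step by (intro Suc.IH) auto
  moreover have "2 ^ k * norm (x\<^sup>2 + cc a + a * y) \<ge> 2 ^ k * (2 * norm x)" using s by (intro mult_left_mono) auto
  ultimately have "2 ^ k * (2 * norm x) \<le> norm (X a k (x\<^sup>2 + cc a + a * y) (a * x))" by linarith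
  then show ?case by (simp add: X_Suc mult_ac)
qed simp

lemma X_growth:
  assumes "norm a < \<delta>" "tame a x y" "norm (X a n x y) \<ge> 3"
  shows "norm (X a (n + k) x y) \<ge> 2 ^ k * norm (X a n x y)"
  using assms(2,3)
proof (induction n arbitrary: x y)
  case 0
  then show ?case using X_growth0[OF assms(1), of x y k] by simp
next
  case (Suc n)
  then show ?case using Suc.IH[of "x\<^sup>2 + cc a + a * y" "a * x"] tame_step[OF assms(1), of x y] by (simp add: X_Suc)
qed

lemma X_growth_gt:
  assumes "norm a < \<delta>" "norm y < \<rho>" "norm (X a n x y) \<ge> 3" "n < m"
  shows "norm (X a m x y) > 3"
proof -
  have "norm (X a m x y) \<ge> 2 ^ (m - n) * norm (X a n x y)"
    using X_growth[OF assms(1) tame_small[OF assms(1,2)] assms(3), of "m - n"] assms(4) by simp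
  moreover have "(2::real) ^ (m - n) \<ge> 2 ^ 1" using assms(4) by (intro power_increasing) auto
  then have "2 ^ (m - n) * norm (X a n x y) \<ge> 2 * 3" using assms(3) by (intro mult_mono) auto
  ultimately show ?thesis by simp
qed

end

text \<open>The assumption \<open>avoid\<close> says that escaping points stay away from the critical value; it is where
  the parabolic dynamics enters.\<close>

locale henon_family = henon_base +
  assumes avoid: "\<And>a x y y' n. norm a < \<delta> \<Longrightarrow> norm y < \<rho> \<Longrightarrow> norm y' < \<rho> \<Longrightarrow> norm (fst ((henon (cc a) a ^^ n) (x, y))) \<ge> 3 \<Longrightarrow>
       norm (x - cc a - a * y') \<ge> e\<^sup>2"
begin

lemma avoid': "norm a < \<delta> \<Longrightarrow> norm y < \<rho> \<Longrightarrow> norm y' < \<rho> \<Longrightarrow> norm (X a n x y) \<ge> 3 \<Longrightarrow> norm (x - cc a - a * y') \<ge> e\<^sup>2"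
  unfolding X_def by (rule avoid)

text \<open>Holomorphy is required along every holomorphic section \<open>Y\<close> because lifting
  evaluates a leaf at the moving height \<open>a * u a\<close>. The escape clause makes the lower
  bound \<open>avoid\<close> applicable; the Lipschitz constant 1 is reproduced by lifting.\<close>

definition leaf :: "(complex \<Rightarrow> complex \<Rightarrow> complex) \<Rightarrow> bool" where
  "leaf g \<longleftrightarrow> (\<forall>Y. Y holomorphic_on ball 0 \<delta> \<longrightarrow> Y ` ball 0 \<delta> \<subseteq> ball 0 \<rho> \<longrightarrow> (\<lambda>a. g a (Y a)) holomorphic_on ball 0 \<delta>)
     \<and> (\<forall>a y y'. norm a < \<delta> \<longrightarrow> norm y < \<rho> \<longrightarrow> norm y' < \<rho> \<longrightarrow> norm (g a y - g a y') \<le> norm (y - y'))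
     \<and> (\<forall>a y. norm a < \<delta> \<longrightarrow> norm y < \<rho> \<longrightarrow> norm (g a y) \<le> 3 \<and> (\<exists>n. norm (X a n (g a y) y) \<ge> 3))
     \<and> (\<forall>y. norm y < \<rho> \<longrightarrow> g 0 y = g 0 0)"

lemma leaf_const: assumes "norm w = 3" shows "leaf (\<lambda>a y. w)"
proof -
  have "norm (X a 0 w y) \<ge> 3" for a y using assms by simp
  then show ?thesis unfolding leaf_def using assms by (auto intro!: exI[of _ "0::nat"])
qed

end

text \<open>Lifting a leaf through the map: the new leaf solves a square-root equation that involves the
  leaf itself, so it is obtained as the fixed point of a contraction acting on holomorphic
  functions of the parameter.\<close>

locale leaf_lift = henon_family +
  fixes g :: "complex \<Rightarrow> complex \<Rightarrow> complex" and \<zeta> :: complex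
  assumes lg: "leaf g" and zeta: "\<zeta>\<^sup>2 = g 0 0 - cc 0"
begin

definition admissible :: "(complex \<Rightarrow> complex) \<Rightarrow> bool" where
  "admissible u \<longleftrightarrow> u holomorphic_on ball 0 \<delta> \<and> (\<forall>a. norm a < \<delta> \<longrightarrow> norm (u a) \<le> 3)"

definition sect :: "(complex \<Rightarrow> complex) \<Rightarrow> bool" where
  "sect Y \<longleftrightarrow> Y holomorphic_on ball 0 \<delta> \<and> (\<forall>a. norm a < \<delta> \<longrightarrow> norm (Y a) < \<rho>)"

text \<open>The Henon map sends \<open>(u a, Y a)\<close> to
  \<open>(u a ^ 2 + cc a + a * Y a, a * u a)\<close>; this point lies on the graph of
  \<open>g\<close> exactly when \<open>u a ^ 2\<close> is the value defined here.\<close>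

definition rad :: "(complex \<Rightarrow> complex) \<Rightarrow> (complex \<Rightarrow> complex) \<Rightarrow> complex \<Rightarrow> complex" where
  "rad Y u a = g a (a * u a) - cc a - a * Y a"

lemma g_le: "norm a < \<delta> \<Longrightarrow> norm y < \<rho> \<Longrightarrow> norm (g a y) \<le> 3"
  and g_esc: "norm a < \<delta> \<Longrightarrow> norm y < \<rho> \<Longrightarrow> \<exists>n. norm (X a n (g a y) y) \<ge> 3"
  and g_lip: "norm a < \<delta> \<Longrightarrow> norm y < \<rho> \<Longrightarrow> norm y' < \<rho> \<Longrightarrow> norm (g a y - g a y') \<le> norm (y - y')"
  and g_hol: "Y holomorphic_on ball 0 \<delta> \<Longrightarrow> Y ` ball 0 \<delta> \<subseteq> ball 0 \<rho> \<Longrightarrow> (\<lambda>a. g a (Y a)) holomorphic_on ball 0 \<delta>"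
  using lg unfolding leaf_def by blast+

lemma zeta_le: "norm \<zeta> \<le> 3"
proof -
  have "norm (\<zeta>\<^sup>2) \<le> norm (g 0 0) + norm (cc 0)" unfolding zeta by (rule norm_triangle_ineq4)
  also have "\<dots> \<le> 3 + 1" using g_le[of 0 0] cc_le[of 0] delta rho by (intro add_mono) auto
  finally have "(norm \<zeta>)\<^sup>2 \<le> 3\<^sup>2" by (simp add: norm_power)
  then show ?thesis by (rule power2_le_imp_le) simp
qed

lemma rad_ge: assumes "sect Y" "admissible u" "norm a < \<delta>" shows "norm (rad Y u a) \<ge> e\<^sup>2"
proof -
  have y: "norm (a * u a) < \<rho>" using norm_a_mult assms by (simp add: admissible_def)
  obtain n where "norm (X a n (g a (a * u a)) (a * u a)) \<ge> 3" using g_esc[OF assms(3) y] by blast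
  then show ?thesis unfolding rad_def using avoid' y assms by (simp add: sect_def)
qed

lemma rad_le: assumes "sect Y" "admissible u" "norm a < \<delta>" shows "norm (rad Y u a) \<le> 5"
proof -
  have y: "norm (a * u a) < \<rho>" using norm_a_mult assms by (simp add: admissible_def)
  have "norm (rad Y u a) \<le> norm (g a (a * u a)) + norm (cc a) + norm (a * Y a)"
    unfolding rad_def by (meson norm_triangle_ineq4 order_trans add_right_mono)
  moreover have "norm a * norm (Y a) \<le> 1" using norm_a_mult_y assms by (simp add: sect_def)
  ultimately show ?thesis using g_le[OF assms(3) y] cc_le[OF assms(3)] by (simp add: norm_mult)
qed

lemma rad_hol: assumes "sect Y" "admissible u" shows "rad Y u holomorphic_on ball 0 \<delta>"
proof -
  have "(\<lambda>a. g a (a * u a)) holomorphic_on ball 0 \<delta>"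
    using assms norm_a_mult by (intro g_hol) (auto intro!: holomorphic_intros simp: admissible_def)
  then show ?thesis unfolding rad_def using assms cc_hol
    by (intro holomorphic_intros) (auto simp: sect_def)
qed

text \<open>By the distance from the critical value the radicand has no zeros on the disc, so it has
  a holomorphic square root; at \<open>a = 0\<close> the radicand is \<open>\<zeta>^2\<close>, which
  fixes the sign.\<close>

lemma root_exists: assumes "sect Y" "admissible u"
  shows "\<exists>S. admissible S \<and> S 0 = \<zeta> \<and> (\<forall>a. norm a < \<delta> \<longrightarrow> (S a)\<^sup>2 = rad Y u a)"
proof -
  have nz: "rad Y u a \<noteq> 0" if "a \<in> ball 0 \<delta>" for a
    using rad_ge[OF assms, of a] that e0 by (auto simp: power2_eq_square mult_le_0_iff)
  obtain S where S: "S holomorphic_on ball 0 \<delta>" "\<And>a. a \<in> ball 0 \<delta> \<Longrightarrow> rad Y u a = (S a)\<^sup>2"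
    using contractible_imp_holomorphic_sqrt[OF rad_hol[OF assms] convex_imp_contractible[OF convex_ball] nz] by metis
  have g00: "g 0 (0 * u 0) = g 0 0" by simp
  have "(S 0)\<^sup>2 = \<zeta>\<^sup>2" using S(2)[of 0] delta zeta by (simp add: rad_def)
  then have "S 0 = \<zeta> \<or> - S 0 = \<zeta>" unfolding power2_eq_iff by auto
  then obtain s where s: "s = 1 \<or> s = -1" "s * S 0 = \<zeta>" by (metis mult_1 mult_minus1)
  have "s\<^sup>2 = 1" using s by auto
  show ?thesis
  proof (intro exI[of _ "\<lambda>a. s * S a"] conjI allI impI)
    show sq: "(s * S a)\<^sup>2 = rad Y u a" if "norm a < \<delta>" for a
      using S(2)[of a] that \<open>s\<^sup>2 = 1\<close> by (simp add: power_mult_distrib)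
    show "admissible (\<lambda>a. s * S a)" unfolding admissible_def
    proof (intro conjI allI impI)
      show "(\<lambda>a. s * S a) holomorphic_on ball 0 \<delta>" by (intro holomorphic_intros S)
      fix a :: complex assume a: "norm a < \<delta>"
      have "(norm (s * S a))\<^sup>2 \<le> 3\<^sup>2" using rad_le[OF assms a] sq[OF a] by (simp flip: norm_power)
      then show "norm (s * S a) \<le> 3" by (rule power2_le_imp_le) simp
    qed
    show "s * S 0 = \<zeta>" by (rule s)
  qed
qed

definition root :: "(complex \<Rightarrow> complex) \<Rightarrow> (complex \<Rightarrow> complex) \<Rightarrow> complex \<Rightarrow> complex" where
  "root Y u = (SOME S. admissible S \<and> S 0 = \<zeta> \<and> (\<forall>a. norm a < \<delta> \<longrightarrow> (S a)\<^sup>2 = rad Y u a))"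

lemma root: assumes "sect Y" "admissible u"
  shows "admissible (root Y u)" "root Y u 0 = \<zeta>" "\<And>a. norm a < \<delta> \<Longrightarrow> (root Y u a)\<^sup>2 = rad Y u a"
  using someI_ex[OF root_exists[OF assms]] unfolding root_def by auto

lemma root_ge: assumes "sect Y" "admissible u" "norm a < \<delta>" shows "norm (root Y u a) \<ge> e"
proof -
  have "(norm (root Y u a))\<^sup>2 \<ge> e\<^sup>2" using rad_ge[OF assms] root(3)[OF assms] by (simp flip: norm_power)
  then show ?thesis by (rule power2_le_imp_le) simp
qed

lemma rad_diff:
  assumes "sect Y1" "admissible u1" "sect Y2" "admissible u2" "norm a < \<delta>"
  shows "norm (rad Y1 u1 a - rad Y2 u2 a) \<le> norm a * (norm (u1 a - u2 a) + norm (Y1 a - Y2 a))"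
proof -
  have y: "norm (a * u1 a) < \<rho>" "norm (a * u2 a) < \<rho>" using norm_a_mult assms by (simp_all add: admissible_def)
  have "rad Y1 u1 a - rad Y2 u2 a = (g a (a * u1 a) - g a (a * u2 a)) - a * (Y1 a - Y2 a)"
    by (simp add: rad_def algebra_simps)
  also have "norm \<dots> \<le> norm (g a (a * u1 a) - g a (a * u2 a)) + norm (a * (Y1 a - Y2 a))" by (rule norm_triangle_ineq4)
  also have "\<dots> \<le> norm (a * u1 a - a * u2 a) + norm (a * (Y1 a - Y2 a))" using g_lip[OF assms(5) y] by simp
  also have "norm (a * u1 a - a * u2 a) = norm a * norm (u1 a - u2 a)"
    by (metis norm_mult right_diff_distrib)
  also have "norm a * norm (u1 a - u2 a) + norm (a * (Y1 a - Y2 a)) = norm a * (norm (u1 a - u2 a) + norm (Y1 a - Y2 a))"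
    by (simp add: norm_mult distrib_left)
  finally show ?thesis .
qed

lemma rad_diff_small:
  assumes "sect Y1" "admissible u1" "sect Y2" "admissible u2" "norm a < \<delta>"
  shows "norm (rad Y1 u1 a - rad Y2 u2 a) < e\<^sup>2"
proof -
  have "norm (u1 a - u2 a) \<le> 6" using norm_triangle_ineq4[of "u1 a" "u2 a"] assms by (force simp: admissible_def)
  moreover have "norm (Y1 a - Y2 a) \<le> 2 * \<rho>" using norm_triangle_ineq4[of "Y1 a" "Y2 a"] assms by (force simp: sect_def)
  ultimately have "norm a * (norm (u1 a - u2 a) + norm (Y1 a - Y2 a)) \<le> \<delta> * (6 + 2 * \<rho>)"
    using assms rho delta by (intro mult_mono add_mono) auto
  then show ?thesis using rad_diff[OF assms] delta by linarith
qed

text \<open>The difference of the roots is the difference of the radicands divided by their sum. The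
  sum is at least \<open>e\<close> because the two branches start at the same value
  \<open>\<zeta>\<close>, and the radicands differ by at most \<open>norm a\<close> times the
  difference of the data.\<close>

lemma root_contraction:
  assumes "sect Y1" "admissible u1" "sect Y2" "admissible u2" "norm a < \<delta>"
  shows "norm (root Y1 u1 a - root Y2 u2 a) \<le> (norm (u1 a - u2 a) + norm (Y1 a - Y2 a)) / 2"
proof -
  note r1 = root[OF assms(1,2)] and r2 = root[OF assms(3,4)]
  have "norm (root Y2 u2 a) \<le> norm (root Y1 u1 a + root Y2 u2 a)"
  proof (rule square_root_branch_near[where S = "ball 0 \<delta>" and ?z0.0 = 0 and ?s1.0 = "root Y1 u1" and ?s2.0 = "root Y2 u2" and z = a])
    show "continuous_on (ball 0 \<delta>) (root Y1 u1)" "continuous_on (ball 0 \<delta>) (root Y2 u2)"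
      using r1(1) r2(1) by (auto simp: admissible_def intro: holomorphic_on_imp_continuous_on)
    fix z :: complex assume "z \<in> ball 0 \<delta>"
    then have z: "norm z < \<delta>" by simp
    have "e\<^sup>2 \<le> (norm (root Y2 u2 z))\<^sup>2" using root_ge[OF assms(3,4) z] e0 by (intro power_mono) auto
    then show "norm ((root Y1 u1 z)\<^sup>2 - (root Y2 u2 z)\<^sup>2) < (norm (root Y2 u2 z))\<^sup>2"
      using rad_diff_small[OF assms(1-4) z] r1(3)[OF z] r2(3)[OF z] by simp
  qed (use delta assms(5) r1 r2 in auto)
  then have ge: "norm (root Y1 u1 a + root Y2 u2 a) \<ge> e" using root_ge[OF assms(3-5)] by simp
  have "norm (root Y1 u1 a - root Y2 u2 a) * norm (root Y1 u1 a + root Y2 u2 a) = norm (rad Y1 u1 a - rad Y2 u2 a)"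
    using r1(3)[OF assms(5)] r2(3)[OF assms(5)] by (simp add: power2_eq_square algebra_simps flip: norm_mult)
  then have "norm (root Y1 u1 a - root Y2 u2 a) * e \<le> norm a * (norm (u1 a - u2 a) + norm (Y1 a - Y2 a))"
    using rad_diff[OF assms] mult_left_mono[OF ge, of "norm (root Y1 u1 a - root Y2 u2 a)"] by simp
  also have "\<dots> \<le> (e / 2) * (norm (u1 a - u2 a) + norm (Y1 a - Y2 a))"
    using assms(5) delta by (intro mult_right_mono) auto
  finally have "norm (root Y1 u1 a - root Y2 u2 a) * e \<le> (norm (u1 a - u2 a) + norm (Y1 a - Y2 a)) / 2 * e"
    by (simp add: mult_ac)
  then show ?thesis by (rule mult_right_le_imp_le[OF _ e0])
qed

primrec iter :: "(complex \<Rightarrow> complex) \<Rightarrow> nat \<Rightarrow> complex \<Rightarrow> complex" where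
  "iter Y 0 = (\<lambda>_. \<zeta>)"
| "iter Y (Suc k) = root Y (iter Y k)"

lemma iter_admissible: "sect Y \<Longrightarrow> admissible (iter Y k)"
proof (induction k)
  case 0
  then show ?case using zeta_le by (simp add: admissible_def)
qed (simp add: root)

lemma iter_0: "sect Y \<Longrightarrow> iter Y k 0 = \<zeta>"
  by (cases k) (simp_all add: root iter_admissible)

lemma iter_step: assumes "sect Y" "norm a < \<delta>" shows "norm (iter Y (Suc k) a - iter Y k a) \<le> 6 / 2 ^ k"
proof (induction k)
  case 0
  have "norm (iter Y (Suc 0) a) \<le> 3" "norm (iter Y 0 a) \<le> 3"
    using iter_admissible[OF assms(1)] assms(2) unfolding admissible_def by blast+
  then show ?case using norm_triangle_ineq4[of "iter Y (Suc 0) a" "iter Y 0 a"] by simp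
next
  case (Suc k)
  have "norm (iter Y (Suc (Suc k)) a - iter Y (Suc k) a) \<le> (norm (iter Y (Suc k) a - iter Y k a) + norm (Y a - Y a)) / 2"
    using root_contraction[OF assms(1) iter_admissible[OF assms(1), of "Suc k"] assms(1) iter_admissible[OF assms(1), of k] assms(2)] by simp
  also have "\<dots> \<le> 6 / 2 ^ k / 2" using Suc by simp
  finally show ?case by (simp add: mult.commute)
qed

lemma iter_dist: assumes "sect Y" "norm a < \<delta>" "k \<le> l" shows "norm (iter Y l a - iter Y k a) \<le> 12 / 2 ^ k"
proof -
  have "norm (iter Y (k + j) a - iter Y k a) \<le> 12 / 2 ^ k - 12 / 2 ^ (k + j)" for j
  proof (induction j)
    case (Suc j)
    have "norm (iter Y (k + Suc j) a - iter Y k a) \<le> norm (iter Y (Suc (k + j)) a - iter Y (k + j) a) + norm (iter Y (k + j) a - iter Y k a)"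
      using norm_triangle_ineq[of "iter Y (Suc (k + j)) a - iter Y (k + j) a" "iter Y (k + j) a - iter Y k a"] by simp
    also have "\<dots> \<le> 6 / 2 ^ (k + j) + (12 / 2 ^ k - 12 / 2 ^ (k + j))"
      by (intro add_mono iter_step assms Suc)
    also have "\<dots> = 12 / 2 ^ k - 12 / 2 ^ (k + Suc j)" by (simp add: field_simps)
    finally show ?case .
  qed simp
  from this[of "l - k"] have "norm (iter Y l a - iter Y k a) \<le> 12 / 2 ^ k - 12 / 2 ^ l" using assms(3) by simp
  moreover have "(0::real) \<le> 12 / 2 ^ l" by simp
  ultimately show ?thesis by linarith
qed

definition sol :: "(complex \<Rightarrow> complex) \<Rightarrow> complex \<Rightarrow> complex" where
  "sol Y a = lim (\<lambda>k. iter Y k a)"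

lemma iter_tendsto: assumes "sect Y" "norm a < \<delta>" shows "(\<lambda>k. iter Y k a) \<longlonglongrightarrow> sol Y a"
proof -
  have "Cauchy (\<lambda>k. iter Y k a)"
  proof (rule metric_CauchyI)
    fix r :: real assume r: "r > 0"
    obtain K where "(1/2) ^ K < r / 12" using real_arch_pow_inv[of "r / 12" "1/2"] r by auto
    then have K: "12 * (1/2) ^ K < r" by simp
    show "\<exists>M. \<forall>m\<ge>M. \<forall>n\<ge>M. dist (iter Y m a) (iter Y n a) < r"
    proof (intro exI[of _ "Suc K"] allI impI)
      fix m n assume mn: "Suc K \<le> m" "Suc K \<le> n"
      have "norm (iter Y m a - iter Y (Suc K) a) \<le> 12 / 2 ^ Suc K" "norm (iter Y n a - iter Y (Suc K) a) \<le> 12 / 2 ^ Suc K"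
        by (intro iter_dist assms mn)+
      then have "dist (iter Y m a) (iter Y n a) \<le> 12 / 2 ^ Suc K + 12 / 2 ^ Suc K"
        using dist_triangle2[of "iter Y m a" "iter Y n a" "iter Y (Suc K) a"] unfolding dist_norm by linarith
      also have "\<dots> = 12 * (1/2) ^ K" by (simp add: power_one_over field_simps)
      finally show "dist (iter Y m a) (iter Y n a) < r" using K by simp
    qed
  qed
  then show ?thesis unfolding sol_def by (simp add: Cauchy_convergent convergent_LIMSEQ_iff[symmetric])
qed

lemma sol_dist: assumes "sect Y" "norm a < \<delta>" shows "norm (sol Y a - iter Y k a) \<le> 12 / 2 ^ k"
proof -
  have "(\<lambda>l. norm (iter Y l a - iter Y k a)) \<longlonglongrightarrow> norm (sol Y a - iter Y k a)"
    by (intro tendsto_intros iter_tendsto assms)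
  then show ?thesis by (rule LIMSEQ_le_const2) (use iter_dist[OF assms] in blast)
qed

lemma sol_admissible: assumes "sect Y" shows "admissible (sol Y)"
  unfolding admissible_def
proof (intro conjI allI impI)
  show "sol Y holomorphic_on ball 0 \<delta>"
  proof (rule holomorphic_uniform_sequence[of _ "iter Y"])
    show "iter Y n holomorphic_on ball 0 \<delta>" for n using iter_admissible[OF assms] by (simp add: admissible_def)
    fix x :: complex assume "x \<in> ball 0 \<delta>"
    then obtain d where d: "d > 0" "cball x d \<subseteq> ball 0 \<delta>" using open_contains_cball open_ball by blast
    have "uniform_limit (cball x d) (iter Y) (sol Y) sequentially"
    proof (rule uniform_limitI)
      fix r :: real assume r: "r > 0"
      have "(\<lambda>k. 12 * (1/2) ^ k) \<longlonglongrightarrow> 12 * (0::real)" by (intro tendsto_intros LIMSEQ_realpow_zero) auto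
      then have "\<forall>\<^sub>F k in sequentially. 12 * (1/2) ^ k < r" using order_tendstoD(2)[of _ 0 sequentially r] r by simp
      then show "\<forall>\<^sub>F n in sequentially. \<forall>x\<in>cball x d. dist (iter Y n x) (sol Y x) < r"
      proof eventually_elim
        case (elim n)
        show ?case
        proof
          fix z assume "z \<in> cball x d"
          then have "norm z < \<delta>" using d by auto
          from sol_dist[OF assms this, of n] show "dist (iter Y n z) (sol Y z) < r"
            using elim by (simp add: dist_norm norm_minus_commute power_one_over)
        qed
      qed
    qed
    then show "\<exists>d>0. cball x d \<subseteq> ball 0 \<delta> \<and> uniform_limit (cball x d) (iter Y) (sol Y) sequentially" using d by blast
  qed simp
  fix a :: complex assume a: "norm a < \<delta>"
  have "(\<lambda>k. norm (iter Y k a)) \<longlonglongrightarrow> norm (sol Y a)" by (intro tendsto_intros iter_tendsto assms a)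
  then show "norm (sol Y a) \<le> 3"
    by (rule LIMSEQ_le_const2) (use iter_admissible[OF assms] a in \<open>auto simp: admissible_def\<close>)
qed

lemma sol_0: assumes "sect Y" shows "sol Y 0 = \<zeta>"
proof -
  have "(\<lambda>k. iter Y k 0) \<longlonglongrightarrow> sol Y 0" using iter_tendsto[OF assms] delta by simp
  then show ?thesis using iter_0[OF assms] by (simp add: LIMSEQ_const_iff)
qed

lemma sol_fixed: assumes "sect Y" "norm a < \<delta>" shows "root Y (sol Y) a = sol Y a"
proof -
  have bound: "norm (iter Y (Suc k) a - root Y (sol Y) a) \<le> norm (iter Y k a - sol Y a) / 2" for k
    using root_contraction[OF assms(1) iter_admissible[OF assms(1), of k] assms(1) sol_admissible[OF assms(1)] assms(2)] by simp
  have "(\<lambda>k. norm (iter Y k a - sol Y a) / 2) \<longlonglongrightarrow> norm (sol Y a - sol Y a) / 2"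
    by (intro tendsto_intros iter_tendsto assms) auto
  then have "(\<lambda>k. norm (iter Y k a - sol Y a) / 2) \<longlonglongrightarrow> 0" by simp
  then have "(\<lambda>k. iter Y (Suc k) a - root Y (sol Y) a) \<longlonglongrightarrow> 0"
    by (rule Lim_null_comparison[OF always_eventually, rotated]) (use bound in blast)
  then have "(\<lambda>k. iter Y (Suc k) a) \<longlonglongrightarrow> root Y (sol Y) a" by (rule LIM_zero_cancel)
  moreover have "(\<lambda>k. iter Y (Suc k) a) \<longlonglongrightarrow> sol Y a" by (rule LIMSEQ_Suc[OF iter_tendsto[OF assms]])
  ultimately show ?thesis by (rule LIMSEQ_unique)
qed

text \<open>At the fixed points the contraction estimate reads
  \<open>d \<le> (d + norm (Y1 a - Y2 a)) / 2\<close>, and absorbing \<open>d\<close> gives the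
  constant 1.\<close>

lemma sol_lip: assumes "sect Y1" "sect Y2" "norm a < \<delta>" shows "norm (sol Y1 a - sol Y2 a) \<le> norm (Y1 a - Y2 a)"
  using root_contraction[OF assms(1) sol_admissible[OF assms(1)] assms(2) sol_admissible[OF assms(2)] assms(3)]
  unfolding sol_fixed[OF assms(1,3)] sol_fixed[OF assms(2,3)] by simp

lemma sect_const: "norm y < \<rho> \<Longrightarrow> sect (\<lambda>_. y)"
  by (simp add: sect_def)

lemma lift_exists:
  "\<exists>g'. leaf g' \<and> g' 0 0 = \<zeta> \<and> (\<forall>a y. norm a < \<delta> \<longrightarrow> norm y < \<rho> \<longrightarrow> (g' a y)\<^sup>2 = g a (a * g' a y) - cc a - a * y)"
proof -
  define g' where "g' a y = sol (\<lambda>_. y) a" for a y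
  have eq: "(g' a y)\<^sup>2 = g a (a * g' a y) - cc a - a * y" if "norm a < \<delta>" "norm y < \<rho>" for a y
  proof -
    note Y = sect_const[OF that(2)]
    have "(root (\<lambda>_. y) (sol (\<lambda>_. y)) a)\<^sup>2 = rad (\<lambda>_. y) (sol (\<lambda>_. y)) a"
      by (rule root(3)[OF Y sol_admissible[OF Y] that(1)])
    then show ?thesis unfolding sol_fixed[OF Y that(1)] by (simp add: g'_def rad_def)
  qed
  have le: "norm (g' a y) \<le> 3" if "norm a < \<delta>" "norm y < \<rho>" for a y
    using sol_admissible[OF sect_const[OF that(2)]] that unfolding g'_def admissible_def by blast
  have z: "g' 0 y = \<zeta>" if "norm y < \<rho>" for y
    unfolding g'_def by (rule sol_0[OF sect_const[OF that]])
  have "leaf g'" unfolding leaf_def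
  proof (intro conjI allI impI)
    fix Y assume Y: "Y holomorphic_on ball 0 \<delta>" "Y ` ball 0 \<delta> \<subseteq> ball 0 \<rho>"
    then have sY: "sect Y" by (auto simp: sect_def image_subset_iff)
    \<comment> \<open>By the Lipschitz bound at the single parameter \<open>a\<close>, the value of
      the solution there depends only on \<open>Y a\<close>, so \<open>Y\<close> may be replaced by
      a constant section.\<close>
    have "sol Y a = g' a (Y a)" if a: "norm a < \<delta>" for a
    proof -
      have "norm (Y a) < \<rho>" using sY a by (simp add: sect_def)
      from sol_lip[OF sY sect_const[OF this] a] show ?thesis by (simp add: g'_def)
    qed
    then show "(\<lambda>a. g' a (Y a)) holomorphic_on ball 0 \<delta>"
      using sol_admissible[OF sY] unfolding admissible_def by (metis holomorphic_transform mem_ball_0)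
  next
    fix a y y' :: complex assume "norm a < \<delta>" "norm y < \<rho>" "norm y' < \<rho>"
    then show "norm (g' a y - g' a y') \<le> norm (y - y')"
      unfolding g'_def using sol_lip[OF sect_const sect_const, of y y' a] by simp
  next
    fix a y :: complex assume ay: "norm a < \<delta>" "norm y < \<rho>"
    then show "norm (g' a y) \<le> 3" by (rule le)
    have "norm (a * g' a y) < \<rho>" using norm_a_mult ay le by blast
    then obtain n where "norm (X a n (g a (a * g' a y)) (a * g' a y)) \<ge> 3" using g_esc ay by blast
    then have "norm (X a (Suc n) (g' a y) y) \<ge> 3" unfolding X_Suc eq[OF ay] by simp
    then show "\<exists>n. norm (X a n (g' a y) y) \<ge> 3" by blast
  next
    fix y :: complex assume "norm y < \<rho>"
    then show "g' 0 y = g' 0 0" using z[of y] z[of 0] rho by simp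
  qed
  then show ?thesis using eq z[of 0] rho by auto
qed

end

text \<open>Write \<open>f = exp L\<close> with \<open>Re L < 0\<close>. A Cayley transform taking
  \<open>L 0\<close> to 0 maps the left half-plane to the unit disc, and Schwarz's lemma bounds it
  by 1/3 for \<open>norm a \<le> \<delta> / 3\<close>. This puts the ratio of the real parts of
  \<open>L a\<close> and \<open>L 0\<close> between 1/2 and 2, whence the exponent 2.\<close>

lemma harnack_nonvanishing:
  fixes f :: "complex \<Rightarrow> complex"
  assumes f: "f holomorphic_on ball 0 \<delta>" and nz: "\<And>a. norm a < \<delta> \<Longrightarrow> f a \<noteq> 0" and le: "\<And>a. norm a < \<delta> \<Longrightarrow> norm (f a) < 1"
    and \<delta>: "\<delta> > 0" and a: "norm a \<le> \<delta> / 3"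
  shows "(norm (f 0))\<^sup>2 \<le> norm (f a)" "(norm (f a))\<^sup>2 \<le> norm (f 0)"
proof -
  obtain L where L: "L holomorphic_on ball 0 \<delta>" "\<And>z. z \<in> ball 0 \<delta> \<Longrightarrow> f z = exp (L z)"
    using contractible_imp_holomorphic_log[OF f convex_imp_contractible[OF convex_ball]] nz by (metis mem_ball_0)
  have ReL: "Re (L z) < 0" if "norm z < \<delta>" for z
    using le[OF that] L(2)[of z] that by simp
  define \<phi> where "\<phi> z = (L (of_real \<delta> * z) - L 0) / (L (of_real \<delta> * z) + cnj (L 0))" for z
  have dz: "of_real \<delta> * z \<in> ball 0 \<delta>" if "norm z < 1" for z :: complex
    using that \<delta> by (simp add: norm_mult)
  have den: "L (of_real \<delta> * z) + cnj (L 0) \<noteq> 0" if "norm z < 1" for z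
  proof
    assume "L (of_real \<delta> * z) + cnj (L 0) = 0"
    then have "Re (L (of_real \<delta> * z)) + Re (L 0) = 0" by (metis complex_cnj(1) plus_complex.simps(1) zero_complex.simps(1) cnj.simps(1))
    then show False using ReL[of "of_real \<delta> * z"] ReL[of 0] dz[OF that] \<delta> by simp
  qed
  have "(\<lambda>z. L (of_real \<delta> * z)) holomorphic_on ball 0 1"
    by (rule holomorphic_on_compose_gen[OF _ L(1), unfolded o_def]) (use dz in \<open>auto intro!: holomorphic_intros\<close>)
  then have hol: "\<phi> holomorphic_on ball 0 1"
    unfolding \<phi>_def using den by (intro holomorphic_intros) auto
  have lt: "norm (\<phi> z) < 1" if "norm z < 1" for z
  proof -
    let ?w = "L (of_real \<delta> * z)"
    have "Re ?w < 0" "Re (L 0) < 0" using ReL dz[OF that] \<delta> by auto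
    then have "Re ?w * Re (L 0) > 0" by (rule mult_neg_neg)
    moreover have "(norm (?w + cnj (L 0)))\<^sup>2 - (norm (?w - L 0))\<^sup>2 = 4 * (Re ?w * Re (L 0))"
      unfolding cmod_power2 by (simp add: power2_eq_square algebra_simps)
    ultimately have "(norm (?w - L 0))\<^sup>2 < (norm (?w + cnj (L 0)))\<^sup>2" by linarith
    then have "norm (?w - L 0) < norm (?w + cnj (L 0))" by (rule power2_less_imp_less) simp
    then show ?thesis using den[OF that] by (simp add: \<phi>_def norm_divide)
  qed
  define z where "z = a / of_real \<delta>"
  have z: "norm z \<le> 1/3" using a \<delta> by (simp add: z_def norm_divide field_simps)
  then have z1: "norm z < 1" by simp
  have "\<phi> 0 = 0" by (simp add: \<phi>_def)
  from Schwarz_Lemma(1)[OF hol this lt z1] z have p: "norm (\<phi> z) \<le> 1/3" by simp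
  have dza: "of_real \<delta> * z = a" using \<delta> by (simp add: z_def)
  have aD: "norm a < \<delta>" using a \<delta> by linarith
  define s where "s = - Re (L a)"
  define s0 where "s0 = - Re (L 0)"
  have s: "s > 0" "s0 > 0" using ReL[OF aD] ReL[of 0] \<delta> by (auto simp: s_def s0_def)
  have "norm (L a - L 0) \<le> 1/3 * norm (L a + cnj (L 0))"
    using p den[OF z1] unfolding \<phi>_def dza by (simp add: norm_divide field_simps)
  then have "(norm (L a - L 0))\<^sup>2 \<le> (1/3 * norm (L a + cnj (L 0)))\<^sup>2" by (intro power_mono) auto
  then have "(Re (L a) - Re (L 0))\<^sup>2 + (Im (L a) - Im (L 0))\<^sup>2 \<le> 1/9 * ((Re (L a) + Re (L 0))\<^sup>2 + (Im (L a) - Im (L 0))\<^sup>2)"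
    unfolding power_mult_distrib cmod_power2 by (simp add: power_divide)
  then have "(s - s0)\<^sup>2 \<le> 1/9 * (s + s0)\<^sup>2"
    using zero_le_power2[of "Im (L a) - Im (L 0)"] by (simp add: s_def s0_def power2_eq_square algebra_simps)
  then have "(s - s0)\<^sup>2 \<le> ((s + s0) / 3)\<^sup>2" by (simp add: power_divide)
  then have "\<bar>s - s0\<bar> \<le> (s + s0) / 3" using s by (simp add: abs_le_square_iff[symmetric])
  then have "3 * \<bar>s - s0\<bar> \<le> s + s0" by simp
  then have ss: "s \<le> 2 * s0" "s0 \<le> 2 * s" by (auto simp: abs_if split: if_splits)
  have na: "norm (f a) = exp (- s)" "norm (f 0) = exp (- s0)"
    using L(2)[of a] L(2)[of 0] aD \<delta> by (auto simp: s_def s0_def)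
  show "(norm (f 0))\<^sup>2 \<le> norm (f a)" "(norm (f a))\<^sup>2 \<le> norm (f 0)"
    unfolding na power2_eq_square exp_add[symmetric] using ss by auto
qed

section \<open>The leaves of the escaping points\<close>

context henon_family
begin

definition PP :: "complex \<Rightarrow> complex" where "PP x = x\<^sup>2 + cc 0"

lemma X_zero: "X 0 n x y = (PP ^^ n) x"
proof (induction n arbitrary: x y)
  case (Suc n)
  have "x\<^sup>2 + cc 0 + 0 * y = PP x" by (simp add: PP_def)
  then show ?case unfolding X_Suc Suc by (simp add: funpow_swap1)
qed simp

text \<open>\<open>level_leaf n z a\<close> is the graph over \<open>y\<close>, for the parameter \<open>a\<close>, that continues \<open>z\<close> with \<open>P\<^sup>n(z)\<close> of modulus 3 and consists
  of points whose \<open>n\<close>-th iterate has the same first coordinate \<open>P\<^sup>n(z)\<close>.\<close>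

primrec level_leaf :: "nat \<Rightarrow> complex \<Rightarrow> complex \<Rightarrow> complex \<Rightarrow> complex" where
  "level_leaf 0 z = (\<lambda>a y. z)"
| "level_leaf (Suc n) z = (SOME g'. leaf g' \<and> g' 0 0 = z \<and> (\<forall>a y. norm a < \<delta> \<longrightarrow> norm y < \<rho> \<longrightarrow>
     (g' a y)\<^sup>2 = level_leaf n (PP z) a (a * g' a y) - cc a - a * y))"

definition level_set :: "nat \<Rightarrow> complex set" where "level_set n = {z. norm ((PP ^^ n) z) = 3}"

lemma level_set_Suc: "z \<in> level_set (Suc n) \<longleftrightarrow> PP z \<in> level_set n"
  by (simp add: level_set_def funpow_swap1)

lemma level_leaf_leaf: "z \<in> level_set n \<Longrightarrow> leaf (level_leaf n z) \<and> level_leaf n z 0 0 = z"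
  and level_leaf_Suc: "z \<in> level_set (Suc n) \<Longrightarrow> norm a < \<delta> \<Longrightarrow> norm y < \<rho> \<Longrightarrow>
     (level_leaf (Suc n) z a y)\<^sup>2 = level_leaf n (PP z) a (a * level_leaf (Suc n) z a y) - cc a - a * y"
proof -
  have step: "leaf (level_leaf (Suc n) z) \<and> level_leaf (Suc n) z 0 0 = z \<and> (\<forall>a y. norm a < \<delta> \<longrightarrow> norm y < \<rho> \<longrightarrow>
     (level_leaf (Suc n) z a y)\<^sup>2 = level_leaf n (PP z) a (a * level_leaf (Suc n) z a y) - cc a - a * y)"
    if "leaf (level_leaf n (PP z))" "level_leaf n (PP z) 0 0 = PP z" for n z
  proof -
    interpret leaf_lift cc \<delta> \<rho> e "level_leaf n (PP z)" z
      by unfold_locales (use that in \<open>auto simp: PP_def\<close>)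
    show ?thesis unfolding level_leaf.simps by (rule someI_ex[OF lift_exists])
  qed
  have leaf: "leaf (level_leaf n z) \<and> level_leaf n z 0 0 = z" if "z \<in> level_set n" for n z
    using that
  proof (induction n arbitrary: z)
    case 0
    then show ?case using leaf_const by (simp add: level_set_def)
  next
    case (Suc n)
    then show ?case using step[of n z] by (simp add: level_set_Suc)
  qed
  then show "z \<in> level_set n \<Longrightarrow> leaf (level_leaf n z) \<and> level_leaf n z 0 0 = z" by blast
  show "z \<in> level_set (Suc n) \<Longrightarrow> norm a < \<delta> \<Longrightarrow> norm y < \<rho> \<Longrightarrow>
     (level_leaf (Suc n) z a y)\<^sup>2 = level_leaf n (PP z) a (a * level_leaf (Suc n) z a y) - cc a - a * y"
    using step[of n z] leaf[of "PP z" n] by (simp add: level_set_Suc del: level_leaf.simps)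
qed

declare level_leaf.simps(2) [simp del]

lemma level_leaf_le: "z \<in> level_set n \<Longrightarrow> norm a < \<delta> \<Longrightarrow> norm y < \<rho> \<Longrightarrow> norm (level_leaf n z a y) \<le> 3"
  and level_leaf_lip: "z \<in> level_set n \<Longrightarrow> norm a < \<delta> \<Longrightarrow> norm y < \<rho> \<Longrightarrow> norm y' < \<rho> \<Longrightarrow> norm (level_leaf n z a y - level_leaf n z a y') \<le> norm (y - y')"
  and level_leaf_at_0: "z \<in> level_set n \<Longrightarrow> norm y < \<rho> \<Longrightarrow> level_leaf n z 0 y = z"
  using level_leaf_leaf[of z n] unfolding leaf_def by metis+

lemma level_leaf_hol: assumes "z \<in> level_set n" "norm y < \<rho>" shows "(\<lambda>a. level_leaf n z a y) holomorphic_on ball 0 \<delta>"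
proof -
  have "(\<lambda>a::complex. y) holomorphic_on ball 0 \<delta>" "(\<lambda>a::complex. y) ` ball 0 \<delta> \<subseteq> ball 0 \<rho>" using assms by auto
  then show ?thesis using level_leaf_leaf[OF assms(1)] unfolding leaf_def by blast
qed

lemma a_level_leaf: "z \<in> level_set n \<Longrightarrow> norm a < \<delta> \<Longrightarrow> norm y < \<rho> \<Longrightarrow> norm (a * level_leaf n z a y) < \<rho>"
  by (rule norm_a_mult[OF _ level_leaf_le])

lemma X_level_leaf: "z \<in> level_set n \<Longrightarrow> norm a < \<delta> \<Longrightarrow> norm y < \<rho> \<Longrightarrow> X a n (level_leaf n z a y) y = (PP ^^ n) z"
proof (induction n arbitrary: z y)
  case (Suc n)
  have "(level_leaf (Suc n) z a y)\<^sup>2 + cc a + a * y = level_leaf n (PP z) a (a * level_leaf (Suc n) z a y)"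
    using level_leaf_Suc[OF Suc.prems] by simp
  then have "X a (Suc n) (level_leaf (Suc n) z a y) y = X a n (level_leaf n (PP z) a (a * level_leaf (Suc n) z a y)) (a * level_leaf (Suc n) z a y)"
    by (simp add: X_Suc)
  also have "\<dots> = (PP ^^ n) (PP z)"
    using Suc.prems a_level_leaf by (intro Suc.IH) (auto simp: level_set_Suc)
  finally show ?case by (simp add: funpow_swap1)
qed simp

lemma level_leaf_ge: assumes "z \<in> level_set (Suc n)" "norm a < \<delta>" "norm y < \<rho>" shows "norm (level_leaf (Suc n) z a y) \<ge> e"
proof -
  have y: "norm (a * level_leaf (Suc n) z a y) < \<rho>" by (rule a_level_leaf[OF assms])
  have "norm (X a n (level_leaf n (PP z) a (a * level_leaf (Suc n) z a y)) (a * level_leaf (Suc n) z a y)) \<ge> 3"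
    using X_level_leaf[of "PP z" n a, OF _ assms(2) y] assms(1) by (simp add: level_set_Suc) (simp add: level_set_def)
  from avoid'[OF assms(2) y assms(3) this] have "e\<^sup>2 \<le> (norm (level_leaf (Suc n) z a y))\<^sup>2"
    using level_leaf_Suc[OF assms] by (simp flip: norm_power)
  then show ?thesis by (rule power2_le_imp_le) simp
qed

lemma level_set_minus: "z \<in> level_set (Suc n) \<longleftrightarrow> - z \<in> level_set (Suc n)" "PP (- z) = PP z"
  by (simp_all add: level_set_Suc PP_def)

text \<open>The leaf of \<open>z\<close> and the negative of the leaf of \<open>- z\<close> coincide
  at \<open>a = 0\<close> and have nearly equal squares, so they stay on the same side. Hence the
  difference of the two leaves is at least the modulus of one of them, which is at least
  \<open>e\<close>.\<close>

lemma level_leaf_opposite: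
  assumes "z \<in> level_set (Suc n)" "norm a < \<delta>" "norm y < \<rho>"
  shows "norm (level_leaf (Suc n) z a y - level_leaf (Suc n) (- z) a y) \<ge> e"
proof -
  have mz: "- z \<in> level_set (Suc n)" using assms(1) level_set_minus by simp
  have Pz: "PP z \<in> level_set n" using assms(1) by (simp add: level_set_Suc)
  let ?u = "\<lambda>a. level_leaf (Suc n) z a y" and ?v = "\<lambda>a. - level_leaf (Suc n) (- z) a y"
  have "norm (?v a) \<le> norm (?u a + ?v a)"
  proof (rule square_root_branch_near[where S = "ball 0 \<delta>" and ?z0.0 = 0 and ?s1.0 = ?u and ?s2.0 = ?v and z = a])
    show "continuous_on (ball 0 \<delta>) ?u" "continuous_on (ball 0 \<delta>) ?v"
      using level_leaf_hol[OF assms(1,3)] level_leaf_hol[OF mz assms(3)] by (auto intro!: holomorphic_on_imp_continuous_on holomorphic_on_minus)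
    show "?u 0 = ?v 0" using level_leaf_at_0 assms(1,3) mz by simp
    fix b :: complex assume "b \<in> ball 0 \<delta>"
    then have b: "norm b < \<delta>" by simp
    have "(?u b)\<^sup>2 - (?v b)\<^sup>2 = level_leaf n (PP z) b (b * level_leaf (Suc n) z b y) - level_leaf n (PP z) b (b * level_leaf (Suc n) (- z) b y)"
      using level_leaf_Suc[OF assms(1) b assms(3)] level_leaf_Suc[OF mz b assms(3)] by (simp add: level_set_minus)
    then have "norm ((?u b)\<^sup>2 - (?v b)\<^sup>2) \<le> norm (b * level_leaf (Suc n) z b y - b * level_leaf (Suc n) (- z) b y)"
      using level_leaf_lip[OF Pz b a_level_leaf[OF assms(1) b assms(3)] a_level_leaf[OF mz b assms(3)]] by simp
    also have "\<dots> = norm b * norm (level_leaf (Suc n) z b y - level_leaf (Suc n) (- z) b y)"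
      by (metis norm_mult right_diff_distrib)
    also have "\<dots> \<le> \<delta> * 6"
      using b delta level_leaf_le[OF assms(1) b assms(3)] level_leaf_le[OF mz b assms(3)] norm_triangle_ineq4[of "level_leaf (Suc n) z b y" "level_leaf (Suc n) (- z) b y"]
      by (intro mult_mono) auto
    also have "\<dots> \<le> \<delta> * (6 + 2 * \<rho>)" using delta rho by (intro mult_left_mono) auto
    also have "\<dots> < e\<^sup>2" by (rule delta)
    also have "\<dots> \<le> (norm (?v b))\<^sup>2" using level_leaf_ge[OF mz b assms(3)] e0 by (intro power_mono) auto
    finally show "norm ((?u b)\<^sup>2 - (?v b)\<^sup>2) < (norm (?v b))\<^sup>2" .
  qed (use delta assms in auto)
  then show ?thesis using level_leaf_ge[OF mz assms(2,3)] by simp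
qed

text \<open>A common point of two leaves is mapped to a common point of the leaves one level down,
  so \<open>PP z = PP z'\<close>; the remaining case \<open>z' = - z\<close> contradicts the gap
  between opposite leaves.\<close>

lemma level_leaf_inj: "z \<in> level_set n \<Longrightarrow> z' \<in> level_set n \<Longrightarrow> norm a < \<delta> \<Longrightarrow> norm y < \<rho> \<Longrightarrow> level_leaf n z a y = level_leaf n z' a y \<Longrightarrow> z = z'"
proof (induction n arbitrary: z z' y)
  case (Suc n)
  let ?x = "level_leaf (Suc n) z a y"
  have eq: "level_leaf n (PP z) a (a * ?x) = level_leaf n (PP z') a (a * ?x)"
    using level_leaf_Suc[OF Suc.prems(1,3,4)] level_leaf_Suc[OF Suc.prems(2,3,4)] Suc.prems(5) by simp
  have "PP z = PP z'"
    by (rule Suc.IH[OF _ _ Suc.prems(3) a_level_leaf[OF Suc.prems(1,3,4)] eq]) (use Suc.prems(1,2) in \<open>simp_all add: level_set_Suc\<close>)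
  then have "z = z' \<or> z' = - z" by (auto simp: PP_def power2_eq_iff)
  moreover have "z' \<noteq> - z" using level_leaf_opposite[OF Suc.prems(1,3,4)] Suc.prems(5) e0 by auto
  ultimately show ?case by blast
qed simp

lemma level_leaf_inj_levels: 
  assumes "z \<in> level_set n" "z' \<in> level_set m" "norm a < \<delta>" "norm y < \<rho>" "n < m"
  shows "level_leaf n z a y \<noteq> level_leaf m z' a y"
proof
  assume eq: "level_leaf n z a y = level_leaf m z' a y"
  have "norm (X a n (level_leaf n z a y) y) = 3" using X_level_leaf[OF assms(1,3,4)] assms(1) by (simp add: level_set_def)
  then have "norm (X a m (level_leaf n z a y) y) > 3" using X_growth_gt[OF assms(3,4) _ assms(5)] by simp
  then show False unfolding eq using X_level_leaf[OF assms(2,3,4)] assms(2) by (simp add: level_set_def)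
qed

text \<open>The image point lies on a leaf of the previous level, whose two lifts are the
  candidates. If \<open>x\<close> is not on the lift \<open>u\<close>, then the difference of
  squares and the Lipschitz bound put \<open>x\<close> within \<open>norm a\<close> of
  \<open>- u\<close>; for both lifts at once this contradicts their distance
  \<open>e\<close>.\<close>

lemma level_leaf_surj: "norm a < \<delta> \<Longrightarrow> norm y < \<rho> \<Longrightarrow> norm (X a n x y) = 3 \<Longrightarrow> \<exists>z\<in>level_set n. x = level_leaf n z a y"
proof (induction n arbitrary: x y)
  case 0
  then show ?case by (simp add: level_set_def)
next
  case (Suc n)
  have x3: "norm x \<le> 3"
  proof (rule ccontr)
    assume "\<not> norm x \<le> 3"
    then show False using X_growth_gt[OF Suc.prems(1,2), of 0 x "Suc n"] Suc.prems(3) by simp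
  qed
  then have ax: "norm (a * x) < \<rho>" using norm_a_mult Suc.prems by blast
  obtain w where w: "w \<in> level_set n" "x\<^sup>2 + cc a + a * y = level_leaf n w a (a * x)"
    using Suc.IH[OF Suc.prems(1) ax] Suc.prems(3) by (auto simp: X_Suc)
  define z where "z = csqrt (w - cc 0)"
  have Pz: "PP z = w" by (simp add: PP_def z_def)
  then have z: "z \<in> level_set (Suc n)" using w by (simp add: level_set_Suc)
  then have mz: "- z \<in> level_set (Suc n)" using level_set_minus by simp
  have near: "norm (x + level_leaf (Suc n) t a y) \<le> norm a" if t: "t \<in> level_set (Suc n)" "PP t = w" "x \<noteq> level_leaf (Suc n) t a y" for t
  proof -
    let ?u = "level_leaf (Suc n) t a y"
    have "(x - ?u) * (x + ?u) = level_leaf n w a (a * x) - level_leaf n w a (a * ?u)"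
    proof -
      have "?u\<^sup>2 = level_leaf n w a (a * ?u) - cc a - a * y" using level_leaf_Suc[OF t(1) Suc.prems(1,2)] t(2) by simp
      moreover have "x\<^sup>2 = level_leaf n w a (a * x) - cc a - a * y" by (simp flip: w(2))
      moreover have "(x - ?u) * (x + ?u) = x\<^sup>2 - ?u\<^sup>2" by (simp add: power2_eq_square algebra_simps)
      ultimately show ?thesis by simp
    qed
    then have "norm (x - ?u) * norm (x + ?u) \<le> norm (a * x - a * ?u)"
      using level_leaf_lip[OF w(1) Suc.prems(1) ax a_level_leaf[OF t(1) Suc.prems(1,2)]] by (simp flip: norm_mult)
    also have "\<dots> = norm (x - ?u) * norm a" by (metis mult.commute norm_mult right_diff_distrib)
    finally show ?thesis using t(3) by simp
  qed
  have "x = level_leaf (Suc n) z a y \<or> x = level_leaf (Suc n) (- z) a y"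
  proof (rule ccontr)
    assume "\<not> ?thesis"
    then have "norm (x + level_leaf (Suc n) z a y) \<le> norm a" "norm (x + level_leaf (Suc n) (- z) a y) \<le> norm a"
      using near[OF z Pz] near[OF mz] Pz by (auto simp: level_set_minus)
    then have "norm (level_leaf (Suc n) z a y - level_leaf (Suc n) (- z) a y) \<le> 2 * norm a"
      using norm_triangle_ineq4[of "x + level_leaf (Suc n) z a y" "x + level_leaf (Suc n) (- z) a y"] by simp
    then show False using level_leaf_opposite[OF z Suc.prems(1,2)] delta Suc.prems(1) by linarith
  qed
  then show ?case using z mz by blast
qed

text \<open>Only the points whose orbit meets the circle of radius 3 exactly. By the intermediate
  value property they still accumulate at every point of the Julia set.\<close>

definition escaping_pts :: "complex set" where "escaping_pts = (\<Union>n. level_set n)"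
definition level :: "complex \<Rightarrow> nat" where "level z = (LEAST n. z \<in> level_set n)"
definition escaping_leaf :: "complex \<Rightarrow> complex \<Rightarrow> complex \<Rightarrow> complex" where "escaping_leaf a y z = level_leaf (level z) z a y"

lemma level_set_unique: assumes "z \<in> level_set n" "z \<in> level_set m" shows "n = m"
proof -
  have "\<not> n < m" if "z \<in> level_set n" "z \<in> level_set m" for n m
    using level_leaf_inj_levels[OF that, of 0 0] level_leaf_at_0[OF that(1), of 0] level_leaf_at_0[OF that(2), of 0] delta rho by auto
  then show ?thesis using assms by (meson linorder_neqE_nat)
qed

lemma level_eq: "z \<in> level_set n \<Longrightarrow> level z = n"
  unfolding level_def by (rule Least_equality) (auto dest: level_set_unique)

lemma escaping_pts_level: "z \<in> escaping_pts \<Longrightarrow> z \<in> level_set (level z)"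
  unfolding escaping_pts_def using level_eq by auto

lemma escaping_leaf_le: "z \<in> escaping_pts \<Longrightarrow> norm a < \<delta> \<Longrightarrow> norm y < \<rho> \<Longrightarrow> norm (escaping_leaf a y z) \<le> 3"
  unfolding escaping_leaf_def by (rule level_leaf_le[OF escaping_pts_level])

lemma escaping_leaf_lip: "z \<in> escaping_pts \<Longrightarrow> norm a < \<delta> \<Longrightarrow> norm y < \<rho> \<Longrightarrow> norm y' < \<rho> \<Longrightarrow> norm (escaping_leaf a y z - escaping_leaf a y' z) \<le> norm (y - y')"
  unfolding escaping_leaf_def by (rule level_leaf_lip[OF escaping_pts_level])

lemma escaping_leaf_hol: "z \<in> escaping_pts \<Longrightarrow> norm y < \<rho> \<Longrightarrow> (\<lambda>a. escaping_leaf a y z) holomorphic_on ball 0 \<delta>"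
  unfolding escaping_leaf_def by (rule level_leaf_hol[OF escaping_pts_level])

lemma escaping_leaf_0: "z \<in> escaping_pts \<Longrightarrow> norm y < \<rho> \<Longrightarrow> escaping_leaf 0 y z = z"
  unfolding escaping_leaf_def by (rule level_leaf_at_0[OF escaping_pts_level])

lemma escaping_leaf_inj: assumes "z \<in> escaping_pts" "z' \<in> escaping_pts" "norm a < \<delta>" "norm y < \<rho>" "z \<noteq> z'" shows "escaping_leaf a y z \<noteq> escaping_leaf a y z'"
proof (cases "level z = level z'")
  case True
  then show ?thesis using assms level_leaf_inj escaping_pts_level unfolding escaping_leaf_def by metis
next
  case False
  then show ?thesis
    using level_leaf_inj_levels[OF escaping_pts_level[OF assms(1)] escaping_pts_level[OF assms(2)] assms(3,4)]
      level_leaf_inj_levels[OF escaping_pts_level[OF assms(2)] escaping_pts_level[OF assms(1)] assms(3,4)]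
    unfolding escaping_leaf_def by (metis linorder_neqE_nat)
qed

lemma escaping_pts_le: "z \<in> escaping_pts \<Longrightarrow> norm z \<le> 3"
  using escaping_leaf_le[of z 0 0] escaping_leaf_0[of z 0] delta rho by simp

text \<open>Distinct leaves never meet, so their difference is a holomorphic function of the parameter without
  zeros, to which Harnack's inequality applies.\<close>

lemma escaping_leaf_holder:
  assumes z: "z \<in> escaping_pts" "z' \<in> escaping_pts" and a: "norm a \<le> \<delta> / 3" and y: "norm y < \<rho>"
  shows "(norm (z - z'))\<^sup>2 \<le> 7 * norm (escaping_leaf a y z - escaping_leaf a y z')" "(norm (escaping_leaf a y z - escaping_leaf a y z'))\<^sup>2 \<le> 7 * norm (z - z')"
proof -
  have "(norm (z - z'))\<^sup>2 \<le> 7 * norm (escaping_leaf a y z - escaping_leaf a y z') \<and> (norm (escaping_leaf a y z - escaping_leaf a y z'))\<^sup>2 \<le> 7 * norm (z - z')"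
  proof (cases "z = z'")
    case False
    define f where "f b = (escaping_leaf b y z - escaping_leaf b y z') / 7" for b
    have f: "f holomorphic_on ball 0 \<delta>" unfolding f_def by (intro holomorphic_intros escaping_leaf_hol z y) auto
    have nz: "f b \<noteq> 0" if "norm b < \<delta>" for b using escaping_leaf_inj[OF z that y False] by (simp add: f_def)
    have lt: "norm (f b) < 1" if "norm b < \<delta>" for b
      using escaping_leaf_le[OF z(1) that y] escaping_leaf_le[OF z(2) that y] norm_triangle_ineq4[of "escaping_leaf b y z" "escaping_leaf b y z'"]
      by (simp add: f_def norm_divide)
    have f0: "norm (f 0) = norm (z - z') / 7" using escaping_leaf_0[OF z(1) y] escaping_leaf_0[OF z(2) y] by (simp add: f_def norm_divide)
    have fa: "norm (f a) = norm (escaping_leaf a y z - escaping_leaf a y z') / 7" by (simp add: f_def norm_divide)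
    show ?thesis using harnack_nonvanishing[OF f nz lt delta(1) a] unfolding f0 fa by (simp add: power_divide)
  qed simp
  then show "(norm (z - z'))\<^sup>2 \<le> 7 * norm (escaping_leaf a y z - escaping_leaf a y z')" "(norm (escaping_leaf a y z - escaping_leaf a y z'))\<^sup>2 \<le> 7 * norm (z - z')" by auto
qed

text \<open>Leaf and base point have modulus at most 3, so a seventh of their difference is below 1;
  it vanishes at \<open>a = 0\<close>, and Schwarz's lemma on the rescaled disc applies.\<close>

lemma escaping_leaf_near:
  assumes z: "z \<in> escaping_pts" and a: "norm a < \<delta>" and y: "norm y < \<rho>"
  shows "norm (escaping_leaf a y z - z) \<le> 7 / \<delta> * norm a"
proof -
  define f where "f b = (escaping_leaf (of_real \<delta> * b) y z - z) / 7" for b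
  have db: "of_real \<delta> * b \<in> ball 0 \<delta>" if "norm b < 1" for b :: complex
    using that delta by (simp add: norm_mult)
  have "(\<lambda>b. escaping_leaf (of_real \<delta> * b) y z) holomorphic_on ball 0 1"
    by (rule holomorphic_on_compose_gen[OF _ escaping_leaf_hol[OF z y], unfolded o_def]) (use db in \<open>auto intro!: holomorphic_intros\<close>)
  then have f: "f holomorphic_on ball 0 1" unfolding f_def by (intro holomorphic_intros) auto
  have f0: "f 0 = 0" using escaping_leaf_0[OF z y] by (simp add: f_def)
  have lt: "norm (f b) < 1" if "norm b < 1" for b
    using escaping_leaf_le[OF z _ y, of "of_real \<delta> * b"] db[OF that] escaping_pts_le[OF z] norm_triangle_ineq4[of "escaping_leaf (of_real \<delta> * b) y z" z]
    by (simp add: f_def norm_divide)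
  have "norm (f (a / of_real \<delta>)) \<le> norm (a / of_real \<delta>)"
    by (rule Schwarz_Lemma(1)[OF f f0 lt]) (use a delta in \<open>auto simp: norm_divide\<close>)
  then show ?thesis using delta by (simp add: f_def norm_divide field_simps)
qed

lemma escaping_leaf_eq:
  assumes "z \<in> escaping_pts" "norm z < 3" "norm a < \<delta>" "norm y < \<rho>"
  shows "PP z \<in> escaping_pts" "(escaping_leaf a y z)\<^sup>2 = escaping_leaf a (a * escaping_leaf a y z) (PP z) - cc a - a * y"
proof -
  have l: "z \<in> level_set (level z)" by (rule escaping_pts_level[OF assms(1)])
  have "level z \<noteq> 0" using l assms(2) by (auto simp: level_set_def intro: ccontr)
  then obtain n where n: "level z = Suc n" by (cases "level z") auto
  have P: "PP z \<in> level_set n" using l n by (simp add: level_set_Suc)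
  then show "PP z \<in> escaping_pts" by (auto simp: escaping_pts_def)
  show "(escaping_leaf a y z)\<^sup>2 = escaping_leaf a (a * escaping_leaf a y z) (PP z) - cc a - a * y"
    using level_leaf_Suc[of z n a y] l n assms level_eq[OF P] by (simp add: escaping_leaf_def)
qed

lemma escaping_leaf_escapes:
  assumes "z \<in> escaping_pts" "norm a < \<delta>" "norm y < \<rho>" shows "\<exists>n. norm (X a n (escaping_leaf a y z) y) = 3"
proof -
  have "norm ((PP ^^ level z) z) = 3" using escaping_pts_level[OF assms(1)] unfolding level_set_def by simp
  then show ?thesis using X_level_leaf[OF escaping_pts_level[OF assms(1)] assms(2,3)] unfolding escaping_leaf_def by (intro exI[of _ "level z"]) simp
qed

lemma escaping_leaf_surj: "norm a < \<delta> \<Longrightarrow> norm y < \<rho> \<Longrightarrow> norm (X a n x y) = 3 \<Longrightarrow> \<exists>z\<in>escaping_pts. x = escaping_leaf a y z"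
  using level_leaf_surj[of a y n x] level_eq unfolding escaping_leaf_def escaping_pts_def by fastforce

end

section \<open>Limit leaves and the forward Julia set\<close>

lemma connected_attains_value:
  fixes h :: "'a::topological_space \<Rightarrow> real"
  assumes "connected S" "continuous_on S h" "u \<in> S" "v \<in> S" "h u \<le> c" "c \<le> h v"
  shows "\<exists>w\<in>S. h w = c"
proof -
  have "connected (h ` S)" by (rule connected_continuous_image[OF assms(2,1)])
  then have "c \<in> h ` S" using assms unfolding connected_iff_interval by (metis imageI)
  then show ?thesis by auto
qed

lemma closure_seq_eventually_near:
  assumes "z \<in> closure S" "open U" "z \<in> U"
  shows "z \<in> closure (S \<inter> U)"
  using open_Int_closure_subset[OF assms(2), of S] assms by (auto simp: Int_commute)

context henon_family
begin

lemma continuous_henon_funpow: "continuous_on UNIV (henon c a ^^ n)"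
proof (induction n)
  case (Suc n)
  have "continuous_on UNIV (henon c a)" unfolding henon_def case_prod_beta by (intro continuous_intros)
  then show ?case using Suc by (auto intro: continuous_on_compose2 simp: comp_def)
qed (simp add: id_def)

lemma continuous_X: "continuous_on UNIV (\<lambda>p. X a n (fst p) (snd p))"
  unfolding X_def by (auto intro!: continuous_intros continuous_henon_funpow)

lemma continuous_PP_funpow: "continuous_on UNIV (PP ^^ n)"
proof (induction n)
  case (Suc n)
  have "continuous_on UNIV PP" unfolding PP_def by (intro continuous_intros)
  then show ?case using Suc by (auto intro: continuous_on_compose2 simp: comp_def)
qed (simp add: id_def)

lemma escaped_forever:
  assumes "norm a < \<delta>" "norm y < \<rho>" "norm (X a n x y) \<ge> 3"
  shows "\<not> bounded (range (\<lambda>m. X a m x y))"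
proof
  assume "bounded (range (\<lambda>m. X a m x y))"
  then obtain B where B: "\<And>m. norm (X a m x y) \<le> B" by (auto simp: bounded_iff)
  obtain k where k: "B < 2 ^ k" using real_arch_pow[of 2 B] by auto
  have "2 ^ k * norm (X a n x y) \<le> norm (X a (n + k) x y)"
    by (rule X_growth[OF assms(1) tame_small[OF assms(1,2)] assms(3)])
  moreover have "2 ^ k * norm (X a n x y) \<ge> 2 ^ k * 1" using assms(3) by (intro mult_left_mono) auto
  ultimately show False using B[of "n + k"] k by simp
qed

text \<open>Once the first coordinate reaches modulus 3 it at least doubles at every step, and the
  second coordinate is \<open>a\<close> times the preceding first one, so the first coordinate
  decides boundedness.\<close>

lemma K_plus_iff:
  assumes "norm a < \<delta>" "norm y < \<rho>"
  shows "(x, y) \<in> K_plus (cc a) a \<longleftrightarrow> (\<forall>n. norm (X a n x y) < 3)"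
proof
  assume "(x, y) \<in> K_plus (cc a) a"
  then have "bounded (fst ` range (\<lambda>n. (henon (cc a) a ^^ n) (x, y)))"
    unfolding K_plus_def by (intro bounded_fst) simp
  then have "bounded (range (\<lambda>m. X a m x y))" by (simp add: X_def image_image)
  then show "\<forall>n. norm (X a n x y) < 3" using escaped_forever[OF assms] not_less by blast
next
  assume *: "\<forall>n. norm (X a n x y) < 3"
  have s: "snd ((henon (cc a) a ^^ Suc n) (x, y)) = a * X a n x y" for n
    by (simp add: X_def henon_def case_prod_beta)
  have "norm (snd ((henon (cc a) a ^^ n) (x, y))) \<le> \<rho>" for n
  proof (cases n)
    case 0
    then show ?thesis using assms by simp
  next
    case (Suc m)
    have "norm (a * X a m x y) < \<rho>" using norm_a_mult[OF assms(1)] * by (simp add: less_imp_le)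
    then show ?thesis using s[of m] Suc by simp
  qed
  then have 2: "bounded (range (\<lambda>n. snd ((henon (cc a) a ^^ n) (x, y))))" by (auto simp: bounded_iff)
  have 1: "bounded (range (\<lambda>n. fst ((henon (cc a) a ^^ n) (x, y))))"
    using * unfolding X_def by (auto simp: bounded_iff intro!: exI[of _ 3] less_imp_le)
  have "range (\<lambda>n. (henon (cc a) a ^^ n) (x, y)) \<subseteq> range (\<lambda>n. fst ((henon (cc a) a ^^ n) (x, y))) \<times> range (\<lambda>n. snd ((henon (cc a) a ^^ n) (x, y)))"
    by (intro subsetI) (auto simp: mem_Times_iff)
  then show "(x, y) \<in> K_plus (cc a) a" unfolding K_plus_def using bounded_subset[OF bounded_Times[OF 1 2]] by simp
qed

lemma PP_escape_mono: assumes "norm ((PP ^^ n) z) \<ge> 3" "n < m" shows "norm ((PP ^^ m) z) > 3"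
  using X_growth_gt[of 0 0 n z m] assms delta rho by (simp add: X_zero)

lemma filled_julia_iff: "z \<in> filled_julia PP \<longleftrightarrow> (\<forall>n. norm ((PP ^^ n) z) < 3)"
proof
  assume "z \<in> filled_julia PP"
  then have "bounded (range (\<lambda>m. X 0 m z 0))" by (simp add: filled_julia_def X_zero)
  then show "\<forall>n. norm ((PP ^^ n) z) < 3"
    using escaped_forever[of 0 0 _ z] delta rho not_less unfolding X_zero by (metis norm_zero less_trans zero_less_numeral)
next
  assume "\<forall>n. norm ((PP ^^ n) z) < 3"
  then show "z \<in> filled_julia PP" unfolding filled_julia_def by (auto simp: bounded_iff intro!: exI[of _ 3] less_imp_le)
qed

definition julia_pts :: "complex set" where
  "julia_pts = {z. (\<forall>n. norm ((PP ^^ n) z) < 3) \<and> z \<in> closure {w. \<exists>n. norm ((PP ^^ n) w) \<ge> 3}}"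

lemma julia_eq: "julia PP = julia_pts"
proof -
  have K: "filled_julia PP = {z. \<forall>n. norm ((PP ^^ n) z) < 3}" using filled_julia_iff by blast
  have K': "filled_julia PP = (\<Inter>n. {z. norm ((PP ^^ n) z) \<le> 3})"
  proof -
    have "norm ((PP ^^ n) z) < 3" if "\<And>n. norm ((PP ^^ n) z) \<le> 3" for n z
      using PP_escape_mono[of n z "Suc n"] that[of "Suc n"] by force
    then show ?thesis unfolding K by (auto intro: less_imp_le)
  qed
  have "closed (filled_julia PP)"
    unfolding K' by (intro closed_INT ballI closed_Collect_le continuous_intros continuous_PP_funpow)
  then have "julia PP = filled_julia PP \<inter> closure (- filled_julia PP)"
    by (simp add: julia_def frontier_closures)
  moreover have "- filled_julia PP = {w. \<exists>n. norm ((PP ^^ n) w) \<ge> 3}"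
    by (intro set_eqI) (simp add: filled_julia_iff not_less)
  ultimately show ?thesis unfolding julia_pts_def by (simp add: K Collect_conj_eq)
qed

lemma closed_julia_pts: "closed julia_pts"
  unfolding julia_eq[symmetric] julia_def by (rule frontier_closed)

lemma julia_pts_norm: "z \<in> julia_pts \<Longrightarrow> norm z < 3"
  unfolding julia_pts_def by (auto dest: spec[of _ 0])

lemma compact_julia_pts: "compact julia_pts"
  unfolding compact_eq_bounded_closed using closed_julia_pts julia_pts_norm by (auto simp: bounded_iff intro!: exI[of _ 3] less_imp_le)

lemma escaping_pts_norm: "z \<in> escaping_pts \<longleftrightarrow> (\<exists>n. norm ((PP ^^ n) z) = 3)"
  by (simp add: escaping_pts_def level_set_def)

lemma escaping_pts_escaping: "escaping_pts \<subseteq> {w. \<exists>n. norm ((PP ^^ n) w) \<ge> 3}"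
  using escaping_pts_norm by (metis (mono_tags, lifting) mem_Collect_eq order_refl subsetI)

text \<open>On a small disc some \<open>\<bar>P\<^sup>n\<bar>\<close> is at most 3 at the centre and
  at least 3 at a nearby escaping point, hence equals 3 somewhere in the disc.\<close>

lemma julia_pts_closure_escaping_pts: assumes "z \<in> julia_pts" shows "z \<in> closure escaping_pts"
  unfolding closure_approachable
proof (intro allI impI)
  fix r :: real assume r: "r > 0"
  have "z \<in> closure {w. \<exists>n. norm ((PP ^^ n) w) \<ge> 3}" using assms by (simp add: julia_pts_def)
  then obtain w n where w: "norm ((PP ^^ n) w) \<ge> 3" "dist w z < r" using r unfolding closure_approachable by blast
  have "\<exists>u\<in>ball z r. norm ((PP ^^ n) u) = 3"
  proof (rule connected_attains_value[of _ _ z w])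
    show "continuous_on (ball z r) (\<lambda>u. norm ((PP ^^ n) u))"
      by (intro continuous_intros continuous_on_subset[OF continuous_PP_funpow]) auto
    show "norm ((PP ^^ n) z) \<le> 3" using assms by (auto simp: julia_pts_def intro: less_imp_le)
  qed (use w r in \<open>auto simp: dist_commute\<close>)
  then obtain u where "u \<in> ball z r" "u \<in> escaping_pts" using escaping_pts_norm by blast
  then show "\<exists>u\<in>escaping_pts. dist u z < r" by (auto simp: dist_commute)
qed

text \<open>If the limit itself escapes, then nearby points have already passed modulus 3 at a fixed
  time \<open>N\<close>. Their levels are at most \<open>N\<close>, and finitely many level sets
  form a closed set.\<close>

lemma closure_escaping_pts: assumes "z \<in> closure escaping_pts" shows "z \<in> escaping_pts \<or> z \<in> julia_pts"
proof (cases "\<forall>n. norm ((PP ^^ n) z) < 3")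
  case True
  then show ?thesis using assms closure_mono[OF escaping_pts_escaping] unfolding julia_pts_def by blast
next
  case False
  then obtain n where "norm ((PP ^^ n) z) \<ge> 3" by (auto simp: not_less)
  then obtain N where N: "norm ((PP ^^ N) z) > 3" using PP_escape_mono[of n z "Suc n"] by blast
  define U where "U = {u. norm ((PP ^^ N) u) > 3}"
  have "open U" unfolding U_def by (intro open_Collect_less continuous_intros continuous_PP_funpow)
  with assms have z: "z \<in> closure (escaping_pts \<inter> U)" by (rule closure_seq_eventually_near) (use N in \<open>simp add: U_def\<close>)
  have "escaping_pts \<inter> U \<subseteq> (\<Union>m\<in>{..N}. level_set m)"
  proof
    fix u assume u: "u \<in> escaping_pts \<inter> U"
    then obtain m where m: "u \<in> level_set m" by (auto simp: escaping_pts_def)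
    have "\<not> N < m" using PP_escape_mono[of N u m] u m by (auto simp: U_def level_set_def)
    then show "u \<in> (\<Union>m\<in>{..N}. level_set m)" using m by auto
  qed
  moreover have "closed (\<Union>m\<in>{..N}. level_set m)"
    unfolding level_set_def by (intro closed_UN finite_atMost ballI closed_Collect_eq continuous_intros continuous_PP_funpow)
  ultimately have "z \<in> (\<Union>m\<in>{..N}. level_set m)" using z closure_minimal by blast
  then show ?thesis by (auto simp: escaping_pts_def)
qed

definition limit_leaf :: "complex \<Rightarrow> complex \<Rightarrow> complex \<Rightarrow> complex" where
  "limit_leaf a y = (SOME h. continuous_on (closure escaping_pts) h \<and> (\<forall>z\<in>escaping_pts. h z = escaping_leaf a y z))"

lemma limit_leaf: assumes "norm a \<le> \<delta> / 3" "norm y < \<rho>"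
  shows "continuous_on (closure escaping_pts) (limit_leaf a y)" "\<And>z. z \<in> escaping_pts \<Longrightarrow> limit_leaf a y z = escaping_leaf a y z"
proof -
  have "uniformly_continuous_on escaping_pts (escaping_leaf a y)"
    unfolding uniformly_continuous_on_def
  proof (intro allI impI)
    fix r :: real assume r: "r > 0"
    show "\<exists>d>0. \<forall>x\<in>escaping_pts. \<forall>x'\<in>escaping_pts. dist x' x < d \<longrightarrow> dist (escaping_leaf a y x') (escaping_leaf a y x) < r"
    proof (intro exI[of _ "r\<^sup>2 / 7"] conjI ballI impI)
      fix x x' assume x: "x \<in> escaping_pts" "x' \<in> escaping_pts" "dist x' x < r\<^sup>2 / 7"
      then have "(norm (escaping_leaf a y x' - escaping_leaf a y x))\<^sup>2 < r\<^sup>2"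
        using escaping_leaf_holder(2)[OF x(2,1) assms] by (simp add: dist_norm)
      then show "dist (escaping_leaf a y x') (escaping_leaf a y x) < r" using r by (simp add: dist_norm power2_less_imp_less)
    qed (use r in simp)
  qed
  then obtain h where "uniformly_continuous_on (closure escaping_pts) h" "\<And>z. z \<in> escaping_pts \<Longrightarrow> escaping_leaf a y z = h z"
    by (rule uniformly_continuous_on_extension_on_closure) blast
  then have "\<exists>h. continuous_on (closure escaping_pts) h \<and> (\<forall>z\<in>escaping_pts. h z = escaping_leaf a y z)"
    by (intro exI[of _ h]) (auto intro: uniformly_continuous_imp_continuous)
  from someI_ex[OF this]
  show "continuous_on (closure escaping_pts) (limit_leaf a y)" "\<And>z. z \<in> escaping_pts \<Longrightarrow> limit_leaf a y z = escaping_leaf a y z"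
    unfolding limit_leaf_def by blast+
qed

lemma limit_leaf_seq: assumes "norm a \<le> \<delta> / 3" "norm y < \<rho>" "\<And>k. z k \<in> escaping_pts" "z \<longlonglongrightarrow> \<zeta>"
  shows "(\<lambda>k. escaping_leaf a y (z k)) \<longlonglongrightarrow> limit_leaf a y \<zeta>"
proof -
  have "\<zeta> \<in> closure escaping_pts" using assms(3,4) closure_sequential by blast
  then have "(\<lambda>k. limit_leaf a y (z k)) \<longlonglongrightarrow> limit_leaf a y \<zeta>"
    using limit_leaf(1)[OF assms(1,2)] assms(3,4) closure_subset[of escaping_pts] unfolding continuous_on_sequentially by (auto simp: comp_def)
  then show ?thesis using limit_leaf(2)[OF assms(1,2) assms(3)] by simp
qed

lemma julia_pts_seq: assumes "\<zeta> \<in> julia_pts" obtains z where "\<And>k. z k \<in> escaping_pts" "\<And>k. norm (z k) < 3" "z \<longlonglongrightarrow> \<zeta>"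
proof -
  have "\<zeta> \<in> closure (escaping_pts \<inter> ball 0 3)"
    using julia_pts_closure_escaping_pts[OF assms] julia_pts_norm[OF assms] by (intro closure_seq_eventually_near) auto
  then show ?thesis using that unfolding closure_sequential by fastforce
qed

lemma a_third: "norm a \<le> \<delta> / 3 \<Longrightarrow> norm a < \<delta>"
  using delta by linarith

lemma limit_leaf_holder:
  assumes \<zeta>: "\<zeta> \<in> julia_pts" "\<zeta>' \<in> julia_pts" and a: "norm a \<le> \<delta> / 3" and y: "norm y < \<rho>"
  shows "(norm (\<zeta> - \<zeta>'))\<^sup>2 \<le> 7 * norm (limit_leaf a y \<zeta> - limit_leaf a y \<zeta>')" "(norm (limit_leaf a y \<zeta> - limit_leaf a y \<zeta>'))\<^sup>2 \<le> 7 * norm (\<zeta> - \<zeta>')"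
proof -
  obtain z where z: "\<And>k. z k \<in> escaping_pts" "z \<longlonglongrightarrow> \<zeta>" using julia_pts_seq[OF \<zeta>(1)] by metis
  obtain z' where z': "\<And>k. z' k \<in> escaping_pts" "z' \<longlonglongrightarrow> \<zeta>'" using julia_pts_seq[OF \<zeta>(2)] by metis
  note l = limit_leaf_seq[OF a y z] limit_leaf_seq[OF a y z']
  have l1: "(\<lambda>k. (norm (z k - z' k))\<^sup>2) \<longlonglongrightarrow> (norm (\<zeta> - \<zeta>'))\<^sup>2"
    and l2: "(\<lambda>k. 7 * norm (escaping_leaf a y (z k) - escaping_leaf a y (z' k))) \<longlonglongrightarrow> 7 * norm (limit_leaf a y \<zeta> - limit_leaf a y \<zeta>')"
    and l3: "(\<lambda>k. (norm (escaping_leaf a y (z k) - escaping_leaf a y (z' k)))\<^sup>2) \<longlonglongrightarrow> (norm (limit_leaf a y \<zeta> - limit_leaf a y \<zeta>'))\<^sup>2"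
    and l4: "(\<lambda>k. 7 * norm (z k - z' k)) \<longlonglongrightarrow> 7 * norm (\<zeta> - \<zeta>')"
    by (intro tendsto_intros l z z')+
  show "(norm (\<zeta> - \<zeta>'))\<^sup>2 \<le> 7 * norm (limit_leaf a y \<zeta> - limit_leaf a y \<zeta>')"
    by (rule LIMSEQ_le[OF l1 l2]) (use escaping_leaf_holder(1)[OF z(1) z'(1) a y] in blast)
  show "(norm (limit_leaf a y \<zeta> - limit_leaf a y \<zeta>'))\<^sup>2 \<le> 7 * norm (\<zeta> - \<zeta>')"
    by (rule LIMSEQ_le[OF l3 l4]) (use escaping_leaf_holder(2)[OF z(1) z'(1) a y] in blast)
qed

lemma limit_leaf_lip:
  assumes \<zeta>: "\<zeta> \<in> closure escaping_pts" and a: "norm a \<le> \<delta> / 3" and y: "norm y < \<rho>" "norm y' < \<rho>"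
  shows "norm (limit_leaf a y \<zeta> - limit_leaf a y' \<zeta>) \<le> norm (y - y')"
proof -
  obtain z where z: "\<And>k. z k \<in> escaping_pts" "z \<longlonglongrightarrow> \<zeta>" using \<zeta> unfolding closure_sequential by metis
  have "(\<lambda>k. norm (escaping_leaf a y (z k) - escaping_leaf a y' (z k))) \<longlonglongrightarrow> norm (limit_leaf a y \<zeta> - limit_leaf a y' \<zeta>)"
    by (intro tendsto_intros limit_leaf_seq a y z)
  then show ?thesis by (rule LIMSEQ_le_const2) (use escaping_leaf_lip[OF z(1) a_third[OF a] y] in blast)
qed

lemma limit_leaf_le:
  assumes \<zeta>: "\<zeta> \<in> closure escaping_pts" and a: "norm a \<le> \<delta> / 3" and y: "norm y < \<rho>"
  shows "norm (limit_leaf a y \<zeta>) \<le> 3"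
proof -
  obtain z where z: "\<And>k. z k \<in> escaping_pts" "z \<longlonglongrightarrow> \<zeta>" using \<zeta> unfolding closure_sequential by metis
  have "(\<lambda>k. norm (escaping_leaf a y (z k))) \<longlonglongrightarrow> norm (limit_leaf a y \<zeta>)"
    by (intro tendsto_intros limit_leaf_seq a y z)
  then show ?thesis by (rule LIMSEQ_le_const2) (use escaping_leaf_le[OF z(1) a_third[OF a] y] in blast)
qed

lemma limit_leaf_near:
  assumes \<zeta>: "\<zeta> \<in> julia_pts" and a: "norm a \<le> \<delta> / 3" and y: "norm y < \<rho>"
  shows "norm (limit_leaf a y \<zeta> - \<zeta>) \<le> 7 / \<delta> * norm a"
proof -
  obtain z where z: "\<And>k. z k \<in> escaping_pts" "z \<longlonglongrightarrow> \<zeta>" using julia_pts_seq[OF \<zeta>] by metis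
  have "(\<lambda>k. norm (escaping_leaf a y (z k) - z k)) \<longlonglongrightarrow> norm (limit_leaf a y \<zeta> - \<zeta>)"
    by (intro tendsto_intros limit_leaf_seq a y z)
  then show ?thesis by (rule LIMSEQ_le_const2) (use escaping_leaf_near[OF z(1) a_third[OF a] y] in blast)
qed

lemma PP_julia_pts: assumes "\<zeta> \<in> julia_pts" shows "PP \<zeta> \<in> julia_pts"
proof -
  have "norm ((PP ^^ n) (PP \<zeta>)) < 3" for n
  proof -
    have "norm ((PP ^^ Suc n) \<zeta>) < 3" using assms unfolding julia_pts_def by blast
    then show ?thesis by (simp add: funpow_swap1)
  qed
  moreover have "PP \<zeta> \<in> closure {w. \<exists>n. norm ((PP ^^ n) w) \<ge> 3}"
  proof -
    have "\<zeta> \<in> closure {w. \<exists>n. norm ((PP ^^ n) w) \<ge> 3}" using assms by (simp add: julia_pts_def)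
    then obtain w where w: "\<And>k. \<exists>n. norm ((PP ^^ n) (w k)) \<ge> 3" "w \<longlonglongrightarrow> \<zeta>" unfolding closure_sequential by blast
    have "\<exists>n. norm ((PP ^^ n) (PP (w k))) \<ge> 3" for k
    proof -
      obtain n where "norm ((PP ^^ n) (w k)) \<ge> 3" using w by blast
      then have "norm ((PP ^^ Suc n) (w k)) > 3" by (rule PP_escape_mono) simp
      then show ?thesis by (intro exI[of _ n]) (simp add: funpow_swap1)
    qed
    moreover have "(\<lambda>k. PP (w k)) \<longlonglongrightarrow> PP \<zeta>" unfolding PP_def by (intro tendsto_intros w)
    ultimately show ?thesis unfolding closure_sequential by (intro exI[of _ "\<lambda>k. PP (w k)"]) simp
  qed
  ultimately show ?thesis by (simp add: julia_pts_def)
qed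

lemma escaping_ge: assumes "norm ((PP ^^ n) w) \<ge> 3" shows "norm (w - cc 0) \<ge> e\<^sup>2"
  using avoid'[of 0 0 0 n w] assms delta rho by (simp add: X_zero)

lemma julia_pts_diff_ge: assumes "\<zeta> \<in> julia_pts" shows "norm (\<zeta> - cc 0) \<ge> e\<^sup>2"
proof -
  have "\<zeta> \<in> closure {w. \<exists>n. norm ((PP ^^ n) w) \<ge> 3}" using assms by (simp add: julia_pts_def)
  moreover have "closed {w. e\<^sup>2 \<le> norm (w - cc 0)}" by (intro closed_Collect_le continuous_intros)
  moreover have "{w. \<exists>n. norm ((PP ^^ n) w) \<ge> 3} \<subseteq> {w. e\<^sup>2 \<le> norm (w - cc 0)}" using escaping_ge by blast
  ultimately show ?thesis using closure_minimal by blast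
qed

text \<open>A distance \<open>e^2\<close> from the critical value becomes a distance
  \<open>e\<close> from the critical point under the square root. This bounds \<open>P'\<close> from
  below on the Julia set.\<close>

lemma preimage_ge: assumes "PP w \<in> julia_pts" shows "norm w \<ge> e"
proof -
  have "e\<^sup>2 \<le> (norm w)\<^sup>2" using julia_pts_diff_ge[OF assms] by (simp add: PP_def flip: norm_power)
  then show ?thesis by (rule power2_le_imp_le) simp
qed

lemma julia_pts_ge: "\<zeta> \<in> julia_pts \<Longrightarrow> norm \<zeta> \<ge> e"
  by (rule preimage_ge[OF PP_julia_pts])

text \<open>The local inverse of \<open>PP\<close> sending \<open>PP w\<close> to \<open>w\<close>;
  after the normalization by \<open>w^2\<close> the principal root is taken near 1, away from its
  cut.\<close>

definition PP_branch :: "complex \<Rightarrow> complex \<Rightarrow> complex" where "PP_branch w v = w * csqrt ((v - cc 0) / w\<^sup>2)"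

lemma PP_branch: assumes "w \<noteq> 0" shows "PP (PP_branch w v) = v" "PP_branch w (PP w) = w" "isCont (PP_branch w) (PP w)"
proof -
  show "PP (PP_branch w v) = v" using assms by (simp add: PP_def PP_branch_def power_mult_distrib)
  show "PP_branch w (PP w) = w" using assms by (simp add: PP_def PP_branch_def)
  have "(PP w - cc 0) / w\<^sup>2 = 1" using assms by (simp add: PP_def)
  then have "isCont csqrt ((PP w - cc 0) / w\<^sup>2)" by (intro continuous_at_csqrt) auto
  moreover have "isCont (\<lambda>v. (v - cc 0) / w\<^sup>2) (PP w)" by (intro continuous_intros) (simp add: assms)
  ultimately have "isCont (\<lambda>v. csqrt ((v - cc 0) / w\<^sup>2)) (PP w)" by (rule isCont_o2[rotated])
  then show "isCont (PP_branch w) (PP w)" unfolding PP_branch_def by (intro continuous_mult continuous_const)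
qed

lemma PP_julia_pts_converse: assumes "PP w \<in> julia_pts" shows "w \<in> julia_pts"
proof -
  have w0: "w \<noteq> 0" using preimage_ge[OF assms] e0 by auto
  have "norm ((PP ^^ n) w) < 3" for n
  proof (rule ccontr)
    assume "\<not> norm ((PP ^^ n) w) < 3"
    then have "norm ((PP ^^ Suc n) w) > 3" by (intro PP_escape_mono[of n]) auto
    moreover have "norm ((PP ^^ n) (PP w)) < 3" using assms unfolding julia_pts_def by blast
    ultimately show False by (simp add: funpow_swap1)
  qed
  moreover have "w \<in> closure {w. \<exists>n. norm ((PP ^^ n) w) \<ge> 3}"
  proof -
    have "PP w \<in> closure {w. \<exists>n. norm ((PP ^^ n) w) \<ge> 3}" using assms by (simp add: julia_pts_def)
    then obtain v where v: "\<And>k. \<exists>n. norm ((PP ^^ n) (v k)) \<ge> 3" "v \<longlonglongrightarrow> PP w" unfolding closure_sequential by blast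
    have "\<exists>n. norm ((PP ^^ n) (PP_branch w (v k))) \<ge> 3" for k
    proof -
      obtain n where "norm ((PP ^^ n) (v k)) \<ge> 3" using v by blast
      then have "norm ((PP ^^ Suc n) (PP_branch w (v k))) \<ge> 3" using PP_branch(1)[OF w0] by (simp add: funpow_swap1)
      then show ?thesis by blast
    qed
    moreover have "(\<lambda>k. PP_branch w (v k)) \<longlonglongrightarrow> w"
      using isCont_tendsto_compose[OF PP_branch(3)[OF w0] v(2)] PP_branch(2)[OF w0] by simp
    ultimately show ?thesis unfolding closure_sequential by (intro exI[of _ "\<lambda>k. PP_branch w (v k)"]) simp
  qed
  ultimately show ?thesis by (simp add: julia_pts_def)
qed

text \<open>The leaf equation passes to the limit. The height \<open>a * xk k\<close> on its
  right-hand side moves as well, which the uniform Lipschitz bound of the leaves absorbs; base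
  points of modulus below 3 are used because leaves of level 0 satisfy no such equation.\<close>

lemma limit_leaf_eq:
  assumes \<zeta>: "\<zeta> \<in> julia_pts" and a: "norm a \<le> \<delta> / 3" and y: "norm y < \<rho>"
  shows "(limit_leaf a y \<zeta>)\<^sup>2 = limit_leaf a (a * limit_leaf a y \<zeta>) (PP \<zeta>) - cc a - a * y"
proof -
  obtain z where z: "\<And>k. z k \<in> escaping_pts" "\<And>k. norm (z k) < 3" "z \<longlonglongrightarrow> \<zeta>" using julia_pts_seq[OF \<zeta>] by metis
  note a' = a_third[OF a]
  define x where "x = limit_leaf a y \<zeta>"
  define xk where "xk k = escaping_leaf a y (z k)" for k
  have xk: "xk \<longlonglongrightarrow> x" unfolding x_def xk_def by (rule limit_leaf_seq[OF a y z(1,3)])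
  have xle: "norm x \<le> 3" unfolding x_def by (rule limit_leaf_le[OF julia_pts_closure_escaping_pts[OF \<zeta>] a y])
  have ax: "norm (a * x) < \<rho>" by (rule norm_a_mult[OF a' xle])
  have axk: "norm (a * xk k) < \<rho>" for k unfolding xk_def by (rule norm_a_mult[OF a' escaping_leaf_le[OF z(1) a' y]])
  have "(\<lambda>k. PP (z k)) \<longlonglongrightarrow> PP \<zeta>" unfolding PP_def by (intro tendsto_intros z)
  then have 1: "(\<lambda>k. escaping_leaf a (a * x) (PP (z k))) \<longlonglongrightarrow> limit_leaf a (a * x) (PP \<zeta>)"
    using escaping_leaf_eq(1)[OF z(1,2) a' y] by (intro limit_leaf_seq a ax) auto
  have "(\<lambda>k. norm (a * xk k - a * x)) \<longlonglongrightarrow> norm (a * x - a * x)" by (intro tendsto_intros xk)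
  then have "(\<lambda>k. norm (a * xk k - a * x)) \<longlonglongrightarrow> 0" by simp
  then have "(\<lambda>k. escaping_leaf a (a * xk k) (PP (z k)) - escaping_leaf a (a * x) (PP (z k))) \<longlonglongrightarrow> 0"
    by (rule Lim_null_comparison[OF always_eventually, rotated])
       (use escaping_leaf_lip[OF escaping_leaf_eq(1)[OF z(1,2) a' y] a' axk ax] in blast)
  from tendsto_add[OF this 1] have "(\<lambda>k. escaping_leaf a (a * xk k) (PP (z k))) \<longlonglongrightarrow> limit_leaf a (a * x) (PP \<zeta>)" by simp
  then have "(\<lambda>k. escaping_leaf a (a * xk k) (PP (z k)) - cc a - a * y) \<longlonglongrightarrow> limit_leaf a (a * x) (PP \<zeta>) - cc a - a * y" by (intro tendsto_intros)
  moreover have "(xk k)\<^sup>2 = escaping_leaf a (a * xk k) (PP (z k)) - cc a - a * y" for k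
    unfolding xk_def by (rule escaping_leaf_eq(2)[OF z(1,2) a' y])
  ultimately have "(\<lambda>k. (xk k)\<^sup>2) \<longlonglongrightarrow> limit_leaf a (a * x) (PP \<zeta>) - cc a - a * y" by simp
  moreover have "(\<lambda>k. (xk k)\<^sup>2) \<longlonglongrightarrow> x\<^sup>2" by (intro tendsto_intros xk)
  ultimately have "x\<^sup>2 = limit_leaf a (a * x) (PP \<zeta>) - cc a - a * y" using LIMSEQ_unique by blast
  then show ?thesis by (simp add: x_def)
qed

lemma limit_leaf_a_bound: assumes "\<zeta> \<in> julia_pts" "norm a \<le> \<delta> / 3" "norm y < \<rho>" shows "norm (a * limit_leaf a y \<zeta>) < \<rho>"
  by (rule norm_a_mult[OF a_third[OF assms(2)] limit_leaf_le[OF julia_pts_closure_escaping_pts[OF assms(1)] assms(2,3)]])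

lemma X_limit_leaf: "\<zeta> \<in> julia_pts \<Longrightarrow> norm a \<le> \<delta> / 3 \<Longrightarrow> norm y < \<rho> \<Longrightarrow> norm (X a n (limit_leaf a y \<zeta>) y) \<le> 3"
proof (induction n arbitrary: \<zeta> y)
  case 0
  then show ?case using limit_leaf_le[OF julia_pts_closure_escaping_pts] by simp
next
  case (Suc n)
  have "(limit_leaf a y \<zeta>)\<^sup>2 + cc a + a * y = limit_leaf a (a * limit_leaf a y \<zeta>) (PP \<zeta>)" using limit_leaf_eq[OF Suc.prems] by simp
  then show ?case
    unfolding X_Suc using Suc.IH[OF PP_julia_pts[OF Suc.prems(1)] Suc.prems(2) limit_leaf_a_bound[OF Suc.prems]] by simp
qed

text \<open>A boundary point is a limit of escaping points. On the segment to each of them some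
  iterate has first coordinate of modulus exactly 3, which gives a point on the leaf of an escaping
  point; a convergent subsequence of the base points yields \<open>\<zeta>\<close>, which cannot be
  escaping because the boundary point is not. Conversely, a limit leaf consists of bounded points
  and is approximated by leaves of escaping points.\<close>

theorem J_plus_eq:
  assumes a: "norm a \<le> \<delta> / 3" and r: "3 < r" "r \<le> \<rho>"
  shows "J_plus (cc a) a \<inter> (ball 0 r \<times> ball 0 r) = (\<lambda>(\<zeta>, y). (limit_leaf a y \<zeta>, y)) ` (julia_pts \<times> ball 0 r)"
proof (intro equalityI subsetI)
  note a' = a_third[OF a]
  fix w assume "w \<in> J_plus (cc a) a \<inter> (ball 0 r \<times> ball 0 r)"
  then obtain x y where w: "w = (x, y)" "(x, y) \<in> frontier (K_plus (cc a) a)" "norm x < r" "norm y < r"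
    by (cases w) (auto simp: J_plus_def)
  have y: "norm y < \<rho>" using w r by simp
  define S where "S = (UNIV :: complex set) \<times> ball (0::complex) \<rho>"
  have oS: "open S" unfolding S_def by (intro open_Times) auto
  have inS: "(x, y) \<in> S" using y by (simp add: S_def)
  have le3: "norm (X a n x y) \<le> 3" for n
  proof -
    have "(x, y) \<in> closure (K_plus (cc a) a)" using w(2) by (simp add: frontier_def)
    then have "(x, y) \<in> closure (K_plus (cc a) a \<inter> S)" by (rule closure_seq_eventually_near[OF _ oS inS])
    moreover have "closed {p. norm (X a n (fst p) (snd p)) \<le> 3}" by (intro closed_Collect_le continuous_intros continuous_X)
    moreover have "K_plus (cc a) a \<inter> S \<subseteq> {p. norm (X a n (fst p) (snd p)) \<le> 3}"
      using K_plus_iff[OF a'] by (auto simp: S_def intro: less_imp_le)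
    ultimately have "(x, y) \<in> {p. norm (X a n (fst p) (snd p)) \<le> 3}" using closure_minimal by blast
    then show ?thesis by simp
  qed
  have "(x, y) \<in> closure (- K_plus (cc a) a)" using w(2) by (simp add: frontier_closures)
  then have "(x, y) \<in> closure (- K_plus (cc a) a \<inter> S)" by (rule closure_seq_eventually_near[OF _ oS inS])
  then obtain p where p: "\<And>k. p k \<in> - K_plus (cc a) a \<inter> S" "p \<longlonglongrightarrow> (x, y)" unfolding closure_sequential by blast
  have "\<exists>p' z. z \<in> escaping_pts \<and> p' \<in> closed_segment (x, y) (p k) \<and> norm (snd p') < \<rho> \<and> fst p' = escaping_leaf a (snd p') z" for k
  proof -
    have pk: "norm (snd (p k)) < \<rho>" "(fst (p k), snd (p k)) \<notin> K_plus (cc a) a" using p(1)[of k] by (auto simp: S_def)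
    then obtain n where n: "norm (X a n (fst (p k)) (snd (p k))) \<ge> 3"
      using K_plus_iff[OF a' pk(1), of "fst (p k)"] by (auto simp: not_less)
    have "\<exists>p'\<in>closed_segment (x, y) (p k). norm (X a n (fst p') (snd p')) = 3"
    proof (rule connected_attains_value[of _ _ "(x, y)" "p k"])
      show "continuous_on (closed_segment (x, y) (p k)) (\<lambda>p. norm (X a n (fst p) (snd p)))"
        by (intro continuous_intros continuous_on_subset[OF continuous_X]) auto
    qed (use le3 n in auto)
    then obtain p' where p': "p' \<in> closed_segment (x, y) (p k)" "norm (X a n (fst p') (snd p')) = 3" by blast
    have "convex S" unfolding S_def by (intro convex_Times) auto
    then have "p' \<in> S" using p'(1) inS p(1)[of k] closed_segment_subset by blast
    then have "norm (snd p') < \<rho>" by (auto simp: S_def)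
    then show ?thesis using escaping_leaf_surj[OF a' _ p'(2)] p'(1) by blast
  qed
  then obtain p' z where z: "\<And>k. z k \<in> escaping_pts" and p': "\<And>k. p' k \<in> closed_segment (x, y) (p k)" "\<And>k. norm (snd (p' k)) < \<rho>"
    and eq: "\<And>k. fst (p' k) = escaping_leaf a (snd (p' k)) (z k)" by metis
  have p'lim: "p' \<longlonglongrightarrow> (x, y)"
  proof -
    have "(\<lambda>k. norm (p k - (x, y))) \<longlonglongrightarrow> norm ((x, y) - (x, y))" by (intro tendsto_intros p)
    then have "(\<lambda>k. norm (p k - (x, y))) \<longlonglongrightarrow> 0" by simp
    then have "(\<lambda>k. p' k - (x, y)) \<longlonglongrightarrow> 0"
      by (rule Lim_null_comparison[OF always_eventually, rotated]) (use segment_bound(1)[OF p'(1)] in \<open>auto simp: norm_minus_commute\<close>)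
    then show ?thesis by (rule LIM_zero_cancel)
  qed
  have "bounded (range z)" using escaping_pts_le[OF z] by (auto simp: bounded_iff)
  then obtain \<zeta> \<sigma> where \<sigma>: "strict_mono (\<sigma> :: nat \<Rightarrow> nat)" "(\<lambda>k. z (\<sigma> k)) \<longlonglongrightarrow> \<zeta>"
    using bounded_imp_convergent_subsequence[of z] by (auto simp: comp_def)
  have \<zeta>: "\<zeta> \<in> closure escaping_pts" using z \<sigma>(2) unfolding closure_sequential by (intro exI[of _ "\<lambda>k. z (\<sigma> k)"]) auto
  have q: "(\<lambda>k. p' (\<sigma> k)) \<longlonglongrightarrow> (x, y)" using LIMSEQ_subseq_LIMSEQ[OF p'lim \<sigma>(1)] by (simp add: comp_def)
  have sy: "(\<lambda>k. snd (p' (\<sigma> k))) \<longlonglongrightarrow> y" and sx: "(\<lambda>k. fst (p' (\<sigma> k))) \<longlonglongrightarrow> x"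
    using tendsto_snd[OF q] tendsto_fst[OF q] by simp_all
  have 1: "(\<lambda>k. escaping_leaf a y (z (\<sigma> k))) \<longlonglongrightarrow> limit_leaf a y \<zeta>" by (rule limit_leaf_seq[OF a y z \<sigma>(2)])
  have "(\<lambda>k. norm (snd (p' (\<sigma> k)) - y)) \<longlonglongrightarrow> norm (y - y)" by (intro tendsto_intros sy)
  then have "(\<lambda>k. norm (snd (p' (\<sigma> k)) - y)) \<longlonglongrightarrow> 0" by simp
  then have "(\<lambda>k. escaping_leaf a (snd (p' (\<sigma> k))) (z (\<sigma> k)) - escaping_leaf a y (z (\<sigma> k))) \<longlonglongrightarrow> 0"
    by (rule Lim_null_comparison[OF always_eventually, rotated]) (use escaping_leaf_lip[OF z a' p'(2) y] in blast)
  from tendsto_add[OF this 1] have "(\<lambda>k. fst (p' (\<sigma> k))) \<longlonglongrightarrow> limit_leaf a y \<zeta>" by (simp add: eq)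
  then have xeq: "x = limit_leaf a y \<zeta>" using LIMSEQ_unique[OF sx] by blast
  have "\<zeta> \<notin> escaping_pts"
  proof
    assume Z: "\<zeta> \<in> escaping_pts"
    then obtain n where "norm (X a n x y) = 3" using escaping_leaf_escapes[OF Z a' y] limit_leaf(2)[OF a y Z] xeq by auto
    then have "norm (X a (Suc n) x y) > 3" using X_growth_gt[OF a' y, of n x "Suc n"] by simp
    then show False using le3[of "Suc n"] by simp
  qed
  then have "\<zeta> \<in> julia_pts" using closure_escaping_pts[OF \<zeta>] by blast
  then show "w \<in> (\<lambda>(\<zeta>, y). (limit_leaf a y \<zeta>, y)) ` (julia_pts \<times> ball 0 r)" using w xeq by force
next
  note a' = a_third[OF a]
  fix w assume "w \<in> (\<lambda>(\<zeta>, y). (limit_leaf a y \<zeta>, y)) ` (julia_pts \<times> ball 0 r)"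
  then obtain \<zeta> y where w: "w = (limit_leaf a y \<zeta>, y)" "\<zeta> \<in> julia_pts" "norm y < r" by auto
  have y: "norm y < \<rho>" using w r by simp
  have lt3: "norm (X a n (limit_leaf a y \<zeta>) y) < 3" for n
  proof (rule ccontr)
    assume "\<not> norm (X a n (limit_leaf a y \<zeta>) y) < 3"
    then have "norm (X a (Suc n) (limit_leaf a y \<zeta>) y) > 3" using X_growth_gt[OF a' y, of n _ "Suc n"] by simp
    then show False using X_limit_leaf[OF w(2) a y, of "Suc n"] by simp
  qed
  then have K: "w \<in> K_plus (cc a) a" using K_plus_iff[OF a' y] w by simp
  obtain z where z: "\<And>k. z k \<in> escaping_pts" "z \<longlonglongrightarrow> \<zeta>" using julia_pts_seq[OF w(2)] by metis
  have "(\<lambda>k. (escaping_leaf a y (z k), y)) \<longlonglongrightarrow> w" unfolding w(1) by (intro tendsto_intros limit_leaf_seq a y z)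
  moreover have "(escaping_leaf a y (z k), y) \<in> - K_plus (cc a) a" for k
    using escaping_leaf_escapes[OF z(1) a' y, of k] K_plus_iff[OF a' y] by (metis ComplI less_irrefl)
  ultimately have "w \<in> closure (- K_plus (cc a) a)" unfolding closure_sequential by (intro exI[of _ "\<lambda>k. (escaping_leaf a y (z k), y)"]) auto
  then have "w \<in> J_plus (cc a) a" using K closure_subset unfolding J_plus_def frontier_closures by blast
  moreover have "norm (limit_leaf a y \<zeta>) < r" using lt3[of 0] r by simp
  ultimately show "w \<in> J_plus (cc a) a \<inter> (ball 0 r \<times> ball 0 r)" using w by simp
qed

end

section \<open>Conjugacy of fibrewise contractions\<close>

lemma geometric_uniform_limit:
  fixes f :: "nat \<Rightarrow> 'a \<Rightarrow> 'b::complete_space"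
  assumes step: "\<And>n x. x \<in> S \<Longrightarrow> dist (f (Suc n) x) (f n x) \<le> C / 2 ^ n"
  obtains g where "uniform_limit S f g sequentially" "\<And>n x. x \<in> S \<Longrightarrow> dist (f n x) (g x) \<le> 2 * C / 2 ^ n"
proof -
  have far: "dist (f (n + j) x) (f n x) \<le> 2 * C / 2 ^ n - 2 * C / 2 ^ (n + j)" if "x \<in> S" for n j x
  proof (induction j)
    case (Suc j)
    have "dist (f (n + Suc j) x) (f n x) \<le> dist (f (Suc (n + j)) x) (f (n + j) x) + dist (f (n + j) x) (f n x)"
      using dist_triangle by simp
    also have "\<dots> \<le> C / 2 ^ (n + j) + (2 * C / 2 ^ n - 2 * C / 2 ^ (n + j))"
      by (intro add_mono step that Suc)
    also have "\<dots> = 2 * C / 2 ^ n - 2 * C / 2 ^ (n + Suc j)" by (simp add: field_simps)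
    finally show ?case .
  qed simp
  have C0: "C \<ge> 0" if "x \<in> S" for x using order_trans[OF zero_le_dist step[OF that, of 0]] by simp
  have far': "dist (f (n + j) x) (f n x) \<le> 2 * C / 2 ^ n" if "x \<in> S" for n j x
  proof -
    have "0 \<le> 2 * C / 2 ^ (n + j)" using C0[OF that] by simp
    then show ?thesis using far[OF that, of n j] by linarith
  qed
  have "Cauchy (\<lambda>n. f n x)" if x: "x \<in> S" for x
  proof (rule metric_CauchyI)
    fix r :: real assume r: "r > 0"
    have C: "C + 1 > 0" using C0[OF x] by simp
    obtain K where "(1/2) ^ K < r / (4 * (C + 1))" using real_arch_pow_inv[of "r / (4 * (C + 1))" "1/2"] r C by auto
    then have K: "4 * (C + 1) / 2 ^ K < r" using C by (simp add: field_simps)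
    show "\<exists>M. \<forall>m\<ge>M. \<forall>n\<ge>M. dist (f m x) (f n x) < r"
    proof (intro exI[of _ K] allI impI)
      fix m n assume "K \<le> m" "K \<le> n"
      then have "dist (f m x) (f K x) \<le> 2 * C / 2 ^ K" "dist (f n x) (f K x) \<le> 2 * C / 2 ^ K"
        using far'[OF x, of K "m - K"] far'[OF x, of K "n - K"] by auto
      then have "dist (f m x) (f n x) \<le> 2 * C / 2 ^ K + 2 * C / 2 ^ K"
        using dist_triangle2[of "f m x" "f n x" "f K x"] by linarith
      also have "\<dots> \<le> 4 * (C + 1) / 2 ^ K" by (simp add: field_simps)
      finally show "dist (f m x) (f n x) < r" using K by simp
    qed
  qed
  then have "\<exists>l. (\<lambda>n. f n x) \<longlonglongrightarrow> l" if "x \<in> S" for x using that Cauchy_convergent by (auto simp: convergent_def)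
  then obtain g where g: "\<And>x. x \<in> S \<Longrightarrow> (\<lambda>n. f n x) \<longlonglongrightarrow> g x" by metis
  have lim: "dist (f n x) (g x) \<le> 2 * C / 2 ^ n" if x: "x \<in> S" for n x
  proof -
    have "(\<lambda>j. dist (f n x) (f (n + j) x)) \<longlonglongrightarrow> dist (f n x) (g x)"
      using LIMSEQ_ignore_initial_segment[OF g[OF x], of n] by (intro tendsto_intros) (simp add: add.commute)
    then show ?thesis by (rule LIMSEQ_le_const2) (use far'[OF x] in \<open>auto simp: dist_commute\<close>)
  qed
  have "uniform_limit S f g sequentially"
  proof (cases "S = {}")
    case False
    then have C: "C \<ge> 0" using C0 by blast
    have "(\<lambda>n. 2 * C * (1/2) ^ n) \<longlonglongrightarrow> 2 * C * 0" by (intro tendsto_intros LIMSEQ_realpow_zero) auto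
    then have l: "(\<lambda>n. 2 * C / 2 ^ n) \<longlonglongrightarrow> 0" by (simp add: power_one_over)
    show ?thesis
    proof (rule uniform_limitI)
      fix r :: real assume "r > 0"
      with l have "\<forall>\<^sub>F n in sequentially. 2 * C / 2 ^ n < r" by (rule order_tendstoD(2))
      then show "\<forall>\<^sub>F n in sequentially. \<forall>x\<in>S. dist (f n x) (g x) < r"
        by eventually_elim (use lim in \<open>meson le_less_trans\<close>)
    qed
  qed (simp add: uniform_limit_iff)
  then show ?thesis using lim by (rule that)
qed

text \<open>A continuous solution of \<open>h \<circ> \<psi> = F \<circ> h\<close> for fibrewise contractions \<open>\<psi>\<close> and \<open>F\<close>: outside the
  image of \<open>\<psi>\<close> (a fundamental domain) prescribe \<open>h\<close> to be \<open>g0\<close>, and solve the functional equation by iteration.\<close>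

lemma skew_semiconjugacy:
  fixes X Y :: "('a::complete_space \<times> 'b::complete_space) set" and \<psi> F g0 :: "'a \<times> 'b \<Rightarrow> 'a \<times> 'b"
  assumes X: "compact X" "Y \<subseteq> X" and \<psi>: "continuous_on X \<psi>" "inj_on \<psi> X" "\<psi> ` X \<subseteq> Y"
    and F: "continuous_on X F" "F ` X \<subseteq> Y" "\<And>p. p \<in> X \<Longrightarrow> fst (F p) = fst (\<psi> p)"
    and Ffst: "\<And>p p'. p \<in> X \<Longrightarrow> p' \<in> X \<Longrightarrow> fst p = fst p' \<Longrightarrow> fst (F p) = fst (F p')"
    and contr: "\<And>p p'. p \<in> X \<Longrightarrow> p' \<in> X \<Longrightarrow> fst p = fst p' \<Longrightarrow> dist (snd (F p)) (snd (F p')) \<le> dist (snd p) (snd p') / 2"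
    and g0: "continuous_on X g0" "g0 ` X \<subseteq> X" "\<And>p. p \<in> X \<Longrightarrow> fst (g0 p) = fst p" "\<And>p. p \<in> X - Y \<Longrightarrow> g0 p = p"
      "\<And>p. p \<in> X \<Longrightarrow> g0 (\<psi> p) = F p"
    and cl: "closed (X - \<psi> ` Y)"
  shows "\<exists>h. continuous_on X h \<and> h ` X \<subseteq> X \<and> (\<forall>p\<in>X. fst (h p) = fst p) \<and> (\<forall>p\<in>X - Y. h p = p) \<and>
    (\<forall>p\<in>X. h (\<psi> p) = F (h p)) \<and> (\<forall>p\<in>X - \<psi> ` X. h p = g0 p)"
proof -
  define adm where "adm h \<longleftrightarrow> continuous_on X h \<and> h ` X \<subseteq> X \<and> (\<forall>p\<in>X. fst (h p) = fst p) \<and> (\<forall>p\<in>X - Y. h p = p)" for h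
  define inv\<psi> where "inv\<psi> = inv_into X \<psi>"
  have inv1: "inv\<psi> (\<psi> p) = p" if "p \<in> X" for p using \<psi>(2) that by (simp add: inv\<psi>_def)
  have cinv: "continuous_on (\<psi> ` X) inv\<psi>" by (rule continuous_on_inv[OF \<psi>(1) X(1)]) (use inv1 in auto)
  define T where "T h p = (if p \<in> \<psi> ` X then F (h (inv\<psi> p)) else g0 p)" for h p
  have T1: "T h (\<psi> p) = F (h p)" if "p \<in> X" for h p using that inv1 by (simp add: T_def)
  have T2: "T h p = g0 p" if "p \<in> X - \<psi> ` X" for h p using that by (simp add: T_def)
  have split: "p \<in> X - \<psi> ` X \<or> (\<exists>p'\<in>X. p = \<psi> p')" if "p \<in> X" for p using that by blast
  have Tadm: "adm (T h)" if h: "adm h" for h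
  proof -
    \<comment> \<open>The two closed pieces overlap in \<open>\<psi>(X - Y)\<close>. There
      \<open>h\<close> is the identity one step back, so both formulas give
      \<open>F p' = g0 (\<psi> p')\<close>.\<close>
    have "continuous_on (\<psi> ` X \<union> (X - \<psi> ` Y)) (T h)" unfolding T_def
    proof (rule continuous_on_cases)
      show "closed (\<psi> ` X)" by (intro compact_imp_closed compact_continuous_image \<psi> X)
      have 1: "continuous_on (\<psi> ` X) (\<lambda>p. h (inv\<psi> p))"
        by (rule continuous_on_compose2[OF _ cinv]) (use h inv1 in \<open>auto simp: adm_def\<close>)
      show "continuous_on (\<psi> ` X) (\<lambda>p. F (h (inv\<psi> p)))"
        by (rule continuous_on_compose2[OF F(1) 1]) (use h inv1 in \<open>auto simp: adm_def\<close>)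
      show "continuous_on (X - \<psi> ` Y) g0" by (rule continuous_on_subset[OF g0(1)]) auto
      have "F (h (inv\<psi> p)) = g0 p" if p: "p \<in> X - \<psi> ` Y" "p \<in> \<psi> ` X" for p
      proof -
        obtain p' where p': "p' \<in> X" "p = \<psi> p'" "p' \<notin> Y" using p by auto
        then have "h p' = p'" using h by (simp add: adm_def)
        then show ?thesis using p' inv1 g0(5) by simp
      qed
      then show "\<forall>p. p \<in> \<psi> ` X \<and> p \<notin> \<psi> ` X \<or> p \<in> X - \<psi> ` Y \<and> p \<in> \<psi> ` X \<longrightarrow> F (h (inv\<psi> p)) = g0 p" by blast
    qed (rule cl)
    moreover have "\<psi> ` X \<union> (X - \<psi> ` Y) = X" using \<psi>(3) X(2) by blast
    ultimately have c: "continuous_on X (T h)" by simp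
    have i: "T h p \<in> X \<and> fst (T h p) = fst p" if p: "p \<in> X" for p
      using split[OF p]
    proof
      assume "p \<in> X - \<psi> ` X"
      then have "T h p = g0 p" by (rule T2)
      moreover have "g0 p \<in> X" using g0(2) p by blast
      ultimately show ?thesis using g0(3)[OF p] by simp
    next
      assume "\<exists>p'\<in>X. p = \<psi> p'"
      then obtain p' where p': "p' \<in> X" "p = \<psi> p'" by blast
      have hp: "h p' \<in> X" "fst (h p') = fst p'" using h p'(1) unfolding adm_def by blast+
      have "F (h p') \<in> X" using F(2) X(2) hp(1) by blast
      moreover have "fst (F (h p')) = fst p"
        using Ffst[OF hp(1) p'(1) hp(2)] F(3)[OF p'(1)] p'(2) by simp
      ultimately show ?thesis using T1[OF p'(1)] p'(2) by simp
    qed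
    have b: "T h p = p" if p: "p \<in> X - Y" for p
    proof -
      have "p \<notin> \<psi> ` X" using \<psi>(3) p by blast
      then have "p \<in> X - \<psi> ` X" using p by blast
      then show ?thesis using T2 g0(4)[OF p] by simp
    qed
    show ?thesis unfolding adm_def using c i b by blast
  qed
  have Tcontr: "dist (T h p) (T h' p) \<le> c / 2" if h: "adm h" "adm h'" and c: "\<And>p. p \<in> X \<Longrightarrow> dist (h p) (h' p) \<le> c" and p: "p \<in> X" for h h' c p
    using split[OF p]
  proof
    assume "p \<in> X - \<psi> ` X"
    moreover have "0 \<le> c" using c[OF p] zero_le_dist order_trans by blast
    ultimately show ?thesis using T2 by simp
  next
    assume "\<exists>p'\<in>X. p = \<psi> p'"
    then obtain p' where p': "p' \<in> X" "p = \<psi> p'" by blast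
    have hX: "h p' \<in> X" "h' p' \<in> X" and f: "fst (h p') = fst (h' p')" using h p' by (auto simp: adm_def)
    have "dist (F (h p')) (F (h' p')) = dist (snd (F (h p'))) (snd (F (h' p')))"
      using Ffst[OF hX f] by (simp add: dist_prod_def)
    also have "\<dots> \<le> dist (snd (h p')) (snd (h' p')) / 2" by (rule contr[OF hX f])
    also have "dist (snd (h p')) (snd (h' p')) \<le> dist (h p') (h' p')" by (rule dist_snd_le)
    finally show ?thesis using c[OF p'(1)] T1[OF p'(1)] p'(2) by simp
  qed
  obtain B where B: "\<And>p p'. p \<in> X \<Longrightarrow> p' \<in> X \<Longrightarrow> dist p p' \<le> B"
    using compact_imp_bounded[OF X(1)] by (auto simp: bounded_two_points)
  define H where "H n = (T ^^ n) (\<lambda>p. p)" for n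
  have HS: "H (Suc n) = T (H n)" for n by (simp add: H_def)
  have Hadm: "adm (H n)" for n
  proof (induction n)
    case 0
    show ?case by (simp add: H_def adm_def)
  qed (simp add: HS Tadm)
  have "dist (H (Suc n) p) (H n p) \<le> B / 2 ^ n" if "p \<in> X" for n p
    using that
  proof (induction n arbitrary: p)
    case 0
    have "H (Suc 0) p \<in> X" using Hadm[of "Suc 0"] 0 unfolding adm_def by blast
    from B[OF this 0] show ?case by (simp add: H_def)
  next
    case (Suc n)
    from Tcontr[OF Hadm Hadm Suc.IH Suc.prems] show ?case by (simp add: HS mult.commute)
  qed
  from geometric_uniform_limit[of X H B, OF this] obtain h where
    h: "uniform_limit X H h sequentially" "\<And>n p. p \<in> X \<Longrightarrow> dist (H n p) (h p) \<le> 2 * B / 2 ^ n" by blast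
  have pt: "(\<lambda>n. H n p) \<longlonglongrightarrow> h p" if "p \<in> X" for p by (rule tendsto_uniform_limitI[OF h(1) that])
  have hc: "continuous_on X h"
    by (rule uniform_limit_theorem[OF _ h(1)]) (use Hadm in \<open>auto simp: adm_def\<close>)
  have hX: "h p \<in> X" if "p \<in> X" for p
  proof (rule closed_sequentially[OF compact_imp_closed[OF X(1)] _ pt[OF that]])
    show "H n p \<in> X" for n using Hadm[of n] that unfolding adm_def by blast
  qed
  have hf: "fst (h p) = fst p" if "p \<in> X" for p
  proof -
    have "(\<lambda>n. fst (H n p)) \<longlonglongrightarrow> fst (h p)" by (intro tendsto_intros pt that)
    moreover have "fst (H n p) = fst p" for n using Hadm[of n] that by (simp add: adm_def)
    ultimately show ?thesis by (simp add: LIMSEQ_const_iff)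
  qed
  have hb: "h p = p" if "p \<in> X - Y" for p
  proof -
    have "H n p = p" for n using Hadm[of n] that by (simp add: adm_def)
    then show ?thesis using pt[of p] that by (simp add: LIMSEQ_const_iff)
  qed
  have adm: "adm h" unfolding adm_def using hc hX hf hb by blast
  have fixed: "T h p = h p" if p: "p \<in> X" for p
  proof -
    have le: "dist (T (H n) p) (T h p) \<le> (2 * B / 2 ^ n) / 2" for n by (rule Tcontr[OF Hadm adm h(2) p])
    have "(\<lambda>n. B * (1/2) ^ n) \<longlonglongrightarrow> B * 0" by (intro tendsto_intros LIMSEQ_realpow_zero) auto
    then have "(\<lambda>n. (2 * B / 2 ^ n) / 2) \<longlonglongrightarrow> 0" by (simp add: power_one_over)
    then have "(\<lambda>n. dist (T (H n) p) (T h p)) \<longlonglongrightarrow> 0"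
      by (rule tendsto_sandwich[OF always_eventually always_eventually tendsto_const, rotated 2]) (use le in auto)
    then have "(\<lambda>n. T (H n) p) \<longlonglongrightarrow> T h p" by (rule iffD2[OF tendsto_dist_iff])
    moreover have "(\<lambda>n. T (H n) p) \<longlonglongrightarrow> h p" using LIMSEQ_Suc[OF pt[OF p]] by (simp add: HS)
    ultimately show ?thesis by (rule LIMSEQ_unique)
  qed
  have c1: "h (\<psi> p) = F (h p)" if "p \<in> X" for p
  proof -
    have "\<psi> p \<in> X" using \<psi>(3) X(2) that by blast
    then show ?thesis using fixed[of "\<psi> p"] T1[OF that] by simp
  qed
  have c2: "h p = g0 p" if "p \<in> X - \<psi> ` X" for p
  proof -
    have "p \<in> X" using that by blast
    show ?thesis using fixed[OF \<open>p \<in> X\<close>] T2[OF that, of h] by simp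
  qed
  have "h ` X \<subseteq> X" using hX by blast
  then show ?thesis using hc hf hb c1 c2 by blast
qed

text \<open>The composite commutes with \<open>\<psi>\<close> and fixes everything outside the image
  of \<open>\<psi>\<close>. Going back one step through \<open>\<psi>\<close> halves the bound on
  the distance of \<open>k (h p)\<close> from \<open>p\<close>, so the distance is at most
  \<open>B / 2^n\<close> for every \<open>n\<close>.\<close>

lemma skew_left_inverse:
  fixes X Y :: "('a::metric_space \<times> 'b::metric_space) set" and \<psi> h k :: "'a \<times> 'b \<Rightarrow> 'a \<times> 'b"
  assumes X: "bounded X" and h: "h ` X \<subseteq> X" "\<And>p. p \<in> X \<Longrightarrow> fst (h p) = fst p"
    and k: "k ` X \<subseteq> X" "\<And>p. p \<in> X \<Longrightarrow> fst (k p) = fst p"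
    and \<psi>: "\<psi> ` X \<subseteq> X" "\<And>p p'. p \<in> X \<Longrightarrow> p' \<in> X \<Longrightarrow> fst p = fst p' \<Longrightarrow> fst (\<psi> p) = fst (\<psi> p')"
      "\<And>p p'. p \<in> X \<Longrightarrow> p' \<in> X \<Longrightarrow> fst p = fst p' \<Longrightarrow> dist (snd (\<psi> p)) (snd (\<psi> p')) \<le> dist (snd p) (snd p') / 2"
    and kh: "\<And>p. p \<in> X \<Longrightarrow> k (h (\<psi> p)) = \<psi> (k (h p))" "\<And>p. p \<in> X - \<psi> ` X \<Longrightarrow> k (h p) = p"
    and p: "p \<in> X"
  shows "k (h p) = p"
proof -
  obtain B where B: "\<And>p p'. p \<in> X \<Longrightarrow> p' \<in> X \<Longrightarrow> dist p p' \<le> B"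
    using X by (auto simp: bounded_two_points)
  have B0: "B \<ge> 0" using B[OF p p] by simp
  have khX: "k (h p) \<in> X" "fst (k (h p)) = fst p" if "p \<in> X" for p
  proof -
    have "h p \<in> X" using h(1) that by blast
    then show "k (h p) \<in> X" "fst (k (h p)) = fst p" using k h(2)[OF that] by auto
  qed
  have le: "dist (k (h p)) p \<le> B * (1/2) ^ n" if "p \<in> X" for n p
    using that
  proof (induction n arbitrary: p)
    case 0
    then show ?case using B khX by simp
  next
    case (Suc n)
    show ?case
    proof (cases "p \<in> \<psi> ` X")
      case True
      then obtain p' where p': "p' \<in> X" "p = \<psi> p'" by blast
      have "dist (k (h p)) p = dist (\<psi> (k (h p'))) (\<psi> p')" using kh(1) p' by simp
      also have "\<dots> = dist (snd (\<psi> (k (h p')))) (snd (\<psi> p'))"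
        using \<psi>(2)[OF khX(1)[OF p'(1)] p'(1) khX(2)[OF p'(1)]] by (simp add: dist_prod_def)
      also have "\<dots> \<le> dist (snd (k (h p'))) (snd p') / 2" by (rule \<psi>(3)[OF khX(1)[OF p'(1)] p'(1) khX(2)[OF p'(1)]])
      also have "dist (snd (k (h p'))) (snd p') \<le> dist (k (h p')) p'" by (rule dist_snd_le)
      finally show ?thesis using Suc.IH[OF p'(1)] by simp
    next
      case False
      then show ?thesis using kh(2)[of p] Suc.prems B0 by simp
    qed
  qed
  have "(\<lambda>n. B * (1/2) ^ n) \<longlonglongrightarrow> B * 0" by (intro tendsto_intros LIMSEQ_realpow_zero) auto
  then have "dist (k (h p)) p \<le> 0" by (intro LIMSEQ_le_const) (use le[OF p] in auto)
  then show ?thesis by simp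
qed

text \<open>The semiconjugacy is constructed in both directions, from \<open>g0\<close> and from its
  inverse \<open>k0\<close>; both composites are the identity by
  \<open>skew_left_inverse\<close>.\<close>

theorem skew_conjugacy:
  fixes X Y :: "('a::complete_space \<times> 'b::complete_space) set" and \<psi> g0 k0 :: "'a \<times> 'b \<Rightarrow> 'a \<times> 'b"
  assumes X: "compact X" "Y \<subseteq> X" and \<psi>: "continuous_on X \<psi>" "inj_on \<psi> X" "\<psi> ` X \<subseteq> Y"
    and \<psi>fst: "\<And>p p'. p \<in> X \<Longrightarrow> p' \<in> X \<Longrightarrow> fst p = fst p' \<Longrightarrow> fst (\<psi> p) = fst (\<psi> p')"
    and \<psi>c: "\<And>p p'. p \<in> X \<Longrightarrow> p' \<in> X \<Longrightarrow> fst p = fst p' \<Longrightarrow> dist (snd (\<psi> p)) (snd (\<psi> p')) \<le> dist (snd p) (snd p') / 2"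
    and Fc: "\<And>p p'. p \<in> X \<Longrightarrow> p' \<in> X \<Longrightarrow> fst p = fst p' \<Longrightarrow> dist (snd (g0 (\<psi> p))) (snd (g0 (\<psi> p'))) \<le> dist (snd p) (snd p') / 2"
    and g0: "homeomorphism X X g0 k0" "\<And>p. p \<in> X \<Longrightarrow> fst (g0 p) = fst p" "\<And>p. p \<in> X - Y \<Longrightarrow> g0 p = p"
    and cl: "closed (X - \<psi> ` Y)"
  obtains h k where "homeomorphism X X h k" "\<And>p. p \<in> X \<Longrightarrow> fst (h p) = fst p" "\<And>p. p \<in> X - Y \<Longrightarrow> h p = p"
    "\<And>p. p \<in> X \<Longrightarrow> h (\<psi> p) = g0 (\<psi> (h p))"
proof -
  have g0c: "continuous_on X g0" "g0 ` X = X" "\<And>p. p \<in> X \<Longrightarrow> k0 (g0 p) = p"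
    and k0c: "continuous_on X k0" "k0 ` X = X" "\<And>p. p \<in> X \<Longrightarrow> g0 (k0 p) = p"
    using g0(1) unfolding homeomorphism_def by auto
  have \<psi>X: "\<psi> p \<in> X" "\<psi> p \<in> Y" if "p \<in> X" for p using \<psi>(3) X(2) that by auto
  \<comment> \<open>An injective map that fixes \<open>X - Y\<close> pointwise cannot move a point
    of \<open>Y\<close> into \<open>X - Y\<close>.\<close>
  have g0Y: "g0 p \<in> Y" if "p \<in> Y" for p
  proof (rule ccontr)
    assume n: "g0 p \<notin> Y"
    have pX: "p \<in> X" using that X(2) by auto
    then have "g0 p \<in> X - Y" using n g0c(2) by auto
    then have "g0 (g0 p) = g0 p" by (rule g0(3))
    then have "g0 p = p" using g0c(2,3) pX by (metis imageI)
    then show False using n that by simp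
  qed
  define F where "F p = g0 (\<psi> p)" for p
  have FY: "F p \<in> Y" if "p \<in> X" for p unfolding F_def by (rule g0Y[OF \<psi>X(2)[OF that]])
  then have FX: "F p \<in> X" if "p \<in> X" for p using that X(2) by blast
  have Fcont: "continuous_on X F" unfolding F_def
    by (rule continuous_on_compose2[OF g0c(1) \<psi>(1)]) (use \<psi>X in auto)
  have Ffst: "fst (F p) = fst (\<psi> p)" if "p \<in> X" for p using g0(2) \<psi>X that by (simp add: F_def)
  have Finj: "inj_on F X"
    unfolding F_def inj_on_def using \<psi>(2) g0c(3) \<psi>X by (metis inj_on_def)
  have k0F: "k0 (F p) = \<psi> p" if "p \<in> X" for p using g0c(3) \<psi>X that by (simp add: F_def)
  have k0f: "fst (k0 p) = fst p" if "p \<in> X" for p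
  proof -
    have "k0 p \<in> X" using k0c(2) that by blast
    then show ?thesis using g0(2)[of "k0 p"] k0c(3)[OF that] by simp
  qed
  have k0b: "k0 p = p" if "p \<in> X - Y" for p using g0(3)[OF that] g0c(3)[of p] that by auto
  have clF: "closed (X - F ` Y)"
  proof -
    have "X - F ` Y = g0 ` (X - \<psi> ` Y)"
    proof (intro equalityI subsetI)
      fix p assume p: "p \<in> X - F ` Y"
      then have "k0 p \<in> X" "g0 (k0 p) = p" using k0c by auto
      moreover have "k0 p \<notin> \<psi> ` Y" using p \<open>g0 (k0 p) = p\<close> unfolding F_def by auto
      ultimately show "p \<in> g0 ` (X - \<psi> ` Y)" by (metis DiffI imageI)
    next
      fix p assume "p \<in> g0 ` (X - \<psi> ` Y)"
      then obtain p' where p': "p' \<in> X" "p' \<notin> \<psi> ` Y" "p = g0 p'" by auto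
      have "p \<notin> F ` Y"
      proof
        assume "p \<in> F ` Y"
        then obtain u where u: "u \<in> Y" "g0 p' = g0 (\<psi> u)" using p' by (auto simp: F_def)
        have "\<psi> u \<in> X" using u(1) X(2) \<psi>X(1) by blast
        then have "p' = \<psi> u" using u(2) g0c(3) p'(1) by metis
        then show False using u p'(2) by blast
      qed
      then show "p \<in> X - F ` Y" using p' g0c(2) by auto
    qed
    moreover have "compact (X - \<psi> ` Y)"
      using X(1) cl by (metis compact_Int_closed Diff_subset inf.absorb_iff2 Int_commute)
    then have "compact (g0 ` (X - \<psi> ` Y))"
      by (intro compact_continuous_image continuous_on_subset[OF g0c(1)]) auto
    ultimately show ?thesis by (simp add: compact_imp_closed)
  qed
  have FYi: "F ` X \<subseteq> Y" using FY by blast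
  have Fff: "fst (F p) = fst (F p')" if "p \<in> X" "p' \<in> X" "fst p = fst p'" for p p'
    using Ffst[OF that(1)] Ffst[OF that(2)] \<psi>fst[OF that] by simp
  have Fc': "dist (snd (F p)) (snd (F p')) \<le> dist (snd p) (snd p') / 2" if "p \<in> X" "p' \<in> X" "fst p = fst p'" for p p'
    unfolding F_def by (rule Fc[OF that])
  have g0F: "g0 (\<psi> p) = F p" if "p \<in> X" for p by (simp add: F_def)
  have g0X: "g0 ` X \<subseteq> X" and k0X: "k0 ` X \<subseteq> X" using g0c(2) k0c(2) by blast+
  obtain h where h: "continuous_on X h" "h ` X \<subseteq> X" "\<And>p. p \<in> X \<Longrightarrow> fst (h p) = fst p" "\<And>p. p \<in> X - Y \<Longrightarrow> h p = p"
    "\<And>p. p \<in> X \<Longrightarrow> h (\<psi> p) = F (h p)" "\<And>p. p \<in> X - \<psi> ` X \<Longrightarrow> h p = g0 p"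
    using skew_semiconjugacy[OF X \<psi> Fcont FYi Ffst Fff Fc' g0c(1) g0X g0(2,3) g0F cl] by blast
  obtain k where k: "continuous_on X k" "k ` X \<subseteq> X" "\<And>p. p \<in> X \<Longrightarrow> fst (k p) = fst p" "\<And>p. p \<in> X - Y \<Longrightarrow> k p = p"
    "\<And>p. p \<in> X \<Longrightarrow> k (F p) = \<psi> (k p)" "\<And>p. p \<in> X - F ` X \<Longrightarrow> k p = k0 p"
    using skew_semiconjugacy[OF X Fcont Finj FYi \<psi>(1,3) Ffst[symmetric] \<psi>fst \<psi>c k0c(1) k0X k0f k0b k0F clF] by blast
  have \<psi>Xi: "\<psi> ` X \<subseteq> X" and FXi: "F ` X \<subseteq> X" using \<psi>X(1) FX by blast+
  have hX: "h p \<in> X" if "p \<in> X" for p using h(2) that by blast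
  have kX: "k p \<in> X" if "p \<in> X" for p using k(2) that by blast
  have kh1: "k (h (\<psi> u)) = \<psi> (k (h u))" if "u \<in> X" for u
    using h(5)[OF that] k(5)[OF hX[OF that]] by simp
  have kh2: "k (h u) = u" if u: "u \<in> X - \<psi> ` X" for u
  proof -
    have uX: "u \<in> X" using u by blast
    have "g0 u \<notin> F ` X"
    proof
      assume "g0 u \<in> F ` X"
      then obtain u' where u': "u' \<in> X" "g0 u = g0 (\<psi> u')" unfolding F_def by blast
      then have "u = \<psi> u'" using g0c(3)[OF uX] g0c(3)[OF \<psi>X(1)[OF u'(1)]] by metis
      then show False using u u' by blast
    qed
    moreover have "g0 u \<in> X" using g0X uX by blast
    ultimately show ?thesis using h(6)[OF u] k(6)[of "g0 u"] g0c(3)[OF uX] by simp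
  qed
  have kh: "k (h p) = p" if p: "p \<in> X" for p
    by (rule skew_left_inverse[OF compact_imp_bounded[OF X(1)] h(2,3) k(2,3) \<psi>Xi \<psi>fst \<psi>c kh1 kh2 p])
  have hk1: "h (k (F u)) = F (h (k u))" if "u \<in> X" for u
    using k(5)[OF that] h(5)[OF kX[OF that]] by simp
  have hk2: "h (k u) = u" if u: "u \<in> X - F ` X" for u
  proof -
    have uX: "u \<in> X" using u by blast
    have "k0 u \<notin> \<psi> ` X"
    proof
      assume "k0 u \<in> \<psi> ` X"
      then obtain u' where u': "u' \<in> X" "k0 u = \<psi> u'" by blast
      then have "u = F u'" using k0c(3)[OF uX] by (simp add: F_def)
      then show False using u u' by blast
    qed
    moreover have "k0 u \<in> X" using k0X uX by blast
    ultimately show ?thesis using k(6)[OF u] h(6)[of "k0 u"] k0c(3)[OF uX] by simp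
  qed
  have hk: "h (k p) = p" if p: "p \<in> X" for p
    by (rule skew_left_inverse[OF compact_imp_bounded[OF X(1)] k(2,3) h(2,3) FXi Fff Fc' hk1 hk2 p])
  have "h ` X = X" "k ` X = X"
    using h(2) k(2) kh hk hX kX by (metis image_eqI subsetI subset_antisym)+
  then have "homeomorphism X X h k"
    unfolding homeomorphism_def using h(1) k(1) kh hk by blast
  from that[OF this h(3,4)] h(5) show ?thesis by (simp only: F_def)
qed

section \<open>Comparison with the model map\<close>

text \<open>\<open>s1\<close> keeps the image of the model map and the support of the correction
  inside the disc of radius \<open>r\<close>; \<open>s2\<close> separates the images of opposite
  points; \<open>s3\<close> is the Lipschitz bound of the correction; \<open>s4\<close> gives both
  maps the fibre contraction 1/2; \<open>s5\<close> allows error terms to be absorbed in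
  \<open>limit_leaf_strong\<close>. The bound \<open>\<delta> / 3\<close> comes from Harnack's
  inequality.\<close>

locale henon_small = henon_family +
  fixes a :: complex and r :: real
  assumes a0: "a \<noteq> 0" and ad: "norm a \<le> \<delta> / 3" and r: "3 < r" "r < \<rho>"
    and s1: "norm a * (3 + e) < r" and s2: "norm a * r \<le> e\<^sup>2"
    and s3: "norm a * (2 * (7 / \<delta> + r / (2 * e)) / e + 6 * ((14 / \<delta> + 1) / e\<^sup>2)) \<le> 1/4"
    and s4: "norm a \<le> 1/2" "(norm a)\<^sup>2 \<le> e" and s5: "14 / \<delta> * norm a \<le> e" "norm a \<le> e / 2"
begin

definition psi :: "complex \<times> complex \<Rightarrow> complex \<times> complex" where
  "psi p = (PP (fst p), a * fst p - a\<^sup>2 * snd p / (2 * fst p))"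

text \<open>The deviation of a leaf from its linear approximation
  \<open>z - a * y / (2 * z)\<close>. Multiplied by \<open>a\<close> it is exactly the difference
  between the second coordinates of the Henon map in leaf coordinates and of the model map.\<close>

definition leaf_error :: "complex \<Rightarrow> complex \<Rightarrow> complex" where
  "leaf_error z y = limit_leaf a y z - z + a * y / (2 * z)"

lemma julia_pts_nz: "z \<in> julia_pts \<Longrightarrow> z \<noteq> 0"
  using julia_pts_ge[of z] e0 by auto

lemma na: "norm a > 0" using a0 by simp

lemma julia_pts_minus: "z \<in> julia_pts \<Longrightarrow> - z \<in> julia_pts"
  using PP_julia_pts[of z] PP_julia_pts_converse[of "- z"] by (simp add: PP_def)

text \<open>The leaf equation improves the Lipschitz constant 1: its difference at two heights reads
  \<open>D * S = B - a * (y - y')\<close> with \<open>S\<close> close to \<open>2 * z\<close> and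
  \<open>B\<close> bounded by \<open>norm a * norm D\<close>, so \<open>D\<close> gains a factor
  \<open>a\<close>. Inserting this once more, \<open>2 * z * E = D * (2 * z - S) + B\<close> gains a
  second one.\<close>

lemma limit_leaf_strong:
  assumes z: "z \<in> julia_pts" and y: "norm y < \<rho>" "norm y' < \<rho>"
  shows "norm (limit_leaf a y z - limit_leaf a y' z) \<le> 2 * norm a / e * norm (y - y')"
    "norm (leaf_error z y - leaf_error z y') \<le> (14 / \<delta> + 1) / e\<^sup>2 * (norm a)\<^sup>2 * norm (y - y')"
proof -
  define D where "D = limit_leaf a y z - limit_leaf a y' z"
  define S where "S = limit_leaf a y z + limit_leaf a y' z"
  define B where "B = limit_leaf a (a * limit_leaf a y z) (PP z) - limit_leaf a (a * limit_leaf a y' z) (PP z)"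
  have DS: "D * S = B - a * (y - y')"
  proof -
    have "B = ((limit_leaf a y z)\<^sup>2 + cc a + a * y) - ((limit_leaf a y' z)\<^sup>2 + cc a + a * y')"
      unfolding B_def using limit_leaf_eq[OF z ad y(1)] limit_leaf_eq[OF z ad y(2)] by simp
    then show ?thesis by (simp add: D_def S_def power2_eq_square algebra_simps)
  qed
  have "norm B \<le> norm (a * limit_leaf a y z - a * limit_leaf a y' z)"
    unfolding B_def by (rule limit_leaf_lip[OF julia_pts_closure_escaping_pts[OF PP_julia_pts[OF z]] ad limit_leaf_a_bound[OF z ad y(1)] limit_leaf_a_bound[OF z ad y(2)]])
  then have B: "norm B \<le> norm a * norm D" by (simp add: D_def norm_mult flip: right_diff_distrib)
  have "S - 2 * z = (limit_leaf a y z - z) + (limit_leaf a y' z - z)" by (simp add: S_def)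
  then have S: "norm (2 * z - S) \<le> 14 / \<delta> * norm a"
    using norm_triangle_ineq[of "limit_leaf a y z - z" "limit_leaf a y' z - z"] limit_leaf_near[OF z ad y(1)] limit_leaf_near[OF z ad y(2)]
    by (simp add: norm_minus_commute)
  have z2: "norm (2 * z) \<ge> 2 * e" using julia_pts_ge[OF z] by (simp add: norm_mult)
  have "norm (2 * z) \<le> norm (2 * z - S) + norm S" by (metis diff_add_cancel norm_triangle_ineq)
  then have Se: "norm S \<ge> e" using S z2 s5(1) by linarith
  have "norm D * norm S \<le> norm B + norm (a * (y - y'))" using DS norm_triangle_ineq4 by (metis norm_mult)
  also have "\<dots> \<le> norm a * norm D + norm a * norm (y - y')" using B by (simp add: norm_mult)
  also have "norm a * norm D \<le> e / 2 * norm D" using s5(2) by (intro mult_right_mono) auto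
  finally have "norm D * norm S \<le> e / 2 * norm D + norm a * norm (y - y')" by simp
  moreover have "norm D * norm S \<ge> norm D * e" using Se by (intro mult_left_mono) auto
  ultimately have "norm D * e \<le> 2 * (norm a * norm (y - y'))" by (simp add: mult.commute)
  then have D: "norm D \<le> 2 * norm a / e * norm (y - y')" using e0 by (simp add: field_simps)
  then show "norm (limit_leaf a y z - limit_leaf a y' z) \<le> 2 * norm a / e * norm (y - y')" by (simp add: D_def)
  define E where "E = leaf_error z y - leaf_error z y'"
  define K where "K = 14 / \<delta> + 1"
  have "2 * z * E = D * (2 * z - S) + B"
  proof -
    have 1: "2 * z * E = 2 * z * D + a * (y - y')" using julia_pts_nz[OF z] by (simp add: E_def leaf_error_def D_def field_simps)
    have 2: "a * (y - y') = B - D * S" using DS by simp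
    show ?thesis unfolding 1 2 by (simp add: algebra_simps)
  qed
  then have "norm (2 * z) * norm E \<le> norm D * norm (2 * z - S) + norm B" by (metis norm_mult norm_triangle_ineq)
  also have "\<dots> \<le> norm D * (14 / \<delta> * norm a) + norm a * norm D" using S B by (intro add_mono mult_left_mono) auto
  also have "\<dots> = norm D * (norm a * (14 / \<delta> + 1))" by (simp add: algebra_simps)
  also have "\<dots> \<le> 2 * norm a / e * norm (y - y') * (norm a * (14 / \<delta> + 1))"
    using D delta by (intro mult_right_mono) auto
  finally have "norm (2 * z) * norm E \<le> 2 * norm a / e * norm (y - y') * (norm a * (14 / \<delta> + 1))" .
  moreover have "2 * e * norm E \<le> norm (2 * z) * norm E" using z2 by (intro mult_right_mono) auto
  ultimately have "2 * e * norm E \<le> 2 * norm a / e * norm (y - y') * (norm a * (14 / \<delta> + 1))" by linarith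
  then have "norm E * e\<^sup>2 \<le> K * (norm a)\<^sup>2 * norm (y - y')"
    unfolding K_def[symmetric] using e0 by (simp add: field_simps power2_eq_square)
  then show "norm (leaf_error z y - leaf_error z y') \<le> (14 / \<delta> + 1) / e\<^sup>2 * (norm a)\<^sup>2 * norm (y - y')"
    unfolding K_def[symmetric] E_def[symmetric] using e0 by (simp add: pos_le_divide_eq)
qed

lemma leaf_error_le:
  assumes z: "z \<in> julia_pts" and y: "norm y \<le> r"
  shows "norm (leaf_error z y) \<le> (7 / \<delta> + r / (2 * e)) * norm a"
proof -
  have "norm (a * y / (2 * z)) = norm a * (norm y / (2 * norm z))" by (simp add: norm_mult norm_divide)
  also have "\<dots> \<le> norm a * (r / (2 * e))"
    using y julia_pts_ge[OF z] e0 r by (intro mult_left_mono frac_le) auto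
  finally have "norm (a * y / (2 * z)) \<le> norm a * (r / (2 * e))" .
  moreover have "norm (limit_leaf a y z - z) \<le> 7 / \<delta> * norm a" using limit_leaf_near[OF z ad] y r by simp
  moreover have "norm (leaf_error z y) \<le> norm (limit_leaf a y z - z) + norm (a * y / (2 * z))" unfolding leaf_error_def by (rule norm_triangle_ineq)
  ultimately show ?thesis by (simp add: algebra_simps)
qed

definition clamp :: "complex \<Rightarrow> complex" where "clamp = closest_point (cball 0 r)"

lemma clamp: "norm (clamp y) \<le> r" "norm y \<le> r \<Longrightarrow> clamp y = y" "norm (clamp y - clamp y') \<le> norm (y - y')"
  and clamp_cont: "continuous_on UNIV clamp"
proof -
  have ne: "closed (cball (0::complex) r)" "cball (0::complex) r \<noteq> {}" "convex (cball (0::complex) r)" using r by auto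
  show "norm (clamp y) \<le> r" using closest_point_in_set[OF ne(1,2), of y] by (simp add: clamp_def)
  show "norm y \<le> r \<Longrightarrow> clamp y = y" unfolding clamp_def by (rule closest_point_self) simp
  show "norm (clamp y - clamp y') \<le> norm (y - y')"
    using closest_point_lipschitz[OF ne(3,1,2), of y y'] by (simp add: clamp_def dist_norm)
  show "continuous_on UNIV clamp" unfolding clamp_def by (rule continuous_on_closest_point[OF ne(3,1,2)])
qed

text \<open>Near the image of the model map the second coordinate has to be moved by \<open>a * leaf_error z y\<close>; the correction is
  cut off at distance \<open>\<bar>a\<bar> e\<close>, so that the two preimages \<open>\<plusminus>z\<close> of a point do not interfere.\<close>

definition cut :: "complex \<Rightarrow> complex \<Rightarrow> real" where
  "cut z w = max 0 (min 1 (2 - 2 * norm (w - a * z) / (norm a * e)))"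

text \<open>The argument of \<open>clamp\<close> is the height \<open>y\<close> with
  \<open>w = a * z - a^2 * y / (2 * z)\<close>; \<open>clamp\<close> extends the correction to all
  \<open>w\<close> without increasing Lipschitz constants.\<close>

definition eta :: "complex \<Rightarrow> complex \<Rightarrow> complex" where
  "eta z w = of_real (cut z w) * (a * leaf_error z (clamp ((a * z - w) * 2 * z / a\<^sup>2)))"

lemma cut_lip: "\<bar>cut z w - cut z w'\<bar> \<le> 2 / (norm a * e) * norm (w - w')"
proof -
  have "\<bar>cut z w - cut z w'\<bar> \<le> \<bar>2 * norm (w - a * z) / (norm a * e) - 2 * norm (w' - a * z) / (norm a * e)\<bar>"
    unfolding cut_def by (auto simp: max_def min_def)
  also have "\<dots> = 2 / (norm a * e) * \<bar>norm (w - a * z) - norm (w' - a * z)\<bar>"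
  proof -
    have eq: "2 * A / c - 2 * B / c = 2 / c * (A - B)" for A B c :: real
      by (simp add: diff_divide_distrib right_diff_distrib)
    show ?thesis unfolding eq abs_mult using na e0 by simp
  qed
  also have "\<dots> \<le> 2 / (norm a * e) * norm (w - w')"
    using norm_triangle_ineq3[of "w - a * z" "w' - a * z"] na e0 by (intro mult_left_mono) auto
  finally show ?thesis .
qed

lemma cut_01: "0 \<le> cut z w" "cut z w \<le> 1" by (auto simp: cut_def)

text \<open>The steep cut-off, with slope of order \<open>1 / (norm a * e)\<close>, multiplies a
  quantity of order \<open>a^2\<close>, and the factor \<open>1/a^2\<close> in the recovered height
  meets the order \<open>a^2\<close> of \<open>limit_leaf_strong\<close>. Both contributions are of
  order \<open>a\<close> and add up to the left side of \<open>s3\<close>.\<close>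

lemma eta_lip: assumes z: "z \<in> julia_pts" shows "norm (eta z w - eta z w') \<le> 1/4 * norm (w - w')"
proof -
  define k where "k w = a * leaf_error z (clamp ((a * z - w) * 2 * z / a\<^sup>2))" for w
  define C0 where "C0 = 7 / \<delta> + r / (2 * e)"
  define C1 where "C1 = (14 / \<delta> + 1) / e\<^sup>2"
  have C: "C0 \<ge> 0" "C1 \<ge> 0" using delta r e0 by (auto simp: C0_def C1_def)
  have k1: "norm (k w) \<le> norm a * (C0 * norm a)" for w
    unfolding k_def norm_mult C0_def using leaf_error_le[OF z clamp(1)] by (intro mult_left_mono) auto
  have k2: "norm (k w - k w') \<le> 6 * C1 * norm a * norm (w - w')"
  proof -
    let ?u = "(a * z - w) * 2 * z / a\<^sup>2" and ?u' = "(a * z - w') * 2 * z / a\<^sup>2"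
    have "norm (leaf_error z (clamp ?u) - leaf_error z (clamp ?u')) \<le> C1 * (norm a)\<^sup>2 * norm (clamp ?u - clamp ?u')"
      unfolding C1_def using clamp(1) r by (intro limit_leaf_strong z) (auto intro: le_less_trans)
    also have "\<dots> \<le> C1 * (norm a)\<^sup>2 * norm (?u - ?u')" using clamp(3) C by (intro mult_left_mono) auto
    also have "?u - ?u' = (w' - w) * 2 * z / a\<^sup>2" by (simp add: diff_divide_distrib algebra_simps)
    also have "norm \<dots> = 2 * norm z / (norm a)\<^sup>2 * norm (w - w')"
      by (simp only: norm_mult norm_divide norm_power norm_minus_commute[of w' w]) simp
    also have "C1 * (norm a)\<^sup>2 * (2 * norm z / (norm a)\<^sup>2 * norm (w - w')) = C1 * (2 * norm z) * norm (w - w')"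
      using na by simp
    also have "\<dots> \<le> C1 * 6 * norm (w - w')"
      using julia_pts_norm[OF z] C by (intro mult_right_mono mult_left_mono) auto
    finally have "norm a * norm (leaf_error z (clamp ?u) - leaf_error z (clamp ?u')) \<le> norm a * (C1 * 6 * norm (w - w'))"
      by (intro mult_left_mono) auto
    then show ?thesis by (simp add: k_def norm_mult mult_ac flip: right_diff_distrib)
  qed
  have "eta z w - eta z w' = of_real (cut z w - cut z w') * k w + of_real (cut z w') * (k w - k w')"
    by (simp add: eta_def k_def algebra_simps)
  then have "norm (eta z w - eta z w') \<le> \<bar>cut z w - cut z w'\<bar> * norm (k w) + \<bar>cut z w'\<bar> * norm (k w - k w')"
    by (metis norm_triangle_ineq norm_mult norm_of_real)
  also have "\<dots> \<le> (2 / (norm a * e) * norm (w - w')) * (norm a * (C0 * norm a)) + 1 * (6 * C1 * norm a * norm (w - w'))"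
    using cut_lip cut_01 k1 k2 na e0 C by (intro add_mono mult_mono) auto
  also have "\<dots> = norm a * (2 * C0 / e + 6 * C1) * norm (w - w')"
    using na e0 by (simp add: field_simps)
  also have "\<dots> \<le> 1/4 * norm (w - w')" using s3 unfolding C0_def C1_def by (intro mult_right_mono) auto
  finally show ?thesis .
qed

lemma eta_0: assumes "norm a * e \<le> norm (w - a * z)" shows "eta z w = 0"
proof -
  have "2 - 2 * norm (w - a * z) / (norm a * e) \<le> 0" using assms na e0 by (simp add: field_simps)
  then have "cut z w = 0" by (simp add: cut_def)
  then show ?thesis by (simp add: eta_def)
qed

lemma limit_leaf_joint:
  assumes z: "\<And>n. z n \<in> julia_pts" "z \<longlonglongrightarrow> z'" "z' \<in> julia_pts" and y: "\<And>n. norm (y n) < \<rho>" "y \<longlonglongrightarrow> y'" "norm y' < \<rho>"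
  shows "(\<lambda>n. limit_leaf a (y n) (z n)) \<longlonglongrightarrow> limit_leaf a y' z'"
proof -
  have b: "norm (limit_leaf a (y n) (z n) - limit_leaf a y' z') \<le> norm (y n - y') + sqrt (7 * norm (z n - z'))" for n
  proof -
    have "norm (limit_leaf a (y n) (z n) - limit_leaf a y' z') \<le> norm (limit_leaf a (y n) (z n) - limit_leaf a y' (z n)) + norm (limit_leaf a y' (z n) - limit_leaf a y' z')"
      using norm_triangle_ineq[of "limit_leaf a (y n) (z n) - limit_leaf a y' (z n)" "limit_leaf a y' (z n) - limit_leaf a y' z'"] by simp
    also have "norm (limit_leaf a (y n) (z n) - limit_leaf a y' (z n)) \<le> norm (y n - y')"
      by (rule limit_leaf_lip[OF julia_pts_closure_escaping_pts[OF z(1)] ad y(1,3)])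
    also have "norm (limit_leaf a y' (z n) - limit_leaf a y' z') \<le> sqrt (7 * norm (z n - z'))"
      by (rule real_le_rsqrt) (rule limit_leaf_holder(2)[OF z(1,3) ad y(3)])
    finally show ?thesis by simp
  qed
  have "(\<lambda>n. norm (y n - y') + sqrt (7 * norm (z n - z'))) \<longlonglongrightarrow> norm (y' - y') + sqrt (7 * norm (z' - z'))"
    by (intro tendsto_intros y z)
  then have "(\<lambda>n. norm (y n - y') + sqrt (7 * norm (z n - z'))) \<longlonglongrightarrow> 0" by simp
  then have "(\<lambda>n. limit_leaf a (y n) (z n) - limit_leaf a y' z') \<longlonglongrightarrow> 0"
    by (rule Lim_null_comparison[OF always_eventually, rotated]) (use b in blast)
  then show ?thesis by (rule LIM_zero_cancel)
qed

lemma eta_joint: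
  assumes z: "\<And>n. z n \<in> julia_pts" "z \<longlonglongrightarrow> z'" "z' \<in> julia_pts" and w: "w \<longlonglongrightarrow> w'"
  shows "(\<lambda>n. eta (z n) (w n)) \<longlonglongrightarrow> eta z' w'"
proof -
  have cl: "(\<lambda>n. clamp ((a * z n - w n) * 2 * z n / a\<^sup>2)) \<longlonglongrightarrow> clamp ((a * z' - w') * 2 * z' / a\<^sup>2)"
  proof (rule isCont_tendsto_compose[where g = clamp])
    show "isCont clamp ((a * z' - w') * 2 * z' / a\<^sup>2)"
      using clamp_cont by (simp add: continuous_on_eq_continuous_at)
    show "(\<lambda>n. (a * z n - w n) * 2 * z n / a\<^sup>2) \<longlonglongrightarrow> (a * z' - w') * 2 * z' / a\<^sup>2"
      using a0 by (intro tendsto_intros z w) auto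
  qed
  have cb: "norm (clamp y) < \<rho>" for y using clamp(1)[of y] r by simp
  have "(\<lambda>n. leaf_error (z n) (clamp ((a * z n - w n) * 2 * z n / a\<^sup>2))) \<longlonglongrightarrow> leaf_error z' (clamp ((a * z' - w') * 2 * z' / a\<^sup>2))"
    unfolding leaf_error_def using julia_pts_nz[OF z(3)] by (intro tendsto_intros limit_leaf_joint z cb cl) auto
  moreover have "(\<lambda>n. cut (z n) (w n)) \<longlonglongrightarrow> cut z' w'"
    unfolding cut_def using na e0 by (intro tendsto_intros z w) auto
  ultimately show ?thesis unfolding eta_def by (intro tendsto_intros)
qed

text \<open>The sum over both preimages of \<open>v\<close> is independent of the choice of root,
  which makes it continuous in \<open>v\<close> across the cut of \<open>csqrt\<close>.\<close>

definition leaf_shift :: "complex \<Rightarrow> complex \<Rightarrow> complex" where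
  "leaf_shift v w = eta (csqrt (v - cc 0)) w + eta (- csqrt (v - cc 0)) w"

lemma PP_csqrt: "PP (csqrt (v - cc 0)) = v" by (simp add: PP_def)

lemma csqrt_julia_pts: "v \<in> julia_pts \<Longrightarrow> csqrt (v - cc 0) \<in> julia_pts"
  by (rule PP_julia_pts_converse) (simp add: PP_csqrt)

lemma PP_eq: "PP z = PP z' \<longleftrightarrow> z = z' \<or> z = - z'"
  by (simp add: PP_def power2_eq_iff)

lemma leaf_shift_root: assumes "PP z = v" shows "leaf_shift v w = eta z w + eta (- z) w"
proof -
  have "csqrt (v - cc 0) = z \<or> csqrt (v - cc 0) = - z" using PP_eq[of "csqrt (v - cc 0)" z] assms PP_csqrt[of v] by simp
  then show ?thesis unfolding leaf_shift_def by (elim disjE) simp_all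
qed

lemma leaf_shift_lip: assumes "v \<in> julia_pts" shows "norm (leaf_shift v w - leaf_shift v w') \<le> 1/2 * norm (w - w')"
proof -
  let ?s = "csqrt (v - cc 0)"
  have s: "?s \<in> julia_pts" "- ?s \<in> julia_pts" using csqrt_julia_pts[OF assms] julia_pts_minus by auto
  have "leaf_shift v w - leaf_shift v w' = (eta ?s w - eta ?s w') + (eta (- ?s) w - eta (- ?s) w')" by (simp add: leaf_shift_def)
  then show ?thesis
    using norm_triangle_ineq[of "eta ?s w - eta ?s w'" "eta (- ?s) w - eta (- ?s) w'"] eta_lip[OF s(1), of w w'] eta_lip[OF s(2), of w w']
    by simp
qed

lemma leaf_shift_outside: assumes "v \<in> julia_pts" "norm w \<ge> r" shows "leaf_shift v w = 0"
proof -
  have "eta z w = 0" if z: "z \<in> julia_pts" for z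
  proof (rule eta_0)
    have "norm a * norm z \<le> norm a * 3" using julia_pts_norm[OF z] by (intro mult_left_mono) auto
    moreover have "norm w \<le> norm (w - a * z) + norm (a * z)" by (metis diff_add_cancel norm_triangle_ineq)
    ultimately show "norm a * e \<le> norm (w - a * z)" using s1 assms(2) by (simp add: norm_mult algebra_simps)
  qed
  then show ?thesis using csqrt_julia_pts[OF assms(1)] julia_pts_minus by (simp add: leaf_shift_def)
qed

lemma psi_dist: assumes "z \<in> julia_pts" "norm y \<le> r" shows "norm (a\<^sup>2 * y / (2 * z)) \<le> norm a * e / 2"
proof -
  have "norm (a\<^sup>2 * y / (2 * z)) = (norm a)\<^sup>2 * norm y / (2 * norm z)" by (simp add: norm_mult norm_divide norm_power)
  also have "\<dots> \<le> (norm a)\<^sup>2 * r / (2 * e)" using assms julia_pts_ge[OF assms(1)] e0 r by (intro frac_le mult_left_mono) auto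
  also have "(norm a)\<^sup>2 * r = norm a * (norm a * r)" by (simp add: power2_eq_square)
  also have "norm a * (norm a * r) / (2 * e) \<le> norm a * e\<^sup>2 / (2 * e)" using s2 e0 by (intro divide_right_mono mult_left_mono) auto
  also have "\<dots> = norm a * e / 2" using e0 by (simp add: power2_eq_square)
  finally show ?thesis .
qed

text \<open>At the image of \<open>(z, y)\<close> the cut-off belonging to \<open>z\<close> equals
  1, since the distance from \<open>a * z\<close> is at most \<open>norm a * e / 2\<close>, while
  \<open>- a * z\<close> is at least \<open>norm a * e\<close> away, so the other summand
  vanishes.\<close>

lemma leaf_shift_psi:
  assumes z: "z \<in> julia_pts" and y: "norm y \<le> r"
  shows "a * z - a\<^sup>2 * y / (2 * z) + leaf_shift (PP z) (a * z - a\<^sup>2 * y / (2 * z)) = a * limit_leaf a y z"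
proof -
  define w where "w = a * z - a\<^sup>2 * y / (2 * z)"
  have d: "norm (w - a * z) \<le> norm a * e / 2" using psi_dist[OF z y] by (simp add: w_def)
  then have "2 * norm (w - a * z) / (norm a * e) \<le> 1" using na e0 by (simp add: field_simps)
  then have c: "cut z w = 1" by (simp add: cut_def)
  have "(a * z - w) * 2 * z / a\<^sup>2 = y" using julia_pts_nz[OF z] a0 by (simp add: w_def)
  then have e1: "eta z w = a * leaf_error z y" using c clamp(2)[OF y] by (simp add: eta_def)
  have e2: "eta (- z) w = 0"
  proof (rule eta_0)
    have "norm (2 * a * z) \<ge> 2 * norm a * e" using julia_pts_ge[OF z] na by (simp add: norm_mult mult_left_mono)
    moreover have "norm (2 * a * z) \<le> norm (w - a * - z) + norm (w - a * z)"
      using norm_triangle_ineq4[of "w - a * - z" "w - a * z"] by (simp add: algebra_simps)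
    moreover have "norm a * e \<ge> 0" using e0 by simp
    ultimately show "norm a * e \<le> norm (w - a * - z)" using d by linarith
  qed
  have "w + leaf_shift (PP z) w = w + a * leaf_error z y" using leaf_shift_root[OF refl, of z w] e1 e2 by simp
  also have "\<dots> = a * limit_leaf a y z" using julia_pts_nz[OF z] by (simp add: w_def leaf_error_def algebra_simps power2_eq_square)
  finally show ?thesis by (simp add: w_def)
qed

definition g0 :: "complex \<times> complex \<Rightarrow> complex \<times> complex" where
  "g0 p = (fst p, snd p + leaf_shift (fst p) (snd p))"

definition XX :: "(complex \<times> complex) set" where "XX = julia_pts \<times> cball 0 r"
definition YY :: "(complex \<times> complex) set" where "YY = julia_pts \<times> ball 0 r"

lemma compact_XX: "compact XX"
  unfolding XX_def by (intro compact_Times compact_julia_pts compact_cball)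

lemma root_seq:
  assumes "\<And>n. v n \<in> julia_pts" "v \<longlonglongrightarrow> PP z" "z \<in> julia_pts"
  shows "\<And>n. PP (PP_branch z (v n)) = v n" "\<And>n. PP_branch z (v n) \<in> julia_pts" "(\<lambda>n. PP_branch z (v n)) \<longlonglongrightarrow> z"
proof -
  show 1: "PP (PP_branch z (v n)) = v n" for n by (rule PP_branch(1)[OF julia_pts_nz[OF assms(3)]])
  then show "PP_branch z (v n) \<in> julia_pts" for n using PP_julia_pts_converse[of "PP_branch z (v n)"] assms(1) by simp
  show "(\<lambda>n. PP_branch z (v n)) \<longlonglongrightarrow> z"
    using isCont_tendsto_compose[OF PP_branch(3)[OF julia_pts_nz[OF assms(3)]] assms(2)] PP_branch(2)[OF julia_pts_nz[OF assms(3)]] by simp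
qed

text \<open>The base points are lifted by the local inverse of \<open>PP\<close> near one preimage;
  the symmetric form of \<open>leaf_shift\<close> allows this branch in place of
  \<open>csqrt\<close>.\<close>

lemma continuous_g0: "continuous_on XX g0"
  unfolding continuous_on_sequentially
proof (intro allI ballI impI)
  fix p u assume "u \<in> XX" and p: "(\<forall>n. p n \<in> XX) \<and> p \<longlonglongrightarrow> u"
  then have u: "fst u \<in> julia_pts" by (auto simp: XX_def)
  have pJ: "fst (p n) \<in> julia_pts" for n using p by (auto simp: XX_def mem_Times_iff)
  have l1: "(\<lambda>n. fst (p n)) \<longlonglongrightarrow> fst u" and l2: "(\<lambda>n. snd (p n)) \<longlonglongrightarrow> snd u"
    using p by (auto intro: tendsto_fst tendsto_snd)
  define z where "z = csqrt (fst u - cc 0)"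
  have z: "PP z = fst u" "z \<in> julia_pts" using PP_csqrt csqrt_julia_pts[OF u] by (auto simp: z_def)
  have "(\<lambda>n. fst (p n)) \<longlonglongrightarrow> PP z" using l1 z by simp
  note rs = root_seq[OF pJ this z(2)]
  have "(\<lambda>n. eta (PP_branch z (fst (p n))) (snd (p n)) + eta (- PP_branch z (fst (p n))) (snd (p n))) \<longlonglongrightarrow> eta z (snd u) + eta (- z) (snd u)"
    by (intro tendsto_add eta_joint rs l2 z julia_pts_minus tendsto_minus)
  then have "(\<lambda>n. leaf_shift (fst (p n)) (snd (p n))) \<longlonglongrightarrow> leaf_shift (fst u) (snd u)"
    using leaf_shift_root[OF rs(1)] leaf_shift_root[OF z(1)] by simp
  then show "(g0 \<circ> p) \<longlonglongrightarrow> g0 u" unfolding comp_def g0_def by (intro tendsto_intros l1 l2)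
qed

lemma g0_inj: assumes "fst p \<in> julia_pts" "fst p' \<in> julia_pts" "g0 p = g0 p'" shows "p = p'"
proof -
  have f: "fst p = fst p'" using assms(3) by (simp add: g0_def)
  have "snd p - snd p' = leaf_shift (fst p) (snd p') - leaf_shift (fst p) (snd p)" using assms(3) f by (simp add: g0_def algebra_simps)
  then have "norm (snd p - snd p') \<le> 1/2 * norm (snd p - snd p')"
    using leaf_shift_lip[OF assms(1), of "snd p'" "snd p"] by (simp add: norm_minus_commute)
  then have "snd p = snd p'" by simp
  then show ?thesis using f by (simp add: prod_eq_iff)
qed

lemma g0_outside: "v \<in> julia_pts \<Longrightarrow> norm w \<ge> r \<Longrightarrow> g0 (v, w) = (v, w)"
  by (simp add: g0_def leaf_shift_outside)

text \<open>On each fibre \<open>g0\<close> is the identity plus a map of Lipschitz constant 1/2,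
  hence bijective on the plane; being the identity outside the disc of radius \<open>r\<close>, it
  preserves the disc.\<close>

lemma g0_image: "g0 ` XX = XX"
proof (intro equalityI subsetI)
  fix p assume "p \<in> g0 ` XX"
  then obtain v w where vw: "v \<in> julia_pts" "norm w \<le> r" "p = g0 (v, w)" by (auto simp: XX_def)
  define u where "u = w + leaf_shift v w"
  have "norm u \<le> r"
  proof (rule ccontr)
    assume "\<not> norm u \<le> r"
    then have "g0 (v, u) = (v, u)" by (intro g0_outside vw) auto
    then have "g0 (v, u) = g0 (v, w)" by (simp add: g0_def[of "(v, w)"] u_def)
    then have "(v, u) = (v, w)" by (rule g0_inj[rotated 2]) (use vw in auto)
    then show False using \<open>\<not> norm u \<le> r\<close> vw(2) by simp
  qed
  then show "p \<in> XX" using vw by (simp add: XX_def g0_def u_def)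
next
  fix p assume "p \<in> XX"
  then obtain v u where vu: "p = (v, u)" "v \<in> julia_pts" "norm u \<le> r" by (auto simp: XX_def)
  have "\<exists>!w. u - leaf_shift v w = w"
    by (rule banach_fix_type[of "1/2"]) (use leaf_shift_lip[OF vu(2)] in \<open>auto simp: dist_norm norm_minus_commute\<close>)
  then obtain w where w: "u - leaf_shift v w = w" by blast
  have "norm w \<le> r"
  proof (rule ccontr)
    assume n: "\<not> norm w \<le> r"
    then have "leaf_shift v w = 0" by (intro leaf_shift_outside vu) auto
    then show False using w n vu by simp
  qed
  moreover have "g0 (v, w) = p" using w vu by (simp add: g0_def algebra_simps)
  ultimately show "p \<in> g0 ` XX" using vu by (intro image_eqI[of _ _ "(v, w)"]) (auto simp: XX_def)
qed

lemma psi_image: assumes "p \<in> XX" shows "psi p \<in> YY"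
proof -
  obtain z y where p: "p = (z, y)" "z \<in> julia_pts" "norm y \<le> r" using assms by (auto simp: XX_def)
  have "norm (a * z - a\<^sup>2 * y / (2 * z)) \<le> norm (a * z) + norm (a\<^sup>2 * y / (2 * z))" by (rule norm_triangle_ineq4)
  also have "\<dots> \<le> norm a * 3 + norm a * e / 2"
    using psi_dist[OF p(2,3)] julia_pts_norm[OF p(2)] by (intro add_mono) (auto simp: norm_mult intro: mult_left_mono)
  also have "\<dots> < r"
  proof -
    have "norm a * e / 2 \<le> norm a * e" using na e0 by simp
    then show ?thesis using s1 by (simp add: algebra_simps)
  qed
  finally show ?thesis using p PP_julia_pts by (simp add: psi_def YY_def)
qed

lemma YY_sub: "YY \<subseteq> XX" by (auto simp: XX_def YY_def)

lemma XX_nz: "p \<in> XX \<Longrightarrow> fst p \<noteq> 0" using julia_pts_nz by (auto simp: XX_def)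

lemma continuous_psi: "continuous_on XX psi"
  unfolding psi_def PP_def using XX_nz by (intro continuous_intros) auto

text \<open>Opposite base points \<open>z\<close> and \<open>- z\<close> have the same image, but
  the discs over them are sent into discs about \<open>a * z\<close> and \<open>- a * z\<close> of
  radius at most \<open>norm a * e / 2\<close>, while the centres are at least
  \<open>2 * norm a * e\<close> apart.\<close>

lemma psi_inj: "inj_on psi XX"
proof (rule inj_onI)
  fix p p' assume p: "p \<in> XX" "p' \<in> XX" "psi p = psi p'"
  obtain z y where z: "p = (z, y)" "z \<in> julia_pts" "norm y \<le> r" using p by (auto simp: XX_def)
  obtain z' y' where z': "p' = (z', y')" "z' \<in> julia_pts" "norm y' \<le> r" using p by (auto simp: XX_def)
  have eq: "PP z = PP z'" "a * z - a\<^sup>2 * y / (2 * z) = a * z' - a\<^sup>2 * y' / (2 * z')"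
    using p(3) z z' by (auto simp: psi_def)
  have "z = z'"
  proof (rule ccontr)
    assume "z \<noteq> z'"
    then have z'm: "z' = - z" using eq(1) PP_eq by (metis minus_minus)
    then have "2 * a * z = a\<^sup>2 * y / (2 * z) - a\<^sup>2 * y' / (2 * z')" using eq(2) by (simp add: algebra_simps)
    then have "norm (2 * a * z) \<le> norm (a\<^sup>2 * y / (2 * z)) + norm (a\<^sup>2 * y' / (2 * z'))" by (metis norm_triangle_ineq4)
    also have "\<dots> \<le> norm a * e / 2 + norm a * e / 2" by (intro add_mono psi_dist z z')
    finally have "2 * (norm a * norm z) \<le> norm a * e" by (simp add: norm_mult mult_ac)
    moreover have "norm a * norm z \<ge> norm a * e" using julia_pts_ge[OF z(2)] by (intro mult_left_mono) auto
    ultimately show False using mult_pos_pos[OF na e0] by linarith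
  qed
  moreover from this have "y = y'" using eq(2) a0 julia_pts_nz[OF z(2)] by simp
  ultimately show "p = p'" using z z' by simp
qed

text \<open>That is, \<open>psi\<close> maps \<open>YY\<close> onto a relatively open set. Points of
  \<open>XX\<close> near an image point are solved for explicitly by the local inverse of
  \<open>PP\<close>, and backward invariance of the Julia set keeps the solutions in the
  domain.\<close>

lemma psi_closed: "closed (XX - psi ` YY)"
  unfolding closed_sequential_limits
proof (intro allI impI)
  fix p u assume p: "(\<forall>n. p n \<in> XX - psi ` YY) \<and> p \<longlonglongrightarrow> u"
  have pX: "p n \<in> XX" "p n \<notin> psi ` YY" for n using p by auto
  have uX: "u \<in> XX" using closed_sequentially[OF compact_imp_closed[OF compact_XX], of p u] pX p by blast
  have "u \<notin> psi ` YY"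
  proof
    assume "u \<in> psi ` YY"
    then obtain z y where zy: "z \<in> julia_pts" "norm y < r" "u = psi (z, y)" by (auto simp: YY_def)
    have pJ: "fst (p n) \<in> julia_pts" for n using pX(1)[of n] by (auto simp: XX_def mem_Times_iff)
    have l1: "(\<lambda>n. fst (p n)) \<longlonglongrightarrow> PP z" and l2: "(\<lambda>n. snd (p n)) \<longlonglongrightarrow> a * z - a\<^sup>2 * y / (2 * z)"
      using tendsto_fst[of p u sequentially] tendsto_snd[of p u sequentially] p zy(3) by (auto simp: psi_def)
    note rs = root_seq[OF pJ l1 zy(1)]
    define t where "t n = (a * PP_branch z (fst (p n)) - snd (p n)) * 2 * PP_branch z (fst (p n)) / a\<^sup>2" for n
    have "t \<longlonglongrightarrow> (a * z - (a * z - a\<^sup>2 * y / (2 * z))) * 2 * z / a\<^sup>2"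
      unfolding t_def using a0 by (intro tendsto_intros rs l2) auto
    also have "(a * z - (a * z - a\<^sup>2 * y / (2 * z))) * 2 * z / a\<^sup>2 = y" using a0 julia_pts_nz[OF zy(1)] by simp
    finally have "t \<longlonglongrightarrow> y" .
    then have "(\<lambda>n. norm (t n)) \<longlonglongrightarrow> norm y" by (rule tendsto_norm)
    then have "\<forall>\<^sub>F n in sequentially. norm (t n) < r" using zy(2) by (rule order_tendstoD(2))
    then obtain n where n: "norm (t n) < r" by (auto simp: eventually_sequentially)
    have "psi (PP_branch z (fst (p n)), t n) = p n"
      using rs(1)[of n] a0 julia_pts_nz[OF rs(2)[of n]] by (simp add: psi_def t_def prod_eq_iff field_simps)
    moreover have "(PP_branch z (fst (p n)), t n) \<in> YY" using n rs(2) by (simp add: YY_def)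
    ultimately show False using pX(2)[of n] by (metis imageI)
  qed
  then show "u \<in> XX - psi ` YY" using uX by simp
qed

lemma psi_contraction:
  assumes "p \<in> XX" "p' \<in> XX" "fst p = fst p'"
  shows "dist (snd (psi p)) (snd (psi p')) \<le> dist (snd p) (snd p') / 2"
proof -
  have z: "fst p \<in> julia_pts" using assms by (auto simp: XX_def)
  have "snd (psi p) - snd (psi p') = a\<^sup>2 / (2 * fst p) * (snd p' - snd p)"
    using assms(3) julia_pts_nz[OF z] by (simp add: psi_def field_simps)
  then have "dist (snd (psi p)) (snd (psi p')) = (norm a)\<^sup>2 / (2 * norm (fst p)) * dist (snd p) (snd p')"
    by (simp add: dist_norm norm_mult norm_divide norm_power norm_minus_commute)
  also have "\<dots> \<le> 1/2 * dist (snd p) (snd p')"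
  proof (intro mult_right_mono)
    have "(norm a)\<^sup>2 / (2 * norm (fst p)) \<le> e / (2 * e)" using s4 julia_pts_ge[OF z] e0 by (intro frac_le) auto
    then show "(norm a)\<^sup>2 / (2 * norm (fst p)) \<le> 1/2" using e0 by simp
  qed simp
  finally show ?thesis by simp
qed

lemma g0_psi: assumes "p \<in> XX" shows "g0 (psi p) = (PP (fst p), a * limit_leaf a (snd p) (fst p))"
  using leaf_shift_psi[of "fst p" "snd p"] assms by (auto simp: g0_def psi_def XX_def)

lemma F_contraction:
  assumes "p \<in> XX" "p' \<in> XX" "fst p = fst p'"
  shows "dist (snd (g0 (psi p))) (snd (g0 (psi p'))) \<le> dist (snd p) (snd p') / 2"
proof -
  have z: "fst p \<in> julia_pts" "norm (snd p) < \<rho>" "norm (snd p') < \<rho>" using assms r by (auto simp: XX_def)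
  have "dist (snd (g0 (psi p))) (snd (g0 (psi p'))) = norm a * norm (limit_leaf a (snd p) (fst p) - limit_leaf a (snd p') (fst p))"
    using g0_psi assms by (simp add: dist_norm norm_mult flip: right_diff_distrib)
  also have "\<dots> \<le> 1/2 * norm (snd p - snd p')"
    using s4(1) limit_leaf_lip[OF julia_pts_closure_escaping_pts[OF z(1)] ad z(2,3)] by (intro mult_mono) auto
  finally show ?thesis by (simp add: dist_norm)
qed

definition leaf_chart :: "complex \<times> complex \<Rightarrow> complex \<times> complex" where
  "leaf_chart p = (limit_leaf a (snd p) (fst p), snd p)"

text \<open>The domain is not compact, so continuity of the inverse needs a bound: the lower Hoelder
  estimate for leaves at a common height, together with their Lipschitz dependence on the
  height.\<close>

lemma leaf_chart_homeomorphism: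
  obtains E' where "homeomorphism YY (leaf_chart ` YY) leaf_chart E'"
proof -
  have Y: "fst p \<in> julia_pts \<and> norm (snd p) < \<rho>" if "p \<in> YY" for p using that r by (auto simp: YY_def)
  have key: "(norm (fst p - fst p'))\<^sup>2 \<le> 7 * (norm (fst (leaf_chart p) - fst (leaf_chart p')) + norm (snd p - snd p'))" if "p \<in> YY" "p' \<in> YY" for p p'
  proof -
    have 1: "fst p \<in> julia_pts" "fst p' \<in> julia_pts" "norm (snd p) < \<rho>" "norm (snd p') < \<rho>" using Y that by blast+
    have "norm (limit_leaf a (snd p) (fst p) - limit_leaf a (snd p) (fst p')) \<le> norm (fst (leaf_chart p) - fst (leaf_chart p')) + norm (limit_leaf a (snd p') (fst p') - limit_leaf a (snd p) (fst p'))"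
      using norm_triangle_ineq[of "fst (leaf_chart p) - fst (leaf_chart p')" "limit_leaf a (snd p') (fst p') - limit_leaf a (snd p) (fst p')"] by (simp add: leaf_chart_def)
    also have "norm (limit_leaf a (snd p') (fst p') - limit_leaf a (snd p) (fst p')) \<le> norm (snd p' - snd p)"
      by (rule limit_leaf_lip[OF julia_pts_closure_escaping_pts[OF 1(2)] ad 1(4,3)])
    finally show ?thesis using limit_leaf_holder(1)[OF 1(1,2) ad 1(3)] by (simp add: norm_minus_commute)
  qed
  have inj: "inj_on leaf_chart YY"
  proof (rule inj_onI)
    fix p p' assume p: "p \<in> YY" "p' \<in> YY" "leaf_chart p = leaf_chart p'"
    then have s: "snd p = snd p'" by (simp add: leaf_chart_def)
    then have "(norm (fst p - fst p'))\<^sup>2 \<le> 0" using key[OF p(1,2)] p(3) by simp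
    then show "p = p'" using s by (simp add: prod_eq_iff)
  qed
  define E' where "E' = inv_into YY leaf_chart"
  have E': "E' (leaf_chart p) = p" if "p \<in> YY" for p using inj that by (simp add: E'_def)
  have c1: "continuous_on YY leaf_chart"
    unfolding continuous_on_sequentially
  proof (intro allI ballI impI)
    fix p u assume u: "u \<in> YY" and p: "(\<forall>n. p n \<in> YY) \<and> p \<longlonglongrightarrow> u"
    have l: "(\<lambda>n. fst (p n)) \<longlonglongrightarrow> fst u" "(\<lambda>n. snd (p n)) \<longlonglongrightarrow> snd u" using p by (auto intro: tendsto_fst tendsto_snd)
    have "(\<lambda>n. limit_leaf a (snd (p n)) (fst (p n))) \<longlonglongrightarrow> limit_leaf a (snd u) (fst u)"
      by (rule limit_leaf_joint) (use Y p u l in auto)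
    then show "(leaf_chart \<circ> p) \<longlonglongrightarrow> leaf_chart u" unfolding comp_def leaf_chart_def by (intro tendsto_intros l)
  qed
  have c2: "continuous_on (leaf_chart ` YY) E'"
    unfolding continuous_on_sequentially
  proof (intro allI ballI impI)
    fix x u assume u: "u \<in> leaf_chart ` YY" and x: "(\<forall>n. x n \<in> leaf_chart ` YY) \<and> x \<longlonglongrightarrow> u"
    obtain p0 where p0: "p0 \<in> YY" "u = leaf_chart p0" using u by blast
    have "\<exists>p. \<forall>n. p n \<in> YY \<and> x n = leaf_chart (p n)" using x by (intro choice allI) blast
    then obtain p where p: "\<And>n. p n \<in> YY" "\<And>n. x n = leaf_chart (p n)" by blast
    have l: "(\<lambda>n. fst (x n)) \<longlonglongrightarrow> fst u" "(\<lambda>n. snd (x n)) \<longlonglongrightarrow> snd u" using x by (auto intro: tendsto_fst tendsto_snd)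
    have l2: "(\<lambda>n. snd (p n)) \<longlonglongrightarrow> snd p0" using l(2) p p0 by (simp add: leaf_chart_def)
    have "(\<lambda>n. 7 * (norm (fst (x n) - fst u) + norm (snd (p n) - snd p0))) \<longlonglongrightarrow> 7 * (norm (fst u - fst u) + norm (snd p0 - snd p0))"
      by (intro tendsto_intros l l2)
    then have "(\<lambda>n. sqrt (7 * (norm (fst (x n) - fst u) + norm (snd (p n) - snd p0)))) \<longlonglongrightarrow> sqrt (7 * (norm (fst u - fst u) + norm (snd p0 - snd p0)))"
      by (rule tendsto_real_sqrt)
    then have l0: "(\<lambda>n. sqrt (7 * (norm (fst (x n) - fst u) + norm (snd (p n) - snd p0)))) \<longlonglongrightarrow> 0" by simp
    have b: "norm (fst (p n) - fst p0) \<le> sqrt (7 * (norm (fst (x n) - fst u) + norm (snd (p n) - snd p0)))" for n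
      by (rule real_le_rsqrt) (use key[OF p(1) p0(1), of n] p(2)[of n] p0(2) in simp)
    have "(\<lambda>n. fst (p n) - fst p0) \<longlonglongrightarrow> 0"
      by (rule Lim_null_comparison[OF always_eventually l0]) (use b in blast)
    then have l1: "(\<lambda>n. fst (p n)) \<longlonglongrightarrow> fst p0" by (rule LIM_zero_cancel)
    have "(\<lambda>n. (fst (p n), snd (p n))) \<longlonglongrightarrow> (fst p0, snd p0)" by (intro tendsto_intros l1 l2)
    then show "(E' \<circ> x) \<longlonglongrightarrow> E' u" using p p0 E' by (simp add: comp_def)
  qed
  have "homeomorphism YY (leaf_chart ` YY) leaf_chart E'"
    unfolding homeomorphism_def using c1 c2 E' by (auto simp: image_image)
  then show ?thesis by (rule that)
qed

text \<open>The conjugacy \<open>h\<close> is constructed over the closed disc, where compactness is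
  available. It is the identity over the boundary circle, so it restricts to the open disc, and
  \<open>leaf_chart\<close> carries it to the forward Julia set.\<close>

theorem henon_conjugate_to_model:
  obtains \<Phi> \<Phi>' where "homeomorphism (julia_pts \<times> ball 0 r) (J_plus (cc a) a \<inter> (ball 0 r \<times> ball 0 r)) \<Phi> \<Phi>'"
    "\<And>p. p \<in> julia_pts \<times> ball 0 r \<Longrightarrow> henon (cc a) a (\<Phi> p) = \<Phi> (psi p)" "\<And>p. p \<in> julia_pts \<times> ball 0 r \<Longrightarrow> psi p \<in> julia_pts \<times> ball 0 r"
proof -
  have bd: "g0 p = p" if "p \<in> XX - YY" for p
  proof -
    have "fst p \<in> julia_pts" "norm (snd p) \<ge> r" using that by (auto simp: XX_def YY_def)
    then show ?thesis using g0_outside[of "fst p" "snd p"] by simp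
  qed
  have "inj_on g0 XX"
    by (intro inj_onI) (metis XX_def g0_inj mem_Times_iff prod.collapse)
  then have "\<exists>k0. homeomorphism XX XX g0 k0"
    using homeomorphism_compact[OF compact_XX continuous_g0 g0_image] by metis
  then obtain k0 where k0: "homeomorphism XX XX g0 k0" by blast
  have psiY: "psi ` XX \<subseteq> YY" using psi_image by blast
  have psif: "fst (psi p) = fst (psi p')" if "p \<in> XX" "p' \<in> XX" "fst p = fst p'" for p p'
    using that by (simp add: psi_def)
  have g0f: "fst (g0 p) = fst p" if "p \<in> XX" for p by (simp add: g0_def)
  have "\<exists>h k. homeomorphism XX XX h k \<and> (\<forall>p\<in>XX. fst (h p) = fst p) \<and> (\<forall>p\<in>XX - YY. h p = p) \<and>
      (\<forall>p\<in>XX. h (psi p) = g0 (psi (h p)))"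
  proof (rule skew_conjugacy[OF compact_XX YY_sub continuous_psi psi_inj psiY psif psi_contraction F_contraction k0 g0f bd psi_closed])
    fix h k assume "homeomorphism XX XX h k" "\<And>p. p \<in> XX \<Longrightarrow> fst (h p) = fst p"
      "\<And>p. p \<in> XX - YY \<Longrightarrow> h p = p" "\<And>p. p \<in> XX \<Longrightarrow> h (psi p) = g0 (psi (h p))"
    then show ?thesis by (intro exI[of _ h] exI[of _ k] conjI ballI)
  qed
  then obtain h k where hk: "homeomorphism XX XX h k" and hf: "\<And>p. p \<in> XX \<Longrightarrow> fst (h p) = fst p"
    and hb: "\<And>p. p \<in> XX - YY \<Longrightarrow> h p = p" and hpsi: "\<And>p. p \<in> XX \<Longrightarrow> h (psi p) = g0 (psi (h p))"
    by metis
  have hX: "h ` XX = XX" "\<And>p. p \<in> XX \<Longrightarrow> k (h p) = p" using hk unfolding homeomorphism_def by auto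
  have hY: "h ` YY = YY"
  proof -
    have inj: "inj_on h XX" using hX(2) by (metis inj_onI)
    have "h ` YY = h ` (XX - (XX - YY))" using YY_sub by (simp add: double_diff)
    also have "\<dots> = h ` XX - h ` (XX - YY)" by (rule inj_on_image_set_diff[OF inj]) auto
    also have "h ` (XX - YY) = XX - YY" using hb by force
    also have "h ` XX - (XX - YY) = YY" using hX(1) YY_sub by blast
    finally show ?thesis .
  qed
  have hkY: "homeomorphism YY YY h k"
    using homeomorphism_of_subsets[OF hk YY_sub _ hY] YY_sub by blast
  obtain E' where E': "homeomorphism YY (leaf_chart ` YY) leaf_chart E'" by (rule leaf_chart_homeomorphism)
  have img: "leaf_chart ` YY = J_plus (cc a) a \<inter> (ball 0 r \<times> ball 0 r)"
    unfolding J_plus_eq[OF ad r(1) less_imp_le[OF r(2)]] leaf_chart_def YY_def by (auto simp: image_iff)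
  show ?thesis
  proof (rule that[of "leaf_chart \<circ> h" "k \<circ> E'"])
    show "homeomorphism (julia_pts \<times> ball 0 r) (J_plus (cc a) a \<inter> (ball 0 r \<times> ball 0 r)) (leaf_chart \<circ> h) (k \<circ> E')"
      using homeomorphism_compose[OF hkY E'] unfolding img unfolding YY_def .
    fix p :: "complex \<times> complex" assume "p \<in> julia_pts \<times> ball 0 r"
    then have pY: "p \<in> YY" by (simp add: YY_def)
    then have pX: "p \<in> XX" using YY_sub by blast
    define u where "u = h p"
    have uY: "u \<in> YY" using hY pY u_def by blast
    then have uX: "u \<in> XX" using YY_sub by blast
    have u: "fst u \<in> julia_pts" "norm (snd u) < \<rho>" using uY r by (auto simp: YY_def)
    have "h (psi p) = (PP (fst u), a * limit_leaf a (snd u) (fst u))"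
      using hpsi[OF pX] g0_psi[OF uX] by (simp add: u_def)
    then have "leaf_chart (h (psi p)) = (limit_leaf a (a * limit_leaf a (snd u) (fst u)) (PP (fst u)), a * limit_leaf a (snd u) (fst u))"
      by (simp add: leaf_chart_def)
    also have "\<dots> = henon (cc a) a (leaf_chart u)"
      using limit_leaf_eq[OF u(1) ad u(2)] by (simp add: henon_def leaf_chart_def)
    finally show "henon (cc a) a ((leaf_chart \<circ> h) p) = (leaf_chart \<circ> h) (psi p)" by (simp add: u_def)
    show "psi p \<in> julia_pts \<times> ball 0 r" using psi_image[OF pX] by (simp add: YY_def)
  qed
qed

end

section \<open>Choice of constants and conclusion\<close>

context root_of_unity
begin

lemma cc_square_holomorphic: "(\<lambda>a. cc (a\<^sup>2)) holomorphic_on A"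
  unfolding cc_def xf_def using lam0 by (intro holomorphic_intros) auto

lemma norm_cc_0: "norm (cc 0) \<le> 3 / 4"
  using norm_triangle_ineq4[of "lam / 2" "lam\<^sup>2 / 4"] lam1 by (simp add: cc_0 norm_divide norm_power)

text \<open>If a point with escaping orbit were close to the critical value, then its first
  coordinate and the next one would lie in the trapped neighbourhood, with parameter
  \<open>b = a^2\<close>. Late terms would then be below 1, against the growth of the orbit after it
  reaches modulus 3.\<close>

lemma henon_family_exists:
  assumes rho: "\<rho> > 3"
  obtains \<delta> e where "henon_family (\<lambda>a. cc (a\<^sup>2)) \<delta> \<rho> e"
proof -
  obtain e1 N where e1: "e1 > 0" and trap: "\<And>b x n. norm b < e1 \<Longrightarrow> norm (x 0 - cc 0) < e1 \<Longrightarrow>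
      norm (x 1 - ((cc 0)\<^sup>2 + cc 0)) < e1 \<Longrightarrow>
      (\<And>n. x (Suc (Suc n)) = (x (Suc n))\<^sup>2 + cc b + b * x n) \<Longrightarrow> n \<ge> N \<Longrightarrow> norm (x n) < 1"
    by (rule critical_value_region_trapped) blast
  \<comment> \<open>The first term ends up within \<open>h\<close> of the critical value. As
    \<open>norm (x + cc 0) \<le> 3\<close>, the second is within \<open>3 * h\<close> plus two
    errors below \<open>h / 6\<close> of its target, hence within
    \<open>5 * h \<le> e1\<close>.\<close>
  define h where "h = min 1 (e1 / 5)"
  have h: "h > 0" "h \<le> 1" "5 * h \<le> e1" using e1 by (auto simp: h_def)
  define e where "e = sqrt (h / 3)"
  have e: "e > 0" "e\<^sup>2 = h / 3" using h by (auto simp: e_def)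
  have "isCont (\<lambda>a. cc (a\<^sup>2)) 0"
    using holomorphic_on_imp_continuous_on[OF cc_square_holomorphic[of UNIV]]
    by (simp add: continuous_on_eq_continuous_at)
  then have "\<exists>d>0. \<forall>a. dist a 0 < d \<longrightarrow> dist (cc (a\<^sup>2)) (cc (0\<^sup>2)) < h / 6"
    unfolding continuous_at_eps_delta using h by (metis divide_pos_pos zero_less_numeral)
  then obtain d where d: "d > 0" "\<And>a. norm a < d \<Longrightarrow> norm (cc (a\<^sup>2) - cc 0) < h / 6"
    by (auto simp: dist_norm)
  define \<delta> where "\<delta> = min d (min (e / 2) (h / (4 * (6 + 2 * \<rho>))))"
  have \<delta>: "\<delta> > 0" "\<delta> \<le> d" "2 * \<delta> \<le> e" using d e h rho by (auto simp: \<delta>_def)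
  have "\<delta> \<le> h / (4 * (6 + 2 * \<rho>))" by (simp add: \<delta>_def)
  then have \<delta>': "\<delta> * (4 * (6 + 2 * \<rho>)) \<le> h" using rho by (simp add: field_simps)
  have "\<delta> * \<rho> > 0" using \<delta> rho by simp
  have d1: "24 * \<delta> + 8 * (\<delta> * \<rho>) \<le> h" using \<delta>' by (simp add: algebra_simps)
  have \<delta>6: "\<delta> * (6 + 2 * \<rho>) < e\<^sup>2" using d1 e h by (simp add: algebra_simps)
  interpret henon_base "\<lambda>a. cc (a\<^sup>2)" \<delta> \<rho> e
  proof
    show "norm (cc (a\<^sup>2)) \<le> 1" if "norm a < \<delta>" for a
      using d(2)[of a] that \<delta>(2) h norm_cc_0 norm_triangle_ineq2[of "cc (a\<^sup>2)" "cc 0"] by simp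
    show "\<delta> * \<rho> \<le> 1" using d1 \<delta>(1) h \<open>\<delta> * \<rho> > 0\<close> by linarith
  qed (use \<delta> \<delta>6 rho e cc_square_holomorphic in auto)
  have "e\<^sup>2 \<le> norm (x - cc (a\<^sup>2) - a * y')"
    if a: "norm a < \<delta>" and y: "norm y < \<rho>" "norm y' < \<rho>" and n: "3 \<le> norm (X a n x y)" for a x y y' n
  proof (rule ccontr)
    assume "\<not> ?thesis"
    then have lt: "norm (x - cc (a\<^sup>2) - a * y') < h / 3" using e by simp
    have ay: "norm (a * y) < h / 6" if "norm y < \<rho>" for y
    proof -
      have "norm a * norm y \<le> \<delta> * \<rho>" using a that rho \<delta> by (intro mult_mono) auto
      then show ?thesis using d1 \<delta>(1) h by (simp add: norm_mult)
    qed
    have ca: "norm (cc (a\<^sup>2) - cc 0) < h / 6" using d(2) a \<delta>(2) by simp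
    have "x - cc 0 = (x - cc (a\<^sup>2) - a * y') + (cc (a\<^sup>2) - cc 0) + a * y'" by simp
    then have "norm (x - cc 0) \<le> norm (x - cc (a\<^sup>2) - a * y') + norm (cc (a\<^sup>2) - cc 0) + norm (a * y')"
      by (metis norm_triangle_mono order_refl norm_triangle_ineq)
    then have x0: "norm (x - cc 0) < h" using lt ca ay[OF y(2)] h(1) by linarith
    have x2: "norm (x + cc 0) \<le> 3"
    proof -
      have "norm (x + cc 0) \<le> norm (x - cc 0) + norm (2 * cc 0)"
        using norm_triangle_ineq[of "x - cc 0" "2 * cc 0"] by (simp add: algebra_simps)
      then show ?thesis using x0 h norm_cc_0 by (simp add: norm_mult)
    qed
    have "norm ((x - cc 0) * (x + cc 0)) \<le> h * 3"
      unfolding norm_mult using x0 x2 h(1) by (intro mult_mono) auto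
    moreover have "x\<^sup>2 + cc (a\<^sup>2) + a * y - ((cc 0)\<^sup>2 + cc 0) = (x - cc 0) * (x + cc 0) + (cc (a\<^sup>2) - cc 0) + a * y"
      by (simp add: algebra_simps power2_eq_square)
    then have "norm (x\<^sup>2 + cc (a\<^sup>2) + a * y - ((cc 0)\<^sup>2 + cc 0)) \<le>
        norm ((x - cc 0) * (x + cc 0)) + norm (cc (a\<^sup>2) - cc 0) + norm (a * y)"
      by (metis norm_triangle_mono order_refl norm_triangle_ineq)
    ultimately have x1: "norm (x\<^sup>2 + cc (a\<^sup>2) + a * y - ((cc 0)\<^sup>2 + cc 0)) < e1"
      using ca ay[OF y(1)] h by linarith
    have "norm (a\<^sup>2) < e1"
    proof -
      have "norm a * norm a \<le> norm a * 1" using a delta_third by (intro mult_left_mono) auto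
      moreover have "24 * \<delta> < e1" using d1 h e1 \<open>\<delta> * \<rho> > 0\<close> by linarith
      ultimately show ?thesis using a \<delta>(1) by (simp add: power2_eq_square norm_mult)
    qed
    moreover have "X a (Suc (Suc n)) x y = (X a (Suc n) x y)\<^sup>2 + cc (a\<^sup>2) + a\<^sup>2 * X a n x y" for n
      unfolding X_def by (simp add: henon_def case_prod_beta power2_eq_square)
    ultimately have "norm (X a (n + N) x y) < 1"
      using x0 x1 h by (intro trap[of "a\<^sup>2" "\<lambda>n. X a n x y"]) (auto simp: X_Suc)
    moreover have "2 ^ N * norm (X a n x y) \<le> norm (X a (n + N) x y)"
      by (rule X_growth[OF a tame_small[OF a y(1)] n])
    moreover have "1 * 3 \<le> 2 ^ N * norm (X a n x y)" using n by (intro mult_mono) auto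
    ultimately show False by linarith
  qed
  then have "henon_family (\<lambda>a. cc (a\<^sup>2)) \<delta> \<rho> e" by unfold_locales (auto simp: X_def)
  then show ?thesis by (rule that)
qed

end

lemma exp_rational_primitive_root:
  fixes p :: int and q :: nat
  assumes q: "q \<ge> 1" and pq: "coprime p (int q)"
    and lam: "lam = exp (2 * complex_of_real pi * \<i> * of_int p / of_nat q)"
  shows "root_of_unity lam q"
proof
  show "norm lam = 1" unfolding lam by simp
  have pow: "lam ^ j = exp (2 * complex_of_real pi * \<i> * of_int p * of_nat j / of_nat q)" for j
    unfolding lam exp_of_nat_mult[symmetric] by (simp add: mult_ac)
  show "lam ^ q = 1"
    unfolding pow exp_eq_1 using q by (auto intro!: exI[of _ p])
  show "lam ^ j \<noteq> 1" if j: "0 < j" "j < q" for j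
  proof
    assume "lam ^ j = 1"
    then obtain n :: int where "2 * pi * real_of_int p * real j / real q = of_int (2 * n) * pi"
      unfolding pow exp_eq_1 by auto
    then have "real_of_int p * real j = real_of_int n * real q" using q by (simp add: field_simps)
    then have "p * int j = n * int q" by (metis of_int_eq_iff of_int_mult of_int_of_nat_eq)
    then have "int q dvd p * int j" by simp
    then have "int q dvd int j" using pq by (metis coprime_commute coprime_dvd_mult_right_iff)
    then show False using j zdvd_imp_le by fastforce
  qed
qed (rule q)

theorem theorem1p1:
  fixes p :: int and q :: nat and r :: real and lam :: complex
  assumes "q \<ge> 1" and "coprime p (int q)"
    and "lam = exp (2 * complex_of_real pi * \<i> * of_int p / of_nat q)"
    and "r > 3"
  shows "\<exists>\<delta>>0. \<forall>c a. (c, a) \<in> param_curve lam \<longrightarrow> 0 < norm a \<longrightarrow> norm a < \<delta> \<longrightarrow>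
    (\<forall>\<zeta>\<in>julia (parabolic_poly lam). deriv (parabolic_poly lam) \<zeta> \<noteq> 0) \<and>
    model_map lam a \<in> julia (parabolic_poly lam) \<times> ball 0 r \<rightarrow> julia (parabolic_poly lam) \<times> ball 0 r \<and>
    (\<exists>\<Phi> \<Phi>'. homeomorphism (julia (parabolic_poly lam) \<times> ball 0 r)
                  (J_plus c a \<inter> (ball 0 r \<times> ball 0 r)) \<Phi> \<Phi>' \<and>
       (\<forall>w\<in>julia (parabolic_poly lam) \<times> ball 0 r. henon c a (\<Phi> w) = \<Phi> (model_map lam a w)))"
proof -
  interpret root_of_unity lam q by (rule exp_rational_primitive_root[OF assms(1-3)])
  \<comment> \<open>The leaves are constructed over a larger disc, so that their estimates hold on
    the closed disc of radius \<open>r\<close>.\<close>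
  have "r + 1 > 3" using assms(4) by simp
  then obtain \<delta> e where "henon_family (\<lambda>a. cc (a\<^sup>2)) \<delta> (r + 1) e" by (rule henon_family_exists)
  then interpret henon_family "\<lambda>a. cc (a\<^sup>2)" \<delta> "r + 1" e .
  have PP: "PP = parabolic_poly lam" by (rule ext) (simp add: PP_def parabolic_poly_def cc_0)
  have J: "julia (parabolic_poly lam) = julia_pts" using julia_eq by (simp add: PP)
  \<comment> \<open>All but one of the smallness conditions on \<open>norm a\<close> are upper
    bounds for a multiple of \<open>norm a\<close>; the quadratic one follows from
    \<open>norm a < e / 2\<close> because \<open>norm a \<le> 1\<close>.\<close>
  have ev: "\<forall>\<^sub>F t in at_right 0. t * M < c" if "c > 0" for M c :: real
  proof -
    have "((\<lambda>t. t * M) \<longlongrightarrow> 0 * M) (at_right 0)" by (intro tendsto_intros)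
    then show ?thesis using that by (intro order_tendstoD(2)) auto
  qed
  have "\<forall>\<^sub>F t in at_right 0. t * 1 < \<delta> / 3 \<and> t * (3 + e) < r \<and> t * r < e\<^sup>2 \<and>
     t * (2 * (7 / \<delta> + r / (2 * e)) / e + 6 * ((14 / \<delta> + 1) / e\<^sup>2)) < 1/4 \<and> t * 1 < 1/2 \<and> t * (14 / \<delta>) < e \<and> t * 1 < e / 2"
    using delta e0 assms(4) by (intro eventually_conj ev) auto
  then obtain d where d: "d > 0" "\<And>t. 0 < t \<Longrightarrow> t < d \<Longrightarrow> t * 1 < \<delta> / 3 \<and> t * (3 + e) < r \<and> t * r < e\<^sup>2 \<and>
     t * (2 * (7 / \<delta> + r / (2 * e)) / e + 6 * ((14 / \<delta> + 1) / e\<^sup>2)) < 1/4 \<and> t * 1 < 1/2 \<and> t * (14 / \<delta>) < e \<and> t * 1 < e / 2"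
    unfolding eventually_at_right_field by blast
  show ?thesis
  proof (intro exI[of _ d] conjI allI impI)
    fix c a assume ca: "(c, a) \<in> param_curve lam" and a: "0 < norm a" "norm a < d"
    note s = d(2)[OF a]
    have "(norm a)\<^sup>2 \<le> norm a" using s power_le_one_iff[of "norm a" 2] by (simp add: power2_eq_square mult_left_le)
    then have "(norm a)\<^sup>2 \<le> e" using s e0 by linarith
    then interpret henon_small "\<lambda>a. cc (a\<^sup>2)" \<delta> "r + 1" e a r
      using s a assms(4) by unfold_locales (auto simp: mult.commute[of "norm a"])
    have c: "c = cc (a\<^sup>2)" using ca param_curve_explicit[OF lam0] by (simp add: cc_def xf_def)
    have psi: "model_map lam a = psi"
      by (rule ext) (simp add: model_map_def psi_def PP deriv_parabolic_poly case_prod_beta)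
    obtain \<Phi> \<Phi>' where \<Phi>: "homeomorphism (julia_pts \<times> ball 0 r) (J_plus (cc (a\<^sup>2)) a \<inter> (ball 0 r \<times> ball 0 r)) \<Phi> \<Phi>'"
      "\<And>p. p \<in> julia_pts \<times> ball 0 r \<Longrightarrow> henon (cc (a\<^sup>2)) a (\<Phi> p) = \<Phi> (psi p)"
      "\<And>p. p \<in> julia_pts \<times> ball 0 r \<Longrightarrow> psi p \<in> julia_pts \<times> ball 0 r"
      by (rule henon_conjugate_to_model) blast
    show "\<forall>\<zeta>\<in>julia (parabolic_poly lam). deriv (parabolic_poly lam) \<zeta> \<noteq> 0"
      using julia_pts_nz by (simp add: J deriv_parabolic_poly)
    show "model_map lam a \<in> julia (parabolic_poly lam) \<times> ball 0 r \<rightarrow> julia (parabolic_poly lam) \<times> ball 0 r"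
      unfolding J psi using \<Phi>(3) by blast
    show "\<exists>\<Phi> \<Phi>'. homeomorphism (julia (parabolic_poly lam) \<times> ball 0 r)
                  (J_plus c a \<inter> (ball 0 r \<times> ball 0 r)) \<Phi> \<Phi>' \<and>
       (\<forall>w\<in>julia (parabolic_poly lam) \<times> ball 0 r. henon c a (\<Phi> w) = \<Phi> (model_map lam a w))"
      unfolding J psi c using \<Phi>(1,2) by blast
  qed (rule d)
qed

end
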